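(* Let $d\ge1$, $T>0$, $\alpha\in(0,1)$, and let $f_0\in\mathcal P_2(\mathbb R^{2d})$, with $\rho_0:=\pi_{x\#}f_0$, satisfy $$\int_{\mathbb R^{4d}}\Big|(v+\nabla W*\rho_0(x))-(v'+\nabla W*\rho_0(x'))\Big|^{\frac{2-3\alpha}{1-\alpha}}\,d(f_0\otimes f_0)\big((x,v),(x',v')\big)<+\infty.$$ Then there exists a weak measure-valued solution $\boldsymbol f=(f_t)_{t\in[0,T]}$ of the alignment equation on $[0,T]$ with initial datum $f_0$ (as defined in the context). This solution is unique in the class of weak measure-valued solutions on $[0,T]$ with initial datum $f_0$ which additionally satisfy, with $\rho_t:=\pi_{x\#}f_t$, $$\sup_{t\in[0,T]}\int_{\mathbb R^{4d}}\Big|(v+\nabla W*\rho_t(x))-(v'+\nabla W*\rho_t(x'))\Big|^{\frac{2-3\alpha}{1-\alpha}}\,d(f_t\otimes f_t)\big((x,v),(x',v')\big)<+\infty.$$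
   Context: Kernel. $W(x)=\frac{1}{(2-\alpha)(1-\alpha)}|x|^{2-\alpha}$ on $\mathbb R^d$, $\phi(r)=r^{-\alpha}$ for $r>0$ and $\phi(0)=+\infty$. Thus $\nabla W(x)=\frac{1}{1-\alpha}|x|^{-\alpha}x$ (with $\nabla W(0)=0$) and $D^2W(x)=\frac{1}{1-\alpha}\phi(|x|)\big(I_d-\alpha\frac{x}{|x|}\otimes\frac{x}{|x|}\big)$ for $x\ne0$. $\mathcal P$ denotes probability measures, $\mathcal P_2$ those with finite second moment; "narrow" means tested against bounded continuous functions. $\pi_{x\#}$ denotes the marginal in $x$, and $\nabla W*\rho(x)=\int_{\mathbb R^d}\nabla W(x-x')\,d\rho(x')$. Powers $|\cdot|^{p}$ with $p<0$ equal $+\infty$ at $0$. Alignment equation: $\partial_tf+v\cdot\nabla_xf+\mathrm{div}_v(\boldsymbol F[f]f)=0$ with $\boldsymbol F[f_t](x,v)=\int_{\mathbb R^{2d}} D^2W(x-x')(v'-v)\,df_t(x',v')$. Let $\Delta=\{((x,v),(x',v'))\in\mathbb R^{4d}:(x,v)=(x',v')\}$. A weak measure-valued solution on $[0,T]$ with initial datum $f_0\in\mathcal P_2(\mathbb R^{2d})$ is a curve $\boldsymbol f\in C([0,T],\mathcal P(\mathbb R^{2d})\text{-narrow})$ such that: (a) for every $\psi\in C^1_c([0,T)\times\mathbb R^{2d})$ with $\nabla_v\psi_t$ Lipschitz-continuous uniformly in $t$, $$-\int_{\mathbb R^{2d}}\psi_0\,df_0=\int_0^T\!\!\int_{\mathbb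 R^{2d}}(\partial_t\psi_t+v\cdot\nabla_x\psi_t)\,df_t\,dt+\frac12\int_0^T\!\!\int_{\mathbb R^{4d}\setminus\Delta}(\nabla_v\psi_t(x,v)-\nabla_v\psi_t(x',v'))^\top D^2W(x-x')(v'-v)\,d(f_t\otimes f_t)\,dt;$$ (b) $\displaystyle\int_{\mathbb R^{2d}}|v|^2\,df_T+\int_0^T\!\!\int_{\mathbb R^{4d}\setminus\Delta}|v-v'|^2\phi(|x-x'|)\,d(f_s\otimes f_s)\,ds\le\int_{\mathbb R^{2d}}|v|^2\,df_0$; (c) $\sup_{t\in[0,T]}\int_{\mathbb R^{2d}}|x|^2\,df_t<\infty$. (By (b), points with $x=x'$, $v\ne v'$ form a null set for $f_t\otimes f_t\otimes dt$, so the undefined value $D^2W(0)$ plays no role in (a).) *)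

theory Defs
  imports "HOL-Probability.Probability"
begin

section \<open>The kernel\<close>

text \<open>The position space is an arbitrary Euclidean space \<open>'a\<close>, with \<open>DIM('a)\<close> in the role of
  \<open>d \<ge> 1\<close>; phase space points \<open>(x, v)\<close> are elements of \<open>'a \<times> 'a\<close>.\<close>

definition epow :: "real \<Rightarrow> real \<Rightarrow> ennreal" where
  \<comment> \<open>\<open>r\<^sup>p\<close> for \<open>r \<ge> 0\<close>, with the value infinity at \<open>r = 0\<close> for \<open>p < 0\<close>, and \<open>0\<^sup>0 = 1\<close>
      (whereas \<open>0 powr p = 0\<close> for all \<open>p\<close>)\<close>
  "epow r p =
     (if r = 0 then (if p < 0 then \<infinity> else if p = 0 then 1 else 0) else ennreal (r powr p))"

definition phi :: "real \<Rightarrow> real \<Rightarrow> ennreal" where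
  "phi \<alpha> r = epow r (- \<alpha>)"

definition W :: "real \<Rightarrow> 'a::euclidean_space \<Rightarrow> real" where
  "W \<alpha> x = 1 / ((2 - \<alpha>) * (1 - \<alpha>)) * norm x powr (2 - \<alpha>)"

definition gradW :: "real \<Rightarrow> 'a::euclidean_space \<Rightarrow> 'a" where
  "gradW \<alpha> x = (1 / (1 - \<alpha>) * norm x powr (- \<alpha>)) *\<^sub>R x"

definition D2W :: "real \<Rightarrow> 'a::euclidean_space \<Rightarrow> 'a \<Rightarrow> 'a" where
  \<comment> \<open>the Hessian at \<open>x\<close>, as a linear map applied to \<open>w\<close>; it takes the dummy value \<open>0\<close> at \<open>x = 0\<close>\<close>
  "D2W \<alpha> x w =
     (1 / (1 - \<alpha>) * norm x powr (- \<alpha>)) *\<^sub>R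
       (w - \<alpha> *\<^sub>R ((x /\<^sub>R norm x) \<bullet> w) *\<^sub>R (x /\<^sub>R norm x))"

lemma has_derivative_norm_powr:
  fixes x :: "'a::euclidean_space"
  assumes "x \<noteq> 0"
  shows "((\<lambda>x. norm x powr p) has_derivative (\<lambda>h. p * norm x powr (p - 2) * (x \<bullet> h))) (at x)"
proof -
  have 1: "(norm has_derivative (\<lambda>h. h \<bullet> sgn x)) (at x)"
    using GDERIV_norm[OF assms] by (simp add: gderiv_def)
  have 2: "((\<lambda>r. r powr p) has_real_derivative p * norm x powr (p - 1)) (at (norm x))"
    using assms by (simp add: has_real_derivative_powr)
  have 3: "norm x powr (p - 1) = norm x powr (p - 2) * norm x"
    using assms powr_add[of "norm x" "p - 2" 1] by simp
  have "((\<lambda>x. norm x powr p) has_derivative (\<lambda>h. p * norm x powr (p - 1) * (h \<bullet> sgn x))) (at x)"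
    using has_derivative_compose[OF 1 2[unfolded has_field_derivative_def]] .
  then show ?thesis
    using assms by (simp add: 3 sgn_div_norm inner_commute field_simps)
qed

lemma GDERIV_W:
  fixes x :: "'a::euclidean_space"
  assumes "0 < \<alpha>" "\<alpha> < 1"
  shows "GDERIV (W \<alpha>) x :> gradW \<alpha> x"
proof (cases "x = 0")
  case False
  have "((\<lambda>x. norm x powr (2 - \<alpha>)) has_derivative
          (\<lambda>h. (2 - \<alpha>) * norm x powr (- \<alpha>) * (x \<bullet> h))) (at x)"
    using has_derivative_norm_powr[OF False, of "2 - \<alpha>"] by simp
  from has_derivative_mult_right[OF this, of "1 / ((2 - \<alpha>) * (1 - \<alpha>))"] show ?thesis
    using assms unfolding gderiv_def W_def gradW_def
    by (simp add: inner_commute mult_ac)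
next
  case True
  have "((\<lambda>h::'a. norm h powr (1 - \<alpha>)) \<longlongrightarrow> 0) (at 0)"
    using assms by (auto intro!: tendsto_eq_intros)
  then have "((\<lambda>h::'a. 1 / ((2 - \<alpha>) * (1 - \<alpha>)) * norm h powr (1 - \<alpha>)) \<longlongrightarrow> 0) (at 0)"
    by (rule tendsto_mult_right_zero)
  then have "((\<lambda>h::'a. W \<alpha> h / norm h) \<longlongrightarrow> 0) (at 0)"
  proof (rule Lim_transform_eventually)
    show "\<forall>\<^sub>F h::'a in at 0.
        1 / ((2 - \<alpha>) * (1 - \<alpha>)) * norm h powr (1 - \<alpha>) = W \<alpha> h / norm h"
      by (auto simp: eventually_at_filter W_def powr_diff power2_eq_square)
  qed
  moreover have "W \<alpha> (0::'a) = 0"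
    by (simp add: W_def)
  moreover have "(\<lambda>h. \<bar>W \<alpha> h\<bar> / norm h) = (\<lambda>h::'a. W \<alpha> h / norm h)"
    using assms by (auto simp: W_def)
  ultimately show ?thesis
    unfolding gderiv_def True gradW_def has_derivative_at by simp
qed

lemma has_derivative_gradW:
  fixes x :: "'a::euclidean_space"
  assumes "x \<noteq> 0"
  shows "(gradW \<alpha> has_derivative D2W \<alpha> x) (at x)"
proof -
  have "((\<lambda>x. norm x powr (- \<alpha>)) has_derivative
          (\<lambda>h. - \<alpha> * norm x powr (- \<alpha>) * (x \<bullet> h) / (norm x)\<^sup>2)) (at x)"
    using has_derivative_norm_powr[OF assms, of "- \<alpha>"] assms
    by (simp add: powr_diff)
  from has_derivative_scaleR[OF has_derivative_mult_right[OF this, of "1 / (1 - \<alpha>)"]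
      has_derivative_ident]
  show ?thesis
    unfolding gradW_def D2W_def
    by (rule has_derivative_eq_rhs) (auto simp: algebra_simps power2_eq_square divide_simps)
qed

definition conv_gradW :: "real \<Rightarrow> 'a::euclidean_space measure \<Rightarrow> 'a \<Rightarrow> 'a" where
  "conv_gradW \<alpha> \<rho> x = (LINT x'|\<rho>. gradW \<alpha> (x - x'))"

section \<open>Measures on phase space\<close>

definition prob_measures :: "'b::topological_space measure set" where
  "prob_measures = {\<mu>. prob_space \<mu> \<and> sets \<mu> = sets borel}"

definition prob_measures2 :: "'b::euclidean_space measure set" where
  "prob_measures2 = {\<mu> \<in> prob_measures. (\<integral>\<^sup>+ z. ennreal ((norm z)\<^sup>2) \<partial>\<mu>) < \<infinity>}"

definition narrowly_continuous_on ::
    "real set \<Rightarrow> (real \<Rightarrow> 'b::topological_space measure) \<Rightarrow> bool" where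
  "narrowly_continuous_on I f \<longleftrightarrow>
     (\<forall>g :: 'b \<Rightarrow> real. continuous_on UNIV g \<and> bounded (range g) \<longrightarrow>
        continuous_on I (\<lambda>t. LINT z|f t. g z))"

definition pos_marginal :: "('a::euclidean_space \<times> 'a) measure \<Rightarrow> 'a measure" where
  "pos_marginal \<mu> = distr \<mu> borel fst"

definition omega :: "real \<Rightarrow> ('a::euclidean_space \<times> 'a) measure \<Rightarrow> 'a \<times> 'a \<Rightarrow> 'a" where
  "omega \<alpha> \<mu> = (\<lambda>(x, v). v + conv_gradW \<alpha> (pos_marginal \<mu>) x)"

definition omega_energy :: "real \<Rightarrow> ('a::euclidean_space \<times> 'a) measure \<Rightarrow> ennreal" where
  "omega_energy \<alpha> \<mu> =
     (\<integral>\<^sup>+ (z, z'). epow (norm (omega \<alpha> \<mu> z - omega \<alpha> \<mu> z')) ((2 - 3 * \<alpha>) / (1 - \<alpha>))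
       \<partial>(\<mu> \<Otimes>\<^sub>M \<mu>))"

section \<open>Weak measure-valued solutions\<close>

text \<open>\<open>test_function T \<psi> \<psi>t \<psi>x \<psi>v\<close>: \<open>\<psi>\<close> is an admissible test function on
  \<open>[0,T) \<times> ('a \<times> 'a)\<close>, with \<open>\<psi>t\<close>, \<open>\<psi>x\<close> and \<open>\<psi>v\<close> its partial derivative in time
  (one-sided at time 0) and its gradients in \<open>x\<close> and \<open>v\<close>. The support is compact in
  \<open>[0,T) \<times> ('a \<times> 'a)\<close>, so that \<open>\<psi>\<close> vanishes near time \<open>T\<close> but not necessarily at time 0.
  The values outside \<open>[0,T)\<close> are irrelevant.\<close>

definition test_function ::
    "real \<Rightarrow> (real \<times> ('a::euclidean_space \<times> 'a) \<Rightarrow> real) \<Rightarrow> (real \<times> ('a \<times> 'a) \<Rightarrow> real)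
      \<Rightarrow> (real \<times> ('a \<times> 'a) \<Rightarrow> 'a) \<Rightarrow> (real \<times> ('a \<times> 'a) \<Rightarrow> 'a) \<Rightarrow> bool" where
  "test_function T \<psi> \<psi>t \<psi>x \<psi>v \<longleftrightarrow>
     (let D = {0..<T} \<times> UNIV in
       (\<forall>p\<in>D. (\<psi> has_derivative
                  (\<lambda>(\<tau>, (\<xi>, \<eta>)). \<psi>t p * \<tau> + \<psi>x p \<bullet> \<xi> + \<psi>v p \<bullet> \<eta>)) (at p within D)) \<and>
       continuous_on D \<psi>t \<and> continuous_on D \<psi>x \<and> continuous_on D \<psi>v \<and>
       (\<exists>K. compact K \<and> K \<subseteq> D \<and> (\<forall>p\<in>D - K. \<psi> p = 0)) \<and>
       (\<exists>L. \<forall>t\<in>{0..<T}. L-lipschitz_on UNIV (\<lambda>z. \<psi>v (t, z))))"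

definition Diag :: "('b \<times> 'b) set" where
  "Diag = {(z, z'). z = z'}"

text \<open>In the weak formulation all integrands are integrable, thanks to the other two conditions on
  a solution, so that the convention that the Bochner integral of a non-integrable
  function is \<open>0\<close> never intervenes.\<close>

definition weak_formulation ::
    "real \<Rightarrow> real \<Rightarrow> ('a::euclidean_space \<times> 'a) measure \<Rightarrow> (real \<Rightarrow> ('a \<times> 'a) measure) \<Rightarrow> bool" where
  "weak_formulation \<alpha> T f0 f \<longleftrightarrow>
     (\<forall>\<psi> \<psi>t \<psi>x \<psi>v. test_function T \<psi> \<psi>t \<psi>x \<psi>v \<longrightarrow>
        - (LINT z|f0. \<psi> (0, z)) =
          (LINT t:{0..<T}|lborel. LINT (x, v)|f t. \<psi>t (t, (x, v)) + v \<bullet> \<psi>x (t, (x, v)))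
          + 1 / 2 * (LINT t:{0..<T}|lborel.
              LINT p:- Diag|f t \<Otimes>\<^sub>M f t.
                (case p of ((x, v), (x', v')) \<Rightarrow>
                  (\<psi>v (t, (x, v)) - \<psi>v (t, (x', v'))) \<bullet> D2W \<alpha> (x - x') (v' - v))))"

definition energy_inequality ::
    "real \<Rightarrow> real \<Rightarrow> ('a::euclidean_space \<times> 'a) measure \<Rightarrow> (real \<Rightarrow> ('a \<times> 'a) measure) \<Rightarrow> bool" where
  "energy_inequality \<alpha> T f0 f \<longleftrightarrow>
     (\<integral>\<^sup>+ (x, v). ennreal ((norm v)\<^sup>2) \<partial>f T)
       + (\<integral>\<^sup>+ s\<in>{0..T}.
            (\<integral>\<^sup>+ p\<in>- Diag.
               (case p of ((x, v), (x', v')) \<Rightarrow>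
                  ennreal ((norm (v - v'))\<^sup>2) * phi \<alpha> (norm (x - x'))) \<partial>(f s \<Otimes>\<^sub>M f s))
          \<partial>lborel)
     \<le> (\<integral>\<^sup>+ (x, v). ennreal ((norm v)\<^sup>2) \<partial>f0)"

definition weak_solution ::
    "real \<Rightarrow> real \<Rightarrow> ('a::euclidean_space \<times> 'a) measure \<Rightarrow> (real \<Rightarrow> ('a \<times> 'a) measure) \<Rightarrow> bool" where
  "weak_solution \<alpha> T f0 f \<longleftrightarrow>
     (\<forall>t\<in>{0..T}. f t \<in> prob_measures) \<and>
     narrowly_continuous_on {0..T} f \<and>
     weak_formulation \<alpha> T f0 f \<and>
     energy_inequality \<alpha> T f0 f \<and>
     (SUP t\<in>{0..T}. \<integral>\<^sup>+ (x, v). ennreal ((norm x)\<^sup>2) \<partial>f t) < \<infinity>"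

end

theory Submission
  imports Defs
begin

text \<open>Below, \<open>al\<close>, \<open>ep\<close>, \<open>dl\<close>, \<open>ta\<close> stand for the exponent \<open>\<alpha>\<close>, regularization parameters \<open>\<epsilon>\<close>, \<open>\<delta>\<close> and a
time \<open>\<tau>\<close>; \<open>ps\<close>, \<open>ph\<close>, \<open>Ph\<close> are test functions.

The equation is first order in disguise. With \<open>u t = gradW * rho t\<close>, the acceleration of a particle
is minus the time derivative of \<open>u\<close> along its trajectory, so the label \<open>om = v + u t x\<close> is conserved
and positions solve \<open>x' = om - u t x\<close>. The potential \<open>W\<close> is convex, so \<open>gradW\<close> and \<open>u t\<close> are monotone,
and they are Hoelder continuous with exponent \<open>1 - al\<close>. Monotonicity makes the first-order system
contract in the mean square (\<open>lagrangian_stability\<close>), with no Lipschitz bound on the field.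

Existence: for the regularized kernel \<open>K al ep\<close> Picard iteration yields solutions; by stability they
converge uniformly as \<open>ep\<close> tends to 0 to a solution \<open>X\<close> of the singular system, and the candidate is
\<open>push X t\<close>, the image of \<open>f0\<close> under position and velocity. The regularized velocity is differentiable
in time and dissipates energy; Fatou's lemma gives the energy inequality (\<open>energy_limit\<close>). For the weak
formulation the test function is evaluated along the trajectory with a regularized velocity, whose
dependence on \<open>x\<close> is only Hoelder in the limit. The interaction term then contains the product
\<open>\<bar>x - x'\<bar> powr (1 - 2 al) \<cdot> \<bar>v - v'\<bar>\<close>, which dissipation and moments alone do not control when \<open>al\<close> is
large. The integrability of differences of labels closes this gap (\<open>cross_term_bound\<close>), and it
persists because labels are conserved; \<open>alignment_limit\<close> is the resulting passage to the limit.

Uniqueness: a weak solution \<open>g\<close> has bounded second moments at all times (\<open>velocity_moment\<close>), and its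
regularized field \<open>u ep\<close> is \<open>C^1\<close> in time and space (\<open>u_joint_derivative\<close>). The weak formulation may
therefore be tested with functions of \<open>v + u ep t x\<close>. The derivatives of \<open>u ep\<close> contribute exactly
the alignment term with the regularized Hessian, and in the limit the two alignment terms cancel
(\<open>transport\<close>): the law of position and label solves a linear transport equation with field
\<open>om - u t x\<close>. Its flow contracts, so the dual equation preserves Lipschitz bounds and the law is the
image of its initial value under the flow (\<open>dual_estimate\<close>). Hence \<open>g\<close> comes from a solution of the
first-order system with the labels of \<open>f0\<close>, and that solution is unique (\<open>lagrangian_unique\<close>).\<close>

abbreviation (input) tends :: "(nat => 'b::topological_space) => 'b => bool" ("((_)/ ----> (_))" [60, 60] 60)
  where "X ----> L == (X \<longlongrightarrow> L) sequentially"

section \<open>The kernel and its regularization\<close>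

definition cH :: "real => real" where "cH al = 4 / (1 - al)"
definition cD :: "real => real" where "cD al = 2 / (1 - al)"

lemma gradW_0 [simp]: "gradW al 0 = 0"
 by (simp add: gradW_def)

text \<open>\<open>gradW\<close> is the gradient of a convex function. Directly: Cauchy-Schwarz reduces the claim to radial
vectors, where it says that \<open>r powr (1 - al)\<close> increases with \<open>r\<close>.\<close>

lemma gradW_mono:
 fixes x y :: "'a::euclidean_space"
 assumes "0 < al" "al < 1"
 shows "0 <= (gradW al x - gradW al y) \<bullet> (x - y)"
proof -
 let ?r = "norm x" and ?s = "norm y"
 have pw: "t powr (- al) * t = t powr (1 - al)" if "t \<ge> 0" for t :: real
  using that powr_add[of t "-al" 1] by (cases "t = 0") auto
 have xy: "x \<bullet> y <= ?r * ?s" by (rule norm_cauchy_schwarz)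
 have "0 <= (?r powr (1 - al) - ?s powr (1 - al)) * (?r - ?s)"
 proof (cases "?r <= ?s")
  case True
  then have "?r powr (1 - al) <= ?s powr (1 - al)" using assms by (intro powr_mono2) auto
  with True show ?thesis by (intro mult_nonpos_nonpos) auto
 next
  case False
  then have "?s powr (1 - al) <= ?r powr (1 - al)" using assms by (intro powr_mono2) auto
  with False show ?thesis by (intro mult_nonneg_nonneg) auto
 qed
 also have "\<dots> = ?r powr (- al) * ?r^2 + ?s powr (- al) * ?s^2 - (?r powr (- al) + ?s powr (- al)) * (?r * ?s)"
  by (simp add: pw[symmetric] algebra_simps power2_eq_square)
 also have "\<dots> <= ?r powr (- al) * ?r^2 + ?s powr (- al) * ?s^2 - (?r powr (- al) + ?s powr (- al)) * (x \<bullet> y)"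
  using xy by (intro diff_left_mono mult_left_mono) auto
 also have "\<dots> = (?r powr (- al) *\<^sub>R x - ?s powr (- al) *\<^sub>R y) \<bullet> (x - y)"
  by (simp add: inner_diff_left inner_diff_right dot_square_norm inner_commute algebra_simps)
 finally have "0 <= 1 / (1 - al) * ((?r powr (- al) *\<^sub>R x - ?s powr (- al) *\<^sub>R y) \<bullet> (x - y))"
  using assms by simp
 also have "\<dots> = (gradW al x - gradW al y) \<bullet> (x - y)"
  unfolding gradW_def by (simp add: inner_diff_left right_diff_distrib)
 finally show ?thesis .
qed

text \<open>The distance of the two points is at most twice the larger norm, whose power with exponent \<open>- al\<close> is
therefore dominated by that of the distance.\<close>

lemma gradW_holder:
 fixes x y :: "'a::euclidean_space"
 assumes "0 < al" "al < 1"
 shows "norm (gradW al x - gradW al y) <= cH al * norm (x - y) powr (1 - al)"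
proof -
 have pw: "t powr (- al) * t = t powr (1 - al)" if "t \<ge> 0" for t :: real
  using that powr_add[of t "-al" 1] by (cases "t = 0") auto
 have main: "norm (gradW al x - gradW al y) <= cH al * norm (x - y) powr (1 - al)"
  if le: "norm y <= norm x" for x y :: 'a
 proof (cases "x = 0")
  case True
  then show ?thesis using le assms by (simp add: cH_def)
 next
  case False
  let ?r = "norm x" and ?s = "norm y" and ?d = "norm (x - y)"
  have r: "?r > 0" using False by simp
  have d2: "?d <= 2 * ?r" using norm_triangle_ineq4[of x y] le by linarith
  have A: "?r powr (- al) * ?d <= 2 * ?d powr (1 - al)"
  proof (cases "?d = 0")
   case d: False
   have "?d = ?d powr (1 - al) * ?d powr al"
    using d by (simp add: powr_add[symmetric])
   also have "\<dots> <= ?d powr (1 - al) * (2 * ?r) powr al"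
    using d2 assms by (intro mult_left_mono powr_mono2) auto
   also have "\<dots> <= ?d powr (1 - al) * (2 * ?r powr al)"
    using assms powr_mono[of al 1 2] by (intro mult_left_mono) (auto simp: powr_mult mult_right_mono)
   finally have "?r powr (- al) * ?d <= ?r powr (- al) * (?d powr (1 - al) * (2 * ?r powr al))"
    by (intro mult_left_mono) auto
   also have "\<dots> = 2 * ?d powr (1 - al)"
    using r by (simp add: powr_minus field_simps)
   finally show ?thesis .
  qed simp
  have B: "norm ((?r powr (- al) - ?s powr (- al)) *\<^sub>R y) <= 2 * ?d powr (1 - al)"
  proof (cases "y = 0")
   case y: False
   have "?r powr (- al) <= ?s powr (- al)"
    using y le assms by (intro powr_mono2') auto
   then have "norm ((?r powr (- al) - ?s powr (- al)) *\<^sub>R y) = ?s powr (1 - al) - ?r powr (- al) * ?s"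
    using pw[of ?s] by (simp add: left_diff_distrib del: scaleR_left_diff_distrib)
   also have "\<dots> <= ?r powr (1 - al) - ?r powr (- al) * ?s"
    using le assms by (intro diff_right_mono powr_mono2) auto
   also have "\<dots> = ?r powr (- al) * (?r - ?s)"
    using pw[of ?r] by (simp add: algebra_simps)
   also have "\<dots> <= ?r powr (- al) * ?d"
    using norm_triangle_ineq2[of x y] by (intro mult_left_mono) auto
   finally show ?thesis using A by linarith
  qed simp
  have "norm (gradW al x - gradW al y) = 1 / (1 - al) *
    norm (?r powr (- al) *\<^sub>R (x - y) + (?r powr (- al) - ?s powr (- al)) *\<^sub>R y)"
  proof -
   have "gradW al x - gradW al y = (1 / (1 - al)) *\<^sub>R
    (?r powr (- al) *\<^sub>R (x - y) + (?r powr (- al) - ?s powr (- al)) *\<^sub>R y)"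
    unfolding gradW_def by (simp add: algebra_simps)
   then show ?thesis using assms by simp
  qed
  also have "\<dots> <= 1 / (1 - al) * (2 * ?d powr (1 - al) + 2 * ?d powr (1 - al))"
   using assms A B by (intro mult_left_mono norm_triangle_le add_mono) auto
  finally show ?thesis by (simp add: cH_def)
 qed
 show ?thesis
 proof (cases "norm y <= norm x")
  case True then show ?thesis by (rule main)
 next
  case False
  then have "norm (gradW al y - gradW al x) <= cH al * norm (y - x) powr (1 - al)"
   by (intro main) auto
  then show ?thesis by (simp add: norm_minus_commute)
 qed
qed

lemma left_inverse_le_1: "inverse (norm x) * norm x <= 1"
 by (cases "norm x = 0") auto

lemma D2W_bound:
 fixes x w :: "'a::euclidean_space"
 assumes "0 < al" "al < 1"
 shows "norm (D2W al x w) <= cD al * norm x powr (- al) * norm w"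
proof -
 have "norm ((x /\<^sub>R norm x) \<bullet> w) <= norm (x /\<^sub>R norm x) * norm w"
  by (simp only: real_norm_def Cauchy_Schwarz_ineq2)
 also have "\<dots> <= 1 * norm w" by (intro mult_right_mono) (auto simp: left_inverse_le_1)
 finally have 1: "\<bar>(x /\<^sub>R norm x) \<bullet> w\<bar> <= norm w" by simp
 have "norm (w - al *\<^sub>R ((x /\<^sub>R norm x) \<bullet> w) *\<^sub>R (x /\<^sub>R norm x))
   <= norm w + al * (\<bar>(x /\<^sub>R norm x) \<bullet> w\<bar> * norm (x /\<^sub>R norm x))"
  using assms by (intro order_trans[OF norm_triangle_ineq4]) (simp add: abs_mult)
 also have "\<dots> <= norm w + 1 * (norm w * 1)"
  using assms 1 by (intro add_left_mono mult_mono) (auto simp: left_inverse_le_1)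
 finally have "norm (w - al *\<^sub>R ((x /\<^sub>R norm x) \<bullet> w) *\<^sub>R (x /\<^sub>R norm x)) <= 2 * norm w" by simp
 then have "1 / (1 - al) * norm x powr (- al) * norm (w - al *\<^sub>R ((x /\<^sub>R norm x) \<bullet> w) *\<^sub>R (x /\<^sub>R norm x))
  <= 1 / (1 - al) * norm x powr (- al) * (2 * norm w)"
  using assms by (intro mult_left_mono) auto
 then show ?thesis
  using assms unfolding D2W_def cD_def by (simp add: mult_ac)
qed

lemma D2W_coercive:
 fixes x w :: "'a::euclidean_space"
 assumes "0 < al" "al < 1"
 shows "norm x powr (- al) * (norm w)^2 <= w \<bullet> D2W al x w"
proof -
 let ?e = "x /\<^sub>R norm x"
 have "(?e \<bullet> w)^2 <= (norm ?e * norm w)^2"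
  by (intro power2_le_iff_abs_le[THEN iffD2] Cauchy_Schwarz_ineq2) auto
 also have "\<dots> <= (1 * norm w)^2"
  by (intro power_mono mult_right_mono) (auto simp: left_inverse_le_1)
 finally have "(?e \<bullet> w)^2 <= (norm w)^2" by simp
 then have "(1 - al) * (norm w)^2 <= (norm w)^2 - al * (?e \<bullet> w)^2"
  using assms by (simp add: algebra_simps)
 then have "1 / (1 - al) * norm x powr (- al) * ((1 - al) * (norm w)^2)
   <= 1 / (1 - al) * norm x powr (- al) * ((norm w)^2 - al * (?e \<bullet> w)^2)"
  using assms by (intro mult_left_mono) auto
 moreover have "w \<bullet> D2W al x w = 1 / (1 - al) * norm x powr (- al) * ((norm w)^2 - al * (?e \<bullet> w)^2)"
  unfolding D2W_def
  by (simp add: inner_diff_right inner_scaleR_right dot_square_norm inner_commute[of w] power2_eq_square mult.assoc)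
 ultimately show ?thesis using assms by simp
qed

lemma D2W_sym: "a \<bullet> D2W al x b = b \<bullet> D2W al x a"
 unfolding D2W_def by (simp add: inner_diff_right inner_commute algebra_simps)

lemma linear_D2W: "linear (D2W al x)"
 unfolding D2W_def
 by (rule linearI) (auto simp: inner_add_right algebra_simps)

lemma continuous_on_D2W: "continuous_on {p. fst p ~= 0} (%p. D2W al (fst p) (snd p))"
 unfolding D2W_def by (intro continuous_intros) auto

text \<open>The regularization lifts the argument to height \<open>ep\<close> in one more dimension, applies the
 singular kernel there and projects back. Monotonicity, the Hoelder bound and the bounds
 on the Hessian are thus inherited from the singular kernel, uniformly in \<open>ep\<close>; its potential is
 \<open>(\<bar>x\<bar>^2 + ep^2) powr ((2 - al) / 2)\<close> up to the constant of \<open>W\<close>.\<close>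

definition K :: "real => real => 'a::euclidean_space => 'a" where
 "K al ep x = fst (gradW al (x, ep))"

definition DK :: "real => real => 'a::euclidean_space => 'a => 'a" where
 "DK al ep x w = fst (D2W al (x, ep) (w, 0))"

lemma K_0: "K al 0 = gradW al"
 by (rule ext) (simp add: K_def gradW_def)

lemma DK_0: "DK al 0 = D2W al"
 by (intro ext) (simp add: DK_def D2W_def)

lemma K_minus: "K al ep (- x) = - K al ep x"
 by (simp add: K_def gradW_def norm_Pair)

lemma K_diff_commute: "K al ep (y - x) = - K al ep (x - y)"
 using K_minus[of al ep "x - y"] by simp

lemma K_zero [simp]: "K al ep 0 = 0"
 by (simp add: K_def gradW_def)

lemma DK_minus: "DK al ep (- x) w = DK al ep x w"
 by (simp add: DK_def D2W_def norm_Pair)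

lemma DK_diff_commute: "DK al ep (y - x) w = DK al ep (x - y) w"
 using DK_minus[of al ep "x - y"] by simp

lemma linear_DK: "linear (DK al ep x)"
proof (rule linearI)
 fix a b :: 'a and c :: real
 have "D2W al (x, ep) ((a, 0) + (b, 0)) = D2W al (x, ep) (a, 0) + D2W al (x, ep) (b, 0)"
  by (rule linear_add[OF linear_D2W])
 then show "DK al ep x (a + b) = DK al ep x a + DK al ep x b" by (simp add: DK_def)
 have "D2W al (x, ep) (c *\<^sub>R (a, 0)) = c *\<^sub>R D2W al (x, ep) (a, 0)"
  by (rule linear_scale[OF linear_D2W])
 then show "DK al ep x (c *\<^sub>R a) = c *\<^sub>R DK al ep x a" by (simp add: DK_def)
qed

lemma DK_sym: "a \<bullet> DK al ep x b = b \<bullet> DK al ep x a"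
proof -
 have "(a, 0::real) \<bullet> D2W al (x, ep) (b, 0) = (b, 0::real) \<bullet> D2W al (x, ep) (a, 0)"
  by (rule D2W_sym)
 then show ?thesis by (simp add: DK_def inner_prod_def)
qed

lemma norm_fst_le_norm: "norm (fst p) <= norm p"
 by (metis norm_fst_le prod.collapse)

lemma norm_snd_le_norm: "norm (snd p) <= norm p"
 by (metis norm_snd_le prod.collapse)

context
 fixes al :: real
 assumes al: "0 < al" "al < 1"
begin

lemma cH_pos: "0 < cH al" and cD_pos: "0 < cD al"
 using al by (auto simp: cH_def cD_def)

lemma K_mono: "0 <= (K al ep x - K al ep y) \<bullet> (x - y)"
proof -
 have "0 <= (gradW al (x, ep) - gradW al (y, ep)) \<bullet> ((x, ep) - (y, ep))"
  using al by (rule gradW_mono)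
 then show ?thesis by (simp add: K_def inner_prod_def)
qed

lemma K_holder: "norm (K al ep x - K al ep y) <= cH al * norm (x - y) powr (1 - al)"
proof -
 have "norm (K al ep x - K al ep y) <= norm (gradW al (x, ep) - gradW al (y, ep))"
  unfolding K_def fst_diff[symmetric] by (rule norm_fst_le_norm)
 also have "\<dots> <= cH al * norm ((x, ep) - (y, ep)) powr (1 - al)"
  using al by (rule gradW_holder)
 finally show ?thesis by (simp add: norm_Pair)
qed

lemma K_conv: "norm (K al ep x - K al dl x) <= cH al * \<bar>ep - dl\<bar> powr (1 - al)"
proof -
 have "norm (K al ep x - K al dl x) <= norm (gradW al (x, ep) - gradW al (x, dl))"
  unfolding K_def fst_diff[symmetric] by (rule norm_fst_le_norm)
 also have "\<dots> <= cH al * norm ((x, ep) - (x, dl)) powr (1 - al)"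
  using al by (rule gradW_holder)
 finally show ?thesis by (simp add: norm_Pair)
qed

lemma powr_le_1_plus: "0 <= r ==> r powr (1 - al) <= 1 + r"
 using al powr_mono[of "1 - al" 1 r] powr_mono2[of "1 - al" r 1]
 by (cases "r <= 1") auto

lemma K_growth: "norm (K al ep x) <= cH al * (1 + norm x)"
proof -
 have "norm (K al ep x) <= cH al * norm x powr (1 - al)"
  using K_holder[of ep x 0] by simp
 also have "\<dots> <= cH al * (1 + norm x)"
  using cH_pos by (intro mult_left_mono powr_le_1_plus) auto
 finally show ?thesis .
qed

lemma continuous_on_gradW: "continuous_on UNIV (gradW al :: 'b::euclidean_space => 'b)"
 unfolding continuous_on_def
proof
 fix x :: 'b
 have "((%y. norm (y - x)) \<longlongrightarrow> 0) (at x)"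
  by (intro tendsto_norm_zero LIM_zero tendsto_ident_at)
 from tendsto_zero_powrI[OF this tendsto_const, of "1 - al"]
 have "((%y. norm (y - x) powr (1 - al)) \<longlongrightarrow> 0) (at x)"
  using al by simp
 then have "((%y. cH al * norm (y - x) powr (1 - al)) \<longlongrightarrow> 0) (at x)"
  by (rule tendsto_mult_right_zero)
 then have "((%y. gradW al y - gradW al x) \<longlongrightarrow> 0) (at x)"
  by (rule Lim_null_comparison[rotated]) (rule always_eventually, rule allI, rule gradW_holder[OF al])
 then show "(gradW al \<longlongrightarrow> gradW al x) (at x)" by (simp add: LIM_zero_iff)
qed

lemma continuous_on_K: "continuous_on S f ==> continuous_on S (%x. K al ep (f x))"
 unfolding K_def
 by (intro continuous_on_fst continuous_on_compose2[OF continuous_on_gradW] continuous_intros) auto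

lemma borel_measurable_K [measurable]: "K al ep : borel_measurable borel"
 by (intro borel_measurable_continuous_onI continuous_on_K continuous_on_id)

lemma K_has_derivative:
 fixes x :: "'b::euclidean_space"
 assumes "ep ~= 0 \<or> x ~= 0"
 shows "(K al ep has_derivative DK al ep x) (at x within S)"
proof -
 have 1: "((%x. (x, ep)) has_derivative (%h. (h, 0))) (at x within S)"
  by (auto intro!: derivative_eq_intros)
 have 2: "(gradW al has_derivative D2W al (x, ep)) (at (x, ep))"
  using assms by (intro has_derivative_gradW) (auto simp: zero_prod_def)
 have "((%x. fst (gradW al (x, ep))) has_derivative (%h. fst (D2W al (x, ep) (h, 0)))) (at x within S)"
  by (rule has_derivative_fst[OF has_derivative_compose[OF 1 2]])
 moreover have "(K al ep :: 'b => 'b) = (%x. fst (gradW al (x, ep)))" "DK al ep x = (%h. fst (D2W al (x, ep) (h, 0)))"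
  by (auto simp: K_def DK_def)
 ultimately show ?thesis by (simp only:)
qed

lemma DK_bound': "norm (DK al ep x w) <= cD al * norm (x, ep) powr (- al) * norm w"
proof -
 have "norm (DK al ep x w) <= norm (D2W al (x, ep) (w, 0))"
  unfolding DK_def by (rule norm_fst_le_norm)
 also have "\<dots> <= cD al * norm (x, ep) powr (- al) * norm (w, 0::real)"
  using al by (rule D2W_bound)
 finally show ?thesis by simp
qed

lemma DK_bound:
 assumes "x ~= 0"
 shows "norm (DK al ep x w) <= cD al * norm x powr (- al) * norm w"
proof -
 have "norm (x, ep) powr (- al) <= norm x powr (- al)"
  using assms al norm_fst_le[of x ep] by (intro powr_mono2') auto
 then show ?thesis
  using DK_bound'[of ep x w] cD_pos
  by (meson mult_left_mono mult_right_mono norm_ge_zero order_trans less_imp_le)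
qed

lemma DK_bound_eps:
 assumes "0 < ep"
 shows "norm (DK al ep x w) <= cD al * ep powr (- al) * norm w"
proof -
 have "norm (x, ep) powr (- al) <= ep powr (- al)"
  using assms al norm_snd_le[of ep x] by (intro powr_mono2') auto
 then show ?thesis
  using DK_bound'[of ep x w] cD_pos
  by (meson mult_left_mono mult_right_mono norm_ge_zero order_trans less_imp_le)
qed

lemma K_lipschitz:
 assumes "0 < ep"
 shows "norm (K al ep x - K al ep y) <= cD al * ep powr (- al) * norm (x - y)"
proof (rule differentiable_bound[of UNIV "K al ep" "DK al ep"])
 fix z :: 'a
 show "(K al ep has_derivative DK al ep z) (at z within UNIV)"
  using assms by (intro K_has_derivative) auto
 show "onorm (DK al ep z) <= cD al * ep powr (- al)"
  using cD_pos DK_bound_eps[OF assms] by (intro onorm_bound) auto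
qed auto

lemma DK_coercive: "norm (x, ep) powr (- al) * (norm w)^2 <= w \<bullet> DK al ep x w"
 using D2W_coercive[OF al, of "(x, ep)" "(w, 0)"] by (simp add: DK_def inner_prod_def)

lemma continuous_on_DK:
 assumes "ep ~= 0" "continuous_on S f" "continuous_on S g"
 shows "continuous_on S (%p. DK al ep (f p) (g p))"
proof -
 have "continuous_on S (%p. (%q. D2W al (fst q) (snd q)) ((f p, ep), (g p, 0::real)))"
  by (rule continuous_on_compose2[OF continuous_on_D2W])
   (use assms in \<open>auto intro!: continuous_intros simp: zero_prod_def\<close>)
 then show ?thesis unfolding DK_def by (auto intro: continuous_on_fst)
qed

lemma tendsto_DK:
 fixes x :: "'b::euclidean_space"
 assumes "x ~= 0" "(e \<longlongrightarrow> 0) F"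
 shows "((%n. DK al (e n) x w) \<longlongrightarrow> D2W al x w) F"
proof -
 have "isCont (%q. D2W al (fst q) (snd q)) ((x, 0::real), (w, 0::real))"
 proof (rule continuous_on_interior[OF continuous_on_D2W])
  have o: "open {p :: ('b \<times> real) \<times> ('b \<times> real). fst p ~= 0}"
   by (rule open_Collect_neq[OF continuous_on_fst[OF continuous_on_id] continuous_on_const])
  show "((x, 0::real), (w, 0::real)) : interior {p. fst p ~= 0}"
   unfolding interior_open[OF o] using assms(1) by (simp add: zero_prod_def)
 qed
 moreover have "((%n. ((x, e n), (w, 0::real))) \<longlongrightarrow> ((x, 0), (w, 0))) F"
  by (rule tendsto_Pair[OF tendsto_Pair[OF tendsto_const assms(2)] tendsto_const])
 ultimately have "((%n. D2W al (x, e n) (w, 0)) \<longlongrightarrow> D2W al (x, 0::real) (w, 0::real)) F"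
  by (auto dest: isCont_tendsto_compose)
 moreover have "fst (D2W al (x, 0::real) (w, 0)) = D2W al x w"
  by (metis DK_0 DK_def)
 ultimately show ?thesis using tendsto_fst by (fastforce simp: DK_def)
qed

end

lemma measurable_D2W [measurable]:
 "(%p. D2W al (fst p) (snd p)) : borel_measurable (borel \<Otimes>\<^sub>M borel)"
 unfolding D2W_def by measurable

lemma measurable_DK [measurable]:
 assumes [measurable]: "f : borel_measurable M" "g : borel_measurable M"
 shows "(%p. DK al ep (f p) (g p)) : borel_measurable M"
proof -
 have "(%p. (%q. D2W al (fst q) (snd q)) ((f p, ep), (g p, 0::real))) : borel_measurable M"
  by (rule measurable_compose[OF _ measurable_D2W], unfold borel_prod[symmetric]) measurable
 from measurable_compose[OF this[unfolded borel_prod[symmetric]] measurable_fst] show ?thesis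
  by (simp add: DK_def)
qed

section \<open>Calculus\<close>

text \<open>Dominated convergence for the difference quotients.\<close>

lemma has_derivative_integral_param:
 fixes F :: "'p::real_normed_vector => 'z => 'b::{banach,second_countable_topology}"
 assumes p0: "p0 : S" and int: "!!p. p : S ==> integrable M (F p)"
  and G: "integrable M G"
  and lip: "!!p z. p : S ==> z : space M ==> norm (F p z - F p0 z) <= G z * norm (p - p0)"
  and der: "!!z. z : space M ==> ((%p. F p z) has_derivative F' z) (at p0 within S)"
  and bd: "!!z h. z : space M ==> norm (F' z h) <= G z * norm h"
  and meas: "!!h. (%z. F' z h) : borel_measurable M"
 shows "((%p. LINT z|M. F p z) has_derivative (%h. LINT z|M. F' z h)) (at p0 within S)"
proof -
 have iF': "integrable M (%z. F' z h)" for h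
  by (rule Bochner_Integration.integrable_bound[of M "%z. G z * norm h"])
   (use G meas in \<open>auto intro!: AE_I2 order_trans[OF bd] abs_ge_self simp flip: abs_mult\<close>)
 have lin: "linear (F' z)" if "z : space M" for z
  using der[OF that] by (rule has_derivative_linear)
 have "bounded_linear (%h. LINT z|M. F' z h)"
 proof (rule bounded_linear_intro[where K="LINT z|M. G z"])
  fix a b c
  have "(LINT z|M. F' z (a + b)) = (LINT z|M. F' z a + F' z b)"
   by (intro Bochner_Integration.integral_cong refl linear_add[OF lin])
  then show "(LINT z|M. F' z (a + b)) = (LINT z|M. F' z a) + (LINT z|M. F' z b)"
   using iF' by simp
  have "(LINT z|M. F' z (c *\<^sub>R a)) = (LINT z|M. c *\<^sub>R F' z a)"
   by (intro Bochner_Integration.integral_cong refl linear_scale[OF lin])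
  then show "(LINT z|M. F' z (c *\<^sub>R a)) = c *\<^sub>R (LINT z|M. F' z a)" by simp
  have "norm (LINT z|M. F' z a) <= (LINT z|M. G z * norm a)"
   by (rule order_trans[OF integral_norm_bound integral_mono]) (use G iF' bd in auto)
  then show "norm (LINT z|M. F' z a) <= norm a * (LINT z|M. G z)" by (simp add: mult.commute)
 qed
 moreover have "((%p. norm ((LINT z|M. F p z) - (LINT z|M. F p0 z) - (LINT z|M. F' z (p - p0))) / norm (p - p0))
   \<longlongrightarrow> 0) (at p0 within S)"
  unfolding tendsto_at_iff_sequentially
 proof (intro allI impI)
  fix X assume X: "ALL i. X i : S - {p0}" "X ----> p0"
  define q where "q i z = norm (F (X i) z - F p0 z - F' z (X i - p0)) / norm (X i - p0)" for i z
  have int3: "integrable M (%z. F (X i) z - F p0 z - F' z (X i - p0))" for i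
   using X(1) int p0 iF' by auto
  have q: "q i : borel_measurable M" for i
   using borel_measurable_integrable[OF int3[of i]] unfolding q_def by measurable
  have "(%i. LINT z|M. q i z) ----> (LINT z|M. 0)"
  proof (rule integral_dominated_convergence[where w="%z. 2 * G z"])
   show "AE z in M. (%i. q i z) ----> 0"
   proof (rule AE_I2)
    fix z assume "z : space M"
    from der[OF this] have "((%p. norm (F p z - F p0 z - F' z (p - p0)) / norm (p - p0)) \<longlongrightarrow> 0) (at p0 within S)"
    unfolding has_derivative_iff_norm by blast
    then show "(%i. q i z) ----> 0"
    using X unfolding tendsto_at_iff_sequentially q_def by (auto simp: comp_def)
   qed
   show "AE z in M. norm (q i z) <= 2 * G z" for i
   proof (rule AE_I2)
    fix z assume z: "z : space M"
    have Xi: "X i : S" "norm (X i - p0) > 0" using X(1) by (auto simp: set_eq_iff)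
    have "norm (F (X i) z - F p0 z - F' z (X i - p0)) <= G z * norm (X i - p0) + G z * norm (X i - p0)"
    by (intro order_trans[OF norm_triangle_ineq4] add_mono lip bd Xi z)
    then show "norm (q i z) <= 2 * G z"
    using Xi(2) by (simp add: q_def divide_le_eq)
   qed
  qed (use G q in auto)
  then have lim: "(%i. LINT z|M. q i z) ----> 0" by simp
  have "(%i. norm ((LINT z|M. F (X i) z) - (LINT z|M. F p0 z) - (LINT z|M. F' z (X i - p0))) / norm (X i - p0)) ----> 0"
  proof (rule Lim_null_comparison[OF always_eventually lim], rule allI)
   fix i
   have XS: "X i : S" using X(1) by auto
   have "(LINT z|M. F (X i) z) - (LINT z|M. F p0 z) - (LINT z|M. F' z (X i - p0))
    = (LINT z|M. F (X i) z - F p0 z - F' z (X i - p0))"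
    using int[OF XS] int[OF p0] iF' by simp
   also have "norm \<dots> <= (LINT z|M. norm (F (X i) z - F p0 z - F' z (X i - p0)))"
    by (rule integral_norm_bound)
   finally show "norm (norm ((LINT z|M. F (X i) z) - (LINT z|M. F p0 z) - (LINT z|M. F' z (X i - p0))) / norm (X i - p0))
    <= (LINT z|M. q i z)"
    unfolding q_def by (simp add: divide_right_mono)
  qed
  then show "((%p. norm ((LINT z|M. F p z) - (LINT z|M. F p0 z) - (LINT z|M. F' z (p - p0))) / norm (p - p0)) \<circ> X) ----> 0"
   by (simp add: comp_def)
 qed
 ultimately show ?thesis unfolding has_derivative_iff_norm by blast
qed

lemma has_vector_derivative_integral_param:
 fixes F :: "real => 'z => 'b::{banach,second_countable_topology}"
 assumes t: "t : {a..b}" and int: "!!s. s : {a..b} ==> integrable M (F s)"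
  and G: "integrable M G"
  and der: "!!z s. z : space M ==> s : {a..b} ==> ((%s. F s z) has_vector_derivative F' s z) (at s within {a..b})"
  and bd: "!!z s. z : space M ==> s : {a..b} ==> norm (F' s z) <= G z"
  and meas: "(%z. F' t z) : borel_measurable M"
 shows "((%s. LINT z|M. F s z) has_vector_derivative (LINT z|M. F' t z)) (at t within {a..b})"
proof -
 have "((%s. LINT z|M. F s z) has_derivative (%h. LINT z|M. h *\<^sub>R F' t z)) (at t within {a..b})"
 proof (rule has_derivative_integral_param[OF t int G])
  fix p z assume p: "p : {a..b}" and z: "z : space M"
  show "norm (F p z - F t z) <= G z * norm (p - t)"
  proof (rule differentiable_bound[of "{a..b}" _ "%s h. h *\<^sub>R F' s z"])
   show "onorm (%h. h *\<^sub>R F' s z) <= G z" if "s : {a..b}" for s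
   proof (rule onorm_bound)
    show "0 <= G z" using bd[OF z t] norm_ge_zero order_trans by blast
    show "norm (h *\<^sub>R F' s z) <= G z * norm h" for h
    using mult_left_mono[OF bd[OF z that], of "\<bar>h\<bar>"] by (simp add: mult.commute)
   qed
  qed (use der[OF z] p t in \<open>auto simp: has_vector_derivative_def\<close>)
 next
  fix z assume z: "z : space M"
  show "((%p. F p z) has_derivative (%h. h *\<^sub>R F' t z)) (at t within {a..b})"
   using der[OF z t] by (simp add: has_vector_derivative_def)
  show "norm (h *\<^sub>R F' t z) <= G z * norm h" for h
   using mult_left_mono[OF bd[OF z t], of "\<bar>h\<bar>"] by (simp add: mult.commute)
 qed (use meas in measurable)
 then show ?thesis by (simp add: has_vector_derivative_def)
qed

lemma real_deriv_le:
 fixes g :: "real => real"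
 assumes "a <= b" and der: "!!t. t : {a..b} ==> (g has_vector_derivative g' t) (at t within {a..b})"
  and le: "!!t. t : {a..b} ==> g' t <= c"
 shows "g b <= g a + c * (b - a)"
proof -
 have "EX x:{a..b}. g b - g a = (%h. h *\<^sub>R g' x) (b - a)"
  using der by (intro mvt_very_simple[OF \<open>a <= b\<close>]) (auto simp: has_vector_derivative_def)
 then obtain x where "x : {a..b}" "g b - g a = (b - a) * g' x" by auto
 then show ?thesis using le[of x] \<open>a <= b\<close> mult_left_mono[of "g' x" c "b - a"] by (simp add: mult.commute)
qed

text \<open>Smoothing the norm to \<open>sqrt (\<bar>y\<bar>^2 + et^2)\<close> makes it differentiable at zeros of \<open>y\<close>.\<close>

lemma norm_growth:
 fixes y :: "real => 'b::real_inner"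
 assumes ab: "a <= b" and der: "!!t. t : {a..b} ==> (y has_vector_derivative y' t) (at t within {a..b})"
  and le: "!!t. t : {a..b} ==> y t \<bullet> y' t <= c * norm (y t)" and c: "0 <= c"
 shows "norm (y b) <= norm (y a) + c * (b - a)"
proof (rule field_le_epsilon)
 fix e :: real assume e: "0 < e"
 define g where "g t = sqrt (y t \<bullet> y t + e^2)" for t
 have pos: "y t \<bullet> y t + e^2 > 0" for t using e by (simp add: add_nonneg_pos)
 have ng: "norm (y t) <= g t" for t
  unfolding g_def norm_eq_sqrt_inner by simp
 have gpos: "g t > 0" for t using pos by (simp add: g_def)
 have "g b <= g a + c * (b - a)"
 proof (rule real_deriv_le[OF ab])
  fix t assume t: "t : {a..b}"
  have 1: "((%t. y t \<bullet> y t + e^2) has_derivative (%h. h * (2 * (y t \<bullet> y' t)))) (at t within {a..b})"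
   using der[OF t] unfolding has_vector_derivative_def
   by (auto intro!: derivative_eq_intros simp: inner_commute algebra_simps)
  have 2: "(sqrt has_real_derivative inverse (g t) / 2) (at (y t \<bullet> y t + e^2))"
   unfolding g_def by (rule DERIV_real_sqrt[OF pos])
  show "(g has_vector_derivative (y t \<bullet> y' t) / g t) (at t within {a..b})"
   using has_derivative_compose[OF 1 2[unfolded has_field_derivative_def]]
   unfolding has_vector_derivative_def g_def by (simp add: field_simps)
  have "y t \<bullet> y' t <= c * g t"
   using le[OF t] ng[of t] c by (meson mult_left_mono order_trans)
  then show "(y t \<bullet> y' t) / g t <= c" using gpos by (simp add: divide_le_eq)
 qed
 moreover have "g a <= norm (y a) + e"
  using e unfolding g_def norm_eq_sqrt_inner
  by (metis abs_of_pos inner_ge_zero real_sqrt_abs sqrt_add_le_add_sqrt zero_le_power2)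
 ultimately show "norm (y b) <= norm (y a) + c * (b - a) + e" using ng[of b] by linarith
qed

section \<open>Cutoff functions\<close>

text \<open>A \<open>C^1\<close> function with Lipschitz derivative; all cutoffs are built from it, since test functions need
no more regularity.\<close>

definition sqpos :: "real => real" where "sqpos r = (max 0 r)^2"

lemma sqpos_deriv: "(sqpos has_real_derivative 2 * max 0 r) (at r within S)"
proof -
 consider "r < 0" | "r = 0" | "r > 0" by linarith
 then have "(sqpos has_real_derivative 2 * max 0 r) (at r)"
 proof cases
  case 1
  have "((%_. 0) has_real_derivative 2 * max 0 r) (at r)" using 1 by (auto intro!: derivative_eq_intros)
  then show ?thesis
   by (rule DERIV_cong_ev[THEN iffD1, rotated 3])
    (use 1 in \<open>auto simp: sqpos_def intro!: eventually_mono[OF eventually_nhds_in_open[of "{..<0}"]]\<close>)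
 next
  case 2
  have "((%h. max 0 h * (max 0 h / h)) \<longlongrightarrow> 0) (at (0::real))"
  proof (rule Lim_null_comparison)
   show "\<forall>\<^sub>F h in at (0::real). norm (max 0 h * (max 0 h / h)) <= \<bar>h\<bar>"
    by (intro always_eventually) (auto simp: max_def abs_mult)
  qed (auto intro!: tendsto_eq_intros)
  then show ?thesis
   unfolding DERIV_def sqpos_def using 2 by (simp add: power2_eq_square)
 next
  case 3
  have "((%r. r^2) has_real_derivative 2 * max 0 r) (at r)" using 3 by (auto intro!: derivative_eq_intros)
  then show ?thesis
   by (rule DERIV_cong_ev[THEN iffD1, rotated 3])
    (use 3 in \<open>auto simp: sqpos_def intro!: eventually_mono[OF eventually_nhds_in_open[of "{0<..}"]]\<close>)
 qed
 then show ?thesis by (rule has_field_derivative_at_within)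
qed

lemma sqpos_nonneg: "0 <= sqpos r" and sqpos_le_1: "r <= 1 ==> sqpos r <= 1"
 and sqpos_0: "r <= 0 ==> sqpos r = 0" and sqpos_1: "sqpos 1 = 1"
 by (auto simp: sqpos_def power_le_one)

lemma continuous_on_sqpos [continuous_intros]: "continuous_on S f ==> continuous_on S (%x. sqpos (f x))"
 unfolding sqpos_def by (intro continuous_intros)

definition bump :: "real => 'b::euclidean_space => real" where
 "bump R z = sqpos (1 - (norm z)^2 / R^2)"

definition dbump :: "real => 'b::euclidean_space => 'b" where
 "dbump R z = - (4 / R^2 * max 0 (1 - (norm z)^2 / R^2)) *\<^sub>R z"

lemma bump_deriv: "(bump R has_derivative (%h. dbump R z \<bullet> h)) (at z within S)"
proof -
 have "((%z. 1 - inverse (R^2) * (z \<bullet> z)) has_derivative (%h. - (inverse (R^2) * (2 * (z \<bullet> h))))) (at z within S)"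
  by (auto intro!: derivative_eq_intros simp: inner_commute)
 then have 1: "((%z. 1 - (norm z)^2 / R^2) has_derivative (%h. - (2 * (z \<bullet> h) / R^2))) (at z within S)"
  unfolding power2_norm_eq_inner by (simp add: divide_inverse mult_ac)
 show ?thesis
  using has_derivative_compose[OF 1 sqpos_deriv[unfolded has_field_derivative_def]]
  unfolding bump_def[abs_def] dbump_def by (simp add: algebra_simps)
qed

lemma bump_nonneg: "0 <= bump R z" and bump_le_1: "bump R z <= 1"
 by (auto simp: bump_def sqpos_nonneg intro!: sqpos_le_1)

lemma bump_0: "0 < R ==> R <= norm z ==> bump R z = 0"
 and dbump_0: "0 < R ==> R <= norm z ==> dbump R z = 0"
 by (auto simp: bump_def dbump_def max_def field_simps intro!: sqpos_0 power_mono)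

lemma continuous_on_bump [continuous_intros]: "continuous_on S f ==> continuous_on S (%x. bump R (f x))"
 unfolding bump_def divide_inverse by (intro continuous_intros)

lemma continuous_on_dbump [continuous_intros]: "continuous_on S f ==> continuous_on S (%x. dbump R (f x))"
 unfolding dbump_def divide_inverse by (intro continuous_intros)

lemma dbump_lipschitz:
 fixes z z' :: "'b::euclidean_space"
 assumes R: "0 < R"
 shows "norm (dbump R z - dbump R z') <= 12 / R^2 * norm (z - z')"
proof -
 define m where "m z = max 0 (1 - (norm z)^2 / R^2)" for z :: 'b
 have m01: "0 <= m z" "m z <= 1" for z by (auto simp: m_def)
 have m0: "m z = 0" if "R <= norm z" for z :: 'b
  using that R power_mono[of R "norm z" 2] by (simp add: m_def max_def field_simps)
 have dm: "\<bar>m z - m z'\<bar> * norm z' <= 2 * norm (z - z')" if z': "norm z' <= R" for z z' :: 'b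
 proof -
  define r s where "r = min (norm z) R" and "s = norm z'"
  have mr: "m z = 1 - r^2 / R^2"
   using R m0[of z] power_mono[of "norm z" R 2] by (auto simp: r_def m_def max_def min_def field_simps)
  have ms: "m z' = 1 - s^2 / R^2"
   using R z' power_mono[of s R 2] by (auto simp: s_def m_def max_def field_simps)
  have rs: "0 <= r" "r <= R" "0 <= s" "s <= R" using R z' by (auto simp: r_def s_def)
  have d: "\<bar>r - s\<bar> <= norm (z - z')"
   using z' norm_triangle_ineq3[of z z'] by (auto simp: r_def s_def min_def)
  have "\<bar>m z - m z'\<bar> = \<bar>r - s\<bar> * (r + s) / R^2"
  proof -
   have "m z - m z' = (s - r) * (r + s) / R^2"
    unfolding mr ms by (simp add: power2_eq_square algebra_simps diff_divide_distrib add_divide_distrib)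
   then show ?thesis using rs by (simp add: abs_mult abs_divide abs_minus_commute)
  qed
  also have "\<dots> <= norm (z - z') * (R + R) / R^2"
   using d rs R by (intro divide_right_mono mult_mono add_mono) auto
  finally have "\<bar>m z - m z'\<bar> * norm z' <= norm (z - z') * (R + R) / R^2 * R"
   using z' R by (intro mult_mono) auto
  then show ?thesis using R by (simp add: power2_eq_square)
 qed
 have key: "norm (m z *\<^sub>R z - m z' *\<^sub>R z') <= 3 * norm (z - z')" if z': "norm z' <= R" for z z' :: 'b
 proof -
  have "m z *\<^sub>R z - m z' *\<^sub>R z' = m z *\<^sub>R (z - z') + (m z - m z') *\<^sub>R z'"
   by (simp add: algebra_simps)
  also have "norm \<dots> <= 1 * norm (z - z') + 2 * norm (z - z')"
   using m01[of z] dm[OF z', of z] by (intro norm_triangle_le add_mono) (auto intro: mult_left_le_one_le)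
  finally show ?thesis by simp
 qed
 have "norm (m z *\<^sub>R z - m z' *\<^sub>R z') <= 3 * norm (z - z')"
 proof (cases "norm z' <= R")
  case True then show ?thesis by (rule key)
 next
  case z': False
  show ?thesis
  proof (cases "norm z <= R")
   case True
   then show ?thesis using key[of z z'] by (simp add: norm_minus_commute)
  qed (use z' m0[of z] m0[of z'] in simp)
 qed
 then have "4 / R^2 * norm (m z *\<^sub>R z - m z' *\<^sub>R z') <= 4 / R^2 * (3 * norm (z - z'))"
  by (intro mult_left_mono) auto
 moreover have "dbump R z - dbump R z' = - (4 / R^2) *\<^sub>R (m z *\<^sub>R z - m z' *\<^sub>R z')"
  by (simp add: dbump_def m_def algebra_simps)
 ultimately show ?thesis by simp
qed

lemma dbump_bound:
 assumes R: "0 < R"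
 shows "norm (dbump R z) <= 4 / R"
proof (cases "norm z <= R")
 case True
 have "norm (dbump R z) = 4 / R^2 * max 0 (1 - (norm z)^2 / R^2) * norm z"
  by (simp add: dbump_def abs_mult)
 also have "\<dots> <= 4 / R^2 * 1 * R"
  using True R by (intro mult_mono) auto
 finally show ?thesis using R by (simp add: power2_eq_square)
qed (use R dbump_0[of R z] in simp)

lemma bump_lipschitz:
 assumes R: "0 < R"
 shows "\<bar>bump R z - bump R z'\<bar> <= 4 / R * norm (z - z')"
proof -
 have "norm (bump R z - bump R z') <= 4 / R * norm (z - z')"
 proof (rule differentiable_bound[of UNIV "bump R" "%z h. dbump R z \<bullet> h"])
  fix z :: 'a
  show "(bump R has_derivative (\<bullet>) (dbump R z)) (at z within UNIV)" by (rule bump_deriv)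
  show "onorm ((\<bullet>) (dbump R z)) <= 4 / R"
  proof (rule onorm_bound)
   show "norm (dbump R z \<bullet> h) <= 4 / R * norm h" for h
    using Cauchy_Schwarz_ineq2[of "dbump R z" h] dbump_bound[OF R, of z]
    by (smt (verit) mult_right_mono norm_ge_zero real_norm_def)
  qed (use R in auto)
 qed auto
 then show ?thesis by simp
qed

text \<open>The complement of a cutoff is comparable to the square of the norm, so tail bounds at all scales \<open>R\<close>
give bounds on second moments and conversely.\<close>

lemma one_minus_bump: "1 - bump R z <= 2 * (norm z)^2 / R^2"
 "0 < R ==> norm z <= R ==> (norm z)^2 / R^2 <= 1 - bump R z"
proof -
 define s where "s = (norm z)^2 / R^2"
 have s: "0 <= s" by (simp add: s_def)
 show "1 - bump R z <= 2 * (norm z)^2 / R^2"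
 proof (cases "s <= 1")
  case True
  then have "1 - bump R z = 2 * s - s^2"
   unfolding bump_def s_def[symmetric] sqpos_def by (simp add: power2_eq_square algebra_simps)
  also have "\<dots> <= 2 * s" by simp
  finally show ?thesis by (simp add: s_def)
 next
  case False
  then have "1 - bump R z <= 2 * s" using bump_nonneg[of R z] by linarith
  then show ?thesis by (simp add: s_def)
 qed
 assume "0 < R" "norm z <= R"
 then have s1: "s <= 1" using power_mono[of "norm z" R 2] by (simp add: s_def)
 then have "1 - bump R z = s + s * (1 - s)"
  unfolding bump_def s_def[symmetric] sqpos_def by (simp add: power2_eq_square algebra_simps)
 moreover have "0 <= s * (1 - s)" using s s1 by auto
 ultimately show "(norm z)^2 / R^2 <= 1 - bump R z" by (simp add: s_def)
qed

lemma one_minus_bump_linear: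
 assumes "0 < R" shows "1 - bump R z <= 2 * norm z / R"
proof (cases "norm z <= R")
 case True
 have "2 * (norm z)^2 / R^2 = 2 * (norm z / R) * (norm z / R)" by (simp add: power2_eq_square)
 also have "\<dots> <= 2 * (norm z / R) * 1" using True assms by (intro mult_left_mono) auto
 finally show ?thesis using one_minus_bump(1)[of R z] by simp
next
 case False
 then have "1 <= norm z / R" using assms by simp
 then show ?thesis using bump_nonneg[of R z] by simp
qed

lemma bump_tendsto_1: "filterlim R at_top F ==> ((%n. bump (R n) z) \<longlongrightarrow> 1) F"
proof -
 assume R: "filterlim R at_top F"
 have "((%n. 2 * (norm z)^2 / (R n)^2) \<longlongrightarrow> 0) F"
  by (intro real_tendsto_divide_at_top[OF tendsto_const] filterlim_pow_at_top R) auto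
 then have "((%n. 1 - bump (R n) z) \<longlongrightarrow> 0) F"
  by (rule tendsto_sandwich[OF _ _ tendsto_const, rotated 2])
   (auto intro!: always_eventually bump_le_1 one_minus_bump)
 from tendsto_diff[OF tendsto_const this, of 1] show ?thesis by simp
qed

section \<open>Narrowly continuous curves of measures\<close>

text \<open>Indicators of compact sets are limits of truncated multiples of the distance to the set, and
compact sets determine a finite Borel measure by inner regularity.\<close>

lemma prob_measure_eqI_lipschitz:
 fixes M N :: "'b::euclidean_space measure"
 assumes M: "prob_space M" "sets M = sets borel" and N: "prob_space N" "sets N = sets borel"
  and eq: "!!(ph :: 'b => real) r L. (!!z. r <= norm z ==> ph z = 0) ==> (!!z z'. \<bar>ph z - ph z'\<bar> <= L * norm (z - z')) ==>
    (LINT z|M. ph z) = (LINT z|N. ph z)"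
 shows "M = N"
proof -
 interpret M: prob_space M by fact
 interpret N: prob_space N by fact
 define ph where "ph (C::'b set) n z = max 0 (1 - real n * infdist z C)" for C n z
 have lim: "(%n. LINT z|L. ph C n z) ----> measure L C"
  if L: "prob_space L" "sets L = sets borel" and C: "compact C" "C ~= {}" for L C
 proof -
  interpret L: prob_space L by fact
  have c: "C : sets L" "C : sets borel" using C L by (auto simp: compact_imp_closed)
  have "(%n. LINT z|L. ph C n z) ----> (LINT z|L. indicator C z)"
  proof (rule integral_dominated_convergence[where w="%_. 1"])
   show "ph C n : borel_measurable L" for n
    unfolding ph_def measurable_cong_sets[OF L(2) refl]
    by (intro borel_measurable_continuous_onI continuous_intros)
   show "AE z in L. norm (ph C n z) <= 1" for n
    by (rule AE_I2) (auto simp: ph_def infdist_nonneg)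
   show "AE z in L. (%n. ph C n z) ----> indicator C z"
   proof (rule AE_I2)
    fix z
    show "(%n. ph C n z) ----> indicator C z"
    proof (cases "z : C")
    case False
    then have "infdist z C > 0"
    using C by (simp add: compact_imp_closed in_closed_iff_infdist_zero less_le infdist_nonneg)
    then obtain n0 :: nat where n0: "1 < real n0 * infdist z C" using reals_Archimedean3 by blast
    have "ph C n z = 0" if "n \<ge> n0" for n
    using n0 that mult_right_mono[of "real n0" "real n" "infdist z C"] infdist_nonneg[of z C] by (auto simp: ph_def)
    then show ?thesis
    using False by (intro tendsto_eventually eventually_sequentiallyI[of n0]) auto
    qed (simp add: ph_def)
   qed
  qed (use c L in auto)
  then show ?thesis using c by simp
 qed
 have agree: "measure M C = measure N C" if C: "compact C" for C :: "'b set"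
 proof (cases "C = {}")
  case False
  have "(LINT z|M. ph C (Suc n) z) = (LINT z|N. ph C (Suc n) z)" for n
  proof -
   obtain r where r: "!!x. x : C ==> norm x <= r" using compact_imp_bounded[OF C] by (auto simp: bounded_iff)
   show ?thesis
   proof (rule eq[where r="r + 1" and L="real (Suc n)"])
    fix z z' :: 'b
    have "\<bar>real (Suc n) * infdist z C - real (Suc n) * infdist z' C\<bar> <= real (Suc n) * dist z z'"
    unfolding right_diff_distrib[symmetric] abs_mult abs_of_nat by (intro mult_left_mono infdist_triangle_abs) simp
    then show "\<bar>ph C (Suc n) z - ph C (Suc n) z'\<bar> <= real (Suc n) * norm (z - z')"
    unfolding ph_def dist_norm by linarith
   next
    fix z :: 'b assume z: "r + 1 <= norm z"
    obtain c where c: "c : C" "infdist z C = dist z c"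
    using infdist_attains_inf[OF compact_imp_closed[OF C] False] by blast
    have "1 <= infdist z C" using c r[of c] z norm_triangle_ineq2[of z c] by (simp add: dist_norm)
    then have "1 <= (1 + real n) * infdist z C" using mult_mono[of 1 "1 + real n" 1 "infdist z C"] by simp
    then show "ph C (Suc n) z = 0" by (simp add: ph_def)
   qed
  qed
  then have "(%n. LINT z|N. ph C (Suc n) z) ----> measure M C"
   using LIMSEQ_Suc[OF lim[OF M C False]] by simp
  then show ?thesis using LIMSEQ_unique LIMSEQ_Suc[OF lim[OF N C False]] by blast
 qed simp
 show ?thesis
 proof (rule measure_eqI_generator_eq[where E="{C. compact C}" and \<Omega>=UNIV and A="%n. cball 0 (real n)"])
  show "Int_stable {C::'b set. compact C}" by (auto simp: Int_stable_def compact_Int)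
  have "sets (borel :: 'b measure) = sigma_sets UNIV {C. compact C}"
  proof
   have "C : sigma_sets UNIV {C. compact C}" if "closed C" for C :: "'b set"
   proof -
    have "(\<Union>n::nat. C \<inter> cball 0 (real n)) : sigma_sets UNIV {C. compact C}"
    using that by (intro sigma_sets.Union sigma_sets.Basic) (auto intro: closed_Int_compact)
    moreover have "(\<Union>n::nat. C \<inter> cball 0 (real n)) = C"
    using real_arch_simple by (auto simp: )
    ultimately show ?thesis by simp
   qed
   then show "sets (borel :: 'b measure) \<subseteq> sigma_sets UNIV {C. compact C}"
    unfolding borel_eq_closed by (auto simp: sets_measure_of intro!: sigma_sets_mono)
   show "sigma_sets UNIV {C. compact C} \<subseteq> sets (borel :: 'b measure)"
    by (intro sets.sigma_sets_subset[of _ borel, simplified]) (auto intro: borel_compact)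
  qed
  then show "sets M = sigma_sets UNIV {C. compact C}" "sets N = sigma_sets UNIV {C. compact C}"
   using M N by auto
  show "emeasure M C = emeasure N C" if "C : {C. compact C}" for C
   using agree that by (simp add: M.emeasure_eq_measure N.emeasure_eq_measure)
  show "(\<Union>i. cball (0::'b) (real i)) = UNIV" using real_arch_simple by auto
 qed auto
qed

text \<open>Measures of closed sets are limits of integrals of truncated distance functions, which depend
continuously on time.\<close>

lemma narrow_measurable_kernel:
 fixes f :: "real => 'b::euclidean_space measure"
 assumes f: "!!t. prob_space (f t)" "!!t. sets (f t) = sets borel"
  and cont: "!!g :: 'b => real. continuous_on UNIV g ==> bounded (range g) ==> continuous_on UNIV (%t. LINT z|f t. g z)"
 shows "f : borel \<rightarrow>\<^sub>M subprob_algebra borel"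
proof (rule measurable_subprob_algebra_generated[where G="{C. closed C}" and \<Omega>=UNIV])
 show "sets (borel :: 'b measure) = sigma_sets UNIV {C. closed C}"
  unfolding borel_eq_closed by (simp add: sets_measure_of)
 show "(%t. emeasure (f t) C) : borel_measurable borel" if C: "C : {C. closed C}" for C
 proof (cases "C = {}")
  case False
  define ph where "ph n z = max 0 (1 - real n * infdist z C)" for n z
  have phc: "continuous_on UNIV (ph n)" for n unfolding ph_def by (intro continuous_intros)
  have m: "(%t. LINT z|f t. ph n z) : borel_measurable borel" for n
  proof (intro borel_measurable_continuous_onI cont phc)
   show "bounded (range (ph n))"
    by (rule boundedI[of _ 1]) (auto simp: ph_def infdist_nonneg)
  qed
  have lim: "(%n. LINT z|f t. ph n z) ----> measure (f t) C" for t
  proof -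
   interpret L: prob_space "f t" by (rule f)
   have c: "C : sets (f t)" using C f by auto
   have "(%n. LINT z|f t. ph n z) ----> (LINT z|f t. indicator C z)"
   proof (rule integral_dominated_convergence[where w="%_. 1"])
    show "ph n : borel_measurable (f t)" for n
    unfolding measurable_cong_sets[OF f(2) refl]
    by (intro borel_measurable_continuous_onI phc)
    show "AE z in f t. norm (ph n z) <= 1" for n
    by (rule AE_I2) (auto simp: ph_def infdist_nonneg)
    show "AE z in f t. (%n. ph n z) ----> indicator C z"
    proof (rule AE_I2)
    fix z
    show "(%n. ph n z) ----> indicator C z"
    proof (cases "z : C")
    case z: False
    then have "infdist z C > 0"
    using C False by (simp add: in_closed_iff_infdist_zero less_le infdist_nonneg)
    then obtain n0 :: nat where n0: "1 < real n0 * infdist z C" using reals_Archimedean3 by blast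
    have "ph n z = 0" if "n \<ge> n0" for n
    using n0 that mult_right_mono[of "real n0" "real n" "infdist z C"] infdist_nonneg[of z C] by (auto simp: ph_def)
    then show ?thesis
    using z by (intro tendsto_eventually eventually_sequentiallyI[of n0]) auto
    qed (simp add: ph_def)
    qed
   qed (use c in auto)
   then show ?thesis using c by simp
  qed
  have "(%t. measure (f t) C) : borel_measurable borel"
   by (rule borel_measurable_LIMSEQ_real[OF lim m])
  then have "(%t. ennreal (measure (f t) C)) : borel_measurable borel" by measurable
  moreover have "emeasure (f t) C = ennreal (measure (f t) C)" for t
   by (simp add: finite_measure.emeasure_eq_measure prob_space.finite_measure f)
  ultimately show ?thesis by simp
 qed simp
 show "(%a. emeasure (f a) UNIV) : borel_measurable borel"
  using prob_space.emeasure_space_1[OF f(1)] by (simp add: sets_eq_imp_space_eq[OF f(2)])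
qed (use f in \<open>auto simp: Int_stable_def prob_space_imp_subprob_space\<close>)

lemma le_one_plus_square: "r <= 1 + r^2" for r :: real
 using zero_le_power2[of "r - 1 / 2"] unfolding power2_diff by (simp add: power2_eq_square)

lemma one_plus_le_square: "1 + r <= 2 * (1 + r^2)" for r :: real
proof -
 have "r <= 1 + r^2 + r^2" by (rule order_trans[OF le_one_plus_square]) simp
 then show ?thesis by simp
qed

text \<open>Narrow continuity extends to integrands of linear growth, since uniformly bounded second moments make
them uniformly integrable.\<close>

lemma continuous_integral_param:
 fixes f :: "real => 'b::euclidean_space measure" and F :: "'p::metric_space => 'b => real"
 assumes f: "!!t. t : I ==> prob_space (f t)" "!!t. t : I ==> sets (f t) = sets borel"
  and cont: "!!g :: 'b => real. continuous_on UNIV g ==> bounded (range g) ==> continuous_on I (%t. LINT z|f t. g z)"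
  and mom: "!!t. t : I ==> integrable (f t) (%z. (norm z)^2)" "!!t. t : I ==> (LINT z|f t. (norm z)^2) <= C"
  and F: "continuous_on (S \<times> UNIV) (%(p, z). F p z)" "!!p z. p : S ==> \<bar>F p z\<bar> <= C' * (1 + norm z)"
  and ta: "continuous_on S ta" "ta ` S \<subseteq> I"
 shows "continuous_on S (%p. LINT z|f (ta p). F p z)"
 unfolding continuous_on_def
proof (intro ballI tendstoI)
 fix p0 and e :: real assume p0: "p0 : S" and e: "0 < e"
 have C': "0 <= C'" using F(2)[OF p0, of 0] by simp
 have C: "0 <= C" 
 proof -
  have "0 <= (LINT z|f (ta p0). (norm z)^2)" by simp
  also have "\<dots> <= C" using mom(2)[of "ta p0"] ta p0 by auto
  finally show ?thesis .
 qed
 define R where "R = 16 * (C' + 1) * (1 + C) / e + 1"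
 have R: "0 < R" using C C' e by (auto simp: R_def intro!: add_nonneg_pos)
 have Fc: "continuous_on UNIV (F p)" if "p : S" for p
 proof -
  have "continuous_on UNIV (%z. (%(p, z). F p z) (p, z))"
   by (rule continuous_on_compose2[OF F(1)]) (use that in \<open>auto intro!: continuous_intros\<close>)
  then show ?thesis by simp
 qed
 define h where "h p z = F p z * bump R z" for p z
 have hc: "continuous_on UNIV (h p)" if "p : S" for p
  unfolding h_def by (intro continuous_intros Fc that)
 have hb: "\<bar>h p z\<bar> <= C' * (1 + R)" if "p : S" for p z
 proof (cases "norm z <= R")
  case True
  have "\<bar>h p z\<bar> <= (C' * (1 + norm z)) * 1"
   unfolding h_def abs_mult using F(2)[OF that, of z] bump_nonneg[of R z] bump_le_1[of R z]
   by (intro mult_mono) auto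
  also have "\<dots> <= C' * (1 + R)" using True C' by (simp add: mult_left_mono)
  finally show ?thesis .
 qed (use R C' bump_0[of R z] in \<open>simp add: h_def\<close>)
 have meas: "g : borel_measurable (f t)" if "continuous_on UNIV g" "t : I" for g :: "'b => real" and t
  unfolding measurable_cong_sets[OF f(2)[OF that(2)] refl]
  by (intro borel_measurable_continuous_onI that)
 have tail: "\<bar>(LINT z|f t. F p z) - (LINT z|f t. h p z)\<bar> <= e / 4" if p: "p : S" and t: "t : I" for p t
 proof -
  interpret L: prob_space "f t" by (rule f[OF t])
  have lin: "norm z <= 1 + (norm z)^2" for z :: 'b
   by (rule le_one_plus_square)
  have iz: "integrable (f t) (%z. 1 + (norm z)^2)" using mom[OF t] by simp
  have iF: "integrable (f t) (F p)"
  proof (rule Bochner_Integration.integrable_bound[of _ "%z. C' * (2 * (1 + (norm z)^2))"])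
   show "AE z in f t. norm (F p z) <= norm (C' * (2 * (1 + (norm z)^2)))"
   proof (rule AE_I2)
    fix z :: 'b
    have "1 + norm z <= 2 * (1 + (norm z)^2)"
    by (rule one_plus_le_square)
    then have "C' * (1 + norm z) <= C' * (2 * (1 + (norm z)^2))" using C' by (rule mult_left_mono)
    then show "norm (F p z) <= norm (C' * (2 * (1 + (norm z)^2)))" using F(2)[OF p, of z] by simp
   qed
  qed (use mom(1)[OF t] meas[OF Fc[OF p] t] in auto)
  have ih: "integrable (f t) (h p)"
   by (rule L.integrable_const_bound[of _ "C' * (1 + R)"]) (use hb[OF p] meas[OF hc[OF p] t] in auto)
  have "\<bar>(LINT z|f t. F p z) - (LINT z|f t. h p z)\<bar> = \<bar>LINT z|f t. F p z - h p z\<bar>"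
   using iF ih by simp
  also have "\<dots> <= (LINT z|f t. 4 * C' / R * (1 + (norm z)^2))"
   unfolding real_norm_def[symmetric]
  proof (rule Bochner_Integration.integral_norm_bound_integral)
   fix z
   have "norm (F p z - h p z) = \<bar>F p z\<bar> * (1 - bump R z)"
   proof -
    have "F p z - h p z = F p z * (1 - bump R z)" by (simp add: h_def algebra_simps)
    then show ?thesis using bump_le_1[of R z] by (simp add: abs_mult)
   qed
   also have "\<dots> <= (C' * (1 + norm z)) * (2 * norm z / R)"
    using F(2)[OF p, of z] one_minus_bump_linear[OF R, of z] bump_le_1[of R z] C' by (intro mult_mono) auto
   also have "\<dots> = 2 * C' / R * (norm z + (norm z)^2)" by (simp add: field_simps power2_eq_square)
   also have "\<dots> <= 2 * C' / R * (2 * (1 + (norm z)^2))"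
    using lin[of z] C' R by (intro mult_left_mono) auto
   finally show "norm (F p z - h p z) <= 4 * C' / R * (1 + (norm z)^2)" by (simp add: field_simps)
  qed (use iF ih iz in auto)
  also have "\<dots> = 4 * C' / R * (1 + (LINT z|f t. (norm z)^2))"
   using mom(1)[OF t] by (simp add: L.prob_space)
  also have "\<dots> <= 4 * C' / R * (1 + C)" using mom[OF t] C' R by (intro mult_left_mono) auto
  also have "\<dots> = 4 * C' * (1 + C) / R" by simp
  also have "\<dots> <= e / 4"
  proof -
   have "4 * C' * (1 + C) <= 4 * (C' + 1) * (1 + C)" using C by (intro mult_right_mono) auto
   also have "\<dots> <= e / 4 * R" using e by (simp add: R_def field_simps)
   finally show ?thesis using R by (simp add: divide_le_eq)
  qed
  finally show ?thesis .
 qed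
 have tI: "ta p : I" if "p : S" for p using ta that by auto
 have "continuous_on (S \<times> cball 0 R) (%(p, z). F p z)"
  by (rule continuous_on_subset[OF F(1)]) auto
 from continuous_on_prod_compactE[OF this compact_cball p0, where e="e / 4"] e
 obtain X0 where X0: "p0 : X0" "open X0"
   "ALL p:X0 \<inter> S. ALL z:cball 0 R. dist (F p z) (F p0 z) <= e / 4"
  by auto
 have close: "\<bar>(LINT z|f t. h p z) - (LINT z|f t. h p0 z)\<bar> <= e / 4" if p: "p : X0 \<inter> S" and t: "t : I" for p t
 proof -
  interpret L: prob_space "f t" by (rule f[OF t])
  have pS: "p : S" using p by simp
  have ih: "integrable (f t) (h q)" if "q : S" for q
   by (rule L.integrable_const_bound[of _ "C' * (1 + R)"]) (use hb[OF that] meas[OF hc[OF that] t] in auto)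
  have "\<bar>(LINT z|f t. h p z) - (LINT z|f t. h p0 z)\<bar> = \<bar>LINT z|f t. h p z - h p0 z\<bar>"
   using ih[OF pS] ih[OF p0] by simp
  also have "\<dots> <= (LINT z|f t. e / 4)"
   unfolding real_norm_def[symmetric]
  proof (rule Bochner_Integration.integral_norm_bound_integral)
   fix z
   show "norm (h p z - h p0 z) <= e / 4"
   proof (cases "norm z <= R")
    case True
    have "norm (h p z - h p0 z) = \<bar>F p z - F p0 z\<bar> * bump R z"
    proof -
    have "h p z - h p0 z = (F p z - F p0 z) * bump R z" by (simp add: h_def algebra_simps)
    then show ?thesis using bump_nonneg[of R z] by (simp add: abs_mult)
    qed
    also have "\<dots> <= e / 4 * 1"
    using X0(3) p True bump_nonneg[of R z] bump_le_1[of R z] e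
    by (intro mult_mono) (auto simp: dist_norm)
    finally show ?thesis by simp
   qed (use R e bump_0[of R z] in \<open>simp add: h_def\<close>)
  qed (use ih[OF pS] ih[OF p0] in auto)
  finally show ?thesis by (simp add: L.prob_space)
 qed
 have "bounded (range (h p0))" using hb[OF p0] by (intro boundedI[of _ "C' * (1 + R)"]) auto
 from cont[OF hc[OF p0] this] have "continuous_on S (%p. LINT z|f (ta p). h p0 z)"
  by (rule continuous_on_compose2[OF _ ta])
 then have "\<forall>\<^sub>F p in at p0 within S. dist (LINT z|f (ta p). h p0 z) (LINT z|f (ta p0). h p0 z) < e / 4"
  using p0 e unfolding continuous_on_def by (intro tendstoD) auto
 moreover have "\<forall>\<^sub>F p in at p0 within S. p : X0 \<inter> S"
  using X0 by (auto simp: eventually_at_topological)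
 ultimately show "\<forall>\<^sub>F p in at p0 within S. dist (LINT z|f (ta p). F p z) (LINT z|f (ta p0). F p0 z) < e"
 proof eventually_elim
  case (elim p)
  then have pS: "p : S" by simp
  show ?case
   using elim tail[OF pS tI[OF pS]] tail[OF p0 tI[OF p0]] close[OF elim(2) tI[OF pS]] e
   unfolding dist_real_def by linarith
 qed
qed

lemma continuous_integral_param_vec:
 fixes f :: "real => 'b::euclidean_space measure" and F :: "'p::metric_space => 'b => 'c::euclidean_space"
 assumes f: "!!t. t : I ==> prob_space (f t)" "!!t. t : I ==> sets (f t) = sets borel"
  and cont: "!!g :: 'b => real. continuous_on UNIV g ==> bounded (range g) ==> continuous_on I (%t. LINT z|f t. g z)"
  and mom: "!!t. t : I ==> integrable (f t) (%z. (norm z)^2)" "!!t. t : I ==> (LINT z|f t. (norm z)^2) <= C"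
  and F: "continuous_on (S \<times> UNIV) (%(p, z). F p z)" "!!p z. p : S ==> norm (F p z) <= C' * (1 + norm z)"
  and ta: "continuous_on S ta" "ta ` S \<subseteq> I"
 shows "continuous_on S (%p. LINT z|f (ta p). F p z)"
proof (rule continuous_on_componentwise[THEN iffD2], rule ballI)
 fix i :: 'c assume i: "i : Basis"
 have "continuous_on S (%p. LINT z|f (ta p). F p z \<bullet> i)"
 proof (rule continuous_integral_param[OF f cont mom _ _ ta])
  show "continuous_on (S \<times> UNIV) (%(p, z). F p z \<bullet> i)"
   using F(1) unfolding case_prod_unfold by (intro continuous_intros)
  show "\<bar>F p z \<bullet> i\<bar> <= C' * (1 + norm z)" if "p : S" for p z
   using Basis_le_norm[OF i, of "F p z"] F(2)[OF that, of z] by linarith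
 qed auto
 moreover have "(LINT z|f (ta p). F p z \<bullet> i) = (LINT z|f (ta p). F p z) \<bullet> i" if p: "p : S" for p
 proof (rule integral_inner_left)
  have t: "ta p : I" using ta p by auto
  interpret L: prob_space "f (ta p)" by (rule f[OF t])
  have C': "0 <= C'" using F(2)[OF p, of 0] norm_ge_zero[of "F p 0"] by (simp del: norm_ge_zero)
  have "continuous_on UNIV (%z. (%(p, z). F p z) (p, z))"
   by (rule continuous_on_compose2[OF F(1)]) (use p in \<open>auto intro!: continuous_intros\<close>)
  then have "F p : borel_measurable (f (ta p))"
   unfolding measurable_cong_sets[OF f(2)[OF t] refl]
   by (simp add: borel_measurable_continuous_onI)
  then show "integrable (f (ta p)) (F p)"
  proof (rule Bochner_Integration.integrable_bound[of _ "%z. C' * (2 * (1 + (norm z)^2))", rotated])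
   show "AE z in f (ta p). norm (F p z) <= norm (C' * (2 * (1 + (norm z)^2)))"
   proof (rule AE_I2)
    fix z :: 'b
    have "1 + norm z <= 2 * (1 + (norm z)^2)"
    by (rule one_plus_le_square)
    then have "C' * (1 + norm z) <= C' * (2 * (1 + (norm z)^2))" using C' by (rule mult_left_mono)
    then show "norm (F p z) <= norm (C' * (2 * (1 + (norm z)^2)))" using F(2)[OF p, of z] by simp
   qed
  qed (use mom(1)[OF t] in auto)
 qed
 ultimately show "continuous_on S (%p. (LINT z|f (ta p). F p z) \<bullet> i)"
  by (simp cong: continuous_on_cong)
qed

section \<open>Picard iteration in a weighted supremum norm\<close>

lemma continuous_on_integral_upto:
 fixes f :: "real => 'z::topological_space => 'b::euclidean_space"
 assumes f: "continuous_on UNIV (%(s, z). f s z)" and g: "continuous_on UNIV g" "!!t. a <= g t"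
 shows "continuous_on UNIV (%(t :: real, z). integral {a..g t} (%s. f s z))"
proof -
 have fz: "continuous_on S (%s. f s z)" for z S
 proof -
  have "continuous_on S (%s. (%(s, z). f s z) (s, z))"
   by (rule continuous_on_compose2[OF f]) (auto intro!: continuous_intros)
  then show ?thesis by simp
 qed
 have eq: "integral {a..g t} (%s. f s z) = (g t - a) *\<^sub>R integral {0..1} (%r. f (a + r * (g t - a)) z)" for t z
 proof -
  define h where "h r = a + r * (g t - a)" for r
  have "((%x. (g t - a) *\<^sub>R f (h x) z) has_integral (integral {h 0..h 1} (%s. f s z))) {0..1}"
  proof (rule has_integral_substitution[of 0 1 h a "g t"])
   show "h ` {0..1} \<subseteq> {a..g t}"
   proof clarsimp
    fix x :: real assume x: "0 <= x" "x <= 1"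
    then have "0 <= x * (g t - a)" "x * (g t - a) <= 1 * (g t - a)"
    using g(2)[of t] by (intro mult_nonneg_nonneg mult_right_mono; simp)+
    then show "a <= h x \<and> h x <= g t" by (simp add: h_def)
   qed
   show "(h has_real_derivative (g t - a)) (at x within {0..1})" for x
    unfolding h_def by (auto intro!: derivative_eq_intros)
  qed (use g fz in \<open>auto simp: h_def\<close>)
  from integral_unique[OF this] show ?thesis by (simp add: h_def)
 qed
 have "continuous_on UNIV (%p. integral (cbox 0 1) (%r::real. f (a + r * (g (fst p) - a)) (snd p)))"
 proof (rule integral_continuous_on_param)
  have "continuous_on (UNIV \<times> cbox 0 1) (%q. (%(s, z). f s z) (a + snd q * (g (fst (fst q)) - a), snd (fst q)))"
   by (rule continuous_on_compose2[OF f])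
    (auto intro!: continuous_intros continuous_on_compose2[OF g(1)])
  then show "continuous_on (UNIV \<times> cbox 0 1) (%(p, r::real). f (a + r * (g (fst p) - a)) (snd p))"
   by (simp add: case_prod_unfold)
 qed
 moreover have "continuous_on UNIV (%p::real \<times> 'z. g (fst p) - a)"
  by (intro continuous_intros continuous_on_compose2[OF g(1)]) auto
 ultimately have "continuous_on UNIV (%p. (g (fst p) - a) *\<^sub>R integral (cbox 0 1) (%r. f (a + r * (g (fst p) - a)) (snd p)))"
  by (rule continuous_on_scaleR[rotated])
 then show ?thesis by (simp add: case_prod_unfold eq)
qed

definition clamp_time :: "real => real => real => real" where
 "clamp_time a b t = max a (min b t)"

lemma clamp_time: "a <= b ==> clamp_time a b t : {a..b}" "t : {a..b} ==> clamp_time a b t = t"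
 by (auto simp: clamp_time_def)

lemma continuous_on_clamp_time [continuous_intros]: "continuous_on S f ==> continuous_on S (%x. clamp_time a b (f x))"
 unfolding clamp_time_def by (intro continuous_intros)

text \<open>The vector field \<open>B\<close> may couple all labels \<open>z\<close>; it only has to be Lipschitz for the norm
 \<open>sup \<bar>X z\<bar> / p z\<close>. The extra factor \<open>exp (2 L (t - a))\<close> makes the integral operator a contraction
 on the whole time interval at once.\<close>

lemma picard:
 fixes B :: "real => ('z::metric_space => 'a::euclidean_space) => 'z => 'a" and p :: "'z => real"
 assumes ab: "a <= b" and L: "0 < L"
  and p: "continuous_on UNIV p" "!!z. 1 <= p z"
  and x0: "continuous_on UNIV x0" "!!z. norm (x0 z) <= C0 * p z"
  and lip: "!!t X Y c z. t : {a..b} ==> continuous_on UNIV X ==> continuous_on UNIV Y ==>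
    (EX C. ALL z. norm (X z) <= C * p z) ==> (EX C. ALL z. norm (Y z) <= C * p z) ==>
    (!!z. norm (X z - Y z) <= c * p z) ==> norm (B t X z - B t Y z) <= L * c * p z"
  and B0: "!!t z. t : {a..b} ==> norm (B t (%_. 0) z) <= M * p z"
  and cont: "!!X. continuous_on UNIV (%(t, z). X t z) ==> (EX C. ALL t z. norm (X t z) <= C * p z) ==>
    continuous_on UNIV (%(t, z). B (clamp_time a b t) (X t) z)"
 obtains X where "continuous_on UNIV (%(t, z). X t z)" "!!t. X (clamp_time a b t) = X t"
  "X a = x0" "EX C. ALL t z. norm (X t z) <= C * p z"
  "!!t z. t : {a..b} ==> ((%t. X t z) has_vector_derivative B t (X t) z) (at t within {a..b})"
proof -
 define lam where "lam = 2 * L"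
 define kp where "kp = clamp_time a b"
 have kp: "a <= kp t" "kp t <= b" for t using clamp_time(1)[OF ab, of t] by (auto simp: kp_def)
 have kpid: "kp t = t" if "t : {a..b}" for t using that by (simp add: kp_def clamp_time)
 have kpc: "continuous_on UNIV kp" unfolding kp_def by (intro continuous_intros)
 have p0: "0 < p z" for z using p(2)[of z] by linarith
 define E where "E t = exp (lam * (kp t - a))" for t
 have E0: "0 < E t" for t by (simp add: E_def)
 have E1: "E t <= exp (lam * (b - a))" for t unfolding E_def using kp L by (simp add: lam_def mult_left_mono)
 define U where "U Y t z = (E t * p z) *\<^sub>R Y (t, z)" for Y :: "real \<times> 'z => 'a" and t z
 define \<Gamma> where "\<Gamma> Y = (%(t, z). (1 / (E t * p z)) *\<^sub>R (x0 z + integral {a..kp t} (%s. B (kp s) (U Y s) z)))"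
  for Y :: "real \<times> 'z => 'a"
 have Uc: "continuous_on UNIV (%(t, z). U Y t z)" if "Y : bcontfun" for Y
  unfolding U_def E_def using that kpc p(1)
  by (auto simp: bcontfun_def case_prod_unfold intro!: continuous_intros
    continuous_on_compose2[OF kpc] continuous_on_compose2[OF p(1)])
 have Uc1: "continuous_on UNIV (U Y t)" if "Y : bcontfun" for Y t
 proof -
  have "continuous_on UNIV (%z. (%(t, z). U Y t z) (t, z))"
   by (rule continuous_on_compose2[OF Uc[OF that]]) (auto intro!: continuous_intros)
  then show ?thesis by simp
 qed
 have Ub: "norm (U Y t z) <= E t * c * p z" if "!!q. norm (Y q) <= c" for Y t z c
 proof -
  have "norm (U Y t z) = E t * p z * norm (Y (t, z))" using E0 p0 by (simp add: U_def abs_mult less_imp_le)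
  also have "\<dots> <= E t * p z * c" using that E0[of t] p0[of z] by (intro mult_left_mono) auto
  finally show ?thesis by (simp add: mult_ac)
 qed
 have Ub': "EX C. ALL t z. norm (U Y t z) <= C * p z" if Y: "Y : bcontfun" for Y
 proof -
  obtain c where c: "!!q. norm (Y q) <= c" using Y by (auto simp: bcontfun_def bounded_iff)
  have c0: "0 <= c" using c norm_ge_zero order_trans by blast
  have "norm (U Y t z) <= exp (lam * (b - a)) * c * p z" for t z
   using Ub[where Y=Y and c=c and t=t and z=z, OF c] E1[of t] c0 p0[of z] by (smt (verit) mult_right_mono)
  then show ?thesis by blast
 qed
 have BUc: "continuous_on UNIV (%(t, z). B (kp t) (U Y t) z)" if Y: "Y : bcontfun" for Y
  using cont[OF Uc[OF Y] Ub'[OF Y]] by (simp add: kp_def)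
 have BUc1: "continuous_on S (%t. B (kp t) (U Y t) z)" if Y: "Y : bcontfun" for Y z S
 proof -
  have "continuous_on S (%t. (%(t, z). B (kp t) (U Y t) z) (t, z))"
   by (rule continuous_on_compose2[OF BUc[OF that]]) (auto intro!: continuous_intros)
  then show ?thesis by simp
 qed
 have BUb: "norm (B (kp s) (U Y s) z) <= (M + L * (exp (lam * (b - a)) * c)) * p z"
  if Y: "Y : bcontfun" and c: "!!q. norm (Y q) <= c" for Y c s z
 proof -
  have c0: "0 <= c" using c norm_ge_zero order_trans by blast
  have "norm (B (kp s) (U Y s) z - B (kp s) (%_. 0) z) <= L * (exp (lam * (b - a)) * c) * p z"
  proof (rule lip)
   show "norm (U Y s z - 0) <= exp (lam * (b - a)) * c * p z" for z
    using Ub[where Y=Y and c=c and t=s and z=z, OF c] E1[of s] c0 p0[of z] by (smt (verit) mult_right_mono diff_zero)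
   show "EX C. ALL z. norm (U Y s z) <= C * p z" using Ub'[OF Y] by blast
   show "EX C. ALL z. norm (0::'a) <= C * p z" by (intro exI[of _ 0]) simp
  qed (use kp Uc1[OF Y] in auto)
  then show ?thesis using B0[of "kp s" z] kp[of s] norm_triangle_sub[of "B (kp s) (U Y s) z" "B (kp s) (%_. 0) z"]
   by (simp add: algebra_simps)
 qed
 have \<Gamma>b: "\<Gamma> Y : bcontfun" if Y: "Y : bcontfun" for Y
 proof -
  obtain c where c: "!!q. norm (Y q) <= c" using Y by (auto simp: bcontfun_def bounded_iff)
  define D where "D = M + L * (exp (lam * (b - a)) * c)"
  show ?thesis
  proof (rule bcontfun_normI)
   have "continuous_on UNIV (%(t, z). integral {a..kp t} (%s. B (kp s) (U Y s) z))"
    by (rule continuous_on_integral_upto[OF BUc[OF Y] kpc kp(1)])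
   then have ci: "continuous_on UNIV (%p. integral {a..kp (fst p)} (%s. B (kp s) (U Y s) (snd p)))"
    by (simp add: case_prod_unfold)
   have nz: "E t * p z ~= 0" for t z using E0[of t] p0[of z] by simp
   show "continuous_on UNIV (\<Gamma> Y)"
    unfolding \<Gamma>_def E_def case_prod_unfold
    by (intro continuous_intros ci continuous_on_compose2[OF kpc] continuous_on_compose2[OF p(1)]
    continuous_on_compose2[OF x0(1)]) (use nz in \<open>auto simp: E_def\<close>)
   fix q :: "real \<times> 'z"
   obtain t z where q: "q = (t, z)" by force
   have "norm (integral {a..kp t} (%s. B (kp s) (U Y s) z)) <= (D * p z) * (kp t - a)"
    using kp(1)[of t] by (intro integral_bound BUc1[OF Y]) (auto simp: D_def intro: BUb[OF Y c])
   also have "\<dots> <= \<bar>D\<bar> * p z * (b - a)"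
    using kp[of t] p0[of z] by (intro mult_mono) auto
   finally have 1: "norm (x0 z + integral {a..kp t} (%s. B (kp s) (U Y s) z)) <= (C0 + \<bar>D\<bar> * (b - a)) * p z"
    using x0(2)[of z] by (intro norm_triangle_le) (simp add: algebra_simps)
   have E1': "1 <= E t" unfolding E_def using kp[of t] L by (simp add: lam_def)
   have "norm (\<Gamma> Y q) = norm (x0 z + integral {a..kp t} (%s. B (kp s) (U Y s) z)) / (E t * p z)"
    using E0[of t] p0[of z] by (simp add: \<Gamma>_def q abs_mult)
   also have "\<dots> <= ((C0 + \<bar>D\<bar> * (b - a)) * p z) / (E t * p z)"
    using 1 E0[of t] p0[of z] by (intro divide_right_mono) auto
   also have "\<dots> = (C0 + \<bar>D\<bar> * (b - a)) / E t" using p0[of z] by simp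
   also have "\<dots> <= \<bar>C0 + \<bar>D\<bar> * (b - a)\<bar> / E t" using E0[of t] by (intro divide_right_mono) auto
   also have "\<dots> <= \<bar>C0 + \<bar>D\<bar> * (b - a)\<bar> / 1" using E1' by (intro divide_left_mono) auto
   finally show "norm (\<Gamma> Y q) <= \<bar>C0 + \<bar>D\<bar> * (b - a)\<bar>" by simp
  qed
 qed
 define G :: "(real \<times> 'z) \<Rightarrow>\<^sub>C 'a => (real \<times> 'z) \<Rightarrow>\<^sub>C 'a" where "G Y = Bcontfun (\<Gamma> (apply_bcontfun Y))" for Y
 have G: "apply_bcontfun (G Y) = \<Gamma> (apply_bcontfun Y)" for Y
  unfolding G_def by (rule Bcontfun_inverse[OF \<Gamma>b[OF apply_bcontfun]])
 have "dist (G Y) (G Y') <= 1 / 2 * dist Y Y'" for Y Y'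
 proof (rule dist_bound)
  fix q :: "real \<times> 'z"
  obtain t z where q: "q = (t, z)" by force
  define d where "d = dist Y Y'"
  have d0: "0 <= d" by (simp add: d_def)
  have yb: "apply_bcontfun Y : bcontfun" "apply_bcontfun Y' : bcontfun" by (rule apply_bcontfun)+
  have diff: "norm (B (kp s) (U Y s) z - B (kp s) (U Y' s) z) <= L * (E s * d) * p z" for s
  proof (rule lip)
   fix z
   have "norm (U Y s z - U Y' s z) = E s * p z * dist (Y (s, z)) (Y' (s, z))"
    using E0[of s] p0[of z] by (simp add: U_def dist_norm abs_mult flip: scaleR_diff_right)
   also have "\<dots> <= E s * p z * d"
    unfolding d_def using E0[of s] p0[of z] by (intro mult_left_mono dist_bounded) auto
   finally show "norm (U Y s z - U Y' s z) <= E s * d * p z" by (simp add: mult_ac)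
  next
   show "EX C. ALL z. norm (U Y s z) <= C * p z" "EX C. ALL z. norm (U Y' s z) <= C * p z"
    using Ub'[OF yb(1)] Ub'[OF yb(2)] by blast+
  qed (use kp Uc1[OF yb(1)] Uc1[OF yb(2)] in auto)
  let ?I = "%Y. integral {a..kp t} (%s. B (kp s) (U Y s) z)"
  have ii: "(%s. B (kp s) (U Y s) z) integrable_on {a..kp t}" if "Y : bcontfun" for Y
   by (intro integrable_continuous_real BUc1[OF that])
  have "((%s. L * d * p z * exp (lam * (s - a))) has_integral
    (d * p z / 2 * exp (lam * (kp t - a)) - d * p z / 2 * exp (lam * (a - a)))) {a..kp t}"
   by (rule fundamental_theorem_of_calculus[OF kp(1)])
    (auto intro!: derivative_eq_intros simp: lam_def has_real_derivative_iff_has_vector_derivative[symmetric])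
  then have hi: "((%s. L * (E s * d) * p z) has_integral (d * p z / 2 * E t - d * p z / 2)) {a..kp t}"
   by (rule has_integral_eq_rhs[OF has_integral_eq, rotated])
    (use kp[of t] in \<open>auto simp: E_def kpid mult_ac\<close>)
  have "norm (?I Y - ?I Y') = norm (integral {a..kp t} (%s. B (kp s) (U Y s) z - B (kp s) (U Y' s) z))"
   using ii yb by (simp add: Henstock_Kurzweil_Integration.integral_diff)
  also have "\<dots> <= integral {a..kp t} (%s. L * (E s * d) * p z)"
   using hi by (intro Henstock_Kurzweil_Integration.integral_norm_bound_integral integrable_diff ii yb diff) auto
  also have "\<dots> <= d * p z / 2 * E t"
   using integral_unique[OF hi] d0 p0[of z] by simp
  finally have 1: "norm (?I Y - ?I Y') <= d * p z / 2 * E t" .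
  have "dist (G Y q) (G Y' q) = norm ((1 / (E t * p z)) *\<^sub>R (?I Y - ?I Y'))"
   by (simp add: G \<Gamma>_def q dist_norm flip: scaleR_diff_right)
  also have "\<dots> = norm (?I Y - ?I Y') / (E t * p z)"
   using E0[of t] p0[of z] by (simp add: abs_mult)
  also have "\<dots> <= (d * p z / 2 * E t) / (E t * p z)"
   using 1 E0[of t] p0[of z] by (intro divide_right_mono) auto
  also have "\<dots> = 1 / 2 * d" using E0[of t] p0[of z] by (simp add: field_simps)
  finally show "dist (G Y q) (G Y' q) <= 1 / 2 * dist Y Y'" by (simp add: d_def)
 qed
 then obtain Y where Y: "G Y = Y" using banach_fix_type[of "1 / 2" G] by auto
 define X where "X t = U Y (kp t)" for t
 have yb: "apply_bcontfun Y : bcontfun" by (rule apply_bcontfun)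
 have kpkp: "kp (kp t) = kp t" for t using kpid kp[of t] by auto
 have Xeq: "X t z = x0 z + integral {a..kp t} (%s. B (kp s) (U Y s) z)" for t z
 proof -
  have "Y (kp t, z) = \<Gamma> Y (kp t, z)" using G[of Y] Y by simp
  then show ?thesis
   using E0[of "kp t"] p0[of z] by (simp add: X_def U_def \<Gamma>_def kpkp)
 qed
 show ?thesis
 proof (rule that)
  have "continuous_on UNIV (%q. (%(t, z). U Y t z) (kp (fst q), snd q))"
   by (rule continuous_on_compose2[OF Uc[OF yb]])
    (auto intro!: continuous_intros continuous_on_compose2[OF kpc])
  then show "continuous_on UNIV (%(t, z). X t z)" by (simp add: X_def case_prod_unfold)
  show "X (clamp_time a b t) = X t" for t by (simp add: X_def kpkp flip: kp_def)
  show "X a = x0" using kpid[of a] ab by (auto simp: Xeq)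
  show "EX C. ALL t z. norm (X t z) <= C * p z" unfolding X_def using Ub'[OF yb] by blast
  fix t z assume t: "t : {a..b}"
  have "((%u. integral {a..u} (%s. B (kp s) (U Y s) z)) has_vector_derivative B (kp t) (U Y t) z) (at t within {a..b})"
   by (rule integral_has_vector_derivative[OF BUc1[OF yb] t])
  then have "((%u. x0 z + integral {a..u} (%s. B (kp s) (U Y s) z)) has_vector_derivative B (kp t) (U Y t) z) (at t within {a..b})"
   by (auto intro!: derivative_eq_intros)
  then have "((%u. X u z) has_vector_derivative B (kp t) (U Y t) z) (at t within {a..b})"
   by (rule has_vector_derivative_transform[OF t, rotated]) (simp add: Xeq kpid)
  moreover have "U Y t = X t" using kpid[OF t] by (simp add: X_def)
  ultimately show "((%t. X t z) has_vector_derivative B t (X t) z) (at t within {a..b})"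
   using kpid[OF t] by simp
 qed
qed

section \<open>Mollification\<close>

definition bump_mass :: "real => 'b::euclidean_space itself => real" where
 "bump_mass dl _ = (LINT q|lborel. bump dl (q :: 'b))"

text \<open>The mollifier is the \<open>C^1\<close> bump, as only a Lipschitz derivative is needed.\<close>

definition mollify :: "real => ('b::euclidean_space => real) => 'b => real" where
 "mollify dl ph z = (LINT q|lborel. ph q * bump dl (z - q)) / bump_mass dl TYPE('b)"

definition dmollify :: "real => ('b::euclidean_space => real) => 'b => 'b" where
 "dmollify dl ph z = (LINT q|lborel. ph q *\<^sub>R dbump dl (z - q)) /\<^sub>R bump_mass dl TYPE('b)"

lemma integrable_continuous_compact_support:
 fixes g :: "'b::euclidean_space => 'c::{banach,second_countable_topology}"
 assumes "continuous_on UNIV g" "!!z. r <= norm z ==> g z = 0"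
 shows "integrable lborel g"
proof -
 have "integrable lborel (%z. indicator (cball 0 r) z *\<^sub>R g z)"
  by (rule borel_integrable_compact) (use assms in \<open>auto intro: continuous_on_subset\<close>)
 moreover have "indicator (cball 0 r) z *\<^sub>R g z = g z" for z
  using assms(2)[of z] by (cases "norm z <= r") (auto simp: indicator_def)
 ultimately show ?thesis by simp
qed

lemma lborel_integral_shift:
 fixes g :: "'b::euclidean_space => 'c::{banach,second_countable_topology}"
 assumes "g : borel_measurable borel"
 shows "(LINT q|lborel. g (a + q)) = (LINT q|lborel. g q)"
proof -
 have "(LINT q|lborel. g q) = (LINT q|distr lborel borel ((+) a). g q)"
  by (simp add: lborel_distr_plus)
 also have "\<dots> = (LINT q|lborel. g (a + q))"
  by (rule integral_distr) (use assms in auto)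
 finally show ?thesis by simp
qed

lemma lborel_integral_reflect:
 fixes g :: "'b::euclidean_space => 'c::{banach,second_countable_topology}"
 assumes [measurable]: "g : borel_measurable borel"
 shows "(LINT q|lborel. g (a - q)) = (LINT q|lborel. g q)"
proof -
 have "(LINT q|lborel. g q) = (LINT q|density (distr lborel borel (%x::'b. a + (-1) *\<^sub>R x)) (%_. ennreal (\<bar>-1\<bar> ^ DIM('b))). g q)"
  by (subst lborel_affine[of "-1" a, symmetric]) auto
 also have "\<dots> = (LINT q|lborel. g (a - q))"
  by (simp add: density_1 integral_distr)
 finally show ?thesis by simp
qed

context
 fixes dl :: real assumes dl: "0 < dl"
begin

lemma integrable_bump: "integrable lborel (bump dl :: 'b::euclidean_space => real)"
 by (rule integrable_continuous_compact_support[of _ dl]) (auto intro!: continuous_intros bump_0 dl)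

lemma bump_mass_pos: "0 < bump_mass dl TYPE('b::euclidean_space)"
proof -
 have "0 < measure lborel (ball (0::'b) (dl / 2)) * (9 / 16)"
  using dl content_ball_pos[of "dl / 2" "0::'b"] by simp
 also have "\<dots> = (LINT q|lborel. 9 / 16 * indicator (ball (0::'b) (dl / 2)) q)" by simp
 also have "\<dots> <= (LINT q|lborel. bump dl (q :: 'b))"
 proof (rule integral_mono)
  show "integrable lborel (%q. 9 / 16 * indicator (ball (0::'b) (dl / 2)) q :: real)"
   by (intro integrable_mult_right integrable_real_indicator) (use emeasure_bounded_finite[OF bounded_ball] in auto)
  fix q :: 'b
  show "9 / 16 * indicator (ball 0 (dl / 2)) q <= bump dl q"
  proof (cases "norm q < dl / 2")
   case True
   have "(norm q)^2 / dl^2 <= (dl / 2)^2 / dl^2" using True by (intro divide_right_mono power_mono) auto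
   then have "3 / 4 <= 1 - (norm q)^2 / dl^2" using dl by (simp add: power_divide)
   then have "3 / 4 <= max 0 (1 - (norm q)^2 / dl^2)" by (rule max.coboundedI2)
   then have "(3 / 4)^2 <= bump dl q" unfolding bump_def sqpos_def by (rule power_mono) simp
   then show ?thesis using True by (simp add: power2_eq_square)
  qed (simp add: bump_nonneg)
 qed (rule integrable_bump)
 finally show ?thesis by (simp add: bump_mass_def)
qed

lemma bump_mass_shift: "(LINT q|lborel. bump dl (z - q)) = bump_mass dl TYPE('b)" for z :: "'b::euclidean_space"
 unfolding bump_mass_def
 by (rule lborel_integral_reflect) (intro borel_measurable_continuous_onI continuous_intros)

lemma integrable_bump_shift: "integrable lborel (%q. bump dl (z - q))" for z :: "'b::euclidean_space"
proof (rule integrable_continuous_compact_support[of _ "norm z + dl"])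
 show "bump dl (z - q) = 0" if "norm z + dl <= norm q" for q
  using that norm_triangle_ineq2[of q z] by (intro bump_0 dl) (simp add: norm_minus_commute)
qed (intro continuous_intros)

context
 fixes ph :: "'b::euclidean_space => real" and r :: real
 assumes ph: "continuous_on UNIV ph" "!!z. r <= norm z ==> ph z = 0"
begin

lemma mollify_integrable: "integrable lborel (%q. ph q * bump dl (z - q))"
 "integrable lborel (%q. ph q *\<^sub>R dbump dl (z - q))" "integrable lborel (%q. \<bar>ph q\<bar>)"
 by (rule integrable_continuous_compact_support[of _ r];
   (intro continuous_intros ph | simp add: ph))+

lemma mollify_deriv: "(mollify dl ph has_derivative (%h. dmollify dl ph z \<bullet> h)) (at z within S)"
proof -
 have "((%z. LINT q|lborel. ph q * bump dl (z - q)) has_derivative (%h. LINT q|lborel. ph q * (dbump dl (z - q) \<bullet> h))) (at z within UNIV)"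
 proof (rule has_derivative_integral_param[where G="%q. \<bar>ph q\<bar> * (4 / dl)"])
  show "norm (ph q * bump dl (p - q) - ph q * bump dl (z - q)) <= \<bar>ph q\<bar> * (4 / dl) * norm (p - z)" for p q
   using mult_left_mono[OF bump_lipschitz[OF dl, of "p - q" "z - q"], of "\<bar>ph q\<bar>"]
   by (simp add: abs_mult[symmetric] right_diff_distrib mult_ac)
  show "norm (ph q * (dbump dl (z - q) \<bullet> h)) <= \<bar>ph q\<bar> * (4 / dl) * norm h" for q h
  proof -
   have "\<bar>dbump dl (z - q) \<bullet> h\<bar> <= 4 / dl * norm h"
    by (rule order_trans[OF Cauchy_Schwarz_ineq2]) (intro mult_right_mono dbump_bound dl norm_ge_zero)
   from mult_left_mono[OF this, of "\<bar>ph q\<bar>"] show ?thesis by (simp add: abs_mult mult_ac)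
  qed
  show "((%p. ph q * bump dl (p - q)) has_derivative (%h. ph q * (dbump dl (z - q) \<bullet> h))) (at z within UNIV)" for q
  proof -
   have "((%p. p - q) has_derivative (%h. h)) (at z)" by (auto intro!: derivative_eq_intros)
   from has_derivative_mult_right[OF has_derivative_compose[OF this bump_deriv]] show ?thesis by simp
  qed
  have "(%q. ph q * (dbump dl (z - q) \<bullet> h)) : borel_measurable borel" for h
   by (intro borel_measurable_continuous_onI continuous_intros ph)
  then show "(%q. ph q * (dbump dl (z - q) \<bullet> h)) : borel_measurable lborel" for h by simp
 qed (use mollify_integrable in auto)
 moreover have "(LINT q|lborel. ph q * (dbump dl (z - q) \<bullet> h)) = (LINT q|lborel. ph q *\<^sub>R dbump dl (z - q)) \<bullet> h" for h
  using integral_inner_left[of h lborel "%q. ph q *\<^sub>R dbump dl (z - q)"] mollify_integrable by simp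
 ultimately have "((%z. inverse (bump_mass dl TYPE('b)) * (LINT q|lborel. ph q * bump dl (z - q))) has_derivative
  (%h. inverse (bump_mass dl TYPE('b)) * ((LINT q|lborel. ph q *\<^sub>R dbump dl (z - q)) \<bullet> h))) (at z within UNIV)"
  by (intro has_derivative_mult_right) simp
 then show ?thesis
  unfolding mollify_def[abs_def] dmollify_def
  by (auto simp: divide_inverse mult.commute intro: has_derivative_subset)
qed

lemma dmollify_lipschitz: "EX L. L-lipschitz_on UNIV (dmollify dl ph)"
proof (intro exI lipschitz_onI)
 let ?c = "bump_mass dl TYPE('b)"
 let ?L = "inverse ?c * ((LINT q|lborel. \<bar>ph q\<bar>) * (12 / dl^2))"
 show "0 <= ?L" using bump_mass_pos[where 'b='b] by simp
 fix z z' :: 'b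
 have "dmollify dl ph z - dmollify dl ph z' = (LINT q|lborel. ph q *\<^sub>R dbump dl (z - q) - ph q *\<^sub>R dbump dl (z' - q)) /\<^sub>R ?c"
  using mollify_integrable by (simp add: dmollify_def scaleR_diff_right)
 then have "dist (dmollify dl ph z) (dmollify dl ph z') = inverse ?c * norm (LINT q|lborel. ph q *\<^sub>R dbump dl (z - q) - ph q *\<^sub>R dbump dl (z' - q))"
  using bump_mass_pos[where 'b='b] by (simp add: dist_norm)
 also have "\<dots> <= inverse ?c * (LINT q|lborel. \<bar>ph q\<bar> * (12 / dl^2 * norm (z - z')))"
 proof (intro mult_left_mono Bochner_Integration.integral_norm_bound_integral)
  fix q
  show "norm (ph q *\<^sub>R dbump dl (z - q) - ph q *\<^sub>R dbump dl (z' - q)) <= \<bar>ph q\<bar> * (12 / dl^2 * norm (z - z'))"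
   using mult_left_mono[OF dbump_lipschitz[OF dl, of "z - q" "z' - q"], of "\<bar>ph q\<bar>"]
   by (simp flip: scaleR_diff_right)
 qed (use mollify_integrable bump_mass_pos[where 'b='b] in auto)
 finally show "dist (dmollify dl ph z) (dmollify dl ph z') <= ?L * dist z z'"
  by (simp add: dist_norm)
qed

lemma mollify_support: "r + dl <= norm z ==> mollify dl ph z = 0" "r + dl <= norm z ==> dmollify dl ph z = 0"
proof -
 assume z: "r + dl <= norm z"
 have *: "ph q = 0 \<or> dl <= norm (z - q)" for q
  using ph(2)[of q] z norm_triangle_ineq2[of z q] by linarith
 have "(%q. ph q * bump dl (z - q)) = (%q. 0)" "(%q. ph q *\<^sub>R dbump dl (z - q)) = (%q. 0)"
  using * bump_0[OF dl] dbump_0[OF dl] by (auto simp: fun_eq_iff)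
 then show "mollify dl ph z = 0" "dmollify dl ph z = 0"
  by (simp_all add: mollify_def dmollify_def)
qed

text \<open>Bounds the increment of a mollification in a direction chosen at the centre: averages move with their
centre, so it suffices to compare increments at nearby points in that same direction.\<close>

lemma mollify_shift_close:
 assumes close: "!!q. norm (q - z) <= dl ==> \<bar>ph (q + a) - c q\<bar> <= e" and c: "continuous_on UNIV c" "!!z. r' <= norm z ==> c z = 0"
 shows "\<bar>mollify dl ph (z + a) - mollify dl c z\<bar> <= e"
proof -
 let ?c = "bump_mass dl TYPE('b)"
 have ic: "integrable lborel (%q. c q * bump dl (z - q))"
  by (rule integrable_continuous_compact_support[of _ r']; (intro continuous_intros c | simp add: c))
 have "(LINT q|lborel. ph q * bump dl (z + a - q)) = (LINT q|lborel. ph (a + q) * bump dl (z + a - (a + q)))"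
  by (rule lborel_integral_shift[symmetric]) (intro borel_measurable_continuous_onI continuous_intros ph)
 then have 1: "(LINT q|lborel. ph q * bump dl (z + a - q)) = (LINT q|lborel. ph (q + a) * bump dl (z - q))"
  by (simp add: add.commute)
 have iph: "integrable lborel (%q. ph (q + a) * bump dl (z - q))"
 proof (rule integrable_continuous_compact_support[of _ "r + norm a"])
  show "continuous_on UNIV (%q. ph (q + a) * bump dl (z - q))"
   by (intro continuous_intros continuous_on_compose2[OF ph(1)]) auto
  show "ph (q + a) * bump dl (z - q) = 0" if "r + norm a <= norm q" for q
   using ph(2)[of "q + a"] that norm_triangle_ineq2[of q "- a"] by simp
 qed
 have "\<bar>(LINT q|lborel. ph (q + a) * bump dl (z - q)) - (LINT q|lborel. c q * bump dl (z - q))\<bar>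
   = norm (LINT q|lborel. ph (q + a) * bump dl (z - q) - c q * bump dl (z - q))"
  using iph ic by simp
 also have "\<dots> <= (LINT q|lborel. e * bump dl (z - q))"
 proof (rule Bochner_Integration.integral_norm_bound_integral)
  fix q
  show "norm (ph (q + a) * bump dl (z - q) - c q * bump dl (z - q)) <= e * bump dl (z - q)"
  proof (cases "norm (q - z) <= dl")
   case True
   have "norm (ph (q + a) * bump dl (z - q) - c q * bump dl (z - q)) = \<bar>ph (q + a) - c q\<bar> * bump dl (z - q)"
    using bump_nonneg[of dl "z - q"] by (simp add: abs_mult flip: left_diff_distrib)
   also have "\<dots> <= e * bump dl (z - q)" using close[OF True] by (intro mult_right_mono bump_nonneg)
   finally show ?thesis .
  next
   case False
   then have "bump dl (z - q) = 0" by (intro bump_0 dl) (simp add: norm_minus_commute)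
   then show ?thesis by simp
  qed
 qed (use iph ic integrable_bump_shift[of z] in auto)
 also have "\<dots> = e * ?c" by (simp add: bump_mass_shift)
 finally have 2: "\<bar>(LINT q|lborel. ph q * bump dl (z + a - q)) - (LINT q|lborel. c q * bump dl (z - q))\<bar> <= e * ?c"
  unfolding 1 .
 have "mollify dl ph (z + a) - mollify dl c z = ((LINT q|lborel. ph q * bump dl (z + a - q)) - (LINT q|lborel. c q * bump dl (z - q))) / ?c"
  by (simp add: mollify_def diff_divide_distrib)
 then show ?thesis
  using 2 bump_mass_pos[where 'b='b] by (simp add: abs_divide divide_le_eq)
qed

lemma mollify_close:
 assumes close: "!!q. norm (q - z) <= dl ==> \<bar>ph q - ph z\<bar> <= e"
 shows "\<bar>mollify dl ph z - ph z\<bar> <= e"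
proof -
 let ?c = "bump_mass dl TYPE('b)"
 have "\<bar>(LINT q|lborel. ph q * bump dl (z - q)) - (LINT q|lborel. ph z * bump dl (z - q))\<bar>
   = norm (LINT q|lborel. ph q * bump dl (z - q) - ph z * bump dl (z - q))"
  using mollify_integrable integrable_bump_shift[of z] by simp
 also have "\<dots> <= (LINT q|lborel. e * bump dl (z - q))"
 proof (rule Bochner_Integration.integral_norm_bound_integral)
  fix q
  show "norm (ph q * bump dl (z - q) - ph z * bump dl (z - q)) <= e * bump dl (z - q)"
  proof (cases "norm (q - z) <= dl")
   case True
   have "norm (ph q * bump dl (z - q) - ph z * bump dl (z - q)) = \<bar>ph q - ph z\<bar> * bump dl (z - q)"
    using bump_nonneg[of dl "z - q"] by (simp add: abs_mult flip: left_diff_distrib)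
   also have "\<dots> <= e * bump dl (z - q)" using close[OF True] by (intro mult_right_mono bump_nonneg)
   finally show ?thesis .
  next
   case False
   then have "bump dl (z - q) = 0" by (intro bump_0 dl) (simp add: norm_minus_commute)
   then show ?thesis by simp
  qed
 qed (use mollify_integrable integrable_bump_shift[of z] in auto)
 also have "\<dots> = e * ?c" by (simp add: bump_mass_shift)
 finally have 2: "\<bar>(LINT q|lborel. ph q * bump dl (z - q)) - ph z * ?c\<bar> <= e * ?c"
  by (simp add: bump_mass_shift)
 have "mollify dl ph z - ph z = ((LINT q|lborel. ph q * bump dl (z - q)) - ph z * ?c) / ?c"
  using bump_mass_pos[where 'b='b] by (simp add: mollify_def diff_divide_distrib)
 then show ?thesis
  using 2 bump_mass_pos[where 'b='b] by (simp add: abs_divide divide_le_eq)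
qed

end
end

section \<open>Convolution with the kernel\<close>

text \<open>The law of the positions is always the image of some probability measure \<open>mu\<close> under a
 position map \<open>X\<close>: labels and flow map for Lagrangian curves, phase space and first projection
 for Eulerian ones.\<close>

definition convK :: "real => real => 'z measure => ('z => 'a::euclidean_space) => 'a => 'a" where
 "convK al ep mu X y = (LINT z|mu. K al ep (y - X z))"

lemma conv_gradW_eq_convK:
 assumes "sets mu = sets borel" "0 < al" "al < 1"
 shows "conv_gradW al (pos_marginal mu) x = convK al 0 mu fst x"
proof -
 have m: "fst : mu \<rightarrow>\<^sub>M borel"
  unfolding measurable_cong_sets[OF assms(1) refl] by (intro borel_measurable_continuous_onI continuous_intros)
 have [measurable]: "K al 0 : borel_measurable (borel :: 'a measure)" using assms by measurable
 show ?thesis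
  unfolding conv_gradW_def pos_marginal_def convK_def K_0[symmetric]
  by (rule integral_distr[OF m]) measurable
qed

text \<open>Jensen's inequality up to a factor 2: below \<open>A\<close> the power is at most \<open>A powr (1 - al)\<close>, above \<open>A\<close> it is
at most \<open>A powr (1 - al)\<close> times \<open>(D z / A)^2\<close>.\<close>

lemma integrable_powr_holder:
 fixes D :: "'z => real"
 assumes al: "0 < al" "al < 1" and mu: "prob_space mu" and D: "!!z. 0 <= D z" "D : borel_measurable mu"
  and i: "integrable mu (%z. (D z)^2)" and A: "0 < A" "(LINT z|mu. (D z)^2) <= A^2"
 shows "integrable mu (%z. D z powr (1 - al))" "(LINT z|mu. D z powr (1 - al)) <= 2 * A powr (1 - al)"
proof -
 interpret prob_space mu by fact
 have pw: "D z powr (1 - al) <= A powr (1 - al) * (1 + (D z)^2 / A^2)" for z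
 proof (cases "D z <= A")
  case True
  have "D z powr (1 - al) <= A powr (1 - al) * 1" using True D al by (simp add: powr_mono2)
  also have "\<dots> <= A powr (1 - al) * (1 + (D z)^2 / A^2)" by (intro mult_left_mono) auto
  finally show ?thesis .
 next
  case False
  have "D z powr (1 - al) = A powr (1 - al) * (D z / A) powr (1 - al)"
   using A D by (simp add: powr_mult[symmetric])
  also have "\<dots> <= A powr (1 - al) * (D z / A) powr 2"
   using False A al by (intro mult_left_mono powr_mono) auto
  also have "\<dots> <= A powr (1 - al) * (1 + (D z)^2 / A^2)"
   using False A by (intro mult_left_mono) (auto simp: power_divide)
  finally show ?thesis .
 qed
 have ir: "integrable mu (%z. A powr (1 - al) * (1 + (D z)^2 / A^2))" using i by simp
 show il: "integrable mu (%z. D z powr (1 - al))"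
  by (rule Bochner_Integration.integrable_bound[OF ir])
   (use D in \<open>auto intro!: AE_I2 order_trans[OF pw]\<close>)
 have "(LINT z|mu. D z powr (1 - al)) <= (LINT z|mu. A powr (1 - al) * (1 + (D z)^2 / A^2))"
  by (rule integral_mono[OF il ir pw])
 also have "\<dots> = A powr (1 - al) * (1 + (LINT z|mu. (D z)^2) / A^2)" using i by (simp add: prob_space)
 also have "\<dots> <= A powr (1 - al) * (1 + 1)" using A by (intro mult_left_mono add_left_mono) auto
 finally show "(LINT z|mu. D z powr (1 - al)) <= 2 * A powr (1 - al)" by simp
qed

lemma sym_integral:
 fixes F :: "'z \<times> 'z => real"
 assumes mu: "prob_space mu" and F: "integrable (mu \<Otimes>\<^sub>M mu) F"
 shows "(LINT p|(mu \<Otimes>\<^sub>M mu). F p) = (LINT p|(mu \<Otimes>\<^sub>M mu). (F p + F (snd p, fst p)) / 2)"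
  "integrable (mu \<Otimes>\<^sub>M mu) (%p. F (snd p, fst p))"
proof -
 interpret prob_space mu by fact
 interpret pair_sigma_finite mu mu ..
 have 1: "integrable (mu \<Otimes>\<^sub>M mu) (%p. F (snd p, fst p))"
  using integrable_product_swap[OF F] by (simp add: case_prod_unfold)
 have 2: "(LINT p|(mu \<Otimes>\<^sub>M mu). F (snd p, fst p)) = (LINT p|(mu \<Otimes>\<^sub>M mu). F p)"
  using integral_product_swap[of F] borel_measurable_integrable[OF F] by (simp add: case_prod_unfold)
 show "(LINT p|(mu \<Otimes>\<^sub>M mu). F p) = (LINT p|(mu \<Otimes>\<^sub>M mu). (F p + F (snd p, fst p)) / 2)"
  using F 1 2 by simp
 show "integrable (mu \<Otimes>\<^sub>M mu) (%p. F (snd p, fst p))" by fact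
qed

lemma integrable_fst_snd:
 fixes f g :: "'z => real"
 assumes mu: "prob_space mu" and f: "integrable mu f" and g: "integrable mu g"
 shows "integrable (mu \<Otimes>\<^sub>M mu) (%p. f (fst p) * g (snd p))"
proof -
 interpret prob_space mu by fact
 interpret pair_sigma_finite mu mu ..
 note [measurable] = borel_measurable_integrable[OF f] borel_measurable_integrable[OF g]
 show ?thesis
 proof (rule Fubini_integrable)
  show "integrable mu (%x. LINT y|mu. norm (f (fst (x, y)) * g (snd (x, y))))"
   using f g by (simp add: abs_mult)
 qed (use g in auto)
qed

lemma has_vector_derivative_norm_square:
 assumes "(f has_vector_derivative f') (at t within S)"
 shows "((%t. (norm (f t))^2) has_vector_derivative 2 * (f t \<bullet> f')) (at t within S)"
 using bounded_bilinear.has_vector_derivative[OF bounded_bilinear_inner assms assms]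
 unfolding power2_norm_eq_inner by (simp add: inner_commute)

context
 fixes al :: real and mu :: "'z measure" and X :: "'z => 'a::euclidean_space"
 assumes al: "0 < al" "al < 1" and mu: "prob_space mu"
  and X[measurable]: "X : borel_measurable mu" and iX: "integrable mu (%z. norm (X z))"
begin

interpretation prob_space mu by (rule mu)

lemma integrable_convK: "integrable mu (%z. K al ep (y - X z))"
proof (rule Bochner_Integration.integrable_bound[of _ "%z. cH al * (1 + (norm y + norm (X z)))"])
 have [measurable]: "K al ep : borel_measurable (borel :: 'a measure)" using al by measurable
 show "(%z. K al ep (y - X z)) : borel_measurable mu" by measurable
 show "AE z in mu. norm (K al ep (y - X z)) <= norm (cH al * (1 + (norm y + norm (X z))))"
 proof (rule AE_I2)
  fix z
  have "norm (K al ep (y - X z)) <= cH al * (1 + (norm y + norm (X z)))"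
   using cH_pos[OF al] by (intro order_trans[OF K_growth[OF al]] mult_left_mono add_left_mono norm_triangle_ineq4) auto
  then show "norm (K al ep (y - X z)) <= norm (cH al * (1 + (norm y + norm (X z))))" by simp
 qed
qed (use iX in simp)

lemma convK_growth: "norm (convK al ep mu X y) <= cH al * (1 + norm y + (LINT z|mu. norm (X z)))"
proof -
 have "norm (convK al ep mu X y) <= (LINT z|mu. cH al * (1 + (norm y + norm (X z))))"
  unfolding convK_def
 proof (rule order_trans[OF integral_norm_bound integral_mono])
  show "norm (K al ep (y - X z)) <= cH al * (1 + (norm y + norm (X z)))" for z
   using cH_pos[OF al] by (intro order_trans[OF K_growth[OF al]] mult_left_mono add_left_mono norm_triangle_ineq4) auto
 qed (use iX integrable_convK in auto)
 also have "\<dots> = cH al * (1 + norm y + (LINT z|mu. norm (X z)))"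
  using iX by (simp add: prob_space)
 finally show ?thesis .
qed

lemma convK_holder: "norm (convK al ep mu X y - convK al ep mu X y') <= cH al * norm (y - y') powr (1 - al)"
proof -
 have "convK al ep mu X y - convK al ep mu X y' = (LINT z|mu. K al ep (y - X z) - K al ep (y' - X z))"
  unfolding convK_def using integrable_convK by simp
 also have "norm \<dots> <= (LINT z|mu. cH al * norm (y - y') powr (1 - al))"
 proof (rule order_trans[OF integral_norm_bound integral_mono])
  show "norm (K al ep (y - X z) - K al ep (y' - X z)) <= cH al * norm (y - y') powr (1 - al)" for z
   using K_holder[OF al, of ep "y - X z" "y' - X z"] by simp
 qed (use integrable_convK in auto)
 finally show ?thesis by (simp add: prob_space)
qed

lemma convK_mono: "0 <= (convK al ep mu X y - convK al ep mu X y') \<bullet> (y - y')"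
proof -
 have "(convK al ep mu X y - convK al ep mu X y') \<bullet> (y - y') = (LINT z|mu. (K al ep (y - X z) - K al ep (y' - X z)) \<bullet> (y - y'))"
  unfolding convK_def using integrable_convK integral_inner_left[of "y - y'" mu "%z. K al ep (y - X z) - K al ep (y' - X z)"] by simp
 also have "0 <= \<dots>"
 proof (rule Bochner_Integration.integral_nonneg)
  show "0 <= (K al ep (y - X z) - K al ep (y' - X z)) \<bullet> (y - y')" for z
   using K_mono[OF al, of ep "y - X z" "y' - X z"] by simp
 qed
 finally show ?thesis .
qed

lemma convK_eps: "norm (convK al ep mu X y - convK al dl mu X y) <= cH al * \<bar>ep - dl\<bar> powr (1 - al)"
proof -
 have "convK al ep mu X y - convK al dl mu X y = (LINT z|mu. K al ep (y - X z) - K al dl (y - X z))"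
  unfolding convK_def using integrable_convK by simp
 also have "norm \<dots> <= (LINT z|mu. cH al * \<bar>ep - dl\<bar> powr (1 - al))"
  by (rule order_trans[OF integral_norm_bound integral_mono]) (use integrable_convK K_conv[OF al] in auto)
 finally show ?thesis by (simp add: prob_space)
qed

lemma convK_lipschitz:
 assumes ep: "0 < ep" shows "norm (convK al ep mu X y - convK al ep mu X y') <= cD al * ep powr (- al) * norm (y - y')"
proof -
 have "convK al ep mu X y - convK al ep mu X y' = (LINT z|mu. K al ep (y - X z) - K al ep (y' - X z))"
  unfolding convK_def using integrable_convK by simp
 also have "norm \<dots> <= (LINT z|mu. cD al * ep powr (- al) * norm (y - y'))"
 proof (rule order_trans[OF integral_norm_bound integral_mono])
  show "norm (K al ep (y - X z) - K al ep (y' - X z)) <= cD al * ep powr (- al) * norm (y - y')" for z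
   using K_lipschitz[OF al ep, of "y - X z" "y' - X z"] by simp
 qed (use integrable_convK in auto)
 finally show ?thesis by (simp add: prob_space)
qed

end

section \<open>Lagrangian solutions of the first-order system\<close>

lemma uniform_limit_of_curves:
 fixes x :: "nat => real => 'z::metric_space => 'a::euclidean_space"
 assumes c: "!!n. continuous_on UNIV (%(t, z). x n t z)" and gp: "gp ----> 0"
  and cauchy: "!!N n m t z. N <= n ==> N <= m ==> norm (x n t z - x m t z) <= gp N"
  and b: "EX C. ALL t z. norm (x 0 t z) <= C * p z" "!!z. 1 <= p z"
 obtains y where "!!t z. (%n. x n t z) ----> y t z" "!!n t z. norm (x n t z - y t z) <= gp n"
  "continuous_on UNIV (%(t, z). y t z)" "EX C. ALL t z. norm (y t z) <= C * p z"
proof -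
 have ev: "EX N. ALL n>=N. gp n < e" if "0 < e" for e
  using order_tendstoD(2)[OF gp that] by (simp add: eventually_sequentially)
 have "Cauchy (%n. x n t z)" for t z
  by (rule CauchyI) (metis ev cauchy le_less_trans order_refl)
 then obtain y where lim: "!!t z. (%n. x n t z) ----> y t z" unfolding Cauchy_convergent_iff convergent_def by metis
 have close: "norm (x n t z - y t z) <= gp n" for n t z
 proof (rule tendsto_upperbound)
  show "(%m. norm (x n t z - x m t z)) ----> norm (x n t z - y t z)" by (intro tendsto_intros lim)
  show "\<forall>\<^sub>F m in sequentially. norm (x n t z - x m t z) <= gp n"
   using cauchy[of n n] by (intro eventually_sequentiallyI[of n]) auto
 qed simp
 have "continuous_on UNIV (%(t, z). y t z)"
 proof (rule uniform_limit_theorem[of _ "%n. %(t, z). x n t z" sequentially])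
  show "uniform_limit UNIV (%n (t, z). x n t z) (%(t, z). y t z) sequentially"
   by (rule uniform_limitI, drule order_tendstoD(2)[OF gp], erule eventually_mono) (auto simp: dist_norm intro!: le_less_trans[OF close])
 qed (use c in auto)
 moreover obtain C where C: "!!t z. norm (x 0 t z) <= C * p z" using b(1) by blast
 have "norm (y t z) <= (C + gp 0) * p z" for t z
  using close[of 0 t z] C[of t z] norm_triangle_sub[of "y t z" "x 0 t z"] mult_left_mono[OF b(2)[of z], of "gp 0"] order_trans[OF norm_ge_zero close[of 0 t z]]
  by (simp add: norm_minus_commute distrib_right)
 ultimately show ?thesis using that lim close by blast
qed

lemma derivative_of_limit:
 fixes x :: "nat => real => 'a::euclidean_space"
 assumes der: "!!n s. s : {a..b} ==> (x n has_vector_derivative v n s) (at s within {a..b})" and lim: "!!s. s : {a..b} ==> (%n. x n s) ----> y s"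
  and v: "!!n s. s : {a..b} ==> norm (v n s - w s) <= vg n" "vg ----> 0" and s: "s : {a..b}"
 shows "(y has_vector_derivative w s) (at s within {a..b})"
proof -
 have "EX y'. ALL s:{a..b}. (%n. x n s) ----> y' s \<and> (y' has_derivative (%h. h *\<^sub>R w s)) (at s within {a..b})"
 proof (rule has_derivative_sequence[OF _ der[unfolded has_vector_derivative_def]])
  show "\<forall>\<^sub>F n in sequentially. ALL s:{a..b}. ALL h. norm (h *\<^sub>R v n s - h *\<^sub>R w s) <= e * norm h" if "0 < e" for e
   using order_tendstoD(2)[OF v(2) that]
  proof eventually_elim
   case (elim n)
   have "\<bar>h\<bar> * norm (v n s - w s) <= \<bar>h\<bar> * e" if "s : {a..b}" for s h
    using v(1)[OF that, of n] elim by (intro mult_left_mono) auto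
   then show ?case by (simp add: scaleR_diff_right[symmetric] mult.commute)
  qed
 qed (use lim s in auto)
 then obtain y' where y': "ALL s:{a..b}. (%n. x n s) ----> y' s \<and> (y' has_vector_derivative w s) (at s within {a..b})"
  unfolding has_vector_derivative_def by blast
 show ?thesis
  by (rule has_vector_derivative_transform[OF s _ conjunct2[OF bspec[OF y' s]]]) (use LIMSEQ_unique[OF lim conjunct1[OF bspec[OF y']]] in blast)
qed

text \<open>The curve is continued by constants outside \<open>{0..T}\<close>, so that continuity can be stated on the whole
line.\<close>

definition lagrangian :: "real => real => ('a::euclidean_space \<times> 'a) measure => ('a \<times> 'a => 'a) => real
  => (real => 'a \<times> 'a => 'a) => bool" where
 "lagrangian al ep f0 om T X \<longleftrightarrow>
  continuous_on UNIV (%(t, z). X t z) \<and> (ALL t. X (clamp_time 0 T t) = X t) \<and> X 0 = fst \<and>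
  (EX C. ALL t z. norm (X t z) <= C * (1 + norm z)) \<and>
  (ALL z. ALL t:{0..T}. ((%t. X t z) has_vector_derivative (om z - convK al ep f0 (X t) (X t z))) (at t within {0..T}))"

locale initial_law =
 fixes al T :: real and f0 :: "('a::euclidean_space \<times> 'a) measure"
 assumes al: "0 < al" "al < 1" and T: "0 < T"
  and f0: "prob_space f0" and sets_f0 [measurable_cong]: "sets f0 = sets borel"
  and f0_square: "integrable f0 (%z. (norm z)^2)"
begin

abbreviation ff0 where "ff0 == f0 \<Otimes>\<^sub>M f0"

sublocale prob_space f0 by (rule f0)

sublocale pair_sigma_finite f0 f0 ..

lemma space_f0 [simp]: "space f0 = UNIV"
 using sets_eq_imp_space_eq[OF sets_f0] by simp

lemma prob_f0_UNIV [simp]: "measure f0 UNIV = 1"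
 using prob_space by simp

lemma f0_wt_square: "integrable f0 (%z. (1 + norm z)^2)"
proof (rule Bochner_Integration.integrable_bound[of _ "%z. 2 * (1 + (norm z)^2)"])
 show "integrable f0 (%z. 2 * (1 + (norm z)^2))" using f0_square by simp
 show "AE z in f0. norm ((1 + norm z)^2) <= norm (2 * (1 + (norm z)^2))"
 proof (rule AE_I2)
  fix z :: "'a \<times> 'a"
  have "(1 + norm z)^2 <= 2 * (1 + (norm z)^2)"
   using zero_le_power2[of "norm z - 1"] unfolding power2_diff power2_sum by simp
  then show "norm ((1 + norm z)^2) <= norm (2 * (1 + (norm z)^2))"
   by simp
 qed
qed measurable

lemma f0_wt: "integrable f0 (%z. 1 + norm z)"
proof (rule Bochner_Integration.integrable_bound[OF f0_wt_square])
 show "AE z in f0. norm (1 + norm z) <= norm ((1 + norm z)^2)"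
 proof (rule AE_I2)
  fix z :: "'a \<times> 'a"
  show "norm (1 + norm z) <= norm ((1 + norm z)^2)"
   using mult_left_mono[of 1 "1 + norm z" "1 + norm z"] by (simp add: power2_eq_square)
 qed
qed measurable

lemma integrable_linear:
 fixes g :: "'a \<times> 'a => 'c::{banach,second_countable_topology}"
 assumes "g : borel_measurable f0" "!!z. norm (g z) <= C * (1 + norm z)"
 shows "integrable f0 g"
proof (rule Bochner_Integration.integrable_bound[of _ "%z. C * (1 + norm z)"])
 show "AE z in f0. norm (g z) <= norm (C * (1 + norm z))"
  using assms(2) by (intro AE_I2 order_trans[OF assms(2)]) auto
qed (use assms f0_wt in auto)

lemma integrable_quadratic:
 fixes g :: "'a \<times> 'a => 'c::{banach,second_countable_topology}"
 assumes "g : borel_measurable f0" "!!z. norm (g z) <= C * (1 + norm z)^2"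
 shows "integrable f0 g"
proof (rule Bochner_Integration.integrable_bound[of _ "%z. C * (1 + norm z)^2"])
 show "AE z in f0. norm (g z) <= norm (C * (1 + norm z)^2)"
  using assms(2) by (intro AE_I2 order_trans[OF assms(2)]) auto
qed (use assms f0_wt_square in auto)

lemma continuous_convK:
 fixes X :: "real => 'a \<times> 'a => 'a" and y :: "'p::metric_space => 'a"
 assumes X: "continuous_on UNIV (%(t, z). X t z)" "!!t z. norm (X t z) <= C * (1 + norm z)"
  and ta: "continuous_on UNIV ta" and y: "continuous_on UNIV y"
 shows "continuous_on UNIV (%p. convK al ep f0 (X (ta p)) (y p))"
proof -
 have C0: "0 <= C" using X(2)[of 0 0] norm_ge_zero[of "X 0 0"] by (auto simp del: norm_ge_zero)
 have loc: "continuous_on {p. norm (y p) < real r} (%p. convK al ep f0 (X (ta p)) (y p))" for r :: nat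
  unfolding convK_def
 proof (rule continuous_integral_param_vec[where I=UNIV and f="%_. f0" and ta="%_. 0" and C="LINT z|f0. (norm z)^2"
    and C'="cH al * (1 + real r + C)"])
  have "continuous_on ({p. norm (y p) < real r} \<times> UNIV) (%q. (%(t, z). X t z) (ta (fst q), snd q))"
   by (rule continuous_on_compose2[OF X(1)])
    (auto intro!: continuous_intros continuous_on_compose2[OF ta])
  moreover have "continuous_on ({p. norm (y p) < real r} \<times> UNIV) (%q. y (fst q))"
   by (auto intro!: continuous_intros continuous_on_compose2[OF y])
  ultimately show "continuous_on ({p. norm (y p) < real r} \<times> UNIV) (%(p, z). K al ep (y p - X (ta p) z))"
   unfolding case_prod_unfold by (intro continuous_on_K[OF al] continuous_on_diff) auto
  fix p z assume "p : {p. norm (y p) < real r}"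
  then have yr: "norm (y p) <= real r" by simp
  have "norm (K al ep (y p - X (ta p) z)) <= cH al * (1 + norm (y p - X (ta p) z))"
   by (rule K_growth[OF al])
  also have "\<dots> <= cH al * ((1 + real r + C) * (1 + norm z))"
  proof (intro mult_left_mono)
   have "norm (y p - X (ta p) z) <= real r + C * (1 + norm z)"
    using norm_triangle_ineq4[of "y p" "X (ta p) z"] X(2)[of "ta p" z] yr by linarith
   then show "1 + norm (y p - X (ta p) z) <= (1 + real r + C) * (1 + norm z)"
    using C0 by (simp add: algebra_simps) (smt (verit) mult_nonneg_nonneg norm_ge_zero of_nat_0_le_iff)
  qed (use cH_pos[OF al] in simp)
  finally show "norm (K al ep (y p - X (ta p) z)) <= cH al * (1 + real r + C) * (1 + norm z)" by (simp add: mult_ac)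
 qed (use f0 sets_f0 f0_square in auto)
 have "continuous_on (\<Union>r::nat. {p. norm (y p) < real r}) (%p. convK al ep f0 (X (ta p)) (y p))"
  using loc by (intro continuous_on_open_UN) (auto intro!: open_Collect_less continuous_intros y)
 moreover have "(\<Union>r::nat. {p. norm (y p) < real r}) = UNIV"
  using reals_Archimedean2 by auto
 ultimately show ?thesis by simp
qed

context
 fixes X :: "real => 'a \<times> 'a => 'a"
 assumes X: "continuous_on UNIV (%(t, z). X t z)" "EX C. ALL t z. norm (X t z) <= C * (1 + norm z)"
begin

lemma flow_continuous: "continuous_on UNIV (X t)"
proof -
 have "continuous_on UNIV (%z. (%(t, z). X t z) (t, z))"
  by (rule continuous_on_compose2[OF X(1)]) (auto intro!: continuous_intros)
 then show ?thesis by simp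
qed

lemma flow_measurable [measurable]: "X t : borel_measurable f0"
 unfolding measurable_cong_sets[OF sets_f0 refl] by (rule borel_measurable_continuous_onI[OF flow_continuous])

lemma flow_integrable: "integrable f0 (%z. norm (X t z))"
 using X(2) by (auto intro!: integrable_norm integrable_linear)

end

lemma lagrangian_exists:
 assumes ep: "0 < ep" and om: "continuous_on UNIV om" "!!z. norm (om z) <= C * (1 + norm z)"
 shows "EX X. lagrangian al ep f0 om T X"
proof -
 define m where "m = (LINT z|f0. 1 + norm z)"
 have m: "0 <= m" unfolding m_def by (intro Bochner_Integration.integral_nonneg) auto
 define L where "L = cD al * ep powr (- al)"
 have L: "0 < L" using cD_pos[OF al] ep by (simp add: L_def)
 define B where "B = (%(t::real) X z. om z - convK al ep f0 X (X z))"
 have intX: "integrable f0 (%z. norm (X z))" "X : borel_measurable f0"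
  if "continuous_on UNIV X" "EX C. ALL z. norm (X z) <= C * (1 + norm z)" for X :: "'a \<times> 'a => 'a"
 proof -
  show "X : borel_measurable f0"
   unfolding measurable_cong_sets[OF sets_f0 refl] by (rule borel_measurable_continuous_onI[OF that(1)])
  then show "integrable f0 (%z. norm (X z))"
   using that(2) by (auto intro!: integrable_norm integrable_linear)
 qed
 obtain X where X: "continuous_on UNIV (%(t, z). X t z)" "!!t. X (clamp_time 0 T t) = X t"
  "X 0 = fst" "EX C. ALL t z. norm (X t z) <= C * (1 + norm z)"
  "!!t z. t : {0..T} ==> ((%t. X t z) has_vector_derivative B t (X t) z) (at t within {0..T})"
 proof (rule picard[of 0 T "L * (1 + m)" "%z. 1 + norm z" fst 1 B C])
  fix t :: real and X Y :: "'a \<times> 'a => 'a" and c z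
  assume XY: "continuous_on UNIV X" "continuous_on UNIV Y"
   "EX C. ALL z. norm (X z) <= C * (1 + norm z)" "EX C. ALL z. norm (Y z) <= C * (1 + norm z)"
   "!!z. norm (X z - Y z) <= c * (1 + norm z)"
  note iX = intX[OF XY(1,3)] and iY = intX[OF XY(2,4)]
  have c: "0 <= c" using XY(5)[of 0] norm_ge_zero[of "X 0 - Y 0"] by (auto simp del: norm_ge_zero)
  have "B t X z - B t Y z = - (LINT z'|f0. K al ep (X z - X z') - K al ep (Y z - Y z'))"
   unfolding B_def convK_def using integrable_convK[OF al f0 iX(2) iX(1)] integrable_convK[OF al f0 iY(2) iY(1)] by simp
  then have "norm (B t X z - B t Y z) <= (LINT z'|f0. norm (K al ep (X z - X z') - K al ep (Y z - Y z')))"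
   by simp
  also have "\<dots> <= (LINT z'|f0. L * (c * (1 + norm z) + c * (1 + norm z')))"
  proof (rule integral_mono)
   fix z'
   have "norm (K al ep (X z - X z') - K al ep (Y z - Y z')) <= L * norm ((X z - X z') - (Y z - Y z'))"
    unfolding L_def by (rule K_lipschitz[OF al ep])
   also have "(X z - X z') - (Y z - Y z') = (X z - Y z) - (X z' - Y z')" by simp
   also have "L * norm \<dots> <= L * (c * (1 + norm z) + c * (1 + norm z'))"
    using L XY(5)[of z] XY(5)[of z'] norm_triangle_ineq4[of "X z - Y z" "X z' - Y z'"]
    by (intro mult_left_mono) linarith+
   finally show "norm (K al ep (X z - X z') - K al ep (Y z - Y z')) <= L * (c * (1 + norm z) + c * (1 + norm z'))" .
  next
   show "integrable f0 (%z'. norm (K al ep (X z - X z') - K al ep (Y z - Y z')))"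
    using integrable_convK[OF al f0 iX(2) iX(1)] integrable_convK[OF al f0 iY(2) iY(1)] by simp
  next
   show "integrable f0 (%z'. L * (c * (1 + norm z) + c * (1 + norm z')))"
    by (intro integrable_mult_right Bochner_Integration.integrable_add f0_wt integrable_const)
  qed
  also have "\<dots> = L * (c * (1 + norm z) + c * m)"
   using f0_wt unfolding m_def by (simp del: Bochner_Integration.integral_add add: prob_space Bochner_Integration.integral_add[of _ "%_. c * (1 + norm z)"])
  also have "\<dots> <= L * (1 + m) * c * (1 + norm z)"
   using L c m by (simp add: algebra_simps mult_left_mono)
  finally show "norm (B t X z - B t Y z) <= L * (1 + m) * c * (1 + norm z)" .
 next
  fix t :: real and z
  show "norm (B t (%_. 0) z) <= C * (1 + norm z)"
   using om(2)[of z] by (simp add: B_def convK_def)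
 next
  fix X :: "real => 'a \<times> 'a => 'a"
  assume X: "continuous_on UNIV (%(t, z). X t z)" "EX C. ALL t z. norm (X t z) <= C * (1 + norm z)"
  then obtain C' where C': "!!t z. norm (X t z) <= C' * (1 + norm z)" by blast
  have "continuous_on UNIV (%p. convK al ep f0 (X (fst p)) ((%(t, z). X t z) p))"
   by (rule continuous_convK[OF X(1) C']) (intro continuous_intros X)+
  moreover have "continuous_on UNIV (%p :: real \<times> 'a \<times> 'a. om (snd p))"
   by (rule continuous_on_compose2[OF om(1)]) (auto intro!: continuous_intros)
  ultimately show "continuous_on UNIV (%(t, z). B (clamp_time 0 T t) (X t) z)"
   unfolding B_def case_prod_unfold by (intro continuous_on_diff)
 qed (use T L m in \<open>auto intro!: continuous_intros norm_fst_le_norm[THEN order_trans] simp: mult_pos_pos\<close>)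
 then show ?thesis unfolding lagrangian_def B_def by blast
qed

lemma square_plus_cross: "a * a + a * b <= 2 * (a^2 + b^2)" for a b :: real
proof -
 have "0 <= (a - b)^2 + a^2 + 3 * b^2" by simp
 also have "\<dots> = 2 * (2 * (a^2 + b^2)) - 2 * (a * a + a * b)" by (simp add: power2_eq_square algebra_simps)
 finally show ?thesis by simp
qed

lemma integrable_pair_quadratic:
 fixes F :: "('a \<times> 'a) \<times> ('a \<times> 'a) => 'c::{banach,second_countable_topology}"
 assumes "F : borel_measurable ff0" "!!z z'. norm (F (z, z')) <= C * ((1 + norm z)^2 + (1 + norm z')^2)"
 shows "integrable ff0 F"
proof (rule Bochner_Integration.integrable_bound[OF integrable_mult_right])
 have "integrable ff0 (%p. (1 + norm (fst p))^2 * 1)" "integrable ff0 (%p. 1 * (1 + norm (snd p))^2)"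
  by (rule integrable_fst_snd[OF f0]; use f0_wt_square in simp)+
 then show "integrable ff0 (%p. (1 + norm (fst p))^2 + (1 + norm (snd p))^2)" by simp
 show "AE p in ff0. norm (F p) <= norm (C * ((1 + norm (fst p))^2 + (1 + norm (snd p))^2))"
 proof (rule AE_I2)
  fix p :: "('a \<times> 'a) \<times> ('a \<times> 'a)"
  show "norm (F p) <= norm (C * ((1 + norm (fst p))^2 + (1 + norm (snd p))^2))"
   using assms(2)[of "fst p" "snd p"] by (simp del: norm_mult)
 qed
qed (rule assms)

end

context initial_law
begin

text \<open>Labels are computed with the same kernel as the flow, so that the initial velocity is exactly \<open>v\<close>.\<close>

definition label :: "real => 'a \<times> 'a => 'a" where
 "label ep z = snd z + convK al ep f0 fst (fst z)"

definition vel :: "real => (real => 'a \<times> 'a => 'a) => real => 'a \<times> 'a => 'a" where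
 "vel ep X t z = label ep z - convK al ep f0 (X t) (X t z)"

lemma fst_measurable [measurable]: "(fst :: 'a \<times> 'a => 'a) : borel_measurable f0"
 "(snd :: 'a \<times> 'a => 'a) : borel_measurable f0"
 unfolding measurable_cong_sets[OF sets_f0 refl] by (intro borel_measurable_continuous_onI continuous_intros)+

lemma fst_integrable: "integrable f0 (%z. norm (fst z))"
 by (intro integrable_norm integrable_linear[of _ 1]) (auto intro: order_trans[OF norm_fst_le_norm])

lemma continuous_label: "continuous_on UNIV (label ep)"
 unfolding label_def
proof (intro continuous_intros)
 show "continuous_on UNIV (%z :: 'a \<times> 'a. convK al ep f0 fst (fst z))"
  by (rule continuous_convK[where X="%_. fst" and C=1 and ta="%_. 0"])
   (auto intro!: continuous_intros order_trans[OF norm_fst_le_norm] simp: case_prod_unfold)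
qed

lemma label_bound: "EX C. ALL z. norm (label ep z) <= C * (1 + norm z)"
proof (intro exI allI)
 fix z :: "'a \<times> 'a"
 define M where "M = (LINT z|f0. norm (fst z))"
 have M: "0 <= M" unfolding M_def by (intro Bochner_Integration.integral_nonneg) auto
 have "norm (label ep z) <= norm (snd z) + cH al * (1 + norm (fst z) + M)"
  unfolding label_def M_def
  by (intro norm_triangle_le add_left_mono convK_growth al f0 fst_measurable fst_integrable)
 also have "\<dots> <= norm z + cH al * (1 + norm z + M)"
  using cH_pos[OF al] by (intro add_mono mult_left_mono norm_snd_le_norm norm_fst_le_norm) auto
 also have "\<dots> <= (1 + cH al * (1 + M)) * (1 + norm z)"
  using cH_pos[OF al] M by (simp add: algebra_simps)
 finally show "norm (label ep z) <= (1 + cH al * (1 + M)) * (1 + norm z)" .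
qed

lemma label_close: "norm (label ep z - label dl z) <= cH al * \<bar>ep - dl\<bar> powr (1 - al)"
 using convK_eps[OF al f0 fst_measurable(1) fst_integrable, of ep "fst z" dl] by (simp add: label_def)

lemma lagrangian_facts:
 assumes X: "lagrangian al ep f0 om T X"
 shows "continuous_on UNIV (%(t, z). X t z)" "X (clamp_time 0 T t) = X t" "X 0 = fst"
  "EX C. ALL t z. norm (X t z) <= C * (1 + norm z)"
  "t : {0..T} ==> ((%t. X t z) has_vector_derivative (om z - convK al ep f0 (X t) (X t z))) (at t within {0..T})"
  "X t : borel_measurable f0" "integrable f0 (%z. norm (X t z))"
proof -
 show *: "continuous_on UNIV (%(t, z). X t z)" "EX C. ALL t z. norm (X t z) <= C * (1 + norm z)"
  "X (clamp_time 0 T t) = X t" "X 0 = fst"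
  "t : {0..T} ==> ((%t. X t z) has_vector_derivative (om z - convK al ep f0 (X t) (X t z))) (at t within {0..T})"
  using X unfolding lagrangian_def by blast+
 show "X t : borel_measurable f0" "integrable f0 (%z. norm (X t z))"
  by (rule flow_measurable[OF *(1,2)] flow_integrable[OF *(1,2)])+
qed

lemma lagrangian_vel_deriv:
 assumes "lagrangian al ep f0 (label ep) T X" "t : {0..T}"
 shows "((%t. X t z) has_vector_derivative vel ep X t z) (at t within {0..T})"
 using lagrangian_facts(5)[OF assms] by (simp add: vel_def)

lemma vel_continuous:
 assumes "continuous_on UNIV (%(t, z). X t z)" "EX C. ALL t z. norm (X t z) <= C * (1 + norm z)"
 shows "continuous_on UNIV (%(t, z). vel ep X t z)"
proof -
 obtain C where C: "!!t z. norm (X t z) <= C * (1 + norm z)" using assms(2) by blast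
 have "continuous_on UNIV (%p. convK al ep f0 (X (fst p)) ((%(t, z). X t z) p))"
  by (rule continuous_convK[OF assms(1) C]) (intro continuous_intros assms(1))+
 moreover have "continuous_on UNIV (%p :: real \<times> 'a \<times> 'a. label ep (snd p))"
  by (rule continuous_on_compose2[OF continuous_label]) (auto intro!: continuous_intros)
 ultimately show ?thesis
  unfolding vel_def case_prod_unfold by (intro continuous_on_diff)
qed

lemma vel_bound:
 assumes "continuous_on UNIV (%(t, z). X t z)" "EX C. ALL t z. norm (X t z) <= C * (1 + norm z)"
 shows "EX C. ALL t z. norm (vel ep X t z) <= C * (1 + norm z)"
proof -
 obtain C where C: "!!t z. norm (X t z) <= C * (1 + norm z)" using assms(2) by blast
 obtain Cl where Cl: "!!z. norm (label ep z) <= Cl * (1 + norm z)" using label_bound by blast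
 have C0: "0 <= C" using C[of 0 0] norm_ge_zero[of "X 0 0"] by (auto simp del: norm_ge_zero)
 define m where "m = (LINT z|f0. 1 + norm z)"
 have m: "0 <= m" unfolding m_def by (intro Bochner_Integration.integral_nonneg) auto
 have "norm (vel ep X t z) <= (Cl + cH al * (1 + C + C * m)) * (1 + norm z)" for t z
 proof -
  have Zi: "integrable f0 (%z. norm (X t z))" and Zm: "X t : borel_measurable f0"
   by (rule flow_integrable[OF assms] flow_measurable[OF assms])+
  have "(LINT z|f0. norm (X t z)) <= C * m"
   unfolding m_def using integral_mono[OF Zi integrable_mult_right[OF f0_wt] C] by simp
  then have "norm (convK al ep f0 (X t) (X t z)) <= cH al * (1 + C * (1 + norm z) + C * m)"
   using cH_pos[OF al] C[of t z]
   by (intro order_trans[OF convK_growth[OF al f0 Zm Zi]] mult_left_mono add_mono) auto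
  also have "\<dots> <= cH al * ((1 + C + C * m) * (1 + norm z))"
   using cH_pos[OF al] C0 m by (intro mult_left_mono) (auto simp: algebra_simps)
  finally show ?thesis using Cl[of z] norm_triangle_ineq4[of "label ep z" "convK al ep f0 (X t) (X t z)"]
   by (simp add: vel_def algebra_simps)
 qed
 then show ?thesis by blast
qed

text \<open>The first-order system is the gradient flow of a convex functional on the space of square integrable
maps: pairing the difference of two solutions with the difference of their velocities and
symmetrizing in the labels leaves the monotone term, which has a sign, and the defect \<open>k\<close> of the
labels and of the kernels.\<close>

lemma lagrangian_stability:
 assumes X: "lagrangian al ep f0 (label ep) T X" and Y: "lagrangian al dl f0 (label dl) T Y"
  and k: "cH al * \<bar>ep - dl\<bar> powr (1 - al) <= k" and t: "t : {0..T}"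
 shows "(LINT z|f0. (norm (X t z - Y t z))^2) <= exp (2 * k * t) - 1" "integrable f0 (%z. (norm (X t z - Y t z))^2)"
proof -
 note FX = lagrangian_facts[OF X] and FY = lagrangian_facts[OF Y]
 note vX = vel_continuous[OF FX(1,4), of ep] vel_bound[OF FX(1,4), of ep] and vY = vel_continuous[OF FY(1,4), of dl] vel_bound[OF FY(1,4), of dl]
 obtain C1 C2 C3 C4 where C14: "!!t z. norm (X t z) <= C1 * (1 + norm z)" "!!t z. norm (Y t z) <= C2 * (1 + norm z)"
  "!!t z. norm (vel ep X t z) <= C3 * (1 + norm z)" "!!t z. norm (vel dl Y t z) <= C4 * (1 + norm z)"
  using FX(4) FY(4) vX(2) vY(2) by blast
 define C where "C = max (max C1 C2) (max C3 C4)"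
 have C: "norm (X t z) <= C * (1 + norm z)" "norm (Y t z) <= C * (1 + norm z)" "norm (vel ep X t z) <= C * (1 + norm z)" "norm (vel dl Y t z) <= C * (1 + norm z)" for t z
  by (rule order_trans[OF C14(1) mult_right_mono] order_trans[OF C14(2) mult_right_mono] order_trans[OF C14(3) mult_right_mono] order_trans[OF C14(4) mult_right_mono]; simp add: C_def)+
 have C0: "0 <= C" using order_trans[OF norm_ge_zero C(1)[of 0 0]] by simp
 have k0: "0 <= k" by (rule order_trans[OF _ k]) (use cH_pos[OF al] in simp)
 define D W where "D t z = X t z - Y t z" and "W t z = vel ep X t z - vel dl Y t z" for t z
 have Db: "norm (D t z) <= 2 * C * (1 + norm z)" and Wb: "norm (W t z) <= 2 * C * (1 + norm z)" for t z
  using order_trans[OF norm_triangle_ineq4 add_mono[OF C(1)[of t z] C(2)[of t z]]] order_trans[OF norm_triangle_ineq4 add_mono[OF C(3)[of t z] C(4)[of t z]]]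
  by (simp_all add: D_def W_def mult.assoc)
 have m [measurable]: "X t : borel_measurable f0" "Y t : borel_measurable f0" "D t : borel_measurable f0" "W t : borel_measurable f0" for t
  unfolding D_def W_def by (intro borel_measurable_diff FX FY flow_measurable[OF vX] flow_measurable[OF vY])+
 have iD: "integrable f0 (%z. (norm (D t z))^2)" for t
 proof (rule integrable_quadratic[of _ "(2 * C)^2"])
  show "norm ((norm (D t z))^2) <= (2 * C)^2 * (1 + norm z)^2" for z
   using power_mono[OF Db[of t z] norm_ge_zero, of 2] by (simp add: power_mult_distrib)
 qed measurable
 then show "integrable f0 (%z. (norm (X t z - Y t z))^2)" by (simp add: D_def)
 define E E' where "E t = (LINT z|f0. (norm (D t z))^2)" and "E' t = (LINT z|f0. 2 * (D t z \<bullet> W t z))" for t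
 have der: "(E has_vector_derivative E' s) (at s within {0..T})" if s: "s : {0..T}" for s
  unfolding E_def E'_def
 proof (rule has_vector_derivative_integral_param[OF s iD integrable_mult_right[OF f0_wt_square]])
  fix z r assume r: "r : {0..T}"
  show "((%t. (norm (D t z))^2) has_vector_derivative 2 * (D r z \<bullet> W r z)) (at r within {0..T})"
   unfolding D_def W_def by (intro has_vector_derivative_norm_square has_vector_derivative_diff lagrangian_vel_deriv X Y r)
  have "\<bar>D r z \<bullet> W r z\<bar> <= (2 * C * (1 + norm z)) * (2 * C * (1 + norm z))"
   using C0 by (intro order_trans[OF Cauchy_Schwarz_ineq2] mult_mono Db Wb) auto
  then show "norm (2 * (D r z \<bullet> W r z)) <= 8 * C^2 * (1 + norm z)^2" by (simp add: abs_mult power2_eq_square algebra_simps)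
 qed measurable
 have le: "E' s <= 2 * k * (1 + E s)" for s
 proof -
  define q where "q z z' = K al ep (X s z - X s z') - K al dl (Y s z - Y s z')" for z z'
  define l where "l z = label ep z - label dl z" for z
  define G where "G p = D s (fst p) \<bullet> (l (fst p) - q (fst p) (snd p))" for p
  define H where "H p = k * (1 + (norm (D s (fst p)))^2) * 1" for p :: "('a \<times> 'a) \<times> ('a \<times> 'a)"
  have lk: "norm (l z) <= k" for z unfolding l_def by (rule order_trans[OF label_close k])
  have [measurable]: "K al ep : borel_measurable (borel :: 'a measure)" "K al dl : borel_measurable (borel :: 'a measure)" "l : borel_measurable f0"
   using al unfolding l_def measurable_cong_sets[OF sets_f0 refl]
   by (auto intro!: borel_measurable_continuous_onI continuous_on_diff continuous_label continuous_on_K continuous_on_id)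
  have iq: "integrable f0 (%z'. K al ep (X s z - X s z'))" "integrable f0 (%z'. K al dl (Y s z - Y s z'))" for z
   by (intro integrable_convK al f0 FX FY)+
  have iG: "integrable ff0 G"
  proof (rule integrable_pair_quadratic)
   show "G : borel_measurable ff0" unfolding G_def q_def by measurable
   fix z z' :: "'a \<times> 'a"
   define a b where "a = 1 + norm z" and "b = 1 + norm z'"
   have ab: "1 <= a" "0 <= b" by (auto simp: a_def b_def)
   have "norm (q z z') <= cH al * (1 + (C * a + C * b)) + cH al * (1 + (C * a + C * b))"
    unfolding q_def a_def b_def using cH_pos[OF al]
    by (intro order_trans[OF norm_triangle_ineq4] add_mono order_trans[OF K_growth[OF al]] mult_left_mono add_left_mono C) auto
   then have "norm (l z - q z z') <= k + 2 * cH al * (1 + C * a + C * b)"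
    using norm_triangle_ineq4[of "l z" "q z z'"] lk[of z] by (simp add: algebra_simps)
   then have "norm (G (z, z')) <= (2 * C * a) * (k + 2 * cH al * (1 + C * a + C * b))"
    unfolding G_def real_norm_def fst_conv snd_conv using C0 ab Db[of s z] by (intro order_trans[OF Cauchy_Schwarz_ineq2] mult_mono) (auto simp: a_def)
   also have "\<dots> <= (2 * C * a) * ((k + 2 * cH al * (1 + C)) * (a + b))"
   proof (rule mult_left_mono)
    have "(k + 2 * cH al) * 1 <= (k + 2 * cH al) * (a + b)" using ab k0 cH_pos[OF al] by (intro mult_left_mono) auto
    then show "k + 2 * cH al * (1 + C * a + C * b) <= (k + 2 * cH al * (1 + C)) * (a + b)" by (simp add: algebra_simps)
   qed (use C0 ab in simp)
   also have "\<dots> = 2 * C * (k + 2 * cH al * (1 + C)) * (a * a + a * b)" by (simp add: algebra_simps)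
   also have "\<dots> <= 2 * C * (k + 2 * cH al * (1 + C)) * (2 * (a^2 + b^2))"
    using C0 k0 cH_pos[OF al] by (intro mult_left_mono square_plus_cross) auto
   finally show "norm (G (z, z')) <= 2 * C * (k + 2 * cH al * (1 + C)) * 2 * ((1 + norm z)^2 + (1 + norm z')^2)"
    by (simp only: a_def b_def mult.assoc)
  qed
  have iH: "integrable ff0 H"
   unfolding H_def by (rule integrable_fst_snd[OF f0]) (use iD in auto)
  have "(LINT z|f0. D s z \<bullet> W s z) = (LINT z|f0. LINT z'|f0. G (z, z'))"
  proof (rule Bochner_Integration.integral_cong[OF refl])
   fix z
   have "(LINT z'|f0. G (z, z')) = D s z \<bullet> (LINT z'|f0. l z - q z z')"
    unfolding G_def fst_conv snd_conv by (rule integral_inner_right) (use iq in \<open>auto simp: q_def\<close>)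
   also have "(LINT z'|f0. l z - q z z') = W s z" unfolding q_def using iq prob_space by (simp add: W_def l_def vel_def convK_def)
   finally show "D s z \<bullet> W s z = (LINT z'|f0. G (z, z'))" by simp
  qed
  also have "\<dots> = (LINT p|ff0. (G p + G (snd p, fst p)) / 2)" using integral_fst'[OF iG] sym_integral(1)[OF f0 iG] by simp
  also have "\<dots> <= (LINT p|ff0. (H p + H (snd p, fst p)) / 2)"
  proof (rule integral_mono)
   fix p :: "('a \<times> 'a) \<times> ('a \<times> 'a)"
   obtain z z' where p: "p = (z, z')" by (rule prod.exhaust)
   define y1 y2 where "y1 = X s z - X s z'" and "y2 = Y s z - Y s z'"
   define d d' where "d = norm (D s z)" and "d' = norm (D s z')"
   have y: "D s z - D s z' = y1 - y2" by (simp add: D_def y1_def y2_def)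
   have yd: "norm (y1 - y2) <= d + d'" unfolding d_def d'_def y[symmetric] by (rule norm_triangle_ineq4)
   have "q z' z = - q z z'" unfolding q_def K_diff_commute[of al _ "_ s z'" "_ s z"] by simp
   then have "G p + G (snd p, fst p) = D s z \<bullet> l z + D s z' \<bullet> l z' - (y1 - y2) \<bullet> q z z'"
    by (simp add: G_def p inner_diff_right inner_diff_left inner_add_right flip: y)
   moreover have "D s z \<bullet> l z <= d * k" "D s z' \<bullet> l z' <= d' * k"
    unfolding d_def d'_def by (intro order_trans[OF norm_cauchy_schwarz] mult_left_mono lk; simp)+
   moreover have "- ((y1 - y2) \<bullet> q z z') <= (d + d') * k"
   proof -
    have "(y1 - y2) \<bullet> q z z' = (y1 - y2) \<bullet> (K al ep y1 - K al ep y2) + (y1 - y2) \<bullet> (K al ep y2 - K al dl y2)"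
    by (simp add: q_def y1_def y2_def flip: inner_add_right)
    moreover have "0 <= (y1 - y2) \<bullet> (K al ep y1 - K al ep y2)" using K_mono[OF al, of ep y1 y2] by (simp add: inner_commute)
    moreover have "\<bar>(y1 - y2) \<bullet> (K al ep y2 - K al dl y2)\<bar> <= (d + d') * k"
    by (intro order_trans[OF Cauchy_Schwarz_ineq2] mult_mono yd order_trans[OF K_conv[OF al] k]) (auto simp: d_def d'_def)
    ultimately show ?thesis by linarith
   qed
   ultimately have "G p + G (snd p, fst p) <= k * (2 * d) + k * (2 * d')" by (simp add: algebra_simps)
   also have "\<dots> <= k * (1 + d^2) + k * (1 + d'^2)"
    using sum_squares_bound[of d 1] sum_squares_bound[of d' 1] k0 by (intro add_mono mult_left_mono) auto
   finally show "(G p + G (snd p, fst p)) / 2 <= (H p + H (snd p, fst p)) / 2" by (simp add: H_def p d_def d'_def)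
  qed (use iG iH sym_integral(2)[OF f0 iG] sym_integral(2)[OF f0 iH] in auto)
  also have "\<dots> = k * (1 + E s)"
   using integral_fst'[OF iH] sym_integral(1)[OF f0 iH] iD[of s] prob_space by (simp add: H_def E_def)
  finally show ?thesis by (simp add: E'_def)
 qed
 define c where "c = 2 * k"
 have "(1 + E t) * exp (- c * t) <= (1 + E 0) * exp (- c * 0) + 0 * (t - 0)"
 proof (rule real_deriv_le)
  fix s assume s: "s : {0..t}"
  have sT: "s : {0..T}" "{0..t} \<subseteq> {0..T}" using s t by auto
  show "((%s. (1 + E s) * exp (- c * s)) has_vector_derivative (E' s - c * (1 + E s)) * exp (- c * s)) (at s within {0..t})"
   using has_vector_derivative_within_subset[OF der[OF sT(1)] sT(2)]
   unfolding has_real_derivative_iff_has_vector_derivative[symmetric]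
   by (auto intro!: derivative_eq_intros simp: algebra_simps)
  show "(E' s - c * (1 + E s)) * exp (- c * s) <= 0" using le[of s] by (simp add: c_def mult_nonpos_nonneg)
 qed (use t in auto)
 moreover have "E 0 = 0" by (simp add: E_def D_def FX FY)
 ultimately have "(1 + E t) * exp (- c * t) * exp (c * t) <= 1 * exp (c * t)" by (intro mult_right_mono) auto
 then show "(LINT z|f0. (norm (X t z - Y t z))^2) <= exp (2 * k * t) - 1" by (simp add: mult.assoc E_def D_def c_def flip: exp_add)
qed

text \<open>Mean square closeness of the flows makes the fields uniformly close, because the kernel is Hoelder
continuous; monotonicity of the field then transfers this to every single trajectory.\<close>

lemma lagrangian_close:
 assumes X: "lagrangian al ep f0 (label ep) T X" and Y: "lagrangian al dl f0 (label dl) T Y"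
  and k: "cH al * \<bar>ep - dl\<bar> powr (1 - al) <= k" and A: "0 < A" "exp (2 * k * T) - 1 <= A^2"
 shows "norm (X t z - Y t z) <= T * (2 * k + 2 * cH al * A powr (1 - al))"
proof -
 note FX = lagrangian_facts[OF X] and FY = lagrangian_facts[OF Y]
 have k0: "0 <= k" by (rule order_trans[OF _ k]) (use cH_pos[OF al] in simp)
 define c where "c = 2 * k + 2 * cH al * A powr (1 - al)"
 have c: "0 <= c" using k0 cH_pos[OF al] by (simp add: c_def)
 have field: "norm (convK al ep f0 (X s) y - convK al dl f0 (Y s) y) <= c - k"
  if s: "s : {0..T}" for s y
 proof -
  note st = lagrangian_stability[OF X Y k s]
  have "exp (2 * k * s) <= exp (2 * k * T)" using s k0 by (simp add: mult_left_mono)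
  then have A2: "(LINT z|f0. (norm (X s z - Y s z))^2) <= A^2" using st(1) A by linarith
  have [measurable]: "X s : borel_measurable f0" "Y s : borel_measurable f0" by (rule FX FY)+
  note ph = integrable_powr_holder[OF al f0 norm_ge_zero _ st(2) A(1) A2]
  have pi: "integrable f0 (%z. norm (X s z - Y s z) powr (1 - al))"
   and pb: "(LINT z|f0. norm (X s z - Y s z) powr (1 - al)) <= 2 * A powr (1 - al)"
   by (rule ph; measurable)+
  have iX: "integrable f0 (%z. K al ep (y - X s z))" and iY: "integrable f0 (%z. K al dl (y - Y s z))"
   by (intro integrable_convK al f0 FX FY)+
  have "convK al ep f0 (X s) y - convK al dl f0 (Y s) y = (LINT z|f0. K al ep (y - X s z) - K al dl (y - Y s z))"
   unfolding convK_def using iX iY by simp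
  also have "norm \<dots> <= (LINT z|f0. k + cH al * norm (X s z - Y s z) powr (1 - al))"
  proof (rule order_trans[OF integral_norm_bound integral_mono])
   fix z
   have "K al ep (y - X s z) - K al dl (y - Y s z) =
    (K al ep (y - Y s z) - K al dl (y - Y s z)) + (K al ep (y - X s z) - K al ep (y - Y s z))" by simp
   also have "norm \<dots> <= k + cH al * norm ((y - X s z) - (y - Y s z)) powr (1 - al)"
    by (intro norm_triangle_le add_mono order_trans[OF K_conv[OF al] k] K_holder al)
   finally show "norm (K al ep (y - X s z) - K al dl (y - Y s z)) <= k + cH al * norm (X s z - Y s z) powr (1 - al)"
    by (simp add: norm_minus_commute)
  qed (use iX iY pi in auto)
  also have "\<dots> <= k + cH al * (2 * A powr (1 - al))" using pi pb cH_pos[OF al] prob_space by (simp add: mult_left_mono)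
  finally show ?thesis by (simp add: c_def mult_ac)
 qed
 define s where "s = clamp_time 0 T t"
 have s: "s : {0..T}" using clamp_time(1)[of 0 T t] T by (simp add: s_def)
 have "norm (X s z - Y s z) <= norm (X 0 z - Y 0 z) + c * (s - 0)"
 proof (rule norm_growth)
  fix r assume r: "r : {0..s}"
  have rT: "r : {0..T}" "{0..s} \<subseteq> {0..T}" using r s by auto
  show "((%t. X t z - Y t z) has_vector_derivative (vel ep X r z - vel dl Y r z)) (at r within {0..s})"
   by (intro has_vector_derivative_diff has_vector_derivative_within_subset[OF _ rT(2)] lagrangian_vel_deriv X Y rT(1))
  define Dl where "Dl = X r z - Y r z"
  have "Dl \<bullet> (vel ep X r z - vel dl Y r z)
   = Dl \<bullet> (label ep z - label dl z) - (convK al ep f0 (X r) (X r z) - convK al ep f0 (X r) (Y r z)) \<bullet> Dl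
    - Dl \<bullet> (convK al ep f0 (X r) (Y r z) - convK al dl f0 (Y r) (Y r z))"
   by (simp add: vel_def inner_diff_right inner_diff_left inner_commute)
  moreover have "Dl \<bullet> (label ep z - label dl z) <= norm Dl * k"
   by (intro order_trans[OF norm_cauchy_schwarz] mult_left_mono order_trans[OF label_close k]) auto
  moreover have "0 <= (convK al ep f0 (X r) (X r z) - convK al ep f0 (X r) (Y r z)) \<bullet> Dl"
   unfolding Dl_def by (intro convK_mono al f0 FX)
  moreover have "\<bar>Dl \<bullet> (convK al ep f0 (X r) (Y r z) - convK al dl f0 (Y r) (Y r z))\<bar> <= norm Dl * (c - k)"
   by (intro order_trans[OF Cauchy_Schwarz_ineq2] mult_left_mono field rT) auto
  ultimately have "Dl \<bullet> (vel ep X r z - vel dl Y r z) <= norm Dl * k + norm Dl * (c - k)" by linarith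
  then show "(X r z - Y r z) \<bullet> (vel ep X r z - vel dl Y r z) <= c * norm (X r z - Y r z)" by (simp add: Dl_def algebra_simps)
 qed (use s c in auto)
 also have "\<dots> <= c * T" using FX(3) FY(3) s c by (simp add: mult_left_mono)
 finally show ?thesis using FX(2)[of t] FY(2)[of t] by (simp add: s_def c_def mult.commute)
qed

lemma lagrangian_unique:
 assumes X: "lagrangian al 0 f0 (label 0) T X" and Y: "lagrangian al 0 f0 (label 0) T Y"
 shows "X t z = Y t z"
proof -
 have b: "norm (X t z - Y t z) <= T * (2 * cH al) * A powr (1 - al)" if "0 < A" for A
  using lagrangian_close[OF X Y, of 0 A t z] that by (simp add: mult_ac)
 have "((%A. A powr (1 - al)) \<longlongrightarrow> 0) (at_right (0::real))"
  using al by (intro tendsto_zero_powrI[OF _ tendsto_const]) (auto simp: eventually_at_filter tendsto_ident_at)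
 then have "((%A. T * (2 * cH al) * A powr (1 - al)) \<longlongrightarrow> 0) (at_right (0::real))"
  by (rule tendsto_mult_right_zero)
 then have "norm (X t z - Y t z) <= 0"
  by (rule tendsto_lowerbound) (use b in \<open>auto simp: eventually_at_filter\<close>)
 then show ?thesis by simp
qed

definition eps :: "nat => real" where "eps n = 1 / real (Suc n)"
definition kap :: "nat => real" where "kap n = cH al * eps n powr (1 - al)"
text \<open>The bound of \<open>lagrangian_close\<close>; the summand \<open>kap n\<close> under the root only makes the radius positive.\<close>

definition gap :: "nat => real" where
 "gap n = T * (2 * kap n + 2 * cH al * sqrt (exp (2 * kap n * T) - 1 + kap n) powr (1 - al))"

lemma eps_pos: "0 < eps n" by (simp add: eps_def)

lemma eps_tendsto: "eps ----> 0"
 unfolding eps_def using LIMSEQ_inverse_real_of_nat by (simp add: inverse_eq_divide)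

lemma kap_pos: "0 < kap n" using cH_pos[OF al] eps_pos[of n] by (simp add: kap_def)

lemma kap_tendsto: "kap ----> 0"
 unfolding kap_def using al
 by (intro tendsto_mult_right_zero tendsto_zero_powrI[OF eps_tendsto tendsto_const])
  (auto intro!: always_eventually less_imp_le eps_pos)

lemma gap_nonneg: "0 <= gap n" using T kap_pos[of n] cH_pos[OF al] by (simp add: gap_def)

lemma gap_tendsto: "gap ----> 0"
proof -
 have "(%n. exp (2 * kap n * T) - 1 + kap n) ----> exp (2 * 0 * T) - 1 + 0"
  by (intro tendsto_intros kap_tendsto)
 then have "(%n. sqrt (exp (2 * kap n * T) - 1 + kap n)) ----> 0"
  using tendsto_real_sqrt by fastforce
 then have "(%n. sqrt (exp (2 * kap n * T) - 1 + kap n) powr (1 - al)) ----> 0"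
 proof (rule tendsto_zero_powrI[OF _ tendsto_const])
  have "0 <= exp (2 * kap n * T) - 1 + kap n" for n
   using kap_pos[of n] T by (simp add: add_nonneg_nonneg)
  then show "\<forall>\<^sub>F n in sequentially. 0 <= sqrt (exp (2 * kap n * T) - 1 + kap n)"
   by (intro always_eventually allI) (rule real_sqrt_ge_zero)
 qed (use al in auto)
 then have "(%n. T * (2 * kap n + 2 * cH al * sqrt (exp (2 * kap n * T) - 1 + kap n) powr (1 - al))) ----> T * (2 * 0 + 2 * cH al * 0)"
  by (intro tendsto_intros kap_tendsto)
 then show ?thesis by (simp add: gap_def[abs_def])
qed

lemma eps_diff_kap: "N <= n ==> N <= m ==> cH al * \<bar>eps n - eps m\<bar> powr (1 - al) <= kap N"
 "N <= n ==> cH al * \<bar>eps n - 0\<bar> powr (1 - al) <= kap N"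
proof -
 have mono: "eps n <= eps N" if "N <= n" for n N using that by (simp add: eps_def frac_le)
 assume n: "N <= n"
 show "cH al * \<bar>eps n - 0\<bar> powr (1 - al) <= kap N"
  unfolding kap_def using mono[OF n] eps_pos[of n] cH_pos[OF al] al by (intro mult_left_mono powr_mono2) auto
 assume m: "N <= m"
 have "\<bar>eps n - eps m\<bar> <= eps N" using mono[OF n] mono[OF m] eps_pos[of n] eps_pos[of m] by linarith
 then show "cH al * \<bar>eps n - eps m\<bar> powr (1 - al) <= kap N"
  unfolding kap_def using cH_pos[OF al] al by (intro mult_left_mono powr_mono2) auto
qed

lemma lagrangian_limit:
 obtains Xn X where "!!n. lagrangian al (eps n) f0 (label (eps n)) T (Xn n)" "lagrangian al 0 f0 (label 0) T X"
  "!!t z. (%n. Xn n t z) ----> X t z" "!!t z. (%n. vel (eps n) (Xn n) t z) ----> vel 0 X t z"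
proof -
 have "EX X. lagrangian al (eps n) f0 (label (eps n)) T X" for n
 proof -
  obtain C where "!!z. norm (label (eps n) z) <= C * (1 + norm z)" using label_bound by blast
  then show ?thesis by (rule lagrangian_exists[OF eps_pos continuous_label])
 qed
 then obtain Xn where Xn: "!!n. lagrangian al (eps n) f0 (label (eps n)) T (Xn n)" by metis
 note F = lagrangian_facts[OF Xn]
 have cauchy: "norm (Xn n t z - Xn m t z) <= gap N" if nm: "N <= n" "N <= m" for N n m t z
 proof -
  define A where "A = sqrt (exp (2 * kap N * T) - 1 + kap N)"
  have p: "0 < exp (2 * kap N * T) - 1 + kap N" using kap_pos[of N] T by (simp add: add_nonneg_pos)
  have A: "0 < A" "A^2 = exp (2 * kap N * T) - 1 + kap N" using p by (auto simp: A_def)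
  have "norm (Xn n t z - Xn m t z) <= T * (2 * kap N + 2 * cH al * A powr (1 - al))"
   by (rule lagrangian_close[OF Xn Xn eps_diff_kap(1)[OF nm] A(1)]) (use A(2) kap_pos[of N] in simp)
  then show ?thesis by (simp add: gap_def A_def)
 qed
 have F4: "EX C. ALL t z. norm (Xn 0 t z) <= C * (1 + norm z)" by (rule F)
 obtain X where lim: "!!t z. (%n. Xn n t z) ----> X t z" and close: "!!n t z. norm (Xn n t z - X t z) <= gap n"
  and Xc: "continuous_on UNIV (%(t, z). X t z)" and Xb: "EX C. ALL t z. norm (X t z) <= C * (1 + norm z)"
  by (rule uniform_limit_of_curves[where x=Xn and p="%z. 1 + norm z", OF F(1) gap_tendsto cauchy F4]) auto
 have Xm: "X t : borel_measurable f0" and Xi: "integrable f0 (%z. norm (X t z))" for t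
  by (rule flow_measurable[OF Xc Xb] flow_integrable[OF Xc Xb])+
 define vg where "vg n = 2 * kap n + cH al * (2 * gap n) powr (1 - al)" for n
 have vg: "vg ----> 0"
 proof -
  have "(%n. 2 * gap n) ----> 0" using tendsto_mult_right_zero[OF gap_tendsto] by blast
  then have "(%n. (2 * gap n) powr (1 - al)) ----> 0"
   using al by (intro tendsto_zero_powrI[OF _ tendsto_const]) (auto intro!: always_eventually gap_nonneg)
  then have "(%n. 2 * kap n + cH al * (2 * gap n) powr (1 - al)) ----> 2 * 0 + cH al * 0"
   by (intro tendsto_intros kap_tendsto)
  then show ?thesis by (simp add: vg_def[abs_def])
 qed
 have vclose: "norm (vel (eps n) (Xn n) t z - vel 0 X t z) <= vg n" for n t z
 proof -
  have i1: "integrable f0 (%z'. K al (eps n) (Xn n t z - Xn n t z'))" and i2: "integrable f0 (%z'. K al 0 (X t z - X t z'))"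
   by (intro integrable_convK al f0 F Xm Xi)+
  have kn: "cH al * \<bar>eps n - 0\<bar> powr (1 - al) <= kap n" by (rule eps_diff_kap) simp
  have "convK al (eps n) f0 (Xn n t) (Xn n t z) - convK al 0 f0 (X t) (X t z)
   = (LINT z'|f0. K al (eps n) (Xn n t z - Xn n t z') - K al 0 (X t z - X t z'))"
   unfolding convK_def using i1 i2 by simp
  also have "norm \<dots> <= (LINT z'|f0. kap n + cH al * (2 * gap n) powr (1 - al))"
  proof (rule order_trans[OF integral_norm_bound integral_mono])
   fix z'
   define y1 where "y1 = Xn n t z - Xn n t z'"
   define y2 where "y2 = X t z - X t z'"
   have "y1 - y2 = (Xn n t z - X t z) - (Xn n t z' - X t z')" by (simp add: y1_def y2_def)
   then have y12: "norm (y1 - y2) <= 2 * gap n"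
    using norm_triangle_ineq4[of "Xn n t z - X t z" "Xn n t z' - X t z'"] close[of n t z] close[of n t z'] by simp
   have "norm (K al (eps n) y1 - K al (eps n) y2) <= cH al * norm (y1 - y2) powr (1 - al)"
    by (rule K_holder[OF al])
   also have "\<dots> <= cH al * (2 * gap n) powr (1 - al)"
    using y12 cH_pos[OF al] al by (intro mult_left_mono powr_mono2) auto
   finally have "norm (K al (eps n) y1 - K al (eps n) y2) <= cH al * (2 * gap n) powr (1 - al)" .
   moreover have "norm (K al (eps n) y2 - K al 0 y2) <= kap n" by (rule order_trans[OF K_conv[OF al] kn])
   ultimately show "norm (K al (eps n) (Xn n t z - Xn n t z') - K al 0 (X t z - X t z')) <= kap n + cH al * (2 * gap n) powr (1 - al)"
    unfolding y1_def[symmetric] y2_def[symmetric]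
    using norm_triangle_ineq[of "K al (eps n) y1 - K al (eps n) y2" "K al (eps n) y2 - K al 0 y2"] by simp
  qed (use i1 i2 in auto)
  finally have a: "norm (convK al (eps n) f0 (Xn n t) (Xn n t z) - convK al 0 f0 (X t) (X t z)) <= kap n + cH al * (2 * gap n) powr (1 - al)"
   by simp
  have "norm (label (eps n) z - label 0 z) <= kap n" by (rule order_trans[OF label_close kn])
  then show ?thesis
   using a norm_triangle_ineq4[of "label (eps n) z - label 0 z" "convK al (eps n) f0 (Xn n t) (Xn n t z) - convK al 0 f0 (X t) (X t z)"]
   by (simp add: vel_def vg_def algebra_simps)
 qed
 have vlim: "(%n. vel (eps n) (Xn n) t z) ----> vel 0 X t z" for t z
 proof -
  have "(%n. vel (eps n) (Xn n) t z - vel 0 X t z) ----> 0"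
   by (rule Lim_null_comparison[OF always_eventually vg]) (use vclose in auto)
  then show ?thesis by (simp add: LIM_zero_iff)
 qed
 have "lagrangian al 0 f0 (label 0) T X"
  unfolding lagrangian_def
 proof (intro conjI allI ballI Xc Xb)
  show "X (clamp_time 0 T t) = X t" for t
   using LIMSEQ_unique[OF lim[of "clamp_time 0 T t"]] lim[of t] by (simp add: fun_eq_iff F(2))
  show "X 0 = fst" using LIMSEQ_unique[OF lim[of 0]] by (simp add: fun_eq_iff F(3))
  fix z t assume t: "t : {0..T}"
  show "((%t. X t z) has_vector_derivative label 0 z - convK al 0 f0 (X t) (X t z)) (at t within {0..T})"
   unfolding vel_def[symmetric] by (rule derivative_of_limit[OF lagrangian_vel_deriv[OF Xn] lim vclose vg t])
 qed
 then show ?thesis using that Xn lim vlim by blast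
qed

end

lemma liminf_sum_le:
 fixes a b :: "nat => ennreal"
 assumes "A <= liminf a" "B <= liminf b" "!!n. a n + b n <= C"
 shows "A + B <= C"
proof -
 define a' where "a' n = (INF m\<in>{n..}. a m)" for n
 define b' where "b' n = (INF m\<in>{n..}. b m)" for n
 have inc: "incseq a'" "incseq b'"
  unfolding a'_def b'_def by (auto intro!: incseq_SucI INF_superset_mono)
 have "A + B <= (SUP n. a' n) + (SUP n. b' n)"
  using assms(1,2) unfolding liminf_SUP_INF a'_def b'_def by (rule add_mono)
 also have "\<dots> = (SUP n. a' n + b' n)" by (rule ennreal_SUP_add[OF inc, symmetric])
 also have "\<dots> <= C"
 proof (rule SUP_least)
  fix n
  have "a' n <= a n" "b' n <= b n" unfolding a'_def b'_def by (auto intro: INF_lower)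
  then show "a' n + b' n <= C" using assms(3)[of n] by (meson add_mono order_trans)
 qed
 finally show ?thesis .
qed

context initial_law
begin

lemma measurable_joint:
 fixes Y :: "real => 'a \<times> 'a => 'b::topological_space"
 assumes "continuous_on UNIV (%(t, z). Y t z)" "g : borel_measurable M" "h : borel_measurable M"
 shows "(%x. Y (g x) (h x)) : borel_measurable M"
 using measurable_compose[OF borel_measurable_Pair[OF assms(2,3)] borel_measurable_continuous_onI[OF assms(1)]] by simp

lemma pair_proj_measurable:
 "fst : borel_measurable ff0" "snd : borel_measurable (M \<Otimes>\<^sub>M f0)" "(%z. z) : borel_measurable f0"
 using measurable_fst[of f0 f0] measurable_snd[of M f0] measurable_ident[of f0]
 by (simp_all add: measurable_cong_sets[OF refl sets_f0] id_def)

lemma measurable_id_f0 [measurable]: "(%z. z) : borel_measurable f0"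
 by (simp add: measurable_cong_sets[OF sets_f0 refl])

text \<open>The acceleration of the regularized system, up to sign.\<close>

definition acc :: "real => (real => 'a \<times> 'a => 'a) => (real => 'a \<times> 'a => 'a) => real => 'a \<times> 'a => 'a" where
 "acc ep X V t z = (LINT z'|f0. DK al ep (X t z - X t z') (V t z - V t z'))"

context
 fixes X V :: "real => 'a \<times> 'a => 'a" and CX CV ep :: real
 assumes X: "continuous_on UNIV (%(t, z). X t z)" "!!t z. norm (X t z) <= CX * (1 + norm z)"
  and V: "continuous_on UNIV (%(t, z). V t z)" "!!t z. norm (V t z) <= CV * (1 + norm z)"
  and der: "!!t z. t : {0..T} ==> ((%t. X t z) has_vector_derivative V t z) (at t within {0..T})"
  and ep: "0 < ep"
begin

lemma flow_joint_measurable: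
 assumes "g : borel_measurable M" "h : borel_measurable M"
 shows "(%x. X (g x) (h x)) : borel_measurable M" "(%x. V (g x) (h x)) : borel_measurable M"
 by (rule measurable_joint[OF X(1) assms] measurable_joint[OF V(1) assms])+

lemma flow_pair_measurable [measurable]:
 "(%p. X t (fst p)) : borel_measurable ff0" "(%p. X t (snd p)) : borel_measurable ff0"
 "(%p. V t (fst p)) : borel_measurable ff0" "(%p. V t (snd p)) : borel_measurable ff0"
 "X t : borel_measurable f0" "V t : borel_measurable f0"
 by (rule flow_joint_measurable, simp, rule pair_proj_measurable)+

lemma CV_nonneg: "0 <= CV" and CX_nonneg: "0 <= CX"
 using X(2)[of 0 0] V(2)[of 0 0] norm_ge_zero[of "X 0 0"] norm_ge_zero[of "V 0 0"] by (auto simp del: norm_ge_zero)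

lemma DK_flow_bound: "norm (DK al ep (X t z - X t z') (V t z - V t z')) <= cD al * ep powr (- al) * (CV * ((1 + norm z) + (1 + norm z')))"
proof -
 have "norm (V t z - V t z') <= CV * ((1 + norm z) + (1 + norm z'))"
  unfolding distrib_left[of CV "1 + norm z"] by (intro order_trans[OF norm_triangle_ineq4] add_mono V)
 then show ?thesis
  using cD_pos[OF al] by (intro order_trans[OF DK_bound_eps[OF al ep]] mult_left_mono) auto
qed

lemma integrable_DK_flow: "integrable f0 (%z'. DK al ep (X t z - X t z') (V t z - V t z'))"
proof (rule integrable_linear[of _ "cD al * ep powr (- al) * (CV * (2 + norm z))"])
 show "norm (DK al ep (X t z - X t z') (V t z - V t z')) <= cD al * ep powr (- al) * (CV * (2 + norm z)) * (1 + norm z')" for z'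
 proof (rule order_trans[OF DK_flow_bound])
  have "(1 + norm z) + (1 + norm z') <= (2 + norm z) * (1 + norm z')" by (simp add: algebra_simps)
  then have "cD al * ep powr (- al) * (CV * ((1 + norm z) + (1 + norm z'))) <= cD al * ep powr (- al) * (CV * ((2 + norm z) * (1 + norm z')))"
   using cD_pos[OF al] CV_nonneg by (intro mult_left_mono) auto
  then show "cD al * ep powr (- al) * (CV * ((1 + norm z) + (1 + norm z'))) <= cD al * ep powr (- al) * (CV * (2 + norm z)) * (1 + norm z')"
   by (simp only: mult.assoc)
 qed
qed measurable

lemma acc_measurable:
 assumes "g : borel_measurable M" "h : borel_measurable M"
 shows "(%x. acc ep X V (g x) (h x)) : borel_measurable M"
proof -
 note m = measurable_compose[OF measurable_fst assms(1)] measurable_compose[OF measurable_fst assms(2)]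
  pair_proj_measurable(2)
 have "(%q. DK al ep (X (g (fst q)) (h (fst q)) - X (g (fst q)) (snd q)) (V (g (fst q)) (h (fst q)) - V (g (fst q)) (snd q)))
   : borel_measurable (M \<Otimes>\<^sub>M f0)"
  by (intro measurable_DK borel_measurable_diff flow_joint_measurable m)
 then have "(%(x, z'). DK al ep (X (g x) (h x) - X (g x) z') (V (g x) (h x) - V (g x) z')) : borel_measurable (M \<Otimes>\<^sub>M f0)"
  by (simp add: case_prod_unfold)
 from sigma_finite_measure.borel_measurable_lebesgue_integral[OF prob_space_imp_sigma_finite[OF f0] this] show ?thesis by (simp add: acc_def)
qed

lemma acc_measurable1 [measurable]: "acc ep X V t : borel_measurable f0"
 by (rule acc_measurable[OF _ pair_proj_measurable(3)]) simp

lemma acc_bound: "EX C. ALL t z. norm (acc ep X V t z) <= C * (1 + norm z)"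
proof (intro exI allI)
 fix t z
 define m where "m = (LINT z|f0. 1 + norm z)"
 have m: "0 <= m" unfolding m_def by (intro Bochner_Integration.integral_nonneg) auto
 have "norm (acc ep X V t z) <= (LINT z'|f0. cD al * ep powr (- al) * (CV * ((1 + norm z) + (1 + norm z'))))"
  unfolding acc_def
 proof (rule order_trans[OF integral_norm_bound integral_mono])
  show "integrable f0 (%z'. cD al * ep powr (- al) * (CV * ((1 + norm z) + (1 + norm z'))))"
   by (intro integrable_mult_right Bochner_Integration.integrable_add[OF integrable_const f0_wt])
 qed (use integrable_DK_flow DK_flow_bound in auto)
 also have "\<dots> = cD al * ep powr (- al) * (CV * ((1 + norm z) + m))"
  unfolding m_def using Bochner_Integration.integral_add[OF integrable_const f0_wt, of "1 + norm z"] by simp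
 also have "\<dots> <= cD al * ep powr (- al) * (CV * ((1 + m) * (1 + norm z)))"
  using cD_pos[OF al] CV_nonneg m by (intro mult_left_mono) (auto simp: algebra_simps)
 finally show "norm (acc ep X V t z) <= cD al * ep powr (- al) * (CV * (1 + m)) * (1 + norm z)"
  by (simp only: mult.assoc)
qed

lemma convK_flow_deriv:
 assumes t: "t : {0..T}"
 shows "((%t. convK al ep f0 (X t) (X t z)) has_vector_derivative acc ep X V t z) (at t within {0..T})"
 unfolding convK_def acc_def
proof (rule has_vector_derivative_integral_param[OF t])
 have Xi: "integrable f0 (%z. norm (X s z))" for s
  by (intro integrable_norm integrable_linear[OF _ X(2)]) measurable
 show "integrable f0 (%z'. K al ep (X s z - X s z'))" for s
  by (intro integrable_convK al f0 Xi) measurable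
 show "integrable f0 (%z'. cD al * ep powr (- al) * (CV * ((1 + norm z) + (1 + norm z'))))"
  by (intro integrable_mult_right Bochner_Integration.integrable_add[OF integrable_const f0_wt])
 show "norm (DK al ep (X s z - X s z') (V s z - V s z')) <= cD al * ep powr (- al) * (CV * ((1 + norm z) + (1 + norm z')))" for s z'
  by (rule DK_flow_bound)
 fix z' s assume s: "s : {0..T}"
 have "((%s. X s z - X s z') has_derivative (%h. h *\<^sub>R (V s z - V s z'))) (at s within {0..T})"
  using has_vector_derivative_diff[OF der[OF s] der[OF s]] by (simp add: has_vector_derivative_def)
 from has_derivative_compose[OF this K_has_derivative[OF al]] ep
 have "((%s. K al ep (X s z - X s z')) has_derivative (%h. DK al ep (X s z - X s z') (h *\<^sub>R (V s z - V s z')))) (at s within {0..T})"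
  by simp
 then show "((%s. K al ep (X s z - X s z')) has_vector_derivative DK al ep (X s z - X s z') (V s z - V s z')) (at s within {0..T})"
  by (simp add: has_vector_derivative_def linear_scale[OF linear_DK])
qed measurable

text \<open>The Hessian is even in the position difference, so exchanging the two labels turns the factor \<open>G z\<close> into
half of a difference.\<close>

lemma acc_symmetrized:
 fixes G :: "'a \<times> 'a => 'a"
 assumes G [measurable]: "G : borel_measurable f0" "!!z. norm (G z) <= CG * (1 + norm z)"
 shows "(LINT z|f0. G z \<bullet> acc ep X V t z) = (LINT p|ff0. (G (fst p) - G (snd p)) \<bullet>
   DK al ep (X t (fst p) - X t (snd p)) (V t (fst p) - V t (snd p)) / 2)"
  "integrable ff0 (%p. (G (fst p) - G (snd p)) \<bullet>
   DK al ep (X t (fst p) - X t (snd p)) (V t (fst p) - V t (snd p)))"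
  "integrable f0 (%z. G z \<bullet> acc ep X V t z)"
proof -
 have CG: "0 <= CG" using G(2)[of 0] norm_ge_zero[of "G 0"] by (auto simp del: norm_ge_zero)
 define c where "c = cD al * ep powr (- al)"
 have c: "0 <= c" using cD_pos[OF al] by (simp add: c_def)
 define D where "D p = DK al ep (X t (fst p) - X t (snd p)) (V t (fst p) - V t (snd p))" for p
 have [measurable]: "D : borel_measurable ff0" unfolding D_def by measurable
 define F where "F p = G (fst p) \<bullet> D p" for p
 have iF: "integrable ff0 F"
 proof (rule integrable_pair_quadratic[of _ "CG * (c * CV) * 2"])
  show "F : borel_measurable ff0" unfolding F_def by measurable
  fix z z' :: "'a \<times> 'a"
  have "norm (F (z, z')) <= (CG * (1 + norm z)) * (c * (CV * ((1 + norm z) + (1 + norm z'))))"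
   unfolding F_def D_def real_norm_def c_def fst_conv snd_conv using CG
   by (intro order_trans[OF Cauchy_Schwarz_ineq2] mult_mono G DK_flow_bound) auto
  also have "\<dots> = CG * (c * CV) * ((1 + norm z) * (1 + norm z) + (1 + norm z) * (1 + norm z'))" by (simp add: algebra_simps)
  also have "\<dots> <= CG * (c * CV) * (2 * ((1 + norm z)^2 + (1 + norm z')^2))"
  proof (rule mult_left_mono)
   show "(1 + norm z) * (1 + norm z) + (1 + norm z) * (1 + norm z') <= 2 * ((1 + norm z)^2 + (1 + norm z')^2)"
    by (rule square_plus_cross)
  qed (use CG c CV_nonneg in simp)
  finally show "norm (F (z, z')) <= CG * (c * CV) * 2 * ((1 + norm z)^2 + (1 + norm z')^2)" by (simp only: mult.assoc)
 qed
 have sw: "F (snd p, fst p) = - (G (snd p) \<bullet> D p)" for p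
 proof -
  have "D (snd p, fst p) = DK al ep (X t (fst p) - X t (snd p)) (- (V t (fst p) - V t (snd p)))"
   unfolding D_def by (simp add: DK_diff_commute[of _ _ "X t (snd p)"])
  then show ?thesis unfolding F_def by (simp add: linear_neg[OF linear_DK] D_def del: minus_diff_eq)
 qed
 have "(LINT z|f0. G z \<bullet> acc ep X V t z) = (LINT z|f0. LINT z'|f0. F (z, z'))"
  unfolding F_def D_def acc_def using integrable_DK_flow by (simp add: integral_inner_right)
 also have "\<dots> = (LINT p|ff0. F p)" by (rule integral_fst'[OF iF])
 also have "\<dots> = (LINT p|ff0. (F p + F (snd p, fst p)) / 2)" by (rule sym_integral(1)[OF f0 iF])
 also have "(%p. (F p + F (snd p, fst p)) / 2) = (%p. (G (fst p) - G (snd p)) \<bullet> D p / 2)"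
  unfolding sw by (simp add: F_def inner_diff_left fun_eq_iff)
 finally show "(LINT z|f0. G z \<bullet> acc ep X V t z) = (LINT p|ff0. (G (fst p) - G (snd p)) \<bullet>
   DK al ep (X t (fst p) - X t (snd p)) (V t (fst p) - V t (snd p)) / 2)"
  unfolding D_def .
 have "integrable ff0 (%p. F p + F (snd p, fst p))"
  using iF sym_integral(2)[OF f0 iF] by simp
 then show "integrable ff0 (%p. (G (fst p) - G (snd p)) \<bullet>
   DK al ep (X t (fst p) - X t (snd p)) (V t (fst p) - V t (snd p)))"
  unfolding sw D_def[symmetric] by (simp add: F_def inner_diff_left)
 obtain Ca where Ca: "!!z. norm (acc ep X V t z) <= Ca * (1 + norm z)" using acc_bound by blast
 show "integrable f0 (%z. G z \<bullet> acc ep X V t z)"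
 proof (rule integrable_quadratic[of _ "CG * Ca"])
  have [measurable]: "(%z. acc ep X V t z) : borel_measurable f0" by measurable
  show "(%z. G z \<bullet> acc ep X V t z) : borel_measurable f0" by measurable
  fix z
  have "norm (G z \<bullet> acc ep X V t z) <= (CG * (1 + norm z)) * (Ca * (1 + norm z))"
   unfolding real_norm_def using CG by (intro order_trans[OF Cauchy_Schwarz_ineq2] mult_mono G Ca) auto
  then show "norm (G z \<bullet> acc ep X V t z) <= CG * Ca * (1 + norm z)^2" by (simp add: power2_eq_square mult_ac)
 qed
qed

end

text \<open>The force tested against the velocity is the dissipation, by symmetrization and the coercivity of the
Hessian.\<close>

lemma energy_regularized:
 assumes ep: "0 < ep" and X: "lagrangian al ep f0 (label ep) T X"
 shows "(nn_integral f0 (%z. ennreal ((norm (vel ep X T z))^2))) +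
  (nn_integral lborel (%t. (nn_integral ff0 (%p. ennreal (norm (X t (fst p) - X t (snd p), ep) powr (- al) * (norm (vel ep X t (fst p) - vel ep X t (snd p)))^2)))
    * indicator {0..T} t))
  <= (nn_integral f0 (%z. ennreal ((norm (snd z))^2)))"
proof -
 note F = lagrangian_facts[OF X]
 obtain CX where CX: "!!t z. norm (X t z) <= CX * (1 + norm z)" using F(4) by blast
 obtain CV where CV: "!!t z. norm (vel ep X t z) <= CV * (1 + norm z)" using vel_bound[OF F(1,4)] by blast
 define V where "V = vel ep X"
 have Vc: "continuous_on UNIV (%(t, z). V t z)" unfolding V_def by (rule vel_continuous[OF F(1,4)])
 have Vb: "norm (V t z) <= CV * (1 + norm z)" for t z unfolding V_def by (rule CV)
 note der = lagrangian_vel_deriv[OF X, folded V_def]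
 note ctx = F(1) CX Vc Vb der ep
 have [measurable]: "X t : borel_measurable f0" "V t : borel_measurable f0" for t
  using flow_pair_measurable(5,6)[OF ctx] by blast+
 note acc_measurable1[OF ctx, measurable]
 have aV: "((%t. V t z) has_vector_derivative - acc ep X V t z) (at t within {0..T})" if "t : {0..T}" for t z
 proof -
  have eq: "(%t. V t z) = (%t. label ep z - convK al ep f0 (X t) (X t z))" by (simp add: V_def vel_def)
  show ?thesis
   unfolding eq
   using has_vector_derivative_diff[OF has_vector_derivative_const convK_flow_deriv[OF ctx that], of "label ep z"] by simp
 qed
 obtain Ca where Ca: "!!t z. norm (acc ep X V t z) <= Ca * (1 + norm z)" using acc_bound[OF ctx] by blast
 have CV0: "0 <= CV" by (rule CV_nonneg[OF ctx])
 define E where "E t = (LINT z|f0. (norm (V t z))^2)" for t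
 define q where "q t = (LINT z|f0. 2 * (V t z \<bullet> acc ep X V t z))" for t
 have iV: "integrable f0 (%z. (norm (V t z))^2)" for t
  by (rule integrable_quadratic[of _ "CV^2"]) (use power_mono[OF Vb, of t _ 2] in \<open>auto simp: power_mult_distrib\<close>)
 have bd: "norm (2 * (V t z \<bullet> - acc ep X V t z)) <= 2 * CV * Ca * (1 + norm z)^2" for t z
 proof -
  have "\<bar>V t z \<bullet> acc ep X V t z\<bar> <= (CV * (1 + norm z)) * (Ca * (1 + norm z))"
   using CV0 by (intro order_trans[OF Cauchy_Schwarz_ineq2] mult_mono Vb Ca) auto
  then have "2 * \<bar>V t z \<bullet> acc ep X V t z\<bar> <= 2 * ((CV * (1 + norm z)) * (Ca * (1 + norm z)))" by simp
  also have "\<dots> = 2 * CV * Ca * (1 + norm z)^2" by (simp add: power2_eq_square algebra_simps)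
  finally show ?thesis by (simp add: abs_mult)
 qed
 have Ed: "(E has_vector_derivative - q t) (at t within {0..T})" if t: "t : {0..T}" for t
 proof -
  have "(E has_vector_derivative (LINT z|f0. 2 * (V t z \<bullet> - acc ep X V t z))) (at t within {0..T})"
   unfolding E_def
  proof (rule has_vector_derivative_integral_param[OF t iV integrable_mult_right[OF f0_wt_square] _ bd])
   show "((%s. (norm (V s z))^2) has_vector_derivative 2 * (V s z \<bullet> - acc ep X V s z)) (at s within {0..T})" if "s : {0..T}" for z s
    by (rule has_vector_derivative_norm_square[OF aV[OF that]])
  qed measurable
  then show ?thesis by (simp add: q_def)
 qed
 have qm: "q : borel_measurable borel"
  unfolding q_def
 proof (rule sigma_finite_measure.borel_measurable_lebesgue_integral[OF prob_space_imp_sigma_finite[OF f0]])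
  note m = measurable_fst[of borel f0] pair_proj_measurable(2)[of borel]
  have "(%x. 2 * (V (fst x) (snd x) \<bullet> acc ep X V (fst x) (snd x))) : borel_measurable (borel \<Otimes>\<^sub>M f0)"
   by (intro borel_measurable_times borel_measurable_const borel_measurable_inner flow_joint_measurable[OF ctx m] acc_measurable[OF ctx m])
  then show "(%(t, z). 2 * (V t z \<bullet> acc ep X V t z)) : borel_measurable (borel \<Otimes>\<^sub>M f0)"
   by (simp add: case_prod_unfold)
 qed
 define Di where "Di t = (nn_integral ff0 (%p. ennreal (norm (X t (fst p) - X t (snd p), ep) powr (- al) * (norm (V t (fst p) - V t (snd p)))^2)))" for t
 have co: "norm (X t (fst p) - X t (snd p), ep) powr (- al) * (norm (V t (fst p) - V t (snd p)))^2
   <= (V t (fst p) - V t (snd p)) \<bullet> DK al ep (X t (fst p) - X t (snd p)) (V t (fst p) - V t (snd p))" for t p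
  by (rule DK_coercive[OF al])
 have qeq: "q t = (LINT p|ff0. (V t (fst p) - V t (snd p)) \<bullet> DK al ep (X t (fst p) - X t (snd p)) (V t (fst p) - V t (snd p)))" for t
 proof -
  have "(LINT z|f0. V t z \<bullet> acc ep X V t z) = (LINT p|ff0. (V t (fst p) - V t (snd p)) \<bullet>
   DK al ep (X t (fst p) - X t (snd p)) (V t (fst p) - V t (snd p)) / 2)"
   by (rule acc_symmetrized(1)[OF F(1) CX Vc Vb _ ep _ Vb]) (use der in auto)
  then show ?thesis by (simp add: q_def)
 qed
 have iq: "integrable ff0 (%p. (V t (fst p) - V t (snd p)) \<bullet> DK al ep (X t (fst p) - X t (snd p)) (V t (fst p) - V t (snd p)))" for t
  by (rule acc_symmetrized(2)[OF F(1) CX Vc Vb _ ep _ Vb]) (use der in auto)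
 have nn: "0 <= (V t (fst p) - V t (snd p)) \<bullet> DK al ep (X t (fst p) - X t (snd p)) (V t (fst p) - V t (snd p))" for t p
  by (rule order_trans[OF _ co]) auto
 have q0: "0 <= q t" for t unfolding qeq by (intro Bochner_Integration.integral_nonneg nn)
 have Di: "Di t <= ennreal (q t)" for t
  unfolding Di_def qeq nn_integral_eq_integral[OF iq AE_I2[OF nn], symmetric]
  by (intro nn_integral_mono ennreal_leI co)
 have "(nn_integral lborel (%t. ennreal (q t) * indicator {0..T} t)) = ennreal ((- E T) - (- E 0))"
 proof -
  have "((%t. - E t) has_vector_derivative q t) (at t within {0..T})" if "t : {0..T}" for t
   using has_vector_derivative_minus[OF Ed[OF that]] by simp
  then have "(q has_integral (- E T) - (- E 0)) {0..T}"
   by (intro fundamental_theorem_of_calculus) (use T in auto)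
  then have "((%t. if t : {0..T} then q t else 0) has_integral (- E T) - (- E 0)) UNIV"
   by (simp only: has_integral_restrict_UNIV)
  then have "(nn_integral lborel (%t. ennreal (if t : {0..T} then q t else 0))) = ennreal ((- E T) - (- E 0))"
   by (intro nn_integral_has_integral_lborel) (use qm q0 in auto)
  moreover have "ennreal (q t) * indicator {0..T} t = ennreal (if t : {0..T} then q t else 0)" for t
   by (simp add: indicator_def)
  ultimately show ?thesis by simp
 qed
 moreover have "(nn_integral lborel (%t. Di t * indicator {0..T} t)) <= (nn_integral lborel (%t. ennreal (q t) * indicator {0..T} t))"
  by (intro nn_integral_mono mult_right_mono Di) auto
 ultimately have "(nn_integral lborel (%t. Di t * indicator {0..T} t)) <= ennreal (E 0 - E T)" by simp
 moreover have ET: "0 <= E t" for t unfolding E_def by (intro Bochner_Integration.integral_nonneg) auto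
 moreover have "E T <= E 0"
  using real_deriv_le[of 0 T E "%t. - q t" 0] Ed q0 T by auto
 ultimately have "ennreal (E T) + (nn_integral lborel (%t. Di t * indicator {0..T} t)) <= ennreal (E 0)"
  using add_left_mono[of "nn_integral lborel (%t. Di t * indicator {0..T} t)" "ennreal (E 0 - E T)" "ennreal (E T)"]
  by (simp flip: ennreal_plus)
 moreover have "V 0 = snd"
  by (simp add: V_def vel_def label_def F(3) fun_eq_iff)
 moreover have "ennreal (E t) = (nn_integral f0 (%z. ennreal ((norm (V t z))^2)))" for t
  unfolding E_def by (rule nn_integral_eq_integral[OF iV, symmetric]) simp
 ultimately show ?thesis by (simp add: Di_def V_def)
qed

lemma real_powr_at_top: "LIM r at_top. r powr al :> at_top" for r :: real
proof -
 have "LIM r at_top. exp (al * ln r) :> (at_top :: real filter)"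
  by (rule filterlim_compose[OF exp_at_top filterlim_tendsto_pos_mult_at_top[OF tendsto_const al(1) ln_at_top]])
 then show ?thesis
  by (rule filterlim_cong[OF refl refl, THEN iffD1, rotated])
   (auto intro!: eventually_mono[OF eventually_gt_at_top[of 0]] simp: powr_def mult.commute)
qed

text \<open>Valid also at \<open>y0 = 0\<close>, where the left-hand side is infinite unless \<open>w0 = 0\<close>.\<close>

lemma phi_liminf:
 assumes y: "(y \<longlongrightarrow> y0) sequentially" and w: "(w \<longlongrightarrow> w0) sequentially" and e: "(e \<longlongrightarrow> 0) sequentially" "!!n. 0 < e n"
 shows "ennreal ((norm w0)^2) * phi al (norm (y0::'b::euclidean_space)) <= liminf (%n. ennreal (norm (y n, e n :: real) powr (- al) * (norm (w n :: 'c::real_normed_vector))^2))"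
proof -
 have lim: "(%n. norm (y n, e n)) ----> norm (y0, 0::real)"
  by (intro tendsto_norm tendsto_Pair y e)
 then have lim: "(%n. norm (y n, e n)) ----> norm y0" by simp
 have w2: "(%n. (norm (w n))^2) ----> (norm w0)^2" by (intro tendsto_intros w)
 have pos: "0 < norm (y n, e n)" for n using e(2)[of n] by (simp add: zero_prod_def)
 consider "y0 ~= 0" | "y0 = 0" "w0 = 0" | "y0 = 0" "w0 ~= 0" by blast
 then show ?thesis
 proof cases
  case 1
  have "(%n. norm (y n, e n) powr (- al)) ----> norm y0 powr (- al)"
   using 1 by (intro tendsto_powr lim tendsto_const) simp
  from tendsto_mult[OF this w2] have "(%n. ennreal (norm (y n, e n) powr (- al) * (norm (w n))^2)) ----> ennreal (norm y0 powr (- al) * (norm w0)^2)"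
   by (rule tendsto_ennrealI)
  from lim_imp_Liminf[OF _ this] show ?thesis
   using 1 by (simp add: phi_def epow_def ennreal_mult'' mult.commute)
 next
  case 3
  have "LIM n sequentially. norm (y n, e n) powr (- al) :> at_top"
  proof -
   have "LIM n sequentially. norm (y n, e n) :> at_right 0"
    using lim 3 pos by (auto simp: filterlim_at)
   then have "LIM n sequentially. inverse (norm (y n, e n)) :> at_top"
    by (rule filterlim_compose[OF filterlim_inverse_at_top_right])
   then have "LIM n sequentially. inverse (norm (y n, e n)) powr al :> at_top"
    using al by (intro filterlim_compose[OF real_powr_at_top])
   then show ?thesis by (simp add: powr_minus inverse_powr)
  qed
  then have "LIM n sequentially. (norm (w n))^2 * norm (y n, e n) powr (- al) :> at_top"
   using 3 by (intro filterlim_tendsto_pos_mult_at_top[OF w2]) auto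
  then have "(%n. ennreal ((norm (w n))^2 * norm (y n, e n) powr (- al))) ----> top"
   by (simp add: ennreal_tendsto_top_eq_at_top)
  from lim_imp_Liminf[OF _ this] show ?thesis by (simp add: mult.commute)
 qed simp
qed

lemma energy_limit:
 assumes Xn: "!!n. lagrangian al (eps n) f0 (label (eps n)) T (Xn n)" and X: "lagrangian al 0 f0 (label 0) T X"
  and lim: "!!t z. (%n. Xn n t z) ----> X t z" "!!t z. (%n. vel (eps n) (Xn n) t z) ----> vel 0 X t z"
 shows "(nn_integral f0 (%z. ennreal ((norm (vel 0 X T z))^2))) +
  (nn_integral lborel (%t. (nn_integral ff0 (%p. ennreal ((norm (vel 0 X t (fst p) - vel 0 X t (snd p)))^2) * phi al (norm (X t (fst p) - X t (snd p)))))
    * indicator {0..T} t))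
  <= (nn_integral f0 (%z. ennreal ((norm (snd z))^2)))"
proof (rule liminf_sum_le)
 note F = lagrangian_facts[OF Xn]
 have Vc: "continuous_on UNIV (%(t, z). vel (eps n) (Xn n) t z)" for n by (rule vel_continuous[OF F(1,4)])
 note m = measurable_fst[of borel "ff0"] measurable_compose[OF measurable_snd[of borel "ff0"] pair_proj_measurable(1)]
  measurable_compose[OF measurable_snd[of borel "ff0"] pair_proj_measurable(2)]
 note [measurable] = measurable_joint[OF F(1) m(1,2)] measurable_joint[OF F(1) m(1,3)]
  measurable_joint[OF Vc m(1,2)] measurable_joint[OF Vc m(1,3)]
 have [measurable]: "vel (eps n) (Xn n) t : borel_measurable f0" for n t
  by (rule measurable_joint[OF Vc _ pair_proj_measurable(3)]) simp
 define a where "a n z = ennreal ((norm (vel (eps n) (Xn n) T z))^2)" for n z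
 define d where "d n t p = ennreal (norm (Xn n t (fst p) - Xn n t (snd p), eps n) powr (- al) * (norm (vel (eps n) (Xn n) t (fst p) - vel (eps n) (Xn n) t (snd p)))^2)" for n t p
 have dm [measurable]: "(%(t, p). d n t p) : borel_measurable (borel \<Otimes>\<^sub>M ff0)" for n
  unfolding d_def norm_Pair case_prod_unfold by measurable
 have dm1: "d n t : borel_measurable ff0" for n t
  using measurable_compose[OF measurable_Pair1' dm, of t n] by simp
 have Dm [measurable]: "(%t. nn_integral ff0 (%p. d n t p)) : borel_measurable borel" for n
 proof -
  interpret pp: pair_prob_space f0 f0 ..
  interpret P: sigma_finite_measure "ff0" by (rule prob_space_imp_sigma_finite[OF pp.P.prob_space_axioms])
  show ?thesis by (rule P.borel_measurable_nn_integral) (rule dm)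
 qed
 show "(nn_integral f0 (%z. ennreal ((norm (vel 0 X T z))^2))) <= liminf (%n. nn_integral f0 (%z. a n z))"
 proof (rule order_trans[OF nn_integral_mono nn_integral_liminf])
  show "ennreal ((norm (vel 0 X T z))^2) <= liminf (%n. a n z)" for z
  proof -
   have "(%n. a n z) ----> ennreal ((norm (vel 0 X T z))^2)"
    unfolding a_def by (intro tendsto_ennrealI tendsto_intros lim)
   from lim_imp_Liminf[OF _ this] show ?thesis by simp
  qed
  show "a n : borel_measurable f0" for n unfolding a_def by measurable
 qed
 show "(nn_integral lborel (%t. (nn_integral ff0 (%p. ennreal ((norm (vel 0 X t (fst p) - vel 0 X t (snd p)))^2) * phi al (norm (X t (fst p) - X t (snd p))))) * indicator {0..T} t))
  <= liminf (%n. nn_integral lborel (%t. (nn_integral ff0 (%p. d n t p)) * indicator {0..T} t))"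
 proof (rule order_trans[OF nn_integral_mono nn_integral_liminf])
  fix t
  have "(nn_integral ff0 (%p. ennreal ((norm (vel 0 X t (fst p) - vel 0 X t (snd p)))^2) * phi al (norm (X t (fst p) - X t (snd p)))))
    <= liminf (%n. nn_integral ff0 (%p. d n t p))"
   unfolding d_def
   by (rule order_trans[OF nn_integral_mono nn_integral_liminf[OF dm1[unfolded d_def]]])
    (intro phi_liminf tendsto_intros lim eps_tendsto eps_pos)
  then show "(nn_integral ff0 (%p. ennreal ((norm (vel 0 X t (fst p) - vel 0 X t (snd p)))^2) * phi al (norm (X t (fst p) - X t (snd p))))) * indicator {0..T} t
    <= liminf (%n. (nn_integral ff0 (%p. d n t p)) * indicator {0..T} t)"
   by (cases "t : {0..T}") (simp_all del: atLeastAtMost_iff)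
 qed measurable
 show "(nn_integral f0 (%z. a n z)) + (nn_integral lborel (%t. (nn_integral ff0 (%p. d n t p)) * indicator {0..T} t)) <= (nn_integral f0 (%z. ennreal ((norm (snd z))^2)))" for n
  unfolding a_def d_def by (rule energy_regularized[OF eps_pos Xn])
qed

end

section \<open>Dissipative curves of measures\<close>

lemma DK_zero [simp]: "DK al ep x 0 = 0"
 by (rule linear_0[OF linear_DK])

lemma ennreal_le_plus: "a <= b + c ==> 0 <= b ==> 0 <= c ==> ennreal a <= ennreal b + ennreal c"
 by (simp add: ennreal_leI flip: ennreal_plus)

text \<open>Dominated convergence twice: in \<open>p\<close> for almost every time, then in time. The inner measure depends on
time, and the dominating function only has a finite iterated integral.\<close>

lemma kernel_dominated_convergence:
 fixes F :: "nat => real => 'p => real" and H :: "real => 'p => ennreal"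
 assumes kp: "kp : borel \<rightarrow>\<^sub>M subprob_algebra N" and S: "S : sets borel"
  and Fm: "!!n. (%(t, p). F n t p) : borel_measurable (borel \<Otimes>\<^sub>M N)"
  and F0m: "(%(t, p). F0 t p) : borel_measurable (borel \<Otimes>\<^sub>M N)"
  and Hm: "(%(t, p). H t p) : borel_measurable (borel \<Otimes>\<^sub>M N)"
  and Hfin: "(nn_integral lborel (%t. (nn_integral (kp t) (%p. H t p)) * indicator S t)) < \<infinity>"
  and good: "AE t in lborel. t : S --> (AE p in kp t. good p)"
  and bd: "!!n t p. t : S ==> good p ==> ennreal \<bar>F n t p\<bar> <= H t p"
  and conv: "!!t p. t : S ==> good p ==> (%n. F n t p) ----> F0 t p"
 shows "(%n. LINT t:S|lborel. (LINT p|kp t. F n t p)) ----> (LINT t:S|lborel. (LINT p|kp t. F0 t p))"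
  "!!n. set_integrable lborel S (%t. LINT p|kp t. F n t p)" "set_integrable lborel S (%t. LINT p|kp t. F0 t p)"
  "!!n. AE t in lborel. t : S --> integrable (kp t) (F n t)"
  "AE t in lborel. t : S --> integrable (kp t) (F0 t)"
proof -
 have sets_kp: "sets (kp t) = sets N" for t
  using measurable_space[OF kp, of t] by (simp add: space_subprob_algebra)
 have Im: "(%t. LINT p|kp t. G t p) : borel_measurable borel"
  if "(%(t, p). G t p) : borel_measurable (borel \<Otimes>\<^sub>M N)" for G :: "real => 'p => real"
 proof -
  have 1: "(%t. distr (kp t) (borel \<Otimes>\<^sub>M N) (%p. (t, p))) : borel \<rightarrow>\<^sub>M subprob_algebra (borel \<Otimes>\<^sub>M N)"
   by (rule measurable_distr2[OF _ kp]) simp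
  have 2: "(%t. LINT q|distr (kp t) (borel \<Otimes>\<^sub>M N) (%p. (t, p)). (%(t, p). G t p) q) : borel_measurable borel"
   by (rule measurable_compose[OF 1 integral_measurable_subprob_algebra[OF that]])
  have "(LINT q|distr (kp t) (borel \<Otimes>\<^sub>M N) (%p. (t, p)). (%(t, p). G t p) q) = (LINT p|kp t. G t p)" for t
  proof (subst integral_distr[OF _ that])
   show "Pair t : kp t \<rightarrow>\<^sub>M borel \<Otimes>\<^sub>M N"
    unfolding measurable_cong_sets[OF sets_kp refl] by (rule measurable_Pair1') simp
  qed simp
  then show ?thesis using 2 by simp
 qed
 have sec: "G t : borel_measurable (kp t)" if "(%(t, p). G t p) : borel_measurable (borel \<Otimes>\<^sub>M N)" for G :: "real => 'p => 'c::topological_space" and t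
  unfolding measurable_cong_sets[OF sets_kp refl]
  using measurable_compose[OF measurable_Pair1' that, of t] by simp
 define h where "h t = (nn_integral (kp t) (%p. H t p))" for t
 have hm: "h : borel_measurable borel" unfolding h_def by (rule nn_integral_measurable_subprob_algebra2[OF Hm kp])
 have m: "(%t. h t * indicator S t) : borel_measurable lborel" using hm S by simp
 have "(nn_integral lborel (%t. h t * indicator S t)) ~= \<infinity>" using Hfin by (simp add: h_def less_top)
 then have "AE t in lborel. h t * indicator S t ~= \<infinity>" by (rule nn_integral_noteq_infinite[OF m])
 then have hfin: "AE t in lborel. t : S --> h t < \<infinity>"
  by eventually_elim (auto simp: less_top)
 have inner: "integrable (kp t) (F n t)" "integrable (kp t) (F0 t)" "(%n. LINT p|kp t. F n t p) ----> (LINT p|kp t. F0 t p)"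
  "\<bar>LINT p|kp t. F n t p\<bar> <= enn2real (h t)"
  if t: "t : S" and ht: "h t < \<infinity>" and g: "AE p in kp t. good p" for t n
 proof -
  have Hf: "AE p in kp t. H t p ~= \<infinity>"
   by (rule nn_integral_noteq_infinite[OF sec[OF Hm]]) (use ht in \<open>auto simp: h_def\<close>)
  have iH: "integrable (kp t) (%p. enn2real (H t p))"
  proof (rule integrableI_nonneg)
   show "(%p. enn2real (H t p)) : borel_measurable (kp t)" using sec[OF Hm, of t] by measurable
   have "(nn_integral (kp t) (%p. ennreal (enn2real (H t p)))) = h t"
    unfolding h_def by (rule nn_integral_cong_AE) (use Hf in \<open>auto simp: less_top\<close>)
   then show "(nn_integral (kp t) (%p. ennreal (enn2real (H t p)))) < \<infinity>" using ht by simp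
  qed simp
  have dom: "AE p in kp t. norm (F n t p) <= enn2real (H t p)" for n
   using g Hf
  proof eventually_elim
   case (elim p)
   then have "ennreal \<bar>F n t p\<bar> <= ennreal (enn2real (H t p))" using bd[OF t, of p n] by (simp add: less_top)
   then show ?case by simp
  qed
  have cv: "AE p in kp t. (%n. F n t p) ----> F0 t p"
   using g by eventually_elim (rule conv[OF t])
  show iF: "integrable (kp t) (F n t)" for n
   by (rule Bochner_Integration.integrable_bound[OF iH sec[OF Fm]]) (use dom[of n] in \<open>eventually_elim, simp\<close>)
  show "integrable (kp t) (F0 t)"
   by (rule integrable_dominated_convergence[OF sec[OF F0m] sec[OF Fm] iH cv dom])
  show "(%n. LINT p|kp t. F n t p) ----> (LINT p|kp t. F0 t p)"
   by (rule integral_dominated_convergence[OF sec[OF F0m] sec[OF Fm] iH cv dom])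
  have "\<bar>LINT p|kp t. F n t p\<bar> <= (LINT p|kp t. norm (F n t p))" using integral_norm_bound[of "kp t" "F n t"] by simp
  also have "\<dots> <= (LINT p|kp t. enn2real (H t p))"
   by (rule integral_mono_AE[OF integrable_norm[OF iF] iH dom])
  also have "\<dots> = enn2real (h t)"
  proof -
   have "ennreal (LINT p|kp t. enn2real (H t p)) = (nn_integral (kp t) (%p. ennreal (enn2real (H t p))))"
    by (rule nn_integral_eq_integral[OF iH, symmetric]) simp
   also have "\<dots> = h t"
    unfolding h_def by (rule nn_integral_cong_AE) (use Hf in \<open>auto simp: less_top\<close>)
   finally show ?thesis by (metis enn2real_ennreal Bochner_Integration.integral_nonneg enn2real_nonneg)
  qed
  finally show "\<bar>LINT p|kp t. F n t p\<bar> <= enn2real (h t)" .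
 qed
 show "AE t in lborel. t : S --> integrable (kp t) (F n t)" for n
  using hfin good by eventually_elim (use inner(1) in blast)
 show "AE t in lborel. t : S --> integrable (kp t) (F0 t)"
  using hfin good by eventually_elim (use inner(2) in blast)
 define w where "w t = indicator S t * enn2real (h t)" for t
 have iw: "integrable lborel w"
 proof (rule integrableI_nonneg)
  show "w : borel_measurable lborel" unfolding w_def using hm S by measurable
  have "(nn_integral lborel (%t. ennreal (w t))) = (nn_integral lborel (%t. h t * indicator S t))"
   by (rule nn_integral_cong_AE) (use hfin in \<open>eventually_elim, auto simp: w_def less_top indicator_def\<close>)
  then show "(nn_integral lborel (%t. ennreal (w t))) < \<infinity>" using Hfin by (simp add: h_def)
 qed (simp add: w_def)
 have m1: "(%t. indicator S t *\<^sub>R (LINT p|kp t. F n t p)) : borel_measurable lborel" for n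
  using Im[OF Fm, of n] S by simp
 have m0: "(%t. indicator S t *\<^sub>R (LINT p|kp t. F0 t p)) : borel_measurable lborel"
  using Im[OF F0m] S by simp
 have cv: "AE t in lborel. (%n. indicator S t *\<^sub>R (LINT p|kp t. F n t p)) ----> indicator S t *\<^sub>R (LINT p|kp t. F0 t p)"
  using hfin good by eventually_elim (auto intro!: tendsto_mult_left inner(3) simp: indicator_def)
 have dom: "AE t in lborel. norm (indicator S t *\<^sub>R (LINT p|kp t. F n t p)) <= w t" for n
  using hfin good by eventually_elim (auto intro!: inner(4) simp: w_def indicator_def)
 show "(%n. LINT t:S|lborel. (LINT p|kp t. F n t p)) ----> (LINT t:S|lborel. (LINT p|kp t. F0 t p))"
  unfolding set_lebesgue_integral_def by (rule integral_dominated_convergence[OF m0 m1 iw cv dom])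
 show "set_integrable lborel S (%t. LINT p|kp t. F n t p)" for n
  unfolding set_integrable_def
  by (rule Bochner_Integration.integrable_bound[OF iw m1]) (use dom[of n] in \<open>eventually_elim, auto\<close>)
 show "set_integrable lborel S (%t. LINT p|kp t. F0 t p)"
  unfolding set_integrable_def by (rule integrable_dominated_convergence[OF m0 m1 iw cv dom])
qed

abbreviation dx :: "(('a::euclidean_space \<times> 'a) \<times> ('a \<times> 'a)) => 'a" where "dx p \<equiv> fst (fst p) - fst (snd p)"
abbreviation dv :: "(('a::euclidean_space \<times> 'a) \<times> ('a \<times> 'a)) => 'a" where "dv p \<equiv> snd (fst p) - snd (snd p)"

text \<open>The density of the energy dissipation.\<close>

definition rate :: "real => (('a::euclidean_space \<times> 'a) \<times> ('a \<times> 'a)) => ennreal" where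
 "rate al p = ennreal ((norm (dv p))^2) * phi al (norm (dx p))"

lemma rate_measurable [measurable]: "rate al : borel_measurable (borel \<Otimes>\<^sub>M borel)"
 unfolding rate_def phi_def epow_def borel_prod[symmetric] by measurable

lemma phi_eq: "y ~= 0 ==> phi al (norm y) = ennreal (norm y powr (- al))"
 by (simp add: phi_def epow_def)

lemma rate_eq: "dx p ~= 0 ==> rate al p = ennreal ((norm (dv p))^2 * norm (dx p) powr (- al))"
 unfolding rate_def phi_eq by (simp add: ennreal_mult')

lemma rate_Diag:
 "(\<integral>\<^sup>+ p\<in>- Diag. (case p of ((x, v), (x', v')) => ennreal ((norm (v - v'))^2) * phi al (norm (x - x'))) \<partial>M) = (nn_integral M (%p. rate al p))"
 by (rule nn_integral_cong) (auto simp: rate_def Diag_def indicator_def split: prod.splits)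

lemma alignment_Diag:
 "(LINT p:- Diag|M. (case p of ((x, v), (x', v')) => (a (x, v) - a (x', v')) \<bullet> D2W al (x - x') (v' - v)))
  = - (LINT p|M. (a (fst p) - a (snd p)) \<bullet> D2W al (dx p) (dv p))"
proof -
 have "indicator (- Diag) p *\<^sub>R (case p of ((x, v), (x', v')) => (a (x, v) - a (x', v')) \<bullet> D2W al (x - x') (v' - v))
  = - ((a (fst p) - a (snd p)) \<bullet> D2W al (dx p) (dv p))" for p
 proof -
  obtain x v x' v' where p: "p = ((x, v), (x', v'))" by (metis prod.collapse)
  have "D2W al (x - x') (v' - v) = - D2W al (x - x') (v - v')"
   using linear_neg[OF linear_D2W, of al "x - x'" "v - v'"] by simp
  then show ?thesis by (auto simp: p Diag_def indicator_def)
 qed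
 then show ?thesis unfolding set_lebesgue_integral_def by simp
qed

text \<open>What the energy inequality and the position moments give; time is extended to the whole line by
constants, which avoids restricting continuity to an interval.\<close>

locale dissipative_curve =
 fixes al T :: real and g :: "real => ('a::euclidean_space \<times> 'a) measure" and Mx :: real
 assumes al: "0 < al" "al < 1" and T: "0 < T"
  and g_prob: "!!t. prob_space (g t)" and g_sets: "!!t. sets (g t) = sets borel"
  and narrow: "!!h :: 'a \<times> 'a => real. continuous_on UNIV h ==> bounded (range h) ==> continuous_on UNIV (%t. LINT z|g t. h z)"
  and xmom: "!!t. (nn_integral (g t) (%z. ennreal ((norm (fst z))^2))) <= ennreal Mx" and Mx: "0 <= Mx"
  and diss: "(nn_integral lborel (%t. (nn_integral (g t \<Otimes>\<^sub>M g t) (%p. rate al p)) * indicator {0..T} t)) < \<infinity>"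
begin

abbreviation gg where "gg t == g t \<Otimes>\<^sub>M g t"

lemma g_space [simp]: "space (g t) = UNIV"
 using sets_eq_imp_space_eq[OF g_sets] by simp

lemma measurable_g: "(h : borel_measurable (g t)) = (h : borel_measurable borel)"
 by (simp add: measurable_cong_sets[OF g_sets refl])

lemma sets_gg: "sets (gg t) = sets (borel \<Otimes>\<^sub>M borel)"
 by (rule sets_pair_measure_cong[OF g_sets g_sets])

lemma measurable_gg: "(h : borel_measurable (gg t)) = (h : borel_measurable (borel \<Otimes>\<^sub>M borel))"
 by (simp add: measurable_cong_sets[OF sets_gg refl])

lemma kernel_g: "g : borel \<rightarrow>\<^sub>M subprob_algebra borel"
 by (rule narrow_measurable_kernel[OF g_prob g_sets narrow])

lemma kernel_gg: "(%t. gg t) : borel \<rightarrow>\<^sub>M subprob_algebra (borel \<Otimes>\<^sub>M borel)"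
 by (rule measurable_pair_measure[OF kernel_g kernel_g])

text \<open>Pairs at the same position with different velocities have infinite dissipation rate, hence are null at
almost every time, and the value of the Hessian at 0 does not matter.\<close>

definition good :: "(('a \<times> 'a) \<times> ('a \<times> 'a)) => bool" where "good p \<longleftrightarrow> dx p ~= 0 \<or> dv p = 0"

lemma good_AE: "AE t in lborel. t : {0..<T} --> (AE p in gg t. good p)"
proof -
 have rm: "(%t. nn_integral (gg t) (%p. rate al p)) : borel_measurable borel"
  by (rule measurable_compose[OF kernel_gg nn_integral_measurable_subprob_algebra]) measurable
 have "AE t in lborel. (nn_integral (gg t) (%p. rate al p)) * indicator {0..T} t ~= \<infinity>"
  by (rule nn_integral_noteq_infinite) (use diss rm in auto)
 then show ?thesis
 proof eventually_elim
  case (elim t)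
  show ?case
  proof
   assume "t : {0..<T}"
   then have "(nn_integral (gg t) (%p. rate al p)) ~= \<infinity>" using elim by (auto simp: indicator_def)
   then have "AE p in gg t. rate al p ~= \<infinity>"
    by (rule nn_integral_noteq_infinite[rotated]) (simp add: measurable_gg)
   then show "AE p in gg t. good p"
   proof eventually_elim
    case (elim p)
    show ?case
    proof (rule ccontr)
    assume "\<not> good p"
    then have "dx p = 0" "dv p ~= 0" by (auto simp: good_def)
    then have "rate al p = \<infinity>" using al by (simp add: rate_def phi_def epow_def ennreal_mult_top)
    then show False using elim by simp
    qed
   qed
  qed
 qed
qed

lemma xmom_pair: "(nn_integral (gg t) (%p. ennreal (1 + (norm (dx p))^2))) <= ennreal (1 + 4 * Mx)"
proof -
 interpret prob_space "g t" by (rule g_prob)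
 interpret pp: pair_prob_space "g t" "g t" ..
 have [measurable]: "fst : borel_measurable (g t)" unfolding measurable_g by (intro borel_measurable_continuous_onI continuous_intros)
 have "(nn_integral (gg t) (%p. ennreal (1 + (norm (dx p))^2)))
  <= (nn_integral (gg t) (%p. 1 + (2 * ennreal ((norm (fst (fst p)))^2) + 2 * ennreal ((norm (fst (snd p)))^2))))"
 proof (rule nn_integral_mono)
  fix p :: "('a \<times> 'a) \<times> 'a \<times> 'a"
  define a where "a = norm (fst (fst p))"
  define b where "b = norm (fst (snd p))"
  have "(norm (dx p))^2 <= (a + b)^2" unfolding a_def b_def by (intro power_mono norm_triangle_ineq4) auto
  also have "\<dots> <= 2 * a^2 + 2 * b^2" using zero_le_power2[of "a - b"] unfolding power2_diff power2_sum by simp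
  finally have "ennreal (1 + (norm (dx p))^2) <= ennreal (1 + (2 * a^2 + 2 * b^2))" by (intro ennreal_leI) simp
  also have "\<dots> = 1 + (2 * ennreal (a^2) + 2 * ennreal (b^2))" by (simp add: ennreal_plus ennreal_mult' del: ennreal_plus_if)
  finally show "ennreal (1 + (norm (dx p))^2) <= 1 + (2 * ennreal ((norm (fst (fst p)))^2) + 2 * ennreal ((norm (fst (snd p)))^2))"
   by (simp add: a_def b_def)
 qed
 also have "\<dots> = 1 + (2 * (nn_integral (gg t) (%p. ennreal ((norm (fst (fst p)))^2))) + 2 * (nn_integral (gg t) (%p. ennreal ((norm (fst (snd p)))^2))))"
  using pp.P.emeasure_space_1 by (simp add: nn_integral_add nn_integral_cmult)
 also have "(nn_integral (gg t) (%p. ennreal ((norm (fst (fst p)))^2))) = (nn_integral (g t) (%z. ennreal ((norm (fst z))^2)))"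
  by (subst nn_integral_fst[symmetric]) (auto simp: emeasure_space_1[simplified])
 also have "(nn_integral (gg t) (%p. ennreal ((norm (fst (snd p)))^2))) = (nn_integral (g t) (%z. ennreal ((norm (fst z))^2)))"
  by (subst nn_integral_fst[symmetric]) (auto simp: emeasure_space_1[simplified])
 also have "1 + (2 * (nn_integral (g t) (%z. ennreal ((norm (fst z))^2))) + 2 * (nn_integral (g t) (%z. ennreal ((norm (fst z))^2)))) <= 1 + (2 * ennreal Mx + 2 * ennreal Mx)"
  by (intro add_left_mono add_mono mult_left_mono xmom) auto
 also have "\<dots> = ennreal (1 + 4 * Mx)"
 proof -
  have "2 * ennreal Mx = ennreal (2 * Mx)" using Mx by (simp add: ennreal_mult')
  then show ?thesis using Mx by (simp flip: ennreal_plus ennreal_1)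
 qed
 finally show ?thesis .
qed

text \<open>Dominates the alignment integrand for functions that are Lipschitz in phase space; functions of the
label require the additional term of \<open>majorant'\<close>.\<close>

definition majorant :: "real => (('a \<times> 'a) \<times> ('a \<times> 'a)) => ennreal" where
 "majorant C p = ennreal C * (rate al p + ennreal (1 + (norm (dx p))^2))"

lemma majorant_measurable [measurable]: "majorant C : borel_measurable (borel \<Otimes>\<^sub>M borel)"
 unfolding majorant_def borel_prod[symmetric]
 using rate_measurable[of al, unfolded borel_prod[symmetric]] by measurable

lemma majorant_finite: "(nn_integral lborel (%t. (nn_integral (gg t) (%p. majorant C p)) * indicator {0..<T} t)) < \<infinity>"
proof -
 have rm: "(%t. nn_integral (gg t) (%p. rate al p)) : borel_measurable borel"
  by (rule measurable_compose[OF kernel_gg nn_integral_measurable_subprob_algebra]) measurable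
 have dm: "(%p. ennreal (1 + (norm (dx p))^2)) : borel_measurable ((borel :: ('a \<times> 'a) measure) \<Otimes>\<^sub>M borel)"
  unfolding borel_prod[symmetric] by measurable
 have "(nn_integral (gg t) (%p. majorant C p)) <= ennreal C * ((nn_integral (gg t) (%p. rate al p)) + ennreal (1 + 4 * Mx))" for t
 proof -
  have "(nn_integral (gg t) (%p. majorant C p)) = ennreal C * ((nn_integral (gg t) (%p. rate al p)) + (nn_integral (gg t) (%p. ennreal (1 + (norm (dx p))^2))))"
   unfolding majorant_def using dm rate_measurable[of al] by (simp add: nn_integral_cmult nn_integral_add measurable_gg)
  also have "\<dots> <= ennreal C * ((nn_integral (gg t) (%p. rate al p)) + ennreal (1 + 4 * Mx))"
   by (intro mult_left_mono add_left_mono xmom_pair) auto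
  finally show ?thesis .
 qed
 then have "(nn_integral lborel (%t. (nn_integral (gg t) (%p. majorant C p)) * indicator {0..<T} t))
  <= (nn_integral lborel (%t. ennreal C * ((nn_integral (gg t) (%p. rate al p)) * indicator {0..T} t + ennreal (1 + 4 * Mx) * indicator {0..T} t)))"
  by (intro nn_integral_mono) (auto simp: indicator_def)
 also have "\<dots> = ennreal C * ((nn_integral lborel (%t. (nn_integral (gg t) (%p. rate al p)) * indicator {0..T} t)) + ennreal (1 + 4 * Mx) * ennreal T)"
  using rm T by (simp add: nn_integral_cmult nn_integral_add nn_integral_cmult_indicator)
 also have "\<dots> < \<infinity>" using diss by (simp add: ennreal_mult_less_top flip: ennreal_mult)
 finally show ?thesis .
qed

end

text \<open>The exponents: a product of the square roots of the dissipation rate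
 \<open>\<bar>w\<bar>^2 \<bar>y\<bar> powr (- al)\<close> and of a power of \<open>\<bar>y\<bar>\<close> between \<open>0\<close> and \<open>2\<close>.\<close>

lemma young_powr:
 fixes y w :: "'b::real_normed_vector"
 assumes y: "y ~= 0" and be: "0 <= al + 2 * be" "al + 2 * be <= 2"
 shows "norm w * norm y powr be <= (norm w)^2 * norm y powr (- al) + (1 + (norm y)^2)"
proof -
 define r where "r = norm y"
 have r: "0 < r" using y by (simp add: r_def)
 define a where "a = norm w * r powr (- al / 2)"
 define b where "b = r powr (be + al / 2)"
 have "a * b = norm w * r powr be" by (simp add: a_def b_def powr_add[symmetric])
 moreover have "a * b <= a^2 + b^2"
 proof -
  have "0 <= (a - b)^2" "0 <= a^2 + b^2" by simp_all
  then show ?thesis unfolding power2_diff by linarith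
 qed
 moreover have "a^2 = (norm w)^2 * r powr (- al)"
  by (simp add: a_def power_mult_distrib power2_eq_square[of "r powr _"] powr_add[symmetric])
 moreover have "b^2 <= 1 + r^2"
 proof -
  have "b^2 = r powr (al + 2 * be)" by (simp add: b_def power2_eq_square powr_add[symmetric] algebra_simps)
  also have "\<dots> <= 1 + r^2"
  proof (cases "r <= 1")
   case True
   then have "r powr (al + 2 * be) <= 1" using be r by (simp add: powr_le1)
   then show ?thesis by (simp add: add_increasing2)
  next
   case False
   then have "r powr (al + 2 * be) <= r powr 2" using be by (intro powr_mono) auto
   then show ?thesis using r by simp
  qed
  finally show ?thesis .
 qed
 ultimately show ?thesis unfolding r_def by linarith
qed

text \<open>This is where the exponent \<open>(2 - 3 al) / (1 - al)\<close> comes from. If \<open>\<bar>w\<bar>\<close> dominates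
 \<open>\<bar>y\<bar> powr (1 - al)\<close>, the dissipation rate controls the left-hand side; otherwise the difference
 \<open>om\<close> of the two labels is at most a multiple of \<open>\<bar>y\<bar> powr (1 - al)\<close>, and the left-hand side
 is at most \<open>\<bar>y\<bar> powr (2 - 3 al)\<close>. For \<open>al <= 2 / 3\<close> moments suffice.\<close>

lemma cross_term_bound:
 fixes y w om :: "'b::euclidean_space"
 assumes al: "0 < al" "al < 1" and y: "y ~= 0" and om: "norm (om - w) <= cH al * norm y powr (1 - al)"
 shows "ennreal (norm w * norm y powr (1 - 2 * al)) <= ennreal ((norm w)^2 * norm y powr (- al)) + ennreal (1 + (norm y)^2)
  + ennreal ((1 + cH al) powr (- ((2 - 3 * al) / (1 - al)))) * epow (norm om) ((2 - 3 * al) / (1 - al))"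
proof (cases "al <= 2 / 3")
 case True
 have "norm w * norm y powr (1 - 2 * al) <= (norm w)^2 * norm y powr (- al) + (1 + (norm y)^2)"
  using True al by (intro young_powr y) auto
 then have "ennreal (norm w * norm y powr (1 - 2 * al)) <= ennreal ((norm w)^2 * norm y powr (- al)) + ennreal (1 + (norm y)^2)"
  by (rule ennreal_le_plus) auto
 then show ?thesis by (rule order_trans) simp
next
 case False
 define r where "r = norm y"
 have r: "0 < r" using y by (simp add: r_def)
 define p where "p = (2 - 3 * al) / (1 - al)"
 have p: "p < 0" using False al by (simp add: p_def divide_neg_pos)
 show ?thesis
 proof (cases "r powr (1 - al) <= norm w")
  case True
  have "norm w * r powr (1 - 2 * al) = norm w * r powr (- al) * r powr (1 - al)"
   by (simp add: powr_add[symmetric])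
  also have "\<dots> <= norm w * r powr (- al) * norm w" using True by (intro mult_left_mono) auto
  also have "\<dots> = (norm w)^2 * r powr (- al)" by (simp add: power2_eq_square)
  finally have "ennreal (norm w * norm y powr (1 - 2 * al)) <= ennreal ((norm w)^2 * norm y powr (- al))"
   unfolding r_def by (rule ennreal_leI)
  then show ?thesis by (rule order_trans) (simp add: add.assoc)
 next
  case w: False
  show ?thesis
  proof (cases "om = 0")
   case True
   have "0 < 1 + cH al" using cH_pos[OF al] by simp
   then have "ennreal ((1 + cH al) powr (- p)) * epow (norm om) p = \<infinity>"
    using True p by (simp add: epow_def ennreal_mult_top)
   then show ?thesis unfolding p_def by simp
  next
   case om0: False
   have "norm om <= norm w + cH al * r powr (1 - al)"
    using om norm_triangle_sub[of om w] by (simp add: r_def)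
   also have "\<dots> <= (1 + cH al) * r powr (1 - al)" using w by (simp add: algebra_simps)
   finally have o: "norm om / (1 + cH al) <= r powr (1 - al)"
    using cH_pos[OF al] by (simp add: divide_le_eq mult.commute)
   have "norm w * r powr (1 - 2 * al) <= r powr (1 - al) * r powr (1 - 2 * al)"
    using w by (intro mult_right_mono) auto
   also have "\<dots> = (r powr (1 - al)) powr p"
    using al by (simp add: powr_add[symmetric] powr_powr p_def)
   also have "\<dots> <= (norm om / (1 + cH al)) powr p"
    using o om0 cH_pos[OF al] p by (intro powr_mono2') auto
   also have "\<dots> = (1 + cH al) powr (- p) * norm om powr p"
    using cH_pos[OF al] by (simp add: powr_divide powr_minus field_simps)
   finally have "ennreal (norm w * norm y powr (1 - 2 * al)) <= ennreal ((1 + cH al) powr (- p)) * epow (norm om) p"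
    unfolding r_def using om0 by (subst epow_def) (simp add: ennreal_leI flip: ennreal_mult')
   then show ?thesis unfolding p_def by (rule order_trans) simp
  qed
 qed
qed

locale phase_curve = dissipative_curve +
 fixes M2 :: real and E :: ennreal
 assumes mom: "!!t. integrable (g t) (%z. (norm z)^2)" "!!t. (LINT z|g t. (norm z)^2) <= M2"
  and om_energy: "!!t. omega_energy al (g t) <= E" and E: "E < \<infinity>"
begin

definition u :: "real => real => 'a => 'a" where "u ep t x = convK al ep (g t) fst x"

lemma g_fst_measurable: "fst : borel_measurable (g t)" "snd : borel_measurable (g t)"
 unfolding measurable_g by (intro borel_measurable_continuous_onI continuous_intros)+

lemma g_linear_integrable:
 fixes h :: "'a \<times> 'a => 'c::{banach,second_countable_topology}"
 assumes "h : borel_measurable borel" "!!z. norm (h z) <= C * (1 + norm z)"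
 shows "integrable (g t) h"
proof (rule Bochner_Integration.integrable_bound[of _ "%z. C * (2 * (1 + (norm z)^2))"])
 interpret prob_space "g t" by (rule g_prob)
 show "integrable (g t) (%z. C * (2 * (1 + (norm z)^2)))" using mom(1)[of t] by simp
 have C: "0 <= C" using assms(2)[of 0] norm_ge_zero[of "h 0"] by (auto simp del: norm_ge_zero)
 show "AE z in g t. norm (h z) <= norm (C * (2 * (1 + (norm z)^2)))"
 proof (rule AE_I2)
  fix z
  have "norm (h z) <= C * (2 * (1 + (norm z)^2))"
   by (rule order_trans[OF assms(2) mult_left_mono[OF one_plus_le_square C]])
  then show "norm (h z) <= norm (C * (2 * (1 + (norm z)^2)))" by simp
 qed
qed (use assms in \<open>simp add: measurable_g\<close>)

lemma g_fst_integrable: "integrable (g t) (%z. norm (fst z))"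
 by (intro g_linear_integrable[of _ 1] borel_measurable_continuous_onI continuous_intros)
  (auto intro: order_trans[OF norm_fst_le_norm])

lemma u_holder: "norm (u ep t x - u ep t x') <= cH al * norm (x - x') powr (1 - al)"
 unfolding u_def by (rule convK_holder[OF al g_prob g_fst_measurable(1) g_fst_integrable])

lemma u_mono: "0 <= (u ep t x - u ep t x') \<bullet> (x - x')"
 unfolding u_def by (rule convK_mono[OF al g_prob g_fst_measurable(1) g_fst_integrable])

lemma u_eps: "norm (u ep t x - u dl t x) <= cH al * \<bar>ep - dl\<bar> powr (1 - al)"
 unfolding u_def by (rule convK_eps[OF al g_prob g_fst_measurable(1) g_fst_integrable])

lemma u_lipschitz: "0 < ep ==> norm (u ep t x - u ep t x') <= cD al * ep powr (- al) * norm (x - x')"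
 unfolding u_def by (rule convK_lipschitz[OF al g_prob g_fst_measurable(1) g_fst_integrable])

lemma mean_norm_bound: "(LINT z|g t. norm (fst z)) <= 1 + M2"
proof -
 interpret prob_space "g t" by (rule g_prob)
 have "(LINT z|g t. norm (fst z)) <= (LINT z|g t. 1 + (norm z)^2)"
 proof (rule integral_mono[OF g_fst_integrable])
  show "norm (fst z) <= 1 + (norm z)^2" for z :: "'a \<times> 'a"
   by (rule order_trans[OF norm_fst_le_norm le_one_plus_square])
 qed (use mom in auto)
 also have "\<dots> <= 1 + M2" using mom(1)[of t] mom(2)[of t] prob_space by simp
 finally show ?thesis .
qed

lemma u_growth: "norm (u ep t x) <= cH al * (2 + M2 + norm x)"
proof -
 have "norm (u ep t x) <= cH al * (1 + norm x + (LINT z|g t. norm (fst z)))"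
  unfolding u_def by (rule convK_growth[OF al g_prob g_fst_measurable(1) g_fst_integrable])
 also have "\<dots> <= cH al * (2 + M2 + norm x)"
  using mean_norm_bound[of t] cH_pos[OF al] by (intro mult_left_mono) auto
 finally show ?thesis .
qed

lemma continuous_mean:
 fixes F :: "'p::metric_space => 'a \<times> 'a => 'c::euclidean_space"
 assumes F: "continuous_on UNIV (%(p, z). F p z)" and n: "continuous_on UNIV n"
  and b: "!!p z. norm (F p z) <= n p * (1 + norm z)" and ta: "continuous_on UNIV ta"
 shows "continuous_on UNIV (%p. LINT z|g (ta p). F p z)"
proof -
 have "continuous_on {p. n p < real r} (%p. LINT z|g (ta p). F p z)" for r :: nat
 proof (rule continuous_integral_param_vec[where I=UNIV and f=g and C=M2 and C'="real r"])
  show "norm (F p z) <= real r * (1 + norm z)" if "p : {p. n p < real r}" for p z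
   using that by (intro order_trans[OF b] mult_right_mono) auto
 qed (use g_prob g_sets narrow mom F ta in \<open>auto intro: continuous_on_subset\<close>)
 then have "continuous_on (\<Union>r::nat. {p. n p < real r}) (%p. LINT z|g (ta p). F p z)"
  by (intro continuous_on_open_UN) (auto intro!: open_Collect_less continuous_intros n)
 moreover have "(\<Union>r::nat. {p. n p < real r}) = UNIV" using reals_Archimedean2 by auto
 ultimately show ?thesis by simp
qed

lemma continuous_u: "continuous_on UNIV (%(t, x). u ep t x)"
 unfolding u_def convK_def case_prod_unfold
proof (rule continuous_mean[where n="%p. cH al * (1 + norm (snd p)) + cH al"])
 show "continuous_on UNIV (%(p, z). K al ep (snd p - fst z) :: 'a)"
  unfolding case_prod_unfold by (intro continuous_on_K[OF al] continuous_intros)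
 fix p :: "real \<times> 'a" and z :: "'a \<times> 'a"
 have "norm (K al ep (snd p - fst z)) <= cH al * (1 + (norm (snd p) + norm z))"
  using cH_pos[OF al]
  by (intro order_trans[OF K_growth[OF al]] mult_left_mono add_left_mono order_trans[OF norm_triangle_ineq4] add_mono norm_fst_le_norm) auto
 also have "\<dots> <= (cH al * (1 + norm (snd p)) + cH al) * (1 + norm z)"
  using cH_pos[OF al] by (simp add: algebra_simps)
 finally show "norm (K al ep (snd p - fst z)) <= (cH al * (1 + norm (snd p)) + cH al) * (1 + norm z)" .
qed (intro continuous_intros)+

lemma omega_eq: "omega al (g t) z = snd z + u 0 t (fst z)"
 unfolding omega_def u_def using conv_gradW_eq_convK[OF g_sets al] by (simp add: case_prod_unfold)

lemma continuous_omega: "continuous_on UNIV (%(t, z). omega al (g t) z)"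
proof -
 have "continuous_on UNIV (%q :: real \<times> 'a \<times> 'a. (%(t, x). u 0 t x) (fst q, fst (snd q)))"
  by (rule continuous_on_compose2[OF continuous_u]) (auto intro!: continuous_intros)
 then show ?thesis unfolding omega_eq case_prod_unfold by (intro continuous_intros) simp
qed

definition majorant' :: "real => real => (('a \<times> 'a) \<times> ('a \<times> 'a)) => ennreal" where
 "majorant' C t p = majorant C p
  + ennreal C * epow (norm (omega al (g t) (fst p) - omega al (g t) (snd p))) ((2 - 3 * al) / (1 - al))"

lemma omega_pair_measurable:
 "(%(t, p). epow (norm (omega al (g t) (fst p) - omega al (g t) (snd p))) q) : borel_measurable (borel \<Otimes>\<^sub>M (borel \<Otimes>\<^sub>M borel))"
proof -
 have "continuous_on UNIV (%q. (%(t, z). omega al (g t) z) (fst q, fst (snd q)))" "continuous_on UNIV (%q. (%(t, z). omega al (g t) z) (fst q, snd (snd q)))"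
  by (rule continuous_on_compose2[OF continuous_omega]; auto intro!: continuous_intros)+
 then have "continuous_on UNIV (%q :: real \<times> ('a \<times> 'a) \<times> ('a \<times> 'a). norm (omega al (g (fst q)) (fst (snd q)) - omega al (g (fst q)) (snd (snd q))))"
  by (intro continuous_intros) simp_all
 then have [measurable]: "(%q :: real \<times> ('a \<times> 'a) \<times> ('a \<times> 'a). norm (omega al (g (fst q)) (fst (snd q)) - omega al (g (fst q)) (snd (snd q)))) : borel_measurable borel"
  by (rule borel_measurable_continuous_onI)
 show ?thesis unfolding borel_prod case_prod_unfold epow_def by measurable
qed

lemma majorant'_measurable: "(%(t, p). majorant' C t p) : borel_measurable (borel \<Otimes>\<^sub>M (borel \<Otimes>\<^sub>M borel))"
proof -
 have [measurable]: "(%q. majorant C (snd q)) : borel_measurable (borel \<Otimes>\<^sub>M (borel \<Otimes>\<^sub>M borel))"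
  by (rule measurable_compose[OF measurable_snd majorant_measurable])
 note [measurable] = omega_pair_measurable[of "(2 - 3 * al) / (1 - al)", unfolded case_prod_unfold]
 show ?thesis unfolding majorant'_def case_prod_unfold by measurable
qed

lemma majorant'_finite: "(nn_integral lborel (%t. (nn_integral (gg t) (%p. majorant' C t p)) * indicator {0..<T} t)) < \<infinity>"
proof -
 let ?e = "%t p. epow (norm (omega al (g t) (fst p) - omega al (g t) (snd p))) ((2 - 3 * al) / (1 - al))"
 have em: "?e t : borel_measurable (borel \<Otimes>\<^sub>M borel)" for t
  using measurable_compose[OF measurable_Pair1' omega_pair_measurable[of "(2 - 3 * al) / (1 - al)"], of t] by simp
 have mm: "(%t. nn_integral (gg t) (%p. majorant C p)) : borel_measurable borel"
  by (rule measurable_compose[OF kernel_gg nn_integral_measurable_subprob_algebra]) measurable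
 have "(nn_integral (gg t) (%p. majorant' C t p)) <= (nn_integral (gg t) (%p. majorant C p)) + ennreal C * E" for t
 proof -
  have "(nn_integral (gg t) (%p. majorant' C t p)) = (nn_integral (gg t) (%p. majorant C p)) + ennreal C * (nn_integral (gg t) (%p. ?e t p))"
   unfolding majorant'_def using em[of t] majorant_measurable[of C] by (simp add: nn_integral_cmult nn_integral_add measurable_gg)
  also have "(nn_integral (gg t) (%p. ?e t p)) = omega_energy al (g t)"
   by (simp add: omega_energy_def case_prod_unfold)
  also have "(nn_integral (gg t) (%p. majorant C p)) + ennreal C * omega_energy al (g t) <= (nn_integral (gg t) (%p. majorant C p)) + ennreal C * E"
   by (intro add_left_mono mult_left_mono om_energy) auto
  finally show ?thesis .
 qed
 then have "(nn_integral lborel (%t. (nn_integral (gg t) (%p. majorant' C t p)) * indicator {0..<T} t))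
  <= (nn_integral lborel (%t. (nn_integral (gg t) (%p. majorant C p)) * indicator {0..<T} t + ennreal C * E * indicator {0..<T} t))"
  by (intro nn_integral_mono) (auto simp: indicator_def)
 also have "\<dots> = (nn_integral lborel (%t. (nn_integral (gg t) (%p. majorant C p)) * indicator {0..<T} t)) + ennreal C * E * ennreal T"
  using mm T by (simp add: nn_integral_add nn_integral_cmult_indicator)
 also have "\<dots> < \<infinity>" using majorant_finite[of C] E by (simp add: ennreal_mult_less_top)
 finally show ?thesis .
qed

text \<open>The three terms of the modulus of continuity, paired with the Hessian, give the three kinds of products:
moments with dissipation, dissipation, and the cross term of \<open>cross_term_bound\<close>.\<close>

lemma alignment_bound:
 assumes p: "good p" and A: "norm a <= L * (norm (dx p) + norm (dv p) + norm (dx p) powr (1 - al))" and L: "0 <= L"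
 shows "ennreal \<bar>a \<bullet> DK al ep (dx p) (dv p)\<bar> <= majorant' (L * cD al * (3 + (1 + cH al) powr (- ((2 - 3 * al) / (1 - al))))) t p"
proof (cases "dv p = 0")
 case True
 then show ?thesis by simp
next
 case False
 then have y: "dx p ~= 0" using p by (simp add: good_def)
 define r w where "r = norm (dx p)" and "w = norm (dv p)"
 have r: "0 < r" using y by (simp add: r_def)
 define k where "k = (1 + cH al) powr (- ((2 - 3 * al) / (1 - al)))"
 have k: "0 <= k" by (simp add: k_def)
 define e where "e = epow (norm (omega al (g t) (fst p) - omega al (g t) (snd p))) ((2 - 3 * al) / (1 - al))"
 have "\<bar>a \<bullet> DK al ep (dx p) (dv p)\<bar> <= (L * (r + w + r powr (1 - al))) * (cD al * r powr (- al) * w)"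
  unfolding r_def w_def using L
  by (intro order_trans[OF Cauchy_Schwarz_ineq2] mult_mono A DK_bound al y) (auto intro!: mult_nonneg_nonneg)
 also have "\<dots> = L * cD al * (w * r powr (1 - al) + w^2 * r powr (- al) + w * r powr (1 - 2 * al))"
 proof -
  have 1: "r * r powr (- al) = r powr (1 - al)" using r powr_add[of r 1 "- al"] by simp
  have 2: "r powr (1 - al) * r powr (- al) = r powr (1 - 2 * al)" by (simp add: powr_add[symmetric])
  have "(L * (r + w + r powr (1 - al))) * (cD al * r powr (- al) * w)
   = L * cD al * (w * (r * r powr (- al)) + w^2 * r powr (- al) + w * (r powr (1 - al) * r powr (- al)))"
   by (simp add: power2_eq_square algebra_simps)
  then show ?thesis by (simp only: 1 2)
 qed
 finally have "ennreal \<bar>a \<bullet> DK al ep (dx p) (dv p)\<bar> <= ennreal (L * cD al) * (ennreal (w * r powr (1 - al)) + ennreal (w^2 * r powr (- al)) + ennreal (w * r powr (1 - 2 * al)))"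
  using L cD_pos[OF al] by (simp add: r_def w_def ennreal_leI flip: ennreal_plus ennreal_mult')
 also have "\<dots> <= ennreal (L * cD al) * ((rate al p + ennreal (1 + r^2)) + (rate al p + ennreal (1 + r^2)) + ((rate al p + ennreal (1 + r^2)) + ennreal k * e))"
 proof (intro mult_left_mono add_mono)
  have re: "rate al p = ennreal (w^2 * r powr (- al))" using rate_eq[OF y] by (simp add: r_def w_def)
  have "w * r powr (1 - al) <= w^2 * r powr (- al) + (1 + r^2)"
   unfolding r_def w_def using al by (intro young_powr y) auto
  then show "ennreal (w * r powr (1 - al)) <= rate al p + ennreal (1 + r^2)"
   unfolding re by (rule ennreal_le_plus) auto
  show "ennreal (w^2 * r powr (- al)) <= rate al p + ennreal (1 + r^2)" unfolding re by simp
  show "ennreal (w * r powr (1 - 2 * al)) <= (rate al p + ennreal (1 + r^2)) + ennreal k * e"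
   unfolding re r_def w_def k_def e_def
  proof (rule cross_term_bound[OF al y])
   have "(omega al (g t) (fst p) - omega al (g t) (snd p)) - dv p = u 0 t (fst (fst p)) - u 0 t (fst (snd p))"
    by (simp add: omega_eq)
   then show "norm ((omega al (g t) (fst p) - omega al (g t) (snd p)) - dv p) <= cH al * norm (dx p) powr (1 - al)"
    using u_holder by simp
  qed
 qed simp
 also have "\<dots> = ennreal (L * cD al) * (3 * (rate al p + ennreal (1 + r^2)) + ennreal k * e)"
 proof -
  have "x + x + (x + z) = 3 * x + z" for x z :: ennreal
  proof -
   have "(3 :: ennreal) = 1 + 1 + 1" by simp
   then show ?thesis by (simp only: distrib_right mult_1 add.assoc)
  qed
  then show ?thesis by (simp only:)
 qed
 also have "\<dots> <= ennreal (L * cD al) * (ennreal (3 + k) * (rate al p + ennreal (1 + r^2)) + ennreal (3 + k) * e)"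
 proof (intro mult_left_mono add_mono mult_right_mono)
  show "3 <= ennreal (3 + k)" using k by (metis ennreal_numeral ennreal_leI le_add_same_cancel1)
  show "ennreal k <= ennreal (3 + k)" by (intro ennreal_leI) simp
 qed auto
 also have "\<dots> = majorant' (L * cD al * (3 + k)) t p"
 proof -
  have "ennreal (L * cD al * (3 + k)) = ennreal (L * cD al) * ennreal (3 + k)"
   using L cD_pos[OF al] k by (intro ennreal_mult') simp
  then show ?thesis by (simp only: majorant'_def majorant_def r_def e_def distrib_left mult.assoc)
 qed
 finally show ?thesis by (simp add: k_def)
qed

lemma alignment_limit:
 fixes A :: "nat => real => 'a \<times> 'a => 'a"
 assumes Am: "!!n. (%(t, z). A n t z) : borel_measurable borel" and A0m: "(%(t, z). A0 t z) : borel_measurable borel"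
  and L: "0 <= L" and Ab: "!!n t p. t : {0..<T} ==> norm (A n t (fst p) - A n t (snd p)) <= L * (norm (dx p) + norm (dv p) + norm (dx p) powr (1 - al))"
  and conv: "!!t z. t : {0..<T} ==> (%n. A n t z) ----> A0 t z" and e: "e ----> 0"
 shows "(%n. LINT t:{0..<T}|lborel. (LINT p|(gg t). (A n t (fst p) - A n t (snd p)) \<bullet> DK al (e n) (dx p) (dv p)))
  ----> (LINT t:{0..<T}|lborel. (LINT p|(gg t). (A0 t (fst p) - A0 t (snd p)) \<bullet> D2W al (dx p) (dv p)))"
  "!!n. set_integrable lborel {0..<T} (%t. LINT p|(gg t). (A n t (fst p) - A n t (snd p)) \<bullet> DK al (e n) (dx p) (dv p))"
  "set_integrable lborel {0..<T} (%t. LINT p|(gg t). (A0 t (fst p) - A0 t (snd p)) \<bullet> D2W al (dx p) (dv p))"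
proof -
 have Fm: "(%(t, p). (B t (fst p) - B t (snd p)) \<bullet> DK al ep (dx p) (dv p)) : borel_measurable (borel \<Otimes>\<^sub>M (borel \<Otimes>\<^sub>M borel))"
  if "(%(t, z). B t z) : borel_measurable borel" for B :: "real => 'a \<times> 'a => 'a" and ep
 proof -
  have 1: "(%q :: real \<times> ('a \<times> 'a) \<times> ('a \<times> 'a). (%(t, z). B t z) (fst q, fst (snd q))) : borel_measurable borel"
   "(%q :: real \<times> ('a \<times> 'a) \<times> ('a \<times> 'a). (%(t, z). B t z) (fst q, snd (snd q))) : borel_measurable borel"
   by (rule measurable_compose[OF _ that]; intro borel_measurable_continuous_onI continuous_intros)+
  have 2: "(%q :: real \<times> ('a \<times> 'a) \<times> ('a \<times> 'a). dx (snd q)) : borel_measurable borel" "(%q :: real \<times> ('a \<times> 'a) \<times> ('a \<times> 'a). dv (snd q)) : borel_measurable borel"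
   by (intro borel_measurable_continuous_onI continuous_intros)+
  have "(%q :: real \<times> ('a \<times> 'a) \<times> ('a \<times> 'a). (B (fst q) (fst (snd q)) - B (fst q) (snd (snd q))) \<bullet> DK al ep (dx (snd q)) (dv (snd q))) : borel_measurable borel"
   using 1 by (intro borel_measurable_inner borel_measurable_diff measurable_DK 2) simp_all
  then show ?thesis by (simp add: borel_prod case_prod_unfold)
 qed
 note dct = kernel_dominated_convergence[OF kernel_gg _ Fm[OF Am] Fm[OF A0m, of 0] majorant'_measurable majorant'_finite good_AE]
 have bd: "ennreal \<bar>(A n t (fst p) - A n t (snd p)) \<bullet> DK al (e n) (dx p) (dv p)\<bar> <= majorant' (L * cD al * (3 + (1 + cH al) powr (- ((2 - 3 * al) / (1 - al))))) t p"
  if "t : {0..<T}" "good p" for n t p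
  by (rule alignment_bound[OF that(2) Ab[OF that(1)] L])
 have cv: "(%n. (A n t (fst p) - A n t (snd p)) \<bullet> DK al (e n) (dx p) (dv p)) ----> (A0 t (fst p) - A0 t (snd p)) \<bullet> DK al 0 (dx p) (dv p)"
  if t: "t : {0..<T}" and p: "good p" for t p
 proof (cases "dv p = 0")
  case True
  then show ?thesis by simp
 next
  case False
  then have "dx p ~= 0" using p by (simp add: good_def)
  then show ?thesis unfolding DK_0 by (intro tendsto_inner tendsto_diff conv t tendsto_DK al e)
 qed
 show "(%n. LINT t:{0..<T}|lborel. (LINT p|(gg t). (A n t (fst p) - A n t (snd p)) \<bullet> DK al (e n) (dx p) (dv p)))
  ----> (LINT t:{0..<T}|lborel. (LINT p|(gg t). (A0 t (fst p) - A0 t (snd p)) \<bullet> D2W al (dx p) (dv p)))"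
  by (rule dct(1)[unfolded DK_0, OF _ bd cv[unfolded DK_0]]) auto
 show "set_integrable lborel {0..<T} (%t. LINT p|(gg t). (A n t (fst p) - A n t (snd p)) \<bullet> DK al (e n) (dx p) (dv p))" for n
  by (rule dct(2)[unfolded DK_0, OF _ bd cv[unfolded DK_0]]) auto
 show "set_integrable lborel {0..<T} (%t. LINT p|(gg t). (A0 t (fst p) - A0 t (snd p)) \<bullet> D2W al (dx p) (dv p))"
  by (rule dct(3)[unfolded DK_0, OF _ bd cv[unfolded DK_0]]) auto
qed

end

section \<open>Test functions\<close>

lemma FTC_lborel:
 fixes F :: "real => real"
 assumes "a <= b" "!!t. t : {a..b} ==> (F has_vector_derivative f t) (at t within {a..b})" "set_integrable lborel {a..b} f"
 shows "(LINT t:{a..b}|lborel. f t) = F b - F a"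
proof -
 have "(f has_integral F b - F a) {a..b}" using assms by (intro fundamental_theorem_of_calculus) auto
 then show ?thesis using set_borel_integral_eq_integral(2)[OF assms(3)] by (simp add: integral_unique)
qed

locale test_fun =
 fixes T :: real and ps pst :: "real \<times> ('a::euclidean_space \<times> 'a) => real" and psx psv :: "real \<times> ('a \<times> 'a) => 'a"
 assumes test: "test_function T ps pst psx psv" and T0: "0 < T"
begin

definition D :: "(real \<times> ('a \<times> 'a)) set" where "D = {0..<T} \<times> UNIV"

lemma deriv: "p : D ==> (ps has_derivative (%(ta, (xi, et)). pst p * ta + psx p \<bullet> xi + psv p \<bullet> et)) (at p within D)"
 and cont: "continuous_on D pst" "continuous_on D psx" "continuous_on D psv"
 and supp: "EX S. compact S \<and> S \<subseteq> D \<and> (ALL p:D - S. ps p = 0)"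
 and lips: "EX L. ALL t:{0..<T}. L-lipschitz_on UNIV (%z. psv (t, z))"
 using test unfolding test_function_def D_def Let_def by blast+

lemma cont_psi: "continuous_on D ps"
 using deriv by (rule has_derivative_continuous_on)

text \<open>At time 0 the derivative in time is one-sided; the domain still contains enough directions to determine
it.\<close>

lemma derivs_zero:
 assumes S: "compact S" "S \<subseteq> D" "ALL p:D - S. ps p = 0" and p: "p : D - S"
 shows "pst p = 0 \<and> psx p = 0 \<and> psv p = 0"
proof -
 have "open (- S)" using S(1) by (simp add: compact_imp_closed open_Compl)
 then obtain d where d: "0 < d" "ball p d \<subseteq> - S" using p by (auto simp: open_contains_ball)
 have z: "(ps has_derivative (%_. 0)) (at p within D)"
  by (rule has_derivative_transform_within[OF has_derivative_const d(1)])
   (use p S d in \<open>auto simp: subset_eq dist_commute\<close>)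
 have "(%(ta, (xi, et)). pst p * ta + psx p \<bullet> xi + psv p \<bullet> et) = (%_. 0)"
 proof (rule frechet_derivative_unique_within[OF deriv z])
  show "p : D" using p by simp
  fix i :: "real \<times> 'a \<times> 'a" and e :: real assume i: "i : Basis" and e: "0 < e"
  have i1: "fst i <= 1" "0 <= fst i"
   using i by (auto simp: Basis_prod_def)
  define h where "h = min (e / 2) ((T - fst p) / 2)"
  have tp: "0 <= fst p" "fst p < T" using p by (auto simp: D_def)
  have "h <= (T - fst p) / 2" unfolding h_def by (rule min.cobounded2)
  then have h: "0 < h" "h < e" "h <= (T - fst p) / 2" using e tp by (simp_all add: h_def)
  have "h < T - fst p" by (rule le_less_trans[OF h(3)]) (use tp in simp)
  moreover have "h * fst i <= h" using mult_left_le[OF i1(1), of h] h by simp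
  ultimately have "h * fst i < T - fst p" by (rule le_less_trans[rotated])
  then have "fst p + h * fst i < T" by simp
  moreover have "0 <= fst p + h * fst i" using tp h i1 by simp
  ultimately show "EX d. 0 < \<bar>d\<bar> \<and> \<bar>d\<bar> < e \<and> p + d *\<^sub>R i : D"
   using h by (intro exI[of _ h]) (auto simp: D_def mem_Times_iff)
 qed
 then have eq: "pst p * ta + psx p \<bullet> xi + psv p \<bullet> et = 0" for ta xi et
  by (metis (mono_tags, lifting) case_prod_conv)
 have "pst p = 0" using eq[of 1 0 0] by simp
 moreover have "psx p \<bullet> psx p = 0" using eq[of 0 "psx p" 0] by simp
 moreover have "psv p \<bullet> psv p = 0" using eq[of 0 0 "psv p"] by simp
 ultimately show ?thesis by simp
qed

lemma bounded_support:
 obtains T' B where "0 <= T'" "T' < T" "0 <= B"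
  "!!t z. T' < t ==> t < T ==> ps (t, z) = 0 \<and> pst (t, z) = 0 \<and> psx (t, z) = 0 \<and> psv (t, z) = 0"
  "!!p. p : D ==> \<bar>ps p\<bar> <= B \<and> \<bar>pst p\<bar> <= B \<and> norm (psx p) <= B \<and> norm (psv p) <= B"
proof -
 obtain S where S: "compact S" "S \<subseteq> D" "ALL p:D - S. ps p = 0" using supp by blast
 note dz = derivs_zero[OF S]
 have "EX T'. 0 <= T' \<and> T' < T \<and> (ALL p:S. fst p <= T')"
 proof (cases "S = {}")
  case False
  have "compact (fst ` S)" using S(1) by (intro compact_continuous_image continuous_intros)
  then obtain m where m: "m : fst ` S" "ALL s:fst ` S. s <= m" using compact_attains_sup[of "fst ` S"] False by blast
  then show ?thesis using S(2) by (intro exI[of _ m]) (auto simp: D_def)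
 qed (use T0 in auto)
 then obtain T' where T': "0 <= T'" "T' < T" "!!p. p : S ==> fst p <= T'" by blast
 have bd: "EX B. ALL p:D. norm (h p) <= B" if "continuous_on D h" "!!p. p : D - S ==> h p = 0" for h :: "real \<times> ('a \<times> 'a) => 'c::real_normed_vector"
 proof -
  note h0 = that(2)
  have "bounded (h ` S)" using S that(1) by (intro compact_imp_bounded compact_continuous_image continuous_on_subset[OF that(1)]) auto
  then obtain B where B: "ALL p:S. norm (h p) <= B" unfolding bounded_iff by blast
  have "norm (h p) <= \<bar>B\<bar>" if p: "p : D" for p
  proof (cases "p : S")
   case True
   then show ?thesis using order_trans[OF bspec[OF B True] abs_ge_self] by simp
  qed (use p h0 in auto)
  then show ?thesis by blast
 qed
 obtain B1 B2 B3 B4 where B: "!!p. p : D ==> norm (ps p) <= B1" "!!p. p : D ==> norm (pst p) <= B2"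
  "!!p. p : D ==> norm (psx p) <= B3" "!!p. p : D ==> norm (psv p) <= B4"
  using bd[OF cont_psi] bd[OF cont(1)] bd[OF cont(2)] bd[OF cont(3)] dz S(3) by (metis (no_types, lifting))
 define B where "B = max (max \<bar>B1\<bar> \<bar>B2\<bar>) (max \<bar>B3\<bar> \<bar>B4\<bar>)"
 show ?thesis
 proof (rule that[OF T'(1,2), of B])
  show "0 <= B" by (simp add: B_def le_max_iff_disj)
  fix t z assume t: "T' < t" "t < T"
  then have "(t, z) : D - S" using T'(1) T'(3)[of "(t, z)"] by (auto simp: D_def)
  then show "ps (t, z) = 0 \<and> pst (t, z) = 0 \<and> psx (t, z) = 0 \<and> psv (t, z) = 0" using dz S(3) by blast
 next
  fix p assume p: "p : D"
  show "\<bar>ps p\<bar> <= B \<and> \<bar>pst p\<bar> <= B \<and> norm (psx p) <= B \<and> norm (psv p) <= B"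
   using B[OF p] by (auto simp: B_def le_max_iff_disj)
 qed
qed

lemma D_borel: "D : sets borel"
 unfolding D_def by (intro borel_Times) auto

text \<open>Test functions are only continuous on their domain; extension by zero makes them measurable.\<close>

definition cut :: "(real \<times> ('a \<times> 'a) => 'c::real_vector) => real \<times> ('a \<times> 'a) => 'c" where
 "cut h p = indicator D p *\<^sub>R h p"

lemma cut_measurable:
 fixes h :: "real \<times> ('a \<times> 'a) => 'c::real_normed_vector"
 shows "continuous_on D h ==> cut h : borel_measurable borel"
 unfolding cut_def[abs_def] by (rule borel_measurable_continuous_on_indicator[OF D_borel])

lemma cut_eq: "t : {0..<T} ==> cut h (t, z) = h (t, z)"
 by (simp add: cut_def D_def)

end

section \<open>Existence\<close>

context initial_law
begin

lemma omega_f0: "omega al f0 z = label 0 z"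
 unfolding omega_def label_def using conv_gradW_eq_convK[OF sets_f0 al] by (simp add: case_prod_unfold)

definition push :: "(real => 'a \<times> 'a => 'a) => real => ('a \<times> 'a) measure" where
 "push X t = distr f0 borel (%z. (X t z, vel 0 X t z))"

context
 fixes X :: "real => 'a \<times> 'a => 'a"
 assumes X: "lagrangian al 0 f0 (label 0) T X"
begin

lemma vel_joint: "continuous_on UNIV (%(t, z). vel 0 X t z)" "EX C. ALL t z. norm (vel 0 X t z) <= C * (1 + norm z)"
 by (rule vel_continuous[OF lagrangian_facts(1,4)[OF X]] vel_bound[OF lagrangian_facts(1,4)[OF X]])+

lemma vel_measurable: "vel 0 X t : borel_measurable f0"
 by (rule flow_measurable[OF vel_joint])

lemma phase_flow_measurable [measurable]: "(%z. (X t z, vel 0 X t z)) : f0 \<rightarrow>\<^sub>M borel"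
 by (intro borel_measurable_Pair lagrangian_facts(6)[OF X] vel_measurable)

lemma prob_push: "prob_space (push X t)" and sets_push [simp]: "sets (push X t) = sets borel"
 unfolding push_def by (auto intro!: prob_space_distr phase_flow_measurable)

lemma integral_push:
 fixes h :: "'a \<times> 'a => 'c::{banach,second_countable_topology}"
 shows "h : borel_measurable borel ==> (LINT z|push X t. h z) = (LINT z|f0. h (X t z, vel 0 X t z))"
 unfolding push_def by (rule integral_distr[OF phase_flow_measurable])

lemma nn_integral_push: "h : borel_measurable borel ==> (nn_integral (push X t) (%z. h z)) = (nn_integral f0 (%z. h (X t z, vel 0 X t z)))"
 by (simp add: push_def nn_integral_distr[OF phase_flow_measurable])

lemma push_pair: "push X t \<Otimes>\<^sub>M push X t = distr ff0 (borel \<Otimes>\<^sub>M borel)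
  (%p. ((X t (fst p), vel 0 X t (fst p)), (X t (snd p), vel 0 X t (snd p))))"
 unfolding push_def
 by (subst pair_measure_distr[OF phase_flow_measurable phase_flow_measurable])
  (auto simp: case_prod_unfold intro!: prob_space_imp_sigma_finite prob_space_distr phase_flow_measurable)

lemma push_pair_measurable:
 "(%p. ((X t (fst p), vel 0 X t (fst p)), (X t (snd p), vel 0 X t (snd p)))) : ff0 \<rightarrow>\<^sub>M (borel \<Otimes>\<^sub>M borel)"
 by (intro measurable_Pair measurable_compose[OF measurable_fst phase_flow_measurable] measurable_compose[OF measurable_snd phase_flow_measurable])

lemma convK_push: "convK al ep (push X t) fst x = convK al ep f0 (X t) x"
proof -
 have "(%z :: 'a \<times> 'a. K al ep (x - fst z)) : borel_measurable borel"
  by (intro borel_measurable_continuous_onI continuous_on_K[OF al] continuous_intros)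
 from integral_push[OF this] show ?thesis by (simp add: convK_def)
qed

lemma omega_push: "omega al (push X t) (X t z, vel 0 X t z) = label 0 z"
 unfolding omega_def using conv_gradW_eq_convK[OF sets_push al] by (simp add: convK_push vel_def)

lemma omega_measurable: "omega al (push X t) : borel_measurable borel"
proof -
 have "continuous_on UNIV (%z :: 'a \<times> 'a. convK al 0 f0 (X t) (fst z))"
 proof -
  obtain C where C: "!!t z. norm (X t z) <= C * (1 + norm z)" using lagrangian_facts(4)[OF X] by blast
  show ?thesis by (rule continuous_convK[OF lagrangian_facts(1)[OF X] C]) (intro continuous_intros)+
 qed
 moreover have "omega al (push X t) = (%z. snd z + convK al 0 f0 (X t) (fst z))"
  unfolding omega_def using conv_gradW_eq_convK[OF sets_push al] by (simp add: convK_push case_prod_unfold fun_eq_iff)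
 ultimately show ?thesis by (intro borel_measurable_continuous_onI) (auto intro!: continuous_intros)
qed

text \<open>The label \<open>v + u t x\<close> is transported unchanged, so its energy does not depend on time.\<close>

lemma omega_energy_push: "omega_energy al (push X t) = omega_energy al f0"
proof -
 have "(%p. epow (norm (omega al (push X t) (fst p) - omega al (push X t) (snd p))) ((2 - 3 * al) / (1 - al))) : borel_measurable (borel \<Otimes>\<^sub>M borel)"
  using omega_measurable unfolding epow_def by measurable
 then show ?thesis
  unfolding omega_energy_def push_pair case_prod_unfold
  by (subst nn_integral_distr[OF push_pair_measurable]) (simp_all add: omega_push omega_f0)
qed

lemma second_moment_push: "integrable (push X t) (%z. (norm z)^2)" "EX M. ALL t. (LINT z|push X t. (norm z)^2) <= M"
proof -
 obtain C where C: "!!t z. norm (X t z) <= C * (1 + norm z)" using lagrangian_facts(4)[OF X] by blast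
 obtain C' where C': "!!t z. norm (vel 0 X t z) <= C' * (1 + norm z)" using vel_joint(2) by blast
 have b: "(norm (X t z, vel 0 X t z))^2 <= (C^2 + C'^2) * (1 + norm z)^2" for t z
  using power_mono[OF C[of t z] norm_ge_zero, of 2] power_mono[OF C'[of t z] norm_ge_zero, of 2]
  by (simp add: norm_Pair power_mult_distrib distrib_right)
 have m: "(%z. (norm (X t z, vel 0 X t z))^2) : borel_measurable f0" for t
  using phase_flow_measurable[of t] by measurable
 have i: "integrable f0 (%z. (norm (X t z, vel 0 X t z))^2)" for t
  by (rule integrable_quadratic[OF m]) (use b in simp)
 show "integrable (push X t) (%z. (norm z)^2)"
  unfolding push_def by (subst integrable_distr_eq[OF phase_flow_measurable]) (use i in auto)
 have "(LINT z|push X t. (norm z)^2) <= (LINT z|f0. (C^2 + C'^2) * (1 + norm z)^2)" for t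
  using integral_push[of "%z. (norm z)^2" t] integral_mono[OF i integrable_mult_right[OF f0_wt_square] b] by simp
 then show "EX M. ALL t. (LINT z|push X t. (norm z)^2) <= M" by blast
qed

lemma xmom_push: "EX M>=0. ALL t. (nn_integral (push X t) (%z. ennreal ((norm (fst z))^2))) <= ennreal M"
proof -
 obtain M where M: "!!t. (LINT z|push X t. (norm z)^2) <= M" using second_moment_push(2) by blast
 have "0 <= (LINT z|push X 0. (norm z)^2)" by simp
 then have M0: "0 <= M" using M[of 0] by linarith
 have "(nn_integral (push X t) (%z. ennreal ((norm (fst z))^2))) <= ennreal M" for t
 proof -
  have "(nn_integral (push X t) (%z. ennreal ((norm (fst z))^2))) <= (nn_integral (push X t) (%z. ennreal ((norm z)^2)))"
   by (intro nn_integral_mono ennreal_leI power_mono norm_fst_le_norm) auto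
  also have "\<dots> = ennreal (LINT z|push X t. (norm z)^2)"
   by (rule nn_integral_eq_integral[OF second_moment_push(1)]) simp
  also have "\<dots> <= ennreal M" using M by (rule ennreal_leI)
  finally show ?thesis .
 qed
 then show ?thesis using M0 by blast
qed

lemma push_narrow:
 fixes h :: "'a \<times> 'a => real"
 assumes h: "continuous_on UNIV h" "bounded (range h)"
 shows "continuous_on UNIV (%t. LINT z|push X t. h z)"
proof -
 obtain B where B: "!!z. \<bar>h z\<bar> <= B" using h(2) by (auto simp: bounded_iff)
 have B0: "0 <= B" using B[of undefined] abs_ge_zero order_trans by blast
 have "continuous_on UNIV (%t. LINT z|f0. h (X t z, vel 0 X t z))"
 proof (rule continuous_integral_param[where I=UNIV and f="%_. f0" and ta="%_. 0" and C="LINT z|f0. (norm z)^2" and C'=B])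
  have "continuous_on UNIV (%q. h ((%(t, z). X t z) q, (%(t, z). vel 0 X t z) q))"
   by (rule continuous_on_compose2[OF h(1)]) (intro continuous_on_Pair lagrangian_facts(1)[OF X] vel_joint(1), simp)
  then show "continuous_on (UNIV \<times> UNIV) (%(t, z). h (X t z, vel 0 X t z))" by (simp add: case_prod_unfold)
  show "\<bar>h (X t z, vel 0 X t z)\<bar> <= B * (1 + norm z)" for t z
   using B[of "(X t z, vel 0 X t z)"] mult_left_mono[of 1 "1 + norm z" B] B0 by simp
 qed (use f0 sets_f0 f0_square in auto)
 then show ?thesis using integral_push[OF borel_measurable_continuous_onI[OF h(1)]] by simp
qed

lemma rate_push: "(nn_integral (push X t \<Otimes>\<^sub>M push X t) (%p. rate al p)) =
 (nn_integral ff0 (%p. ennreal ((norm (vel 0 X t (fst p) - vel 0 X t (snd p)))^2) * phi al (norm (X t (fst p) - X t (snd p)))))"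
 unfolding push_pair by (subst nn_integral_distr[OF push_pair_measurable]) (simp_all add: rate_def)

lemma push_deriv:
 assumes ep: "0 < ep" and t: "t : {0..T}"
 shows "((%t. label 0 z - convK al ep f0 (X t) (X t z)) has_vector_derivative - acc ep X (vel 0 X) t z) (at t within {0..T})"
proof -
 obtain C where C: "!!t z. norm (X t z) <= C * (1 + norm z)" using lagrangian_facts(4)[OF X] by blast
 obtain C' where C': "!!t z. norm (vel 0 X t z) <= C' * (1 + norm z)" using vel_joint(2) by blast
 have "((%t. convK al ep f0 (X t) (X t z)) has_vector_derivative acc ep X (vel 0 X) t z) (at t within {0..T})"
  by (rule convK_flow_deriv[OF lagrangian_facts(1)[OF X] C vel_joint(1) C' lagrangian_vel_deriv[OF X] ep t])
 from has_vector_derivative_diff[OF has_vector_derivative_const this] show ?thesis by simp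
qed

context
 assumes en: "(nn_integral f0 (%z. ennreal ((norm (vel 0 X T z))^2))) +
  (nn_integral lborel (%t. (nn_integral ff0 (%p. ennreal ((norm (vel 0 X t (fst p) - vel 0 X t (snd p)))^2) * phi al (norm (X t (fst p) - X t (snd p)))))
    * indicator {0..T} t))
  <= (nn_integral f0 (%z. ennreal ((norm (snd z))^2)))"
  and om: "omega_energy al f0 < \<infinity>"
begin

lemma phase_curve_push: "EX Mx M2. phase_curve al T (push X) Mx M2 (omega_energy al f0)"
proof -
 obtain Mx where Mx: "0 <= Mx" "!!t. (nn_integral (push X t) (%z. ennreal ((norm (fst z))^2))) <= ennreal Mx" using xmom_push by blast
 obtain M2 where M2: "!!t. (LINT z|push X t. (norm z)^2) <= M2" using second_moment_push(2) by blast
 have "(nn_integral f0 (%z. ennreal ((norm (snd z))^2))) <= (nn_integral f0 (%z. ennreal ((norm z)^2)))"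
  by (intro nn_integral_mono ennreal_leI power_mono norm_snd_le_norm) auto
 also have "\<dots> < \<infinity>" using f0_square by (simp add: nn_integral_eq_integral)
 finally have fin: "(nn_integral f0 (%z. ennreal ((norm (snd z))^2))) < \<infinity>" .
 have d: "(nn_integral lborel (%t. (nn_integral (push X t \<Otimes>\<^sub>M push X t) (%p. rate al p)) * indicator {0..T} t)) < \<infinity>"
  unfolding rate_push using en fin by (meson add_increasing le_less_trans zero_le order_refl)
 then have "phase_curve al T (push X) Mx M2 (omega_energy al f0)"
  by (intro phase_curve.intro dissipative_curve.intro phase_curve_axioms.intro) (assumption | rule al T prob_push sets_push push_narrow Mx second_moment_push(1) M2 om d | simp add: omega_energy_push)+
 then show ?thesis by blast
qed

text \<open>Along the limit flow, the velocity computed with the regularized kernel is differentiable in time, its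
derivative being the regularized alignment force. The weak formulation is the fundamental theorem of
calculus for the test function along this curve, integrated over labels and symmetrized, in the limit.\<close>

lemma weak_formulation_push: "weak_formulation al T f0 (push X)"
 unfolding weak_formulation_def
proof (intro allI impI)
 fix ps pst psx psv assume test: "test_function T ps pst psx (psv :: real \<times> ('a \<times> 'a) => 'a)"
 interpret tf: test_fun T ps pst psx psv by unfold_locales (use test T in auto)
 obtain Mx M2 where "phase_curve al T (push X) Mx M2 (omega_energy al f0)" using phase_curve_push by blast
 then interpret pc: phase_curve al T "push X" Mx M2 "omega_energy al f0" .
 obtain T' B where T': "0 <= T'" "T' < T" and B0: "0 <= B"
  and vanish: "!!t z. T' < t ==> t < T ==> ps (t, z) = 0 \<and> pst (t, z) = 0 \<and> psx (t, z) = 0 \<and> psv (t, z) = 0"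
  and B: "!!p. p : tf.D ==> \<bar>ps p\<bar> <= B \<and> \<bar>pst p\<bar> <= B \<and> norm (psx p) <= B \<and> norm (psv p) <= B"
  using tf.bounded_support by blast
 obtain L where L: "!!t. t : {0..<T} ==> L-lipschitz_on UNIV (%z. psv (t, z))" using tf.lips by blast
 have L0: "0 <= L" using L[of 0] T by (auto dest: lipschitz_on_nonneg)
 obtain C where C: "!!t z. norm (X t z) <= C * (1 + norm z)" using lagrangian_facts(4)[OF X] by blast
 obtain C' where C': "!!t z. norm (vel 0 X t z) <= C' * (1 + norm z)" using vel_joint(2) by blast
 define V where "V = vel 0 X"
 note ctx = lagrangian_facts(1)[OF X] C vel_joint(1)[folded V_def] C'[folded V_def]
 define Ve where "Ve n t z = label 0 z - convK al (eps n) f0 (X t) (X t z)" for n t z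
 define c where "c n t z = (t, (X t z, Ve n t z))" for n t z
 have cD: "c n t z : tf.D" if "t : {0..<T}" for n t z using that by (simp add: c_def tf.D_def)
 have Vec: "continuous_on UNIV (%(t, z). Ve n t z)" for n
 proof -
  have "continuous_on UNIV (%p. convK al (eps n) f0 (X (fst p)) ((%(t, z). X t z) p))"
   by (rule continuous_convK[OF lagrangian_facts(1)[OF X] C]) (intro continuous_intros lagrangian_facts(1)[OF X])+
  moreover have "continuous_on UNIV (%p :: real \<times> 'a \<times> 'a. label 0 (snd p))"
   by (rule continuous_on_compose2[OF continuous_label]) (auto intro!: continuous_intros)
  ultimately show ?thesis unfolding Ve_def case_prod_unfold by (intro continuous_on_diff)
 qed
 have cc: "continuous_on UNIV (%(t, z). c n t z)" for n
  unfolding c_def case_prod_unfold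
  using lagrangian_facts(1)[OF X] Vec[of n] by (intro continuous_intros) (simp_all add: case_prod_unfold)
 have cm: "(%q. (%(t, z). c n t z) q) : borel_measurable (borel \<Otimes>\<^sub>M f0)" for n
 proof -
  have "(%q. c n (fst q) (snd q)) : borel_measurable (borel \<Otimes>\<^sub>M f0)"
   by (rule measurable_joint[OF cc]) (auto intro: pair_proj_measurable)
  then show ?thesis by (simp add: case_prod_unfold)
 qed
 have Velim: "(%n. Ve n t z) ----> V t z" for t z
 proof -
  have "(%n. Ve n t z - V t z) ----> 0"
  proof (rule Lim_null_comparison[OF always_eventually kap_tendsto], rule allI)
   fix n
   have "norm (Ve n t z - V t z) = norm (convK al (eps n) f0 (X t) (X t z) - convK al 0 f0 (X t) (X t z))"
    by (simp add: Ve_def V_def vel_def norm_minus_commute)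
   also have "\<dots> <= cH al * \<bar>eps n - 0\<bar> powr (1 - al)" by (intro convK_eps al f0 lagrangian_facts[OF X])
   also have "\<dots> <= kap n" by (rule eps_diff_kap) simp
   finally show "norm (Ve n t z - V t z) <= kap n" .
  qed
  then show ?thesis by (simp add: LIM_zero_iff)
 qed
 have clim: "(%n. h (c n t z)) ----> h (t, (X t z, V t z))" if "continuous_on tf.D h" "t : {0..<T}" for h :: "real \<times> 'a \<times> 'a => 'c::topological_space" and t z
  by (rule continuous_on_tendsto_compose[OF that(1)])
   (use that(2) in \<open>auto simp: c_def tf.D_def intro!: tendsto_intros Velim\<close>)
 \<comment> \<open>a function on phase space that along the flow takes the value of psv at the regularized velocity\<close>
 define A where "A n t z = tf.cut psv (t, (fst z, snd z + (pc.u 0 t (fst z) - pc.u (eps n) t (fst z))))" for n t z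
 define A0 where "A0 t z = tf.cut psv (t, z)" for t z
 have Aflow: "A n t (X t z, V t z) = psv (c n t z)" if "t : {0..<T}" for n t z
  by (simp add: tf.cut_eq[OF that] A_def c_def Ve_def V_def vel_def pc.u_def convK_push)
 \<comment> \<open>the weak formulation before the passage to the limit\<close>
 have eq: "- (LINT z|f0. ps (c n 0 z)) = (LINT t:{0..<T}|lborel. (LINT z|f0. tf.cut pst (c n t z) + V t z \<bullet> tf.cut psx (c n t z)))
  - 1 / 2 * (LINT t:{0..<T}|lborel. (LINT p|(push X t \<Otimes>\<^sub>M push X t). (A n t (fst p) - A n t (snd p)) \<bullet> DK al (eps n) (dx p) (dv p)))"
  (is "_ = ?I1 - 1 / 2 * ?I2") and i1: "set_integrable lborel {0..<T} (%t. LINT z|f0. tf.cut pst (c n t z) + V t z \<bullet> tf.cut psx (c n t z))" for n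
 proof -
  note ctxe = ctx lagrangian_vel_deriv[OF X, folded V_def] eps_pos[of n]
  obtain Ca where Ca: "!!t z. norm (acc (eps n) X V t z) <= Ca * (1 + norm z)" using acc_bound[OF ctxe] by blast
  have am: "acc (eps n) X V t : borel_measurable f0" for t by (rule acc_measurable1[OF ctxe])
  have C'0: "0 <= C'" by (rule CV_nonneg[OF ctxe])
  define a1 where "a1 t z = tf.cut pst (c n t z) + V t z \<bullet> tf.cut psx (c n t z)" for t z
  define a2 where "a2 t z = tf.cut psv (c n t z) \<bullet> acc (eps n) X V t z" for t z
  have cut_b: "\<bar>tf.cut pst p\<bar> <= B" "norm (tf.cut psx p) <= B" "norm (tf.cut psv p) <= B" for p
   using B[of p] B0 by (auto simp: tf.cut_def indicator_def)
  have Vm: "(%q. V (fst q) (snd q)) : borel_measurable (borel \<Otimes>\<^sub>M f0)"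
   by (rule measurable_joint[OF vel_joint(1)[folded V_def]]) (auto intro: pair_proj_measurable)
  have accm: "(%q. acc (eps n) X V (fst q) (snd q)) : borel_measurable (borel \<Otimes>\<^sub>M f0)"
   by (rule acc_measurable[OF ctxe]) (auto intro: pair_proj_measurable)
  have cutm: "(%q. tf.cut pst (c n (fst q) (snd q))) : borel_measurable (borel \<Otimes>\<^sub>M f0)"
   "(%q. tf.cut psx (c n (fst q) (snd q))) : borel_measurable (borel \<Otimes>\<^sub>M f0)"
   "(%q. tf.cut psv (c n (fst q) (snd q))) : borel_measurable (borel \<Otimes>\<^sub>M f0)"
   using measurable_compose[OF cm[of n] tf.cut_measurable[OF tf.cont(1)]] measurable_compose[OF cm[of n] tf.cut_measurable[OF tf.cont(2)]]
    measurable_compose[OF cm[of n] tf.cut_measurable[OF tf.cont(3)]] by (simp_all add: case_prod_unfold)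
  have a1m: "(%(t, z). a1 t z) : borel_measurable (borel \<Otimes>\<^sub>M f0)"
   unfolding a1_def case_prod_unfold using Vm cutm by measurable
  have a2m: "(%(t, z). a2 t z) : borel_measurable (borel \<Otimes>\<^sub>M f0)"
   unfolding a2_def case_prod_unfold using accm cutm by measurable
  have a1b: "norm (a1 t z) <= (B + C' * B) * (1 + norm z)" for t z
  proof -
   have "\<bar>V t z \<bullet> tf.cut psx (c n t z)\<bar> <= (C' * (1 + norm z)) * B"
    using C'0 by (intro order_trans[OF Cauchy_Schwarz_ineq2] mult_mono C'[folded V_def] cut_b) auto
   moreover have "\<bar>tf.cut pst (c n t z)\<bar> <= B * (1 + norm z)"
    using cut_b(1)[of "c n t z"] mult_left_mono[of 1 "1 + norm z" B] B0 by simp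
   ultimately have "\<bar>a1 t z\<bar> <= B * (1 + norm z) + (C' * (1 + norm z)) * B" unfolding a1_def by linarith
   then show ?thesis by (simp add: algebra_simps)
  qed
  have a2b: "norm (a2 t z) <= (B * Ca) * (1 + norm z)" for t z
  proof -
   have "\<bar>a2 t z\<bar> <= B * (Ca * (1 + norm z))"
    unfolding a2_def using B0 by (intro order_trans[OF Cauchy_Schwarz_ineq2] mult_mono Ca cut_b) auto
   then show ?thesis by (simp add: mult.assoc)
  qed
  have sec: "b t : borel_measurable f0" if "(%(t, z). b t z) : borel_measurable (borel \<Otimes>\<^sub>M f0)" for b :: "real => 'a \<times> 'a => real" and t
   using measurable_compose[OF measurable_Pair1' that, of t] by simp
  have ia1: "integrable f0 (a1 t)" and ia2: "integrable f0 (a2 t)" for t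
   by (rule integrable_linear[OF sec[OF a1m] a1b] integrable_linear[OF sec[OF a2m] a2b])+
  have setint: "set_integrable lborel S (%t. LINT z|f0. b t z)"
   if b: "(%(t, z). b t z) : borel_measurable (borel \<Otimes>\<^sub>M f0)" "!!t z. norm (b t z) <= Cb * (1 + norm z)"
    and S: "S : sets borel" "S \<subseteq> {0..T}" for b :: "real => 'a \<times> 'a => real" and Cb S
  proof -
   have bd: "\<bar>LINT z|f0. b t z\<bar> <= (LINT z|f0. Cb * (1 + norm z))" for t
    by (rule order_trans[OF integral_abs_bound integral_mono[OF integrable_abs[OF integrable_linear[OF sec[OF b(1)] b(2)]] integrable_mult_right[OF f0_wt]]]) (use b(2) in simp)
   have m: "(%t. LINT z|f0. b t z) : borel_measurable borel"
    by (rule sigma_finite_measure.borel_measurable_lebesgue_integral[OF prob_space_imp_sigma_finite[OF f0] b(1)])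
   have "emeasure lborel S < \<infinity>"
    using emeasure_mono[OF S(2), of lborel] T by (auto simp: le_less_trans)
   then show ?thesis
    unfolding set_integrable_def using m S bd
    by (intro integrableI_bounded_set_indicator[where B="LINT z|f0. Cb * (1 + norm z)"]) (auto simp: borel_measurable_lebesgue_integral)
  qed
  have si1: "set_integrable lborel S (%t. LINT z|f0. a1 t z)" and si2: "set_integrable lborel S (%t. LINT z|f0. a2 t z)"
   if "S : sets borel" "S \<subseteq> {0..T}" for S
   by (rule setint[OF a1m a1b that] setint[OF a2m a2b that])+
  have subT: "{0..<T} \<subseteq> {0..T}" by auto
  show "set_integrable lborel {0..<T} (%t. LINT z|f0. tf.cut pst (c n t z) + V t z \<bullet> tf.cut psx (c n t z))"
   using si1[OF _ subT] by (simp add: a1_def)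
  define T1 where "T1 = (T' + T) / 2"
  have T1: "T' < T1" "T1 < T" "0 <= T1" using T' by (auto simp: T1_def)
  have sub: "{0..T1} \<subseteq> {0..T}" using T1 by auto
  have tT: "t : {0..T}" "t : {0..<T}" if "t : {0..T1}" for t using that T1 by auto
  define h where "h t = (LINT z|f0. ps (c n t z))" for t
  have psim: "(%z. ps (c n t z)) : borel_measurable f0" if t: "t : {0..<T}" for t
  proof -
   have "(%q. tf.cut ps ((%(t, z). c n t z) q)) : borel_measurable (borel \<Otimes>\<^sub>M f0)"
    by (rule measurable_compose[OF cm tf.cut_measurable[OF tf.cont_psi]])
   then have "(%(t, z). tf.cut ps (c n t z)) : borel_measurable (borel \<Otimes>\<^sub>M f0)" by (simp add: case_prod_unfold)
   from sec[OF this, of t] show ?thesis using t by (simp add: c_def tf.cut_eq)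
  qed
  have der: "(h has_vector_derivative (LINT z|f0. a1 t z - a2 t z)) (at t within {0..T1})" if t: "t : {0..T1}" for t
   unfolding h_def
  proof (rule has_vector_derivative_integral_param[OF t])
   show "integrable f0 (%z. ps (c n s z))" if s: "s : {0..T1}" for s
    by (rule integrable_const_bound[of _ B]) (use B[OF cD] psim tT[OF s] in auto)
   show "integrable f0 (%z. (B + C' * B) * (1 + norm z) + (B * Ca) * (1 + norm z))"
    by (intro Bochner_Integration.integrable_add integrable_mult_right f0_wt)
   show "(%z. a1 t z - a2 t z) : borel_measurable f0" using ia1[of t] ia2[of t] by simp
   fix z s assume s: "s : {0..T1}"
   show "norm (a1 s z - a2 s z) <= (B + C' * B) * (1 + norm z) + (B * Ca) * (1 + norm z)"
    by (rule order_trans[OF norm_triangle_ineq4 add_mono[OF a1b a2b]])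
   have "((%t. X t z) has_derivative (%h. h *\<^sub>R V s z)) (at s within {0..T1})"
    using has_vector_derivative_within_subset[OF lagrangian_vel_deriv[OF X tT(1)[OF s]] sub] by (simp add: has_vector_derivative_def V_def)
   moreover have "((%t. Ve n t z) has_derivative (%h. h *\<^sub>R (- acc (eps n) X V s z))) (at s within {0..T1})"
    using has_vector_derivative_within_subset[OF push_deriv[OF eps_pos tT(1)[OF s]] sub] by (simp add: has_vector_derivative_def V_def Ve_def[abs_def])
   ultimately have dc: "((%t. c n t z) has_derivative (%h. (h, (h *\<^sub>R V s z, h *\<^sub>R (- acc (eps n) X V s z))))) (at s within {0..T1})"
    unfolding c_def by (intro has_derivative_Pair has_derivative_ident)
   have "(ps has_derivative (%(ta, (xi, et)). pst (c n s z) * ta + psx (c n s z) \<bullet> xi + psv (c n s z) \<bullet> et)) (at (c n s z) within (%t. c n t z) ` {0..T1})"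
    by (rule has_derivative_subset[OF tf.deriv[OF cD[OF tT(2)[OF s]]]]) (intro image_subsetI cD tT)
   from has_derivative_in_compose[OF dc this]
   have "((%t. ps (c n t z)) has_derivative (%h. pst (c n s z) * h + psx (c n s z) \<bullet> (h *\<^sub>R V s z) + psv (c n s z) \<bullet> (h *\<^sub>R (- acc (eps n) X V s z)))) (at s within {0..T1})"
    by simp
   then show "((%t. ps (c n t z)) has_vector_derivative a1 s z - a2 s z) (at s within {0..T1})"
    unfolding has_vector_derivative_def
    by (rule has_derivative_eq_rhs) (auto simp: tf.cut_eq[OF tT(2)[OF s]] a1_def a2_def c_def inner_commute algebra_simps)
  qed
  have "h T1 = 0" using vanish[of T1] T1 by (simp add: h_def c_def)
  moreover have "(LINT t:{0..T1}|lborel. (LINT z|f0. a1 t z - a2 t z)) = h T1 - h 0"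
  proof (rule FTC_lborel[OF T1(3) der])
   have "set_integrable lborel {0..T1} (%t. (LINT z|f0. a1 t z) - (LINT z|f0. a2 t z))"
    by (intro set_integral_diff(1) si1 si2 sub) auto
   then show "set_integrable lborel {0..T1} (%t. LINT z|f0. a1 t z - a2 t z)" using ia1 ia2 by simp
  qed
  moreover have "(LINT t:{0..T1}|lborel. (LINT z|f0. a1 t z - a2 t z)) = (LINT t:{0..<T}|lborel. (LINT z|f0. a1 t z - a2 t z))"
   unfolding set_lebesgue_integral_def
  proof (rule Bochner_Integration.integral_cong[OF refl])
   fix t
   have "a1 t z - a2 t z = 0" if "T1 < t" "t < T" for z
    using vanish[of t] that T1 T' by (simp add: tf.cut_eq a1_def a2_def c_def)
   then show "indicator {0..T1} t *\<^sub>R (LINT z|f0. a1 t z - a2 t z) = indicator {0..<T} t *\<^sub>R (LINT z|f0. a1 t z - a2 t z)"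
    by (cases "T1 < t \<and> t < T") (use T1 in \<open>auto simp: indicator_def\<close>)
  qed
  ultimately have "- h 0 = (LINT t:{0..<T}|lborel. (LINT z|f0. a1 t z) - (LINT z|f0. a2 t z))"
   using ia1 ia2 by simp
  also have "\<dots> = (LINT t:{0..<T}|lborel. (LINT z|f0. a1 t z)) - (LINT t:{0..<T}|lborel. (LINT z|f0. a2 t z))"
   by (rule set_integral_diff(2)[OF si1[OF _ subT] si2[OF _ subT]]) auto
  also have "(LINT t:{0..<T}|lborel. (LINT z|f0. a2 t z)) = (LINT t:{0..<T}|lborel. 1 / 2 * (LINT p|(push X t \<Otimes>\<^sub>M push X t). (A n t (fst p) - A n t (snd p)) \<bullet> DK al (eps n) (dx p) (dv p)))"
  proof (rule set_lebesgue_integral_cong)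
   show "ALL t. t : {0..<T} --> (LINT z|f0. a2 t z) = 1 / 2 * (LINT p|(push X t \<Otimes>\<^sub>M push X t). (A n t (fst p) - A n t (snd p)) \<bullet> DK al (eps n) (dx p) (dv p))"
   proof (intro allI impI)
    fix t assume t: "t : {0..<T}"
    define G where "G z = tf.cut psv (c n t z)" for z
    have Gm: "G : borel_measurable f0"
    using measurable_compose[OF measurable_Pair1' cutm(3), of t] by (simp add: G_def[abs_def])
    have Gb: "norm (G z) <= B * (1 + norm z)" for z
    using cut_b(3)[of "c n t z"] mult_left_mono[of 1 "1 + norm z" B] B0 by (simp add: G_def)
    have "(LINT z|f0. a2 t z) = (LINT p|ff0. (G (fst p) - G (snd p)) \<bullet>
    DK al (eps n) (X t (fst p) - X t (snd p)) (V t (fst p) - V t (snd p)) / 2)"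
    using acc_symmetrized(1)[OF ctx _ eps_pos Gm Gb] lagrangian_vel_deriv[OF X, folded V_def] unfolding a2_def G_def by blast
    also have "\<dots> = (LINT p|(push X t \<Otimes>\<^sub>M push X t). (A n t (fst p) - A n t (snd p)) \<bullet> DK al (eps n) (dx p) (dv p) / 2)"
    proof -
    have "(%z. A n t z) : borel_measurable borel"
    proof -
    have "continuous_on UNIV (%z. (t, (fst z, snd z + (pc.u 0 t (fst z) - pc.u (eps n) t (fst z)))))"
    proof -
    have "continuous_on UNIV (%z :: 'a \<times> 'a. (%(t, x). pc.u e t x) (t, fst z))" for e
    by (rule continuous_on_compose2[OF pc.continuous_u]) (auto intro!: continuous_intros)
    then show ?thesis by (intro continuous_intros) simp_all
    qed
    from measurable_compose[OF borel_measurable_continuous_onI[OF this] tf.cut_measurable[OF tf.cont(3)]]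
    show ?thesis by (simp add: A_def)
    qed
    then have "(%p. (A n t (fst p) - A n t (snd p)) \<bullet> DK al (eps n) (dx p) (dv p) / 2) : borel_measurable (borel \<Otimes>\<^sub>M borel)"
    by (intro borel_measurable_divide borel_measurable_const borel_measurable_inner borel_measurable_diff measurable_DK
    measurable_compose[OF measurable_fst] measurable_compose[OF measurable_snd]; (assumption | simp add: borel_prod; intro borel_measurable_continuous_onI continuous_intros)?)
    from integral_distr[OF push_pair_measurable this, of t] show ?thesis
    unfolding push_pair using Aflow[OF t] by (simp add: tf.cut_eq[OF t] G_def V_def c_def)
    qed
    finally show "(LINT z|f0. a2 t z) = 1 / 2 * (LINT p|(push X t \<Otimes>\<^sub>M push X t). (A n t (fst p) - A n t (snd p)) \<bullet> DK al (eps n) (dx p) (dv p))"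
    by simp
   qed
  qed simp
  finally show "- (LINT z|f0. ps (c n 0 z)) = ?I1 - 1 / 2 * ?I2"
   by (simp add: h_def a1_def)
 qed
 have lim0: "(%n. - (LINT z|f0. ps (c n 0 z))) ----> - (LINT z|f0. ps (0, z))"
 proof (intro tendsto_minus integral_dominated_convergence[where w="%_. B"])
  have t0: "0 : {0..<T}" using T by simp
  have V0: "V 0 = snd" unfolding V_def vel_def label_def fun_eq_iff lagrangian_facts(3)[OF X] by simp
  show "AE z in f0. (%n. ps (c n 0 z)) ----> ps (0, z)"
   using clim[OF tf.cont_psi t0] V0 lagrangian_facts(3)[OF X] by (intro AE_I2) simp
  show "AE z in f0. norm (ps (c n 0 z)) <= B" for n using B[OF cD[OF t0]] by (intro AE_I2) simp
  show "(%z. ps (c n 0 z)) : borel_measurable f0" for n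
  proof -
   have "(%(t, z). tf.cut ps (c n t z)) : borel_measurable (borel \<Otimes>\<^sub>M f0)"
    using measurable_compose[OF cm[of n] tf.cut_measurable[OF tf.cont_psi]] by (simp add: case_prod_unfold)
   from measurable_compose[OF measurable_Pair1' this, of 0] show ?thesis using t0 by (simp add: c_def tf.cut_eq)
  qed
  have "(%z. tf.cut ps (0, z)) : borel_measurable borel"
   by (rule measurable_compose[OF _ tf.cut_measurable[OF tf.cont_psi]]) (intro borel_measurable_continuous_onI continuous_intros)
  then show "(%z. ps (0, z)) : borel_measurable f0" using t0 by (simp add: tf.cut_eq measurable_cong_sets[OF sets_f0 refl])
 qed simp
 have lim1: "(%n. LINT t:{0..<T}|lborel. (LINT z|f0. tf.cut pst (c n t z) + V t z \<bullet> tf.cut psx (c n t z)))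
  ----> (LINT t:{0..<T}|lborel. (LINT z|f0. tf.cut pst (t, (X t z, V t z)) + V t z \<bullet> tf.cut psx (t, (X t z, V t z))))"
 proof (rule kernel_dominated_convergence(1)[where N=f0 and good="%_. True" and H="%t z. ennreal ((B + \<bar>C'\<bar> * B) * (1 + norm z))"])
  show "(%_. f0) : borel \<rightarrow>\<^sub>M subprob_algebra f0"
   by (rule measurable_const) (simp add: space_subprob_algebra prob_space_imp_subprob_space f0)
  have Vm: "(%q. V (fst q) (snd q)) : borel_measurable (borel \<Otimes>\<^sub>M f0)" "(%q. X (fst q) (snd q)) : borel_measurable (borel \<Otimes>\<^sub>M f0)"
   by (rule measurable_joint[OF vel_joint(1)[folded V_def]] measurable_joint[OF lagrangian_facts(1)[OF X]]; auto intro: pair_proj_measurable)+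
  have c0m: "(%q. (fst q, (X (fst q) (snd q), V (fst q) (snd q)))) : borel_measurable (borel \<Otimes>\<^sub>M f0)"
   by (intro borel_measurable_Pair Vm) simp
  show "(%(t, z). tf.cut pst (c n t z) + V t z \<bullet> tf.cut psx (c n t z)) : borel_measurable (borel \<Otimes>\<^sub>M f0)" for n
   using measurable_compose[OF cm[of n] tf.cut_measurable[OF tf.cont(1)]] measurable_compose[OF cm[of n] tf.cut_measurable[OF tf.cont(2)]] Vm
   unfolding case_prod_unfold by measurable
  show "(%(t, z). tf.cut pst (t, (X t z, V t z)) + V t z \<bullet> tf.cut psx (t, (X t z, V t z))) : borel_measurable (borel \<Otimes>\<^sub>M f0)"
   using measurable_compose[OF c0m tf.cut_measurable[OF tf.cont(1)]] measurable_compose[OF c0m tf.cut_measurable[OF tf.cont(2)]] Vm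
   unfolding case_prod_unfold by measurable
  show "(%(t :: real, z :: 'a \<times> 'a). ennreal ((B + \<bar>C'\<bar> * B) * (1 + norm z))) : borel_measurable (borel \<Otimes>\<^sub>M f0)"
   unfolding case_prod_unfold using pair_proj_measurable(2)[of borel] by measurable
  have "(nn_integral f0 (%z. ennreal ((B + \<bar>C'\<bar> * B) * (1 + norm z)))) = ennreal (LINT z|f0. (B + \<bar>C'\<bar> * B) * (1 + norm z))"
   using f0_wt B0 by (intro nn_integral_eq_integral integrable_mult_right) (auto intro!: mult_nonneg_nonneg add_nonneg_nonneg)
  then show "(nn_integral lborel (%t. (nn_integral f0 (%z. ennreal ((B + \<bar>C'\<bar> * B) * (1 + norm z)))) * indicator {0..<T} t)) < \<infinity>"
   using T by (simp add: nn_integral_cmult_indicator ennreal_mult_less_top)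
  fix n t z assume t: "t : {0..<T}"
  have cut_b: "\<bar>tf.cut pst p\<bar> <= B" "norm (tf.cut psx p) <= B" for p
   using B[of p] B0 by (auto simp: tf.cut_def indicator_def)
  have V': "norm (V t z) <= \<bar>C'\<bar> * (1 + norm z)"
   by (rule order_trans[OF C'[folded V_def] mult_right_mono]) auto
  have "\<bar>V t z \<bullet> tf.cut psx (c n t z)\<bar> <= (\<bar>C'\<bar> * (1 + norm z)) * B"
   by (intro order_trans[OF Cauchy_Schwarz_ineq2] mult_mono V' cut_b) auto
  moreover have "\<bar>tf.cut pst (c n t z)\<bar> <= B * (1 + norm z)"
   using cut_b(1)[of "c n t z"] mult_left_mono[of 1 "1 + norm z" B] B0 by simp
  ultimately have "\<bar>tf.cut pst (c n t z) + V t z \<bullet> tf.cut psx (c n t z)\<bar> <= B * (1 + norm z) + (\<bar>C'\<bar> * (1 + norm z)) * B" by linarith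
  also have "\<dots> = (B + \<bar>C'\<bar> * B) * (1 + norm z)" by (simp add: algebra_simps)
  finally show "ennreal \<bar>tf.cut pst (c n t z) + V t z \<bullet> tf.cut psx (c n t z)\<bar> <= ennreal ((B + \<bar>C'\<bar> * B) * (1 + norm z))" by (rule ennreal_leI)
 next
  fix t z assume t: "t : {0..<T}"
  have "(%n. pst (c n t z) + V t z \<bullet> psx (c n t z)) ----> pst (t, (X t z, V t z)) + V t z \<bullet> psx (t, (X t z, V t z))"
   by (intro tendsto_intros clim tf.cont t)
  then show "(%n. tf.cut pst (c n t z) + V t z \<bullet> tf.cut psx (c n t z)) ----> tf.cut pst (t, (X t z, V t z)) + V t z \<bullet> tf.cut psx (t, (X t z, V t z))"
   by (simp add: tf.cut_eq[OF t] c_def)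
 qed auto
 have ucont: "continuous_on UNIV (%q :: real \<times> 'a \<times> 'a. pc.u e (fst q) (fst (snd q)))" for e
 proof -
  have "continuous_on UNIV (%q :: real \<times> 'a \<times> 'a. (%(t, x). pc.u e t x) (fst q, fst (snd q)))"
   by (rule continuous_on_compose2[OF pc.continuous_u]) (auto intro!: continuous_intros)
  then show ?thesis by simp
 qed
 have lim2: "(%n. LINT t:{0..<T}|lborel. (LINT p|(push X t \<Otimes>\<^sub>M push X t). (A n t (fst p) - A n t (snd p)) \<bullet> DK al (eps n) (dx p) (dv p)))
  ----> (LINT t:{0..<T}|lborel. (LINT p|(push X t \<Otimes>\<^sub>M push X t). (A0 t (fst p) - A0 t (snd p)) \<bullet> D2W al (dx p) (dv p)))"
 proof (rule pc.alignment_limit(1)[where L="L * (1 + 2 * cH al)"])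
  show "(%(t, z). A n t z) : borel_measurable borel" for n
  proof -
   have "continuous_on UNIV (%q :: real \<times> 'a \<times> 'a. (fst q, (fst (snd q), snd (snd q) + (pc.u 0 (fst q) (fst (snd q)) - pc.u (eps n) (fst q) (fst (snd q))))))"
    by (intro continuous_intros ucont)
   from measurable_compose[OF borel_measurable_continuous_onI[OF this] tf.cut_measurable[OF tf.cont(3)]]
   show ?thesis by (simp add: A_def case_prod_unfold)
  qed
  show "(%(t, z). A0 t z) : borel_measurable borel"
   using tf.cut_measurable[OF tf.cont(3)] by (simp add: A0_def case_prod_unfold)
  show "0 <= L * (1 + 2 * cH al)" using L0 cH_pos[OF al] by simp
  show "eps ----> 0" by (rule eps_tendsto)
  fix t assume t: "t : {0..<T}"
  show "(%n. A n t z) ----> A0 t z" for z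
  proof -
   have "(%n. pc.u 0 t (fst z) - pc.u (eps n) t (fst z)) ----> 0"
   proof (rule Lim_null_comparison[OF always_eventually kap_tendsto], rule allI)
    fix n
    show "norm (pc.u 0 t (fst z) - pc.u (eps n) t (fst z)) <= kap n"
    using pc.u_eps[of 0 t "fst z" "eps n"] eps_diff_kap(2)[of n n] by (simp add: abs_minus_commute)
   qed
   then have "(%n. snd z + (pc.u 0 t (fst z) - pc.u (eps n) t (fst z))) ----> snd z + 0" by (intro tendsto_intros)
   then have l: "(%n. (t, (fst z, snd z + (pc.u 0 t (fst z) - pc.u (eps n) t (fst z))))) ----> (t, z)"
    using tendsto_Pair[OF tendsto_const[of t] tendsto_Pair[OF tendsto_const[of "fst z"]]] by fastforce
   have "(%n. psv (t, (fst z, snd z + (pc.u 0 t (fst z) - pc.u (eps n) t (fst z))))) ----> psv (t, z)"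
    by (rule continuous_on_tendsto_compose[OF tf.cont(3) l]) (use t in \<open>auto simp: tf.D_def\<close>)
   then show ?thesis by (simp add: tf.cut_eq[OF t] A_def A0_def)
  qed
  fix n and p :: "('a \<times> 'a) \<times> ('a \<times> 'a)"
  define x where "x = fst (fst p)" define x' where "x' = fst (snd p)"
  define v where "v = snd (fst p)" define v' where "v' = snd (snd p)"
  define s where "s y = pc.u 0 t y - pc.u (eps n) t y" for y
  have "norm (A n t (fst p) - A n t (snd p)) = dist (psv (t, (x, v + s x))) (psv (t, (x', v' + s x')))"
   by (simp add: tf.cut_eq[OF t] A_def dist_norm x_def x'_def v_def v'_def s_def)
  also have "\<dots> <= L * dist (x, v + s x) (x', v' + s x')"
   using lipschitz_onD[OF L[OF t]] by blast
  also have "dist (x, v + s x) (x', v' + s x') <= (1 + 2 * cH al) * (norm (x - x') + norm (v - v') + norm (x - x') powr (1 - al))"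
  proof -
   have "dist (x, v + s x) (x', v' + s x') <= norm (x - x') + norm ((v - v') + ((pc.u 0 t x - pc.u 0 t x') - (pc.u (eps n) t x - pc.u (eps n) t x')))"
    unfolding dist_norm s_def by (rule order_trans[OF _ norm_Pair_le]) (simp add: algebra_simps)
   also have "\<dots> <= norm (x - x') + (norm (v - v') + (cH al * norm (x - x') powr (1 - al) + cH al * norm (x - x') powr (1 - al)))"
    by (intro add_left_mono norm_triangle_le add_mono order_refl order_trans[OF norm_triangle_ineq4] pc.u_holder)
   also have "\<dots> <= (1 + 2 * cH al) * (norm (x - x') + norm (v - v') + norm (x - x') powr (1 - al))"
    using cH_pos[OF al] by (simp add: algebra_simps)
   finally show ?thesis .
  qed
  finally show "norm (A n t (fst p) - A n t (snd p)) <= L * (1 + 2 * cH al) * (norm (dx p) + norm (dv p) + norm (dx p) powr (1 - al))"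
   using L0 by (simp add: x_def x'_def v_def v'_def mult_left_mono mult.assoc)
 qed
 have "(%n. - (LINT z|f0. ps (c n 0 z))) ----> (LINT t:{0..<T}|lborel. (LINT z|f0. tf.cut pst (t, (X t z, V t z)) + V t z \<bullet> tf.cut psx (t, (X t z, V t z))))
  - 1 / 2 * (LINT t:{0..<T}|lborel. (LINT p|(push X t \<Otimes>\<^sub>M push X t). (A0 t (fst p) - A0 t (snd p)) \<bullet> D2W al (dx p) (dv p)))"
  unfolding eq by (intro tendsto_intros lim1 lim2)
 from LIMSEQ_unique[OF lim0 this]
 have fin: "- (LINT z|f0. ps (0, z)) = (LINT t:{0..<T}|lborel. (LINT z|f0. tf.cut pst (t, (X t z, V t z)) + V t z \<bullet> tf.cut psx (t, (X t z, V t z))))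
  + 1 / 2 * (LINT t:{0..<T}|lborel. - (LINT p|(push X t \<Otimes>\<^sub>M push X t). (A0 t (fst p) - A0 t (snd p)) \<bullet> D2W al (dx p) (dv p)))"
  by (simp add: set_lebesgue_integral_def)
 have "(LINT t:{0..<T}|lborel. (LINT z|f0. tf.cut pst (t, (X t z, V t z)) + V t z \<bullet> tf.cut psx (t, (X t z, V t z))))
   = (LINT t:{0..<T}|lborel. LINT (x, v)|push X t. pst (t, (x, v)) + v \<bullet> psx (t, (x, v)))"
 proof (rule set_lebesgue_integral_cong)
  show "ALL t. t : {0..<T} --> (LINT z|f0. tf.cut pst (t, (X t z, V t z)) + V t z \<bullet> tf.cut psx (t, (X t z, V t z))) = (LINT (x, v)|push X t. pst (t, (x, v)) + v \<bullet> psx (t, (x, v)))"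
  proof (intro allI impI)
   fix t assume t: "t : {0..<T}"
   have m: "(%z. tf.cut h (t, z)) : borel_measurable borel" if "continuous_on tf.D h" for h :: "real \<times> 'a \<times> 'a => 'c::real_normed_vector"
    by (rule measurable_compose[OF _ tf.cut_measurable[OF that]]) (intro borel_measurable_continuous_onI continuous_intros)
   have "(%z. tf.cut pst (t, z) + snd z \<bullet> tf.cut psx (t, z)) : borel_measurable borel"
    by (intro borel_measurable_add borel_measurable_inner m tf.cont) (intro borel_measurable_continuous_onI continuous_intros)
   from integral_push[OF this, of t]
   show "(LINT z|f0. tf.cut pst (t, (X t z, V t z)) + V t z \<bullet> tf.cut psx (t, (X t z, V t z))) = (LINT (x, v)|push X t. pst (t, (x, v)) + v \<bullet> psx (t, (x, v)))"
    by (simp add: tf.cut_eq[OF t] V_def case_prod_unfold)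
  qed
 qed simp
 moreover have "(LINT t:{0..<T}|lborel. - (LINT p|(push X t \<Otimes>\<^sub>M push X t). (A0 t (fst p) - A0 t (snd p)) \<bullet> D2W al (dx p) (dv p)))
  = (LINT t:{0..<T}|lborel. LINT p:- Diag|push X t \<Otimes>\<^sub>M push X t.
    (case p of ((x, v), (x', v')) => (psv (t, (x, v)) - psv (t, (x', v'))) \<bullet> D2W al (x - x') (v' - v)))"
 proof (rule set_lebesgue_integral_cong)
  show "ALL t. t : {0..<T} --> - (LINT p|(push X t \<Otimes>\<^sub>M push X t). (A0 t (fst p) - A0 t (snd p)) \<bullet> D2W al (dx p) (dv p)) =
   (LINT p:- Diag|push X t \<Otimes>\<^sub>M push X t. (case p of ((x, v), (x', v')) => (psv (t, (x, v)) - psv (t, (x', v'))) \<bullet> D2W al (x - x') (v' - v)))"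
   unfolding alignment_Diag[where a="%z. psv (_, z)"] by (simp add: tf.cut_eq A0_def)
 qed simp
 ultimately show "- (LINT z|f0. ps (0, z)) =
    (LINT t:{0..<T}|lborel. LINT (x, v)|push X t. pst (t, (x, v)) + v \<bullet> psx (t, (x, v)))
    + 1 / 2 * (LINT t:{0..<T}|lborel. LINT p:- Diag|push X t \<Otimes>\<^sub>M push X t.
    (case p of ((x, v), (x', v')) => (psv (t, (x, v)) - psv (t, (x', v'))) \<bullet> D2W al (x - x') (v' - v)))"
  using fin by simp
qed

lemma weak_solution_push: "weak_solution al T f0 (push X)"
 unfolding weak_solution_def
proof (intro conjI ballI)
 show "push X t : prob_measures" for t by (simp add: prob_measures_def prob_push)
 show "narrowly_continuous_on {0..T} (push X)"
  unfolding narrowly_continuous_on_def using push_narrow by (blast intro: continuous_on_subset)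
 show "weak_formulation al T f0 (push X)" by (rule weak_formulation_push)
 show "energy_inequality al T f0 (push X)"
  unfolding energy_inequality_def rate_Diag rate_push
 proof -
  have "(%z :: 'a \<times> 'a. ennreal ((norm (snd z))^2)) : borel_measurable borel"
   by (intro measurable_compose[OF borel_measurable_continuous_onI measurable_ennreal] continuous_intros)
  from nn_integral_push[OF this, of T] en
  show "(\<integral>\<^sup>+ (x, v). ennreal ((norm v)^2) \<partial>push X T) + (\<integral>\<^sup>+ s\<in>{0..T}.
   (nn_integral ff0 (%p. ennreal ((norm (vel 0 X s (fst p) - vel 0 X s (snd p)))^2) * phi al (norm (X s (fst p) - X s (snd p))))) \<partial>lborel)
   <= (\<integral>\<^sup>+ (x, v). ennreal ((norm v)^2) \<partial>f0)"
   by (simp add: case_prod_unfold)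
 qed
 obtain Mx where Mx: "!!t. (nn_integral (push X t) (%z. ennreal ((norm (fst z))^2))) <= ennreal Mx" using xmom_push by blast
 have "(SUP t\<in>{0..T}. \<integral>\<^sup>+ (x, v). ennreal ((norm x)^2) \<partial>push X t) <= ennreal Mx"
  using Mx by (intro SUP_least) (simp add: case_prod_unfold)
 then show "(SUP t\<in>{0..T}. \<integral>\<^sup>+ (x, v). ennreal ((norm x)^2) \<partial>push X t) < \<infinity>"
  by (rule le_less_trans) simp
qed

end
end

lemma lagrangian_weak_solution:
 assumes "omega_energy al f0 < \<infinity>"
 obtains X where "lagrangian al 0 f0 (label 0) T X" "weak_solution al T f0 (push X)"
  "!!t. omega_energy al (push X t) = omega_energy al f0"
proof -
 obtain Xn X where *: "!!n. lagrangian al (eps n) f0 (label (eps n)) T (Xn n)" "lagrangian al 0 f0 (label 0) T X"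
  "!!t z. (%n. Xn n t z) ----> X t z" "!!t z. (%n. vel (eps n) (Xn n) t z) ----> vel 0 X t z"
  by (rule lagrangian_limit) blast
 show ?thesis
  by (rule that[OF *(2) weak_solution_push[OF *(2) energy_limit[OF *] assms] omega_energy_push[OF *(2)]])
qed

end

section \<open>Weak solutions between two times\<close>

lemma continuous_on_slice:
 assumes "continuous_on UNIV k" shows "continuous_on UNIV (%z. k (t, z))"
 by (rule continuous_on_compose2[OF assms _ subset_UNIV]) (intro continuous_intros)

lemma ennreal_norm_integral_le:
 fixes f :: "'z => 'b::{banach,second_countable_topology}"
 shows "ennreal (norm (integral\<^sup>L M f)) <= (nn_integral M (%x. ennreal (norm (f x))))"
 by (cases "integrable M f") (auto intro: integral_norm_bound_ennreal simp: not_integrable_integral_eq)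

lemma kernel_integral_le:
 assumes "AE t in lborel. t : S --> (AE p in kp t. ennreal \<bar>F t p\<bar> <= H t p)" "S : sets borel"
 shows "ennreal \<bar>LINT t:S|lborel. (LINT p|kp t. F t p)\<bar> <= (nn_integral lborel (%t. (nn_integral (kp t) (%p. H t p)) * indicator S t))"
proof -
 have "ennreal \<bar>LINT t:S|lborel. (LINT p|kp t. F t p)\<bar> <= (nn_integral lborel (%t. ennreal (norm (indicator S t *\<^sub>R (LINT p|kp t. F t p)))))"
  unfolding set_lebesgue_integral_def real_norm_def[symmetric] by (rule ennreal_norm_integral_le)
 also have "\<dots> <= (nn_integral lborel (%t. (nn_integral (kp t) (%p. H t p)) * indicator S t))"
 proof (rule nn_integral_mono_AE, use assms(1) in eventually_elim)
  fix t assume t: "t : S --> (AE p in kp t. ennreal \<bar>F t p\<bar> <= H t p)"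
  show "ennreal (norm (indicator S t *\<^sub>R (LINT p|kp t. F t p))) <= (nn_integral (kp t) (%p. H t p)) * indicator S t"
  proof (cases "t : S")
   case True
   then have "(nn_integral (kp t) (%p. ennreal \<bar>F t p\<bar>)) <= (nn_integral (kp t) (%p. H t p))" using t by (intro nn_integral_mono_AE) simp
   then show ?thesis using order_trans[OF ennreal_norm_integral_le[of "kp t" "F t"]] True by simp
  qed simp
 qed
 finally show ?thesis .
qed

definition ramp :: "real => real => real" where "ramp h r = sqpos (1 - sqpos (r / h))"

definition dramp :: "real => real => real" where
 "dramp h r = - (4 / h * (max 0 (1 - sqpos (r / h)) * max 0 (r / h)))"

lemma ramp_deriv: "(ramp h has_real_derivative dramp h r) (at r within S)"
proof -
 have a: "((%r. r / h) has_real_derivative 1 / h) (at r within S)" by (rule DERIV_cdivide[OF DERIV_ident])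
 have b: "((%r. 1 - sqpos (r / h)) has_real_derivative 0 - 2 * max 0 (r / h) * (1 / h)) (at r within S)"
  by (rule DERIV_diff[OF DERIV_const DERIV_chain2[OF sqpos_deriv a]])
 show ?thesis unfolding ramp_def[abs_def] dramp_def
  by (rule DERIV_cong[OF DERIV_chain2[OF sqpos_deriv b]]) (simp add: field_simps)
qed

lemma continuous_on_ramp [continuous_intros]:
 "continuous_on S f ==> continuous_on S (%x. ramp h (f x))" "continuous_on S f ==> continuous_on S (%x. dramp h (f x))"
 unfolding ramp_def dramp_def divide_inverse by (intro continuous_intros; assumption)+

context
 fixes h r :: real assumes h: "0 < h"
begin

lemma ramp_01: "0 <= ramp h r" "ramp h r <= 1"
 by (simp_all add: ramp_def sqpos_nonneg sqpos_le_1)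

lemma ramp_left: "r <= 0 ==> ramp h r = 1" "r <= 0 ==> dramp h r = 0"
 using h by (simp_all add: ramp_def dramp_def sqpos_0 sqpos_1 divide_nonpos_pos max_absorb1)

lemma ramp_right: assumes "h <= r" shows "ramp h r = 0" "dramp h r = 0"
proof -
 have "1 <= r / h" using assms h by simp
 then have "1 <= sqpos (r / h)" using power_mono[of 1 "r / h" 2] by (simp add: sqpos_def)
 then show "ramp h r = 0" "dramp h r = 0" by (simp_all add: ramp_def dramp_def sqpos_0 max_def)
qed

lemma dramp_bound: "\<bar>dramp h r\<bar> <= 4 / h"
proof (cases "h <= r")
 case False
 then have "max 0 (r / h) <= 1" using h by simp
 moreover have "max 0 (1 - sqpos (r / h)) <= 1" by (simp add: sqpos_nonneg)
 ultimately have "max 0 (1 - sqpos (r / h)) * max 0 (r / h) <= 1 * 1" by (intro mult_mono) auto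
 then have "4 / h * (max 0 (1 - sqpos (r / h)) * max 0 (r / h)) <= 4 / h * 1" using h by (intro mult_left_mono) auto
 moreover have "0 <= 4 / h * (max 0 (1 - sqpos (r / h)) * max 0 (r / h))" using h by simp
 ultimately show ?thesis unfolding dramp_def by simp
qed (use h ramp_right in simp)

end

text \<open>The derivative of a ramp descending before \<open>ta\<close> approximates a negative point mass at \<open>ta\<close>.\<close>

lemma ramp_limit:
 assumes P: "continuous_on UNIV P" and h: "!!n. 0 < h n" "h ----> 0"
 shows "(%n. integral {ta - h n..ta} (%t. dramp (h n) (t - ta + h n) * P t)) ----> - P ta"
proof (rule LIMSEQ_I)
 fix e :: real assume e: "0 < e"
 have "isCont P ta" using P by (simp add: continuous_on_eq_continuous_at)
 then obtain d where d: "0 < d" "!!t. \<bar>t - ta\<bar> < d ==> \<bar>P t - P ta\<bar> < e / 8"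
  using e unfolding continuous_at_eps_delta dist_real_def by (metis divide_pos_pos zero_less_numeral)
 obtain N where N: "!!n. N <= n ==> \<bar>h n\<bar> < d" using LIMSEQ_D[OF h(2) d(1)] by auto
 show "EX N. ALL n>=N. norm (integral {ta - h n..ta} (%t. dramp (h n) (t - ta + h n) * P t) - - P ta) < e"
 proof (intro exI[of _ N] allI impI)
  fix n assume n: "N <= n"
  define a where "a t = dramp (h n) (t - ta + h n)" for t
  have hn: "0 < h n" "ta - h n <= ta" using h(1)[of n] by auto
  have ac: "continuous_on S a" for S unfolding a_def by (intro continuous_intros)
  have "(a has_integral ramp (h n) (ta - ta + h n) - ramp (h n) (ta - h n - ta + h n)) {ta - h n..ta}"
  proof (rule fundamental_theorem_of_calculus[OF hn(2)])
   fix t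
   have "((%t. t - ta + h n) has_real_derivative 1) (at t within {ta - h n..ta})" by (auto intro!: derivative_eq_intros)
   from DERIV_chain2[OF ramp_deriv this]
   show "((%t. ramp (h n) (t - ta + h n)) has_vector_derivative a t) (at t within {ta - h n..ta})"
    by (simp add: has_real_derivative_iff_has_vector_derivative a_def)
  qed
  then have "(a has_integral - 1) {ta - h n..ta}" using hn by (simp add: ramp_left ramp_right)
  from has_integral_mult_left[OF this, of "P ta"]
  have i1: "((%t. a t * P ta) has_integral - P ta) {ta - h n..ta}" by simp
  have PS: "continuous_on S P" for S using P by (rule continuous_on_subset) simp
  have "((%t. a t * P t) has_integral integral {ta - h n..ta} (%t. a t * P t)) {ta - h n..ta}"
   by (intro integrable_integral integrable_continuous_real continuous_intros ac PS)
  from integral_unique[OF has_integral_diff[OF this i1]]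
  have "integral {ta - h n..ta} (%t. a t * P t) - - P ta = integral {ta - h n..ta} (%t. a t * P t - a t * P ta)" by simp
  moreover have "norm (integral {ta - h n..ta} (%t. a t * P t - a t * P ta)) <= (4 / h n * (e / 8)) * (ta - (ta - h n))"
  proof (rule integral_bound[OF hn(2)])
   show "continuous_on {ta - h n..ta} (%t. a t * P t - a t * P ta)" by (intro continuous_intros ac PS)
   fix t assume "t : {ta - h n..ta}"
   then have "\<bar>P t - P ta\<bar> < e / 8" using N[OF n] by (intro d(2)) auto
   then have "\<bar>a t\<bar> * \<bar>P t - P ta\<bar> <= 4 / h n * (e / 8)"
    unfolding a_def using hn by (intro mult_mono dramp_bound) auto
   then show "norm (a t * P t - a t * P ta) <= 4 / h n * (e / 8)" by (simp add: abs_mult[symmetric] algebra_simps)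
  qed
  ultimately show "norm (integral {ta - h n..ta} (%t. dramp (h n) (t - ta + h n) * P t) - - P ta) < e"
   using hn e by (simp add: a_def)
 qed
qed

locale weak_curve = dissipative_curve +
 fixes f0 :: "('a::euclidean_space \<times> 'a) measure"
 assumes clamped: "g (clamp_time 0 T t) = g t" and il: "initial_law al T f0"
  and wf: "weak_formulation al T f0 g"

sublocale weak_curve \<subseteq> il: initial_law al T f0 by (rule il)

context dissipative_curve
begin

lemma bounded_integrable:
 fixes F :: "'a \<times> 'a => 'c::{banach,second_countable_topology}"
 shows "F : borel_measurable borel ==> (!!z. norm (F z) <= B) ==> integrable (g t) F"
 by (rule finite_measure.integrable_const_bound[where B=B, OF prob_space.finite_measure[OF g_prob]]) (simp_all add: measurable_g)

lemma bounded_mean: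
 fixes F :: "'a \<times> 'a => real"
 assumes B: "!!z. \<bar>F z\<bar> <= B" and F: "F : borel_measurable borel"
 shows "\<bar>LINT z|g t. F z\<bar> <= B"
proof -
 interpret prob_space "g t" by (rule g_prob)
 have "\<bar>LINT z|g t. F z\<bar> <= (LINT z|g t. B)"
  by (rule order_trans[OF integral_abs_bound integral_mono]) (auto intro!: integrable_abs bounded_integrable[OF F, of B] B)
 then show ?thesis using prob_space by simp
qed

lemma continuous_mean_compact:
 fixes F :: "real => 'a \<times> 'a => real"
 assumes F: "continuous_on UNIV (%(t, z). F t z)" and r: "!!t z. r <= norm z ==> F t z = 0"
 shows "continuous_on UNIV (%t. LINT z|g t. F t z)"
 unfolding continuous_on_iff
proof (intro ballI allI impI)
 fix t0 e :: real assume e: "0 < e"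
 let ?K = "{t0 - 1..t0 + 1} \<times> cball (0 :: 'a \<times> 'a) r"
 have Fc: "continuous_on UNIV (F t)" for t
  using continuous_on_slice[OF F, of t] by simp
 have "compact ?K" by (intro compact_Times) auto
 then have "uniformly_continuous_on ?K (%(t, z). F t z)"
  by (intro compact_uniformly_continuous continuous_on_subset[OF F]) auto
 then obtain d where d: "0 < d" "!!p q. p : ?K ==> q : ?K ==> dist p q < d ==> dist ((%(t, z). F t z) p) ((%(t, z). F t z) q) < e / 4"
  using e unfolding uniformly_continuous_on_def by (metis divide_pos_pos zero_less_numeral dist_commute)
 obtain B where B: "!!t z. t : {t0 - 1..t0 + 1} ==> \<bar>F t z\<bar> <= B"
 proof -
  have "bounded ((%(t, z). F t z) ` ?K)" using \<open>compact ?K\<close> by (intro compact_imp_bounded compact_continuous_image continuous_on_subset[OF F]) auto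
  then obtain B where B: "!!p. p : ?K ==> norm ((%(t, z). F t z) p) <= B" unfolding bounded_iff by blast
  have "\<bar>F t z\<bar> <= \<bar>B\<bar>" if "t : {t0 - 1..t0 + 1}" for t z
   using B[of "(t, z)"] that r[of z t] by (cases "norm z <= r") auto
  then show thesis by (rule that)
 qed
 have b0: "bounded (range (F t0))" unfolding bounded_iff using B[of t0] by auto
 have "continuous_on UNIV (%t. LINT z|g t. F t0 z)" by (rule narrow[OF Fc b0])
 then obtain d' where d': "0 < d'" "!!t. dist t t0 < d' ==> dist (LINT z|g t. F t0 z) (LINT z|g t0. F t0 z) < e / 2"
  using e unfolding continuous_on_iff by (metis UNIV_I half_gt_zero)
 show "EX d>0. ALL t:UNIV. dist t t0 < d --> dist (LINT z|g t. F t z) (LINT z|g t0. F t0 z) < e"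
 proof (intro exI[of _ "min (min d d') 1"] conjI ballI impI)
  fix t assume t: "dist t t0 < min (min d d') 1"
  have tI: "t : {t0 - 1..t0 + 1}" "t0 : {t0 - 1..t0 + 1}" using t by (auto simp: dist_real_def)
  have cl: "\<bar>F t z - F t0 z\<bar> <= e / 4" for z
  proof (cases "norm z <= r")
   case True
   then show ?thesis using d(2)[of "(t, z)" "(t0, z)"] tI t by (simp add: dist_Pair_Pair dist_real_def)
  qed (use r e in auto)
  have i: "integrable (g t) (F s)" if "s : {t0 - 1..t0 + 1}" for s
   by (rule bounded_integrable[OF borel_measurable_continuous_onI[OF Fc]]) (use B[OF that] in simp)
  have "\<bar>LINT z|g t. F t z - F t0 z\<bar> <= e / 4"
   by (rule bounded_mean[OF cl]) (intro borel_measurable_diff borel_measurable_continuous_onI Fc)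
  then have "\<bar>(LINT z|g t. F t z) - (LINT z|g t. F t0 z)\<bar> <= e / 4" using i[OF tI(1)] i[OF tI(2)] by simp
  moreover have "\<bar>(LINT z|g t. F t0 z) - (LINT z|g t0. F t0 z)\<bar> < e / 2" using d'(2)[of t] t by (simp add: dist_real_def)
  ultimately show "dist (LINT z|g t. F t z) (LINT z|g t0. F t0 z) < e" using e unfolding dist_real_def by linarith
 qed (use d d' in auto)
qed

text \<open>For test functions that are Lipschitz in phase space the cross term has the exponent \<open>1 - al\<close> in the
position difference, which is covered by dissipation and moments for every \<open>al\<close>.\<close>

lemma lipschitz_alignment_bound:
 fixes w :: 'a
 assumes p: "good p" and w: "norm w <= La * norm (dx p) + Lb * norm (dv p)" and L: "0 <= La" "0 <= Lb"
 shows "ennreal \<bar>w \<bullet> D2W al (dx p) (dv p)\<bar> <= majorant (cD al * (La + Lb)) p"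
proof (cases "dv p = 0")
 case True
 then show ?thesis using linear_0[OF linear_D2W[of al "dx p"]] by simp
next
 case False
 then have y: "dx p ~= 0" using p by (simp add: good_def)
 define a b where "a = norm (dx p)" and "b = norm (dv p)"
 have a: "0 < a" "0 <= b" using y by (auto simp: a_def b_def)
 have "\<bar>w \<bullet> D2W al (dx p) (dv p)\<bar> <= (La * a + Lb * b) * (cD al * a powr (- al) * b)"
  unfolding a_def b_def by (intro order_trans[OF Cauchy_Schwarz_ineq2] mult_mono w D2W_bound al) (use L in auto)
 also have "\<dots> = cD al * (La * (b * a powr (1 - al)) + Lb * (b^2 * a powr (- al)))"
  using powr_add[of a 1 "- al"] a by (simp add: algebra_simps power2_eq_square)
 also have "\<dots> <= cD al * (La * (b^2 * a powr (- al) + (1 + a^2)) + Lb * (b^2 * a powr (- al) + (1 + a^2)))"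
  using young_powr[OF y, of al "1 - al" "dv p"] al L cD_pos[OF al]
  by (intro mult_left_mono add_mono) (auto simp: a_def b_def)
 also have "\<dots> = cD al * (La + Lb) * (b^2 * a powr (- al) + (1 + a^2))" by (simp add: algebra_simps)
 finally have "ennreal \<bar>w \<bullet> D2W al (dx p) (dv p)\<bar> <= ennreal (cD al * (La + Lb) * (b^2 * a powr (- al) + (1 + a^2)))" by (rule ennreal_leI)
 also have "\<dots> = majorant (cD al * (La + Lb)) p"
  unfolding majorant_def rate_eq[OF y] a_def[symmetric] b_def[symmetric]
  by (subst ennreal_mult', use L cD_pos[OF al] in simp, subst ennreal_plus) auto
 finally show ?thesis .
qed

end

context weak_curve
begin

text \<open>Testing with \<open>Ph\<close> cut off by a ramp in time gives the balance of \<open>Ph\<close> between times 0 and \<open>ta\<close>.\<close>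

lemma balance:
 fixes Ph Pht :: "real \<times> ('a \<times> 'a) => real" and Phx Phv :: "real \<times> ('a \<times> 'a) => 'a"
 assumes ta: "0 < ta" "ta < T"
  and der: "!!p. p : {0..<T} \<times> UNIV ==>
    (Ph has_derivative (%(s, (xi, et)). Pht p * s + Phx p \<bullet> xi + Phv p \<bullet> et)) (at p within {0..<T} \<times> UNIV)"
  and cont: "continuous_on UNIV Ph" "continuous_on UNIV Pht" "continuous_on UNIV Phx" "continuous_on UNIV Phv"
  and supp: "!!t z. r <= norm z ==> Ph (t, z) = 0 \<and> Pht (t, z) = 0 \<and> Phx (t, z) = 0"
  and lip: "!!t z z'. norm (Phv (t, z) - Phv (t, z')) <= L * norm (z - z')" and L: "0 <= L"
 shows "(LINT z|g ta. Ph (ta, z)) - (LINT z|f0. Ph (0, z)) =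
  (LINT t:{0..<ta}|lborel. (LINT z|g t. Pht (t, z) + snd z \<bullet> Phx (t, z)))
  - 1 / 2 * (LINT t:{0..<ta}|lborel. (LINT p|(gg t). (Phv (t, fst p) - Phv (t, snd p)) \<bullet> D2W al (dx p) (dv p)))"
proof -
 \<comment> \<open>widths of the ramps; they start after time 0, where the cutoff must be 1\<close>
 define h where "h n = ta / real (Suc n)" for n
 have h: "0 < h n" "h n <= ta" for n using ta by (auto simp: h_def field_simps)
 have h0: "h ----> 0" unfolding h_def by (rule LIMSEQ_Suc[OF lim_const_over_n])
 define e de where "e n t = ramp (h n) (t - ta + h n)" and "de n t = dramp (h n) (t - ta + h n)" for n t
 have ec [continuous_intros]: "continuous_on S f ==> continuous_on S (%x. e n (f x))" "continuous_on S f ==> continuous_on S (%x. de n (f x))"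
  for S and f :: "'q::topological_space => real" and n
  unfolding e_def de_def by (intro continuous_intros; assumption)+
 have e01: "0 <= e n t" "e n t <= 1" for n t using ramp_01[OF h(1)] by (auto simp: e_def)
 have e0: "e n 0 = 1" for n using h[of n] by (simp add: e_def ramp_left)
 have e_right: "e n t = 0" "de n t = 0" if "ta <= t" for n t using h[of n] that by (simp_all add: e_def de_def ramp_right)
 have de_left: "de n t = 0" if "t <= ta - h n" for n t using h[of n] that by (simp add: de_def ramp_left)
 have elim: "(%n. e n t) ----> indicator {..<ta} t" for t
 proof (cases "t < ta")
  case True
  then have "\<forall>\<^sub>F n in sequentially. h n < ta - t" using h0 by (intro order_tendstoD) auto
  then have "\<forall>\<^sub>F n in sequentially. e n t = 1" by eventually_elim (use h in \<open>simp add: e_def ramp_left\<close>)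
  then show ?thesis using True by (simp add: tendsto_eventually)
 qed (simp add: e_right)
 define Q where "Q t z = Pht (t, z) + snd z \<bullet> Phx (t, z)" for t z
 note secm = borel_measurable_continuous_onI[OF continuous_on_slice]
 have Qc: "continuous_on UNIV (%(t, z). Q t z)"
  unfolding Q_def case_prod_unfold using cont by (auto intro!: continuous_intros)
 have Q0: "Q t z = 0" if "r <= norm z" for t z using supp[OF that, of t] by (simp add: Q_def)
 have bd: "EX B>=0. ALL t:{0..<T}. ALL z. \<bar>k (t, z)\<bar> <= B"
  if kc: "continuous_on UNIV k" and k0: "!!t z. r <= norm z ==> k (t, z) = 0" for k :: "real \<times> ('a \<times> 'a) => real"
 proof -
  have "bounded (k ` ({0..T} \<times> cball 0 r))"
   by (intro compact_imp_bounded compact_continuous_image continuous_on_subset[OF kc] compact_Times) auto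
  then obtain B where B: "!!p. p : {0..T} \<times> cball 0 r ==> norm (k p) <= B" unfolding bounded_iff by blast
  have "\<bar>k (t, z)\<bar> <= \<bar>B\<bar>" if "t : {0..<T}" for t z
   using B[of "(t, z)"] that k0[of z t] by (cases "norm z <= r") auto
  then show ?thesis by (intro exI[of _ "\<bar>B\<bar>"]) auto
 qed
 obtain B where B: "0 <= B" "!!t z. t : {0..<T} ==> \<bar>Q t z\<bar> <= B" using bd[OF Qc] Q0 by fastforce
 obtain B' where B': "!!t z. t : {0..<T} ==> \<bar>Ph (t, z)\<bar> <= B'" using bd[OF cont(1)] supp by blast
 define P where "P t = (LINT z|g t. Ph (t, z))" for t
 have P: "continuous_on UNIV P"
  unfolding P_def by (rule continuous_mean_compact) (use cont supp in auto)
 have eq: "- (LINT z|f0. Ph (0, z)) = (LINT t:{0..<T}|lborel. de n t * P t) + (LINT t:{0..<T}|lborel. (LINT z|g t. e n t * Q t z))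
   + 1 / 2 * (LINT t:{0..<T}|lborel. - (LINT p|(gg t). e n t * ((Phv (t, fst p) - Phv (t, snd p)) \<bullet> D2W al (dx p) (dv p))))"
  (is "_ = ?I1 + ?I2 + _") if iQ: "set_integrable lborel {0..<T} (%t. LINT z|g t. e n t * Q t z)" for n
 proof -
  have "test_function T (%p. e n (fst p) * Ph p) (%p. de n (fst p) * Ph p + e n (fst p) * Pht p) (%p. e n (fst p) *\<^sub>R Phx p) (%p. e n (fst p) *\<^sub>R Phv p)"
   unfolding test_function_def Let_def
  proof (intro conjI ballI)
   fix p :: "real \<times> ('a \<times> 'a)" assume p: "p : {0..<T} \<times> UNIV"
   have "((%p :: real \<times> ('a \<times> 'a). fst p - ta + h n) has_derivative fst) (at p within {0..<T} \<times> UNIV)"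
    by (auto intro!: derivative_eq_intros)
   from has_derivative_compose[OF this ramp_deriv[unfolded has_field_derivative_def]]
   have "((%p :: real \<times> ('a \<times> 'a). e n (fst p)) has_derivative (%k. de n (fst p) * fst k)) (at p within {0..<T} \<times> UNIV)"
    by (simp add: e_def[abs_def] de_def)
   from has_derivative_mult[OF this der[OF p]]
   show "((%p. e n (fst p) * Ph p) has_derivative (%(s, (xi, et)). (de n (fst p) * Ph p + e n (fst p) * Pht p) * s + e n (fst p) *\<^sub>R Phx p \<bullet> xi + e n (fst p) *\<^sub>R Phv p \<bullet> et)) (at p within {0..<T} \<times> UNIV)"
    by (rule has_derivative_eq_rhs) (auto simp: fun_eq_iff algebra_simps)
  next
   show "continuous_on ({0..<T} \<times> UNIV) (%p. de n (fst p) * Ph p + e n (fst p) * Pht p)"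
    "continuous_on ({0..<T} \<times> UNIV) (%p. e n (fst p) *\<^sub>R Phx p)" "continuous_on ({0..<T} \<times> UNIV) (%p. e n (fst p) *\<^sub>R Phv p)"
    by (intro continuous_intros continuous_on_subset[OF cont(1)] continuous_on_subset[OF cont(2)] continuous_on_subset[OF cont(3)] continuous_on_subset[OF cont(4)] subset_UNIV)+
  next
   show "EX K. compact K \<and> K \<subseteq> {0..<T} \<times> UNIV \<and> (ALL p:{0..<T} \<times> UNIV - K. e n (fst p) * Ph p = 0)"
   proof (intro exI[of _ "{0..ta} \<times> cball 0 r"] conjI ballI)
    fix p :: "real \<times> ('a \<times> 'a)" assume "p : {0..<T} \<times> UNIV - {0..ta} \<times> cball 0 r"
    then have "ta <= fst p \<or> r <= norm (snd p)" by (cases p) auto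
    then show "e n (fst p) * Ph p = 0" using e_right(1)[of "fst p" n] supp[of "snd p" "fst p"] by (cases p) auto
   qed (use ta in \<open>auto intro: compact_Times\<close>)
   have "norm (e n t *\<^sub>R Phv (t, z) - e n t *\<^sub>R Phv (t, z')) <= L * norm (z - z')" for t z z'
    using mult_left_le_one_le[OF norm_ge_zero e01(1)[of n t] e01(2)[of n t], of "Phv (t, z) - Phv (t, z')"] e01(1)[of n t] lip[of t z z']
    by (simp add: scaleR_diff_right[symmetric] mult.commute)
   then show "EX L. ALL t:{0..<T}. L-lipschitz_on UNIV (%z. e n (fst (t, z)) *\<^sub>R Phv (t, z))"
    using L by (intro exI[of _ L] ballI lipschitz_onI) (auto simp: dist_norm)
  qed
  from wf[unfolded weak_formulation_def, rule_format, OF this]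
  have w: "- (LINT z|f0. Ph (0, z)) = (LINT t:{0..<T}|lborel. LINT (x, v)|g t. (de n t * Ph (t, (x, v)) + e n t * Pht (t, (x, v))) + v \<bullet> (e n t *\<^sub>R Phx (t, (x, v))))
   + 1 / 2 * (LINT t:{0..<T}|lborel. - (LINT p|(gg t). (e n t *\<^sub>R Phv (t, fst p) - e n t *\<^sub>R Phv (t, snd p)) \<bullet> D2W al (dx p) (dv p)))"
   unfolding fst_conv e0 mult_1 alignment_Diag[where a="%z. e n _ *\<^sub>R Phv (_, z)"] by simp
  have i1: "set_integrable lborel {0..<T} (%t. de n t * P t)"
   by (rule set_integrable_subset[of _ "{0..T}"]) (auto intro!: borel_integrable_atLeastAtMost' continuous_intros continuous_on_subset[OF P])
  have "(LINT t:{0..<T}|lborel. LINT (x, v)|g t. (de n t * Ph (t, (x, v)) + e n t * Pht (t, (x, v))) + v \<bullet> (e n t *\<^sub>R Phx (t, (x, v)))) = (LINT t:{0..<T}|lborel. de n t * P t + (LINT z|g t. e n t * Q t z))"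
  proof (rule set_lebesgue_integral_cong)
   show "ALL t. t : {0..<T} --> (LINT (x, v)|g t. (de n t * Ph (t, (x, v)) + e n t * Pht (t, (x, v))) + v \<bullet> (e n t *\<^sub>R Phx (t, (x, v)))) = de n t * P t + (LINT z|g t. e n t * Q t z)"
   proof (intro allI impI)
    fix t assume t: "t : {0..<T}"
    have 1: "integrable (g t) (%z. Ph (t, z))" by (rule bounded_integrable[OF secm[OF cont(1)]]) (use B'[OF t] in simp)
    have 2: "integrable (g t) (Q t)"
    by (rule bounded_integrable[of _ B]) (use B(2)[OF t] secm[OF Qc, of t] in simp_all)
    have "(LINT (x, v)|g t. (de n t * Ph (t, (x, v)) + e n t * Pht (t, (x, v))) + v \<bullet> (e n t *\<^sub>R Phx (t, (x, v)))) = (LINT z|g t. de n t * Ph (t, z) + e n t * Q t z)"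
    by (rule Bochner_Integration.integral_cong) (auto simp: Q_def algebra_simps)
    then show "(LINT (x, v)|g t. (de n t * Ph (t, (x, v)) + e n t * Pht (t, (x, v))) + v \<bullet> (e n t *\<^sub>R Phx (t, (x, v)))) = de n t * P t + (LINT z|g t. e n t * Q t z)"
    using 1 2 by (simp add: P_def)
   qed
  qed simp
  also have "\<dots> = ?I1 + ?I2" by (rule set_integral_add(2)[OF i1 iQ])
  finally show ?thesis
   unfolding w by (simp add: scaleR_diff_right[symmetric])
 qed
 have I1: "(LINT t:{0..<T}|lborel. de n t * P t) = integral {ta - h n..ta} (%t. dramp (h n) (t - ta + h n) * P t)" for n
 proof -
  have "(LINT t:{0..<T}|lborel. de n t * P t) = (LINT t:{ta - h n..ta}|lborel. de n t * P t)"
   unfolding set_lebesgue_integral_def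
  proof (rule Bochner_Integration.integral_cong[OF refl])
   fix t show "indicator {0..<T} t *\<^sub>R (de n t * P t) = indicator {ta - h n..ta} t *\<^sub>R (de n t * P t)"
    using e_right(2)[of t n] de_left[of t n] h[of n] ta by (cases "t <= ta - h n \<or> ta <= t") (auto simp: indicator_def)
  qed
  also have "\<dots> = integral {ta - h n..ta} (%t. de n t * P t)"
   by (intro set_borel_integral_eq_integral borel_integrable_atLeastAtMost' continuous_intros continuous_on_subset[OF P]) auto
  finally show ?thesis by (simp add: de_def)
 qed
 have pairm: "(%(t, p). (Phv (t, fst p) - Phv (t, snd p)) \<bullet> D2W al (dx p) (dv p)) : borel_measurable (borel \<Otimes>\<^sub>M (borel \<Otimes>\<^sub>M borel))"
 proof -
  have "(%q :: real \<times> ('a \<times> 'a) \<times> ('a \<times> 'a). (Phv (fst q, fst (snd q)) - Phv (fst q, snd (snd q))) \<bullet> DK al 0 (dx (snd q)) (dv (snd q))) : borel_measurable borel"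
   by (intro borel_measurable_inner borel_measurable_diff measurable_DK borel_measurable_continuous_onI continuous_on_compose2[OF cont(4)] continuous_intros subset_UNIV)
  then show ?thesis by (simp add: DK_0 borel_prod case_prod_unfold)
 qed
 have em: "(%(t, p). e n t * F t p) : borel_measurable (borel \<Otimes>\<^sub>M N)" "(%(t, p). indicator {..<ta} t * F t p) : borel_measurable (borel \<Otimes>\<^sub>M N)"
  if "(%(t, p). F t p) : borel_measurable (borel \<Otimes>\<^sub>M N)" for F :: "real => 'p => real" and N :: "'p measure" and n
 proof -
  have [measurable]: "e n : borel_measurable borel" by (intro borel_measurable_continuous_onI continuous_intros)
  note that[unfolded case_prod_unfold, measurable]
  show "(%(t, p). e n t * F t p) : borel_measurable (borel \<Otimes>\<^sub>M N)" "(%(t, p). indicator {..<ta} t * F t p) : borel_measurable (borel \<Otimes>\<^sub>M N)"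
   unfolding case_prod_unfold by measurable
 qed
 have ele: "ennreal \<bar>e n t * c\<bar> <= ennreal \<bar>c\<bar>" for n t c
  using e01[of n t] by (intro ennreal_leI) (simp add: abs_mult mult_left_le_one_le)
 have QB: "(%(t, z). Q t z) : borel_measurable (borel \<Otimes>\<^sub>M borel)" using borel_measurable_continuous_onI[OF Qc] by (simp add: borel_prod)
 have "(nn_integral lborel (%t. (nn_integral (g t) (%p. ennreal B)) * indicator {0..<T} t)) < \<infinity>"
  using T prob_space.emeasure_space_1[OF g_prob] by (simp add: nn_integral_cmult_indicator ennreal_mult_less_top)
 note q = kernel_dominated_convergence[OF kernel_g _ em[OF QB] _ this, of "%_. True"]
 have bq: "ennreal \<bar>e n t * Q t z\<bar> <= ennreal B" if "t : {0..<T}" for n t z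
  by (rule order_trans[OF ele ennreal_leI[OF B(2)[OF that]]])
 have q1: "(%n. LINT t:{0..<T}|lborel. (LINT z|g t. e n t * Q t z)) ----> (LINT t:{0..<T}|lborel. (LINT z|g t. indicator {..<ta} t * Q t z))"
  by (rule q(1); (rule bq tendsto_mult[OF elim tendsto_const], assumption?)?; simp)
 have q2: "set_integrable lborel {0..<T} (%t. LINT z|g t. e n t * Q t z)" for n
  by (rule q(2); (rule bq tendsto_mult[OF elim tendsto_const], assumption?)?; simp)
 note a = kernel_dominated_convergence[OF kernel_gg _ em[OF pairm] _ majorant_finite[of "cD al * (L + L)"] good_AE]
 have Lz: "norm (Phv (t, fst p) - Phv (t, snd p)) <= L * norm (dx p) + L * norm (dv p)" for t and p :: "('a \<times> 'a) \<times> ('a \<times> 'a)"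
  using order_trans[OF lip mult_left_mono[OF norm_Pair_le[of "dx p" "dv p", folded minus_prod_def] L], of t]
  by (simp add: distrib_left)
 have ba: "ennreal \<bar>e n t * ((Phv (t, fst p) - Phv (t, snd p)) \<bullet> D2W al (dx p) (dv p))\<bar> <= majorant (cD al * (L + L)) p" if "good p" for n t p
  by (rule order_trans[OF ele lipschitz_alignment_bound[OF that Lz L L]])
 have a1: "(%n. LINT t:{0..<T}|lborel. (LINT p|(gg t). e n t * ((Phv (t, fst p) - Phv (t, snd p)) \<bullet> D2W al (dx p) (dv p))))
  ----> (LINT t:{0..<T}|lborel. (LINT p|(gg t). indicator {..<ta} t * ((Phv (t, fst p) - Phv (t, snd p)) \<bullet> D2W al (dx p) (dv p))))"
  by (rule a(1); (rule ba tendsto_mult[OF elim tendsto_const], assumption?)?; (simp add: case_prod_unfold; fail)?)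
 have "- (LINT z|f0. Ph (0, z)) = - P ta + (LINT t:{0..<T}|lborel. (LINT z|g t. indicator {..<ta} t * Q t z))
  + 1 / 2 * (- (LINT t:{0..<T}|lborel. (LINT p|(gg t). indicator {..<ta} t * ((Phv (t, fst p) - Phv (t, snd p)) \<bullet> D2W al (dx p) (dv p)))))"
  (is "_ = ?R")
 proof (rule LIMSEQ_unique[OF tendsto_const])
  have en: "- (LINT z|f0. Ph (0, z)) = (LINT t:{0..<T}|lborel. de n t * P t) + (LINT t:{0..<T}|lborel. (LINT z|g t. e n t * Q t z))
   + 1 / 2 * (- (LINT t:{0..<T}|lborel. (LINT p|(gg t). e n t * ((Phv (t, fst p) - Phv (t, snd p)) \<bullet> D2W al (dx p) (dv p)))))" for n
   using eq[OF q2, of n] by (simp add: set_lebesgue_integral_def)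
  show "(%n :: nat. - (LINT z|f0. Ph (0, z))) ----> ?R"
   using tendsto_add[OF tendsto_add[OF ramp_limit[OF P h(1) h0] q1] tendsto_mult[OF tendsto_const tendsto_minus[OF a1]], of ta "1 / 2"]
   unfolding I1[symmetric] en[symmetric] .
 qed
 moreover have ind: "(LINT t:{0..<T}|lborel. (LINT p|kp t. indicator {..<ta} t * F t p)) = (LINT t:{0..<ta}|lborel. (LINT p|kp t. F t p))"
  for F :: "real => 'p => real" and kp
  unfolding set_lebesgue_integral_def by (rule Bochner_Integration.integral_cong) (use ta in \<open>auto simp: indicator_def\<close>)
 ultimately show ?thesis by (simp only: ind P_def Q_def)
qed

definition total :: real where
 "total = enn2real (nn_integral lborel (%t. (nn_integral (gg t) (%p. majorant 1 p)) * indicator {0..<T} t))"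

lemma alignment_total:
 fixes b :: "real => 'a \<times> 'a => 'a"
 assumes b: "!!t p. norm (b t (fst p) - b t (snd p)) <= La * norm (dx p) + Lb * norm (dv p)" and L: "0 <= La" "0 <= Lb" and ta: "ta <= T"
 shows "\<bar>LINT t:{0..<ta}|lborel. (LINT p|(gg t). (b t (fst p) - b t (snd p)) \<bullet> D2W al (dx p) (dv p))\<bar> <= cD al * (La + Lb) * total"
proof -
 let ?C = "cD al * (La + Lb)"
 have C: "0 <= ?C" using L cD_pos[OF al] by simp
 have "AE t in lborel. t : {0..<ta} --> (AE p in gg t. ennreal \<bar>(b t (fst p) - b t (snd p)) \<bullet> D2W al (dx p) (dv p)\<bar> <= majorant ?C p)"
  using good_AE
 proof eventually_elim
  case (elim t)
  show ?case
  proof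
   assume "t : {0..<ta}"
   then have "AE p in gg t. good p" using elim ta by simp
   then show "AE p in gg t. ennreal \<bar>(b t (fst p) - b t (snd p)) \<bullet> D2W al (dx p) (dv p)\<bar> <= majorant ?C p"
    by eventually_elim (rule lipschitz_alignment_bound[OF _ b L])
  qed
 qed
 note kernel_integral_le[OF this]
 also have "(nn_integral lborel (%t. (nn_integral (gg t) (%p. majorant ?C p)) * indicator {0..<ta} t))
  <= (nn_integral lborel (%t. ennreal ?C * ((nn_integral (gg t) (%p. majorant 1 p)) * indicator {0..<T} t)))"
 proof (rule nn_integral_mono)
  fix t
  have "(nn_integral (gg t) (%p. majorant ?C p)) = ennreal ?C * (nn_integral (gg t) (%p. majorant 1 p))"
   unfolding majorant_def[of ?C] by (subst nn_integral_cmult[symmetric]) (simp_all add: majorant_def measurable_gg)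
  then show "(nn_integral (gg t) (%p. majorant ?C p)) * indicator {0..<ta} t <= ennreal ?C * ((nn_integral (gg t) (%p. majorant 1 p)) * indicator {0..<T} t)"
   using ta by (auto simp: indicator_def)
 qed
 also have "\<dots> = ennreal ?C * (nn_integral lborel (%t. (nn_integral (gg t) (%p. majorant 1 p)) * indicator {0..<T} t))"
 proof (rule nn_integral_cmult)
  have "(%t. nn_integral (gg t) (%p. majorant 1 p)) : borel_measurable borel"
   by (rule measurable_compose[OF kernel_gg nn_integral_measurable_subprob_algebra]) simp
  then show "(%t. (nn_integral (gg t) (%p. majorant 1 p)) * indicator {0..<T} t) : borel_measurable lborel" by simp
 qed
 also have "\<dots> = ennreal (?C * total)"
  unfolding total_def ennreal_mult'[OF C] using majorant_finite[of 1] by (simp add: ennreal_enn2real)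
 finally show ?thesis using C by (simp add: total_def)
qed

text \<open>The constants show that the interaction is negligible for a cutoff at large velocities \<open>M\<close>, even if the
position factor grows linearly up to the scale \<open>M\<close>.\<close>

lemma product_balance:
 fixes a :: "'a => real" and da :: "'a => 'a"
 assumes ta: "0 < ta" "ta < T" and M: "0 < M" and der: "!!x. (a has_derivative (%h. da x \<bullet> h)) (at x)" and dac: "continuous_on UNIV da"
  and Ca: "!!x. \<bar>a x\<bar> <= Ca" and La: "!!x x'. \<bar>a x - a x'\<bar> <= La * norm (x - x')" and r: "!!x. r <= norm x ==> a x = 0 \<and> da x = 0"
 shows "\<bar>(LINT z|g ta. a (fst z) * bump M (snd z)) - (LINT z|f0. a (fst z) * bump M (snd z))
   - (LINT t:{0..<ta}|lborel. (LINT z|g t. snd z \<bullet> da (fst z) * bump M (snd z)))\<bar> <= cD al * (4 * La / M + 12 * Ca / M^2) * total"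
proof -
 have Ca0: "0 <= Ca" using Ca[of 0] by linarith
 obtain b :: 'a where "b : Basis" using nonempty_Basis by blast
 then have La0: "0 <= La" using La[of b 0] by simp
 let ?d = "%p. a (fst (snd p)) *\<^sub>R dbump M (snd (snd p)) :: 'a"
 have L: "norm (?d (t, z) - ?d (t, z')) <= 4 * La / M * norm (fst z - fst z') + 12 * Ca / M^2 * norm (snd z - snd z')" for t :: real and z z'
 proof -
  have "?d (t, z) - ?d (t, z') = (a (fst z) - a (fst z')) *\<^sub>R dbump M (snd z) + a (fst z') *\<^sub>R (dbump M (snd z) - dbump M (snd z'))"
   by (simp add: algebra_simps)
  also have "norm \<dots> <= (La * norm (fst z - fst z')) * (4 / M) + Ca * (12 / M^2 * norm (snd z - snd z'))"
    by (rule order_trans[OF norm_triangle_ineq], unfold norm_scaleR, intro add_mono mult_mono La Ca dbump_bound[OF M] dbump_lipschitz[OF M]) (simp_all add: La0 Ca0)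
  finally show ?thesis by (simp add: mult_ac)
 qed
 have aUc: "continuous_on UNIV a" by (rule has_derivative_continuous_on[OF der])
 note ac = continuous_on_compose2[OF aUc _ subset_UNIV] continuous_on_compose2[OF dac _ subset_UNIV]
 have "(LINT z|g ta. (%p. a (fst (snd p)) * bump M (snd (snd p))) (ta, z)) - (LINT z|f0. (%p. a (fst (snd p)) * bump M (snd (snd p))) (0 :: real, z)) =
  (LINT t:{0..<ta}|lborel. (LINT z|g t. (%_. 0) (t, z) + snd z \<bullet> (%p. bump M (snd (snd p)) *\<^sub>R da (fst (snd p))) (t, z)))
  - 1 / 2 * (LINT t:{0..<ta}|lborel. (LINT p|(gg t). (?d (t, fst p) - ?d (t, snd p)) \<bullet> D2W al (dx p) (dv p)))"
 proof (rule balance[where r="r + M" and L="4 * La / M + 12 * Ca / M^2", OF ta])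
  fix p :: "real \<times> ('a \<times> 'a)"
  have 1: "((%p :: real \<times> ('a \<times> 'a). fst (snd p)) has_derivative (%k. fst (snd k))) (at p within {0..<T} \<times> UNIV)"
   and 2: "((%p :: real \<times> ('a \<times> 'a). snd (snd p)) has_derivative (%k. snd (snd k))) (at p within {0..<T} \<times> UNIV)"
   by (auto intro!: derivative_eq_intros)
  from has_derivative_mult[OF has_derivative_compose[OF 1 der] has_derivative_compose[OF 2 bump_deriv]]
  show "((%p. a (fst (snd p)) * bump M (snd (snd p))) has_derivative (%(s, (xi, et)). 0 * s + bump M (snd (snd p)) *\<^sub>R da (fst (snd p)) \<bullet> xi + ?d p \<bullet> et)) (at p within {0..<T} \<times> UNIV)"
   by (rule has_derivative_eq_rhs) (auto simp: fun_eq_iff algebra_simps)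
 next
  fix t :: real and z :: "'a \<times> 'a" assume "r + M <= norm z"
  then have "r <= norm (fst z) \<or> M <= norm (snd z)" using norm_Pair_le[of "fst z" "snd z"] by auto
  then show "a (fst (snd (t, z))) * bump M (snd (snd (t, z))) = 0 \<and> (0 :: real) = 0 \<and> bump M (snd (snd (t, z))) *\<^sub>R da (fst (snd (t, z))) = 0"
   using r bump_0[OF M] by auto
 next
  fix t :: real and z z' :: "'a \<times> 'a"
  show "norm (?d (t, z) - ?d (t, z')) <= (4 * La / M + 12 * Ca / M^2) * norm (z - z')"
   unfolding distrib_right
   by (rule order_trans[OF L add_mono[OF mult_left_mono[OF norm_fst_le_norm[of "z - z'", unfolded fst_diff]] mult_left_mono[OF norm_snd_le_norm[of "z - z'", unfolded snd_diff]]]])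
    (use La0 Ca0 M in auto)
 qed (use La0 Ca0 M in \<open>auto intro!: continuous_intros ac\<close>)
 moreover have "\<bar>LINT t:{0..<ta}|lborel. (LINT p|(gg t). (?d (t, fst p) - ?d (t, snd p)) \<bullet> D2W al (dx p) (dv p))\<bar> <= cD al * (4 * La / M + 12 * Ca / M^2) * total"
  by (rule alignment_total[where b="%t z. ?d (t, z)", OF L]) (use La0 Ca0 M ta in auto)
 moreover have "0 <= cD al * (4 * La / M + 12 * Ca / M^2) * total" using La0 Ca0 M cD_pos[OF al] by (simp add: total_def)
 ultimately show ?thesis unfolding fst_conv snd_conv add_0_left inner_scaleR_right mult.commute[of "bump M _"] by linarith
qed

text \<open>The cutoff in position is removed first; what is lost in the cutoff at velocity \<open>M\<close> is then of order
\<open>1 / M^2\<close>, which is just what a second moment needs.\<close>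

lemma velocity_tail:
 assumes ta: "0 < ta" "ta < T" and M: "0 < M"
 shows "(LINT z|f0. bump M (snd z)) - cD al * (12 / M^2) * total <= (LINT z|g ta. bump M (snd z))"
proof -
 define R where "R n = real (Suc n)" for n
 have R: "0 < R n" for n by (simp add: R_def)
 have Rinf: "filterlim R at_top sequentially" unfolding R_def by (rule filterlim_compose[OF filterlim_real_sequentially filterlim_Suc])
 have b: "\<bar>(LINT z|g ta. bump (R n) (fst z) * bump M (snd z)) - (LINT z|f0. bump (R n) (fst z) * bump M (snd z))\<bar>
  <= 4 * M * ta / R n + cD al * (4 * (4 / R n) / M + 12 * 1 / M^2) * total" for n
 proof -
  have "\<bar>snd z \<bullet> dbump (R n) (fst z) * bump M (snd z)\<bar> <= 4 * M / R n" for z :: "'a \<times> 'a"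
  proof (cases "norm (snd z) <= M")
   case True
   have "\<bar>snd z \<bullet> dbump (R n) (fst z)\<bar> * bump M (snd z) <= (M * (4 / R n)) * 1"
    by (intro mult_mono order_trans[OF Cauchy_Schwarz_ineq2] True dbump_bound R bump_le_1) (use M R[of n] in \<open>auto simp: bump_nonneg\<close>)
   then show ?thesis by (simp add: abs_mult bump_nonneg mult_ac)
  qed (use M R[of n] in \<open>simp add: bump_0\<close>)
  then have "AE t in lborel. t : {0..<ta} --> (AE z in g t. ennreal \<bar>snd z \<bullet> dbump (R n) (fst z) * bump M (snd z)\<bar> <= ennreal (4 * M / R n))"
   by (intro AE_I2 impI ennreal_leI) auto
  from kernel_integral_le[OF this]
  have "ennreal \<bar>LINT t:{0..<ta}|lborel. (LINT z|g t. snd z \<bullet> dbump (R n) (fst z) * bump M (snd z))\<bar> <= ennreal (4 * M / R n) * ennreal ta"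
   using prob_space.emeasure_space_1[OF g_prob] ta by (simp add: nn_integral_cmult_indicator)
  then have "\<bar>LINT t:{0..<ta}|lborel. (LINT z|g t. snd z \<bullet> dbump (R n) (fst z) * bump M (snd z))\<bar> <= 4 * M / R n * ta"
   using M R[of n] ta by (simp add: ennreal_mult'[symmetric])
  moreover have "\<bar>(LINT z|g ta. bump (R n) (fst z) * bump M (snd z)) - (LINT z|f0. bump (R n) (fst z) * bump M (snd z))
   - (LINT t:{0..<ta}|lborel. (LINT z|g t. snd z \<bullet> dbump (R n) (fst z) * bump M (snd z)))\<bar> <= cD al * (4 * (4 / R n) / M + 12 * 1 / M^2) * total"
   by (rule product_balance[OF ta M bump_deriv, where r="R n", OF _ _ bump_lipschitz[OF R]])
    (auto simp: bump_0[OF R] dbump_0[OF R] bump_nonneg bump_le_1 intro!: continuous_intros)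
  ultimately show ?thesis by (simp add: mult_ac)
 qed
 have lim: "(%n. LINT z|N. bump (R n) (fst z) * bump M (snd z)) ----> (LINT z|N. 1 * bump M (snd z))"
  if N: "prob_space N" "sets N = sets borel" for N :: "('a \<times> 'a) measure"
 proof (rule integral_dominated_convergence[where w="%_. 1"])
  interpret prob_space N by (rule N)
  show "integrable N (%_. 1 :: real)" by simp
  have "(%z :: 'a \<times> 'a. bump M (snd z)) : borel_measurable borel" "!!n. (%z :: 'a \<times> 'a. bump (R n) (fst z) * bump M (snd z)) : borel_measurable borel"
   by (intro borel_measurable_continuous_onI continuous_intros)+
  then show "(%z. 1 * bump M (snd z)) : borel_measurable N" "!!n. (%z. bump (R n) (fst z) * bump M (snd z)) : borel_measurable N"
   by (simp_all add: measurable_cong_sets[OF N(2) refl])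
  show "AE z in N. (%n. bump (R n) (fst z) * bump M (snd z)) ----> 1 * bump M (snd z)"
   by (intro AE_I2 tendsto_mult bump_tendsto_1 Rinf tendsto_const)
  show "AE z in N. norm (bump (R n) (fst z) * bump M (snd z)) <= 1" for n
   by (simp add: abs_mult bump_nonneg bump_le_1 mult_le_one)
 qed
 have "\<bar>(LINT z|g ta. 1 * bump M (snd z)) - (LINT z|f0. 1 * bump M (snd z))\<bar> <= 4 * M * ta * 0 + cD al * (4 * (4 * 0) / M + 12 * 1 / M^2) * total"
 proof (rule LIMSEQ_le[OF tendsto_rabs[OF tendsto_diff[OF lim[OF g_prob g_sets] lim[OF il.f0 il.sets_f0]]]])
  have i: "(%n. inverse (R n)) ----> 0" by (rule tendsto_inverse_0_at_top[OF Rinf])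
  show "(%n. 4 * M * ta / R n + cD al * (4 * (4 / R n) / M + 12 * 1 / M^2) * total) ----> 4 * M * ta * 0 + cD al * (4 * (4 * 0) / M + 12 * 1 / M^2) * total"
   unfolding divide_inverse[of _ "R _"] by (intro tendsto_intros i) (use M in simp)
 qed (use b in blast)
 then show ?thesis by simp
qed

text \<open>The energy inequality bounds the velocities at time \<open>T\<close> only. At the other times the bound follows from
\<open>velocity_tail\<close>, multiplied by \<open>M^2\<close>, and Fatou's lemma.\<close>

lemma velocity_moment: "EX C>=0. ALL t. (nn_integral (g t) (%z. ennreal ((norm (snd z))^2))) <= ennreal C"
proof -
 define C where "C = 2 * (LINT z|f0. (norm (snd z))^2) + cD al * 12 * total"
 have C0: "0 <= C" using cD_pos[OF al] by (simp add: C_def total_def)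
 have sm: "(%z :: 'a \<times> 'a. (norm (snd z))^2) : borel_measurable borel"
  by (intro borel_measurable_continuous_onI continuous_intros)
 have bm: "(%z :: 'a \<times> 'a. bump M (snd z)) : borel_measurable borel" for M
  by (intro borel_measurable_continuous_onI continuous_intros)
 have bi: "integrable (g t) (%z. bump M (snd z))" for M t by (rule bounded_integrable[where B=1, OF bm]) (simp add: bump_nonneg bump_le_1)
 have tail: "M^2 * (LINT z|g t. 1 - bump M (snd z)) <= C" if M: "0 < M" for M t
 proof -
  have bf: "integrable f0 (%z. bump M (snd z))"
   by (rule finite_measure.integrable_const_bound[where B=1, OF prob_space.finite_measure[OF il.f0]])
    (use bm in \<open>simp_all add: bump_nonneg bump_le_1 measurable_cong_sets[OF il.sets_f0 refl]\<close>)
  have i: "integrable f0 (%z. (norm (snd z))^2)"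
   by (rule Bochner_Integration.integrable_bound[OF il.f0_square])
    (use sm in \<open>auto simp: measurable_cong_sets[OF il.sets_f0 refl] intro!: power_mono norm_snd_le_norm\<close>)
  have "(LINT z|f0. 1 - bump M (snd z)) <= (LINT z|f0. 2 / M^2 * (norm (snd z))^2)"
   by (rule integral_mono) (use bf i one_minus_bump(1)[of M] prob_space.finite_measure[OF il.f0] in \<open>auto intro!: Bochner_Integration.integrable_diff finite_measure.integrable_const\<close>)
  then have f: "1 - (LINT z|f0. bump M (snd z)) <= 2 / M^2 * (LINT z|f0. (norm (snd z))^2)"
   using bf prob_space.prob_space[OF il.f0] finite_measure.integrable_const[OF prob_space.finite_measure[OF il.f0]] by (simp add: il.space_f0)
  have c: "continuous_on S (%t. LINT z|g t. bump M (snd z))" for S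
   by (rule continuous_on_subset[OF narrow]) (auto intro!: continuous_intros boundedI[of _ 1] simp: bump_nonneg bump_le_1)
  have "- (LINT z|g (clamp_time 0 T t). bump M (snd z)) <= - ((LINT z|f0. bump M (snd z)) - cD al * (12 / M^2) * total)"
  proof (rule continuous_le_on_closure[of "{0<..<T}" "%t. - (LINT z|g t. bump M (snd z))"])
   show "clamp_time 0 T t : closure {0<..<T}" using clamp_time(1)[of 0 T t] T by simp
   fix s assume "s : {0<..<T}"
   then show "- (LINT z|g s. bump M (snd z)) <= - ((LINT z|f0. bump M (snd z)) - cD al * (12 / M^2) * total)"
    unfolding neg_le_iff_le by (intro velocity_tail M) auto
  qed (intro continuous_intros c)
  then have "1 - (LINT z|g t. bump M (snd z)) <= (2 * (LINT z|f0. (norm (snd z))^2) + cD al * 12 * total) / M^2"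
   using f unfolding clamped by (simp add: add_divide_distrib)
  then have "M^2 * (1 - (LINT z|g t. bump M (snd z))) <= C" using M unfolding C_def by (simp add: pos_le_divide_eq mult.commute)
  interpret p: prob_space "g t" by (rule g_prob)
  show ?thesis using \<open>M^2 * (1 - _) <= C\<close> bi[of t M] p.prob_space by simp
 qed
 have "(nn_integral (g t) (%z. ennreal ((norm (snd z))^2))) <= ennreal C" for t
 proof -
  define F where "F n z = ennreal ((norm (snd z))^2) * indicator {z. norm (snd z) <= real (Suc n)} z" for n and z :: "'a \<times> 'a"
  have Fm: "F n : borel_measurable (g t)" for n
  proof -
   have "closed {z :: 'a \<times> 'a. norm (snd z) <= real (Suc n)}" by (intro closed_Collect_le continuous_intros)
   then show ?thesis using sm unfolding F_def measurable_g by (intro borel_measurable_times_ennreal borel_measurable_indicator) (auto intro: borel_closed)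
  qed
  have "(nn_integral (g t) (%z. F n z)) <= ennreal C" for n
  proof -
   let ?M = "real (Suc n)"
   have "(nn_integral (g t) (%z. F n z)) <= (nn_integral (g t) (%z. ennreal (?M^2 * (1 - bump ?M (snd z)))))"
   proof (rule nn_integral_mono)
    fix z :: "'a \<times> 'a"
    show "F n z <= ennreal (?M^2 * (1 - bump ?M (snd z)))"
    using one_minus_bump(2)[of ?M "snd z"] by (auto simp: F_def indicator_def pos_divide_le_eq mult.commute simp del: of_nat_Suc intro!: ennreal_leI)
   qed
   also have "\<dots> = ennreal (?M^2 * (LINT z|g t. 1 - bump ?M (snd z)))"
    by (subst nn_integral_eq_integral) (auto intro!: Bochner_Integration.integrable_diff integrable_mult_right bi finite_measure.integrable_const prob_space.finite_measure g_prob simp: bump_le_1 simp del: of_nat_Suc)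
   also have "\<dots> <= ennreal C" by (intro ennreal_leI tail) simp
   finally show ?thesis .
  qed
  then have l: "liminf (%n. nn_integral (g t) (%z. F n z)) <= ennreal C" by (intro Liminf_le always_eventually) auto
  have Fl: "(%n. F n z) ----> ennreal ((norm (snd z))^2)" for z
  proof (rule tendsto_eventually)
   obtain k where "norm (snd z) <= real k" using real_arch_simple by blast
   then show "\<forall>\<^sub>F n in sequentially. F n z = ennreal ((norm (snd z))^2)"
    unfolding eventually_sequentially by (intro exI[of _ k]) (auto simp: F_def indicator_def)
  qed
  have "(nn_integral (g t) (%z. ennreal ((norm (snd z))^2))) = (nn_integral (g t) (%z. liminf (%n. F n z)))"
   by (intro nn_integral_cong lim_imp_Liminf[symmetric] Fl) simp
  also have "\<dots> <= ennreal C" by (rule order_trans[OF nn_integral_liminf[OF Fm] l])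
  finally show ?thesis .
 qed
 then show ?thesis using C0 by blast
qed

lemma second_moments: "EX M2. ALL t. integrable (g t) (%z. (norm z)^2) \<and> (LINT z|g t. (norm z)^2) <= M2"
proof -
 obtain C where C: "0 <= C" "!!t. (nn_integral (g t) (%z. ennreal ((norm (snd z))^2))) <= ennreal C" using velocity_moment by blast
 have m: "(%z :: 'a \<times> 'a. (norm z)^2) : borel_measurable borel" "(%z :: 'a \<times> 'a. (norm (fst z))^2) : borel_measurable borel" "(%z :: 'a \<times> 'a. (norm (snd z))^2) : borel_measurable borel"
  by (intro borel_measurable_continuous_onI continuous_intros)+
 have "(nn_integral (g t) (%z. ennreal ((norm z)^2))) <= ennreal (Mx + C)" for t
 proof -
  have "(nn_integral (g t) (%z. ennreal ((norm z)^2))) = (nn_integral (g t) (%z. ennreal ((norm (fst z))^2) + ennreal ((norm (snd z))^2)))"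
   by (intro nn_integral_cong) (simp add: norm_prod_def)
  also have "\<dots> = (nn_integral (g t) (%z. ennreal ((norm (fst z))^2))) + (nn_integral (g t) (%z. ennreal ((norm (snd z))^2)))"
   by (rule nn_integral_add) (use m in \<open>auto simp: measurable_g\<close>)
  also have "\<dots> <= ennreal Mx + ennreal C" by (rule add_mono[OF xmom C(2)])
  finally show ?thesis using Mx C by simp
 qed
 note n = this
 have "integrable (g t) (%z. (norm z)^2)" for t
  by (rule integrableI_bounded) (use m n[of t] in \<open>auto simp: measurable_g intro: le_less_trans\<close>)
 moreover from this have "(LINT z|g t. (norm z)^2) <= Mx + C" for t
  using n[of t] Mx C by (subst (asm) nn_integral_eq_integral) (auto simp: ennreal_plus[symmetric] simp del: ennreal_plus)
 ultimately show ?thesis by blast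
qed

end

section \<open>Transport of the labels\<close>

lemma LINT_Ico:
 fixes f :: "real => 'b::euclidean_space"
 assumes "continuous_on UNIV f" shows "(LINT t:{0..<ta}|lborel. f t) = integral {0..ta} f"
proof -
 have "(LINT t:{0..<ta}|lborel. f t) = (LINT t:{0..ta}|lborel. f t)"
  unfolding set_lebesgue_integral_def
 proof (rule integral_cong_AE)
  show "AE t in lborel. indicator {0..<ta} t *\<^sub>R f t = indicator {0..ta} t *\<^sub>R f t"
   using AE_lborel_singleton[of ta] by eventually_elim (auto simp: indicator_def)
 qed (use borel_measurable_continuous_onI[OF assms] in auto)
 also have "\<dots> = integral {0..ta} f"
  by (intro set_borel_integral_eq_integral borel_integrable_atLeastAtMost' continuous_on_subset[OF assms]) simp
 finally show ?thesis .
qed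

locale moving_curve = weak_curve al T g Mx f0 + phase_curve al T g Mx M2 E
 for al T Mx M2 :: real and g :: "real => ('a::euclidean_space \<times> 'a) measure" and f0 E
begin

text \<open>By the continuity equation for the positions, \<open>- w\<close> is the time derivative of \<open>u\<close>, and \<open>ux\<close> is its
derivative in space.\<close>

definition w :: "real => real => 'a => 'a" where "w ep t x = (LINT z|g t. DK al ep (x - fst z) (snd z))"

definition ux :: "real => real => 'a => 'a => 'a" where "ux ep t x h = (LINT z|g t. DK al ep (x - fst z) h)"

lemma kernel_g_dominated:
 fixes F :: "nat => real => 'a \<times> 'a => real"
 assumes F: "!!n. continuous_on UNIV (%(t, z). F n t z)" "continuous_on UNIV (%(t, z). F0 t z)"
  and bd: "!!n t z. \<bar>F n t z\<bar> <= C * (1 + norm z)" and lim: "!!t z. (%n. F n t z) ----> F0 t z"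
 shows "(%n. LINT t:{0..<ta}|lborel. (LINT z|g t. F n t z)) ----> (LINT t:{0..<ta}|lborel. (LINT z|g t. F0 t z))"
  "set_integrable lborel {0..<ta} (%t. LINT z|g t. F n t z)"
proof -
 have C: "0 <= C" using bd[of 0 0 0] by simp
 have i: "integrable (g t) (%z. C * (1 + norm z))" for t
  by (rule g_linear_integrable[of _ C]) (use C in \<open>auto intro!: borel_measurable_continuous_onI continuous_intros\<close>)
 have "(LINT z|g t. C * (1 + norm z)) <= C * (2 + M2)" for t
 proof -
  interpret prob_space "g t" by (rule g_prob)
  have "(LINT z|g t. 1 + norm z) <= (LINT z|g t. 1 + (1 + (norm z)^2))"
   by (rule integral_mono) (use g_linear_integrable[of "%z. 1 + norm z" 1 t] mom(1)[of t] le_one_plus_square[of "norm _"] in \<open>auto intro!: borel_measurable_continuous_onI continuous_intros\<close>)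
  also have "\<dots> <= 2 + M2" using mom(1,2)[of t] prob_space by simp
  finally show ?thesis using C by (simp add: mult_left_mono)
 qed
 then have "(nn_integral (g t) (%z. ennreal (C * (1 + norm z)))) <= ennreal (C * (2 + M2))" for t
  using C by (subst nn_integral_eq_integral[OF i]) (auto intro!: ennreal_leI)
 then have "(nn_integral lborel (%t. (nn_integral (g t) (%z. ennreal (C * (1 + norm z)))) * indicator {0..<ta} t)) <= (nn_integral lborel (%t. ennreal (C * (2 + M2)) * indicator {0..<ta} t))"
  by (intro nn_integral_mono mult_right_mono) auto
 also have "\<dots> < \<infinity>" by (cases "0 <= ta") (auto simp: nn_integral_cmult_indicator ennreal_mult_less_top)
 finally have fin: "(nn_integral lborel (%t. (nn_integral (g t) (%z. ennreal (C * (1 + norm z)))) * indicator {0..<ta} t)) < \<infinity>" .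
 have m: "(%(t :: real, z :: 'a \<times> 'a). ennreal (C * (1 + norm z))) : borel_measurable (borel \<Otimes>\<^sub>M borel)" by measurable
 have Fm: "(%(t, z). F n t z) : borel_measurable (borel \<Otimes>\<^sub>M borel)" "(%(t, z). F0 t z) : borel_measurable (borel \<Otimes>\<^sub>M borel)" for n
  unfolding borel_prod by (intro borel_measurable_continuous_onI F)+
 note k = kernel_dominated_convergence[OF kernel_g _ Fm m fin, of "%_. True", OF _ _ ennreal_leI[OF bd] lim]
 show "(%n. LINT t:{0..<ta}|lborel. (LINT z|g t. F n t z)) ----> (LINT t:{0..<ta}|lborel. (LINT z|g t. F0 t z))"
  "set_integrable lborel {0..<ta} (%t. LINT z|g t. F n t z)"
  by (rule k; simp)+
qed

lemma continuous_u' [continuous_intros]: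
 assumes "continuous_on S a" "continuous_on S b" shows "continuous_on S (%p. u ep (a p) (b p))"
 using continuous_on_compose2[OF continuous_u continuous_on_Pair[OF assms] subset_UNIV] by simp

context
 fixes ep :: real assumes ep: "0 < ep"
begin

lemma DK_linear_bound: "norm (DK al ep y h) <= (cD al * ep powr (- al)) * norm h"
 by (rule DK_bound_eps[OF al ep])

lemma DK_coeff: "0 <= cD al * ep powr (- al)" using cD_pos[OF al] by simp

lemma continuous_w: "continuous_on UNIV (%p :: real \<times> 'a. w ep (fst p) (snd p))"
 unfolding w_def
proof (rule continuous_mean[where n="%_. cD al * ep powr (- al)"])
 show "continuous_on UNIV (%(p :: real \<times> 'a, z). DK al ep (snd p - fst z) (snd z))"
  unfolding case_prod_unfold by (intro continuous_on_DK al continuous_intros) (use ep in auto)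
 show "norm (DK al ep (snd p - fst z) (snd z)) <= cD al * ep powr (- al) * (1 + norm z)" for p :: "real \<times> 'a" and z
  by (rule order_trans[OF DK_linear_bound mult_left_mono[OF _ DK_coeff]]) (use norm_snd_le_norm[of z] in auto)
qed (intro continuous_intros)+

lemma continuous_w' [continuous_intros]:
 assumes "continuous_on S a" "continuous_on S b" shows "continuous_on S (%p. w ep (a p) (b p))"
 using continuous_on_compose2[OF continuous_w continuous_on_Pair[OF assms] subset_UNIV] by simp

lemma continuous_ux:
 fixes X :: "'p::metric_space => 'a"
 assumes "continuous_on UNIV ta" "continuous_on UNIV X" "continuous_on UNIV h"
 shows "continuous_on UNIV (%p. ux ep (ta p) (X p) (h p))"
 unfolding ux_def
proof (rule continuous_mean[where n="%p. cD al * ep powr (- al) * norm (h p)"])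
 show "continuous_on UNIV (%(p, z :: 'a \<times> 'a). DK al ep (X p - fst z) (h p))"
  unfolding case_prod_unfold
  by (intro continuous_on_DK al continuous_intros continuous_on_compose2[OF assms(2)] continuous_on_compose2[OF assms(3)]) (use ep in auto)
 show "norm (DK al ep (X p - fst z) (h p)) <= cD al * ep powr (- al) * norm (h p) * (1 + norm z)" for p and z :: "'a \<times> 'a"
  using mult_left_mono[of 1 "1 + norm z" "cD al * ep powr (- al) * norm (h p)"] DK_coeff
  by (intro order_trans[OF DK_linear_bound]) simp
qed (intro continuous_intros assms)+

lemma integrable_DK_g:
 "integrable (g t) (%z. DK al ep (x - fst z) h)" "integrable (g t) (%z. DK al ep (x - fst z) (snd z))"
proof -
 have m: "(%z :: 'a \<times> 'a. x - fst z) : borel_measurable borel" "(%z :: 'a \<times> 'a. snd z) : borel_measurable borel"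
  by (intro borel_measurable_continuous_onI continuous_intros)+
 show "integrable (g t) (%z. DK al ep (x - fst z) h)"
  by (rule bounded_integrable[OF measurable_DK[OF m(1) measurable_const[of h]] DK_linear_bound]) simp
 show "integrable (g t) (%z. DK al ep (x - fst z) (snd z))"
  by (rule g_linear_integrable[where C="cD al * ep powr (- al)", OF measurable_DK[OF m]], rule order_trans[OF DK_linear_bound mult_left_mono[OF _ DK_coeff]])
   (use add_increasing[OF zero_le_one norm_snd_le_norm] in auto)
qed

lemma ux_sym: "a \<bullet> ux ep t x b = b \<bullet> ux ep t x a"
 unfolding ux_def integral_inner_right[OF integrable_DK_g(1), symmetric] by (rule Bochner_Integration.integral_cong[OF refl DK_sym])

lemma u_has_derivative: "(u ep t has_derivative ux ep t x) (at x within S)"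
proof -
 have "((%x. LINT z|g t. K al ep (x - fst z)) has_derivative (%h. LINT z|g t. DK al ep (x - fst z) h)) (at x within UNIV)"
 proof (rule has_derivative_integral_param[OF UNIV_I])
  interpret prob_space "g t" by (rule g_prob)
  show "integrable (g t) (%_. cD al * ep powr (- al))" by simp
  fix y h :: 'a and z :: "'a \<times> 'a"
  show "integrable (g t) (%z. K al ep (y - fst z))" by (rule integrable_convK[OF al g_prob g_fst_measurable(1) g_fst_integrable])
  show "norm (K al ep (y - fst z) - K al ep (x - fst z)) <= cD al * ep powr (- al) * norm (y - x)"
   using K_lipschitz[OF al ep, of "y - fst z" "x - fst z"] by simp
  show "((%x. K al ep (x - fst z)) has_derivative DK al ep (x - fst z)) (at x within UNIV)"
   by (rule has_derivative_compose[where f="%x. x - fst z" and f'="%h. h"], auto intro!: derivative_eq_intros K_has_derivative[OF al]) (use ep in simp)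
  show "norm (DK al ep (x - fst z) h) <= cD al * ep powr (- al) * norm h" by (rule DK_linear_bound)
  show "(%z. DK al ep (x - fst z) h) : borel_measurable (g t)" by (rule borel_measurable_integrable[OF integrable_DK_g(1)])
 qed
 then show ?thesis unfolding u_def[abs_def] ux_def[abs_def] convK_def by (rule has_derivative_subset) simp
qed

text \<open>Testing with the cut-off kernel \<open>K (x - \<cdot>)\<close>: the cut-off in the velocity makes the interaction
 term negligible, so that only the free transport contributes.\<close>

lemma u_component:
 fixes x e :: 'a
 assumes ta: "0 < ta" "ta < T" and e: "norm e = 1"
 shows "(u ep ta x - convK al ep f0 fst x + integral {0..ta} (%t. w ep t x)) \<bullet> e = 0"
proof -
 define c where "c = cD al * ep powr (- al)"
 define R where "R n = real (Suc n)" for n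
 define k dk where "k y = K al ep (x - y) \<bullet> e" and "dk y = - DK al ep (x - y) e" for y
 define a da where "a n y = bump (R n) y * k y" and "da n y = k y *\<^sub>R dbump (R n) y + bump (R n) y *\<^sub>R dk y" for n y
 define C where "C = cH al * (2 + norm x)"
 define La where "La = 4 * C + c"
 have R: "0 < R n" "1 <= R n" for n by (simp_all add: R_def)
 have Rinf: "filterlim R at_top sequentially" unfolding R_def by (rule filterlim_compose[OF filterlim_real_sequentially filterlim_Suc])
 have iR: "(%n. inverse (R n)) ----> 0" by (rule tendsto_inverse_0_at_top[OF Rinf])
 have c0: "0 <= c" "0 <= C" "0 <= La" using DK_coeff cH_pos[OF al] by (auto simp: c_def C_def La_def)
 have kd: "(k has_derivative (%h. dk y \<bullet> h)) (at y)" for y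
 proof -
  have "((%y. x - y) has_derivative (%h. - h)) (at y)" by (auto intro!: derivative_eq_intros)
  from has_derivative_inner_left[OF has_derivative_compose[OF this K_has_derivative[OF al disjI1[OF less_imp_neq[OF ep, symmetric]]]], of e]
  have "((%y. K al ep (x - y) \<bullet> e) has_derivative (%h. DK al ep (x - y) (- h) \<bullet> e)) (at y)" .
  moreover have "DK al ep (x - y) (- h) \<bullet> e = dk y \<bullet> h" for h
   unfolding dk_def by (metis DK_sym inner_commute inner_minus_left linear_neg linear_DK)
  ultimately show ?thesis unfolding k_def by simp
 qed
 have ad: "(a n has_derivative (%h. da n y \<bullet> h)) (at y)" for n y
  unfolding a_def[abs_def] da_def by (rule has_derivative_eq_rhs[OF has_derivative_mult[OF bump_deriv kd]]) (auto simp: algebra_simps)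
 have kc: "continuous_on S (%q. k (f q))" "continuous_on S (%q. dk (f q))" if "continuous_on S f" for S and f :: "'q::topological_space => 'a"
  unfolding k_def dk_def using that ep by (auto intro!: continuous_intros continuous_on_K[OF al] continuous_on_DK[OF al])
 have kb: "\<bar>k y\<bar> <= C * (1 + norm y)" for y
 proof -
  have "\<bar>k y\<bar> <= cH al * (1 + norm (x - y))"
   unfolding k_def using Cauchy_Schwarz_ineq2[of "K al ep (x - y)" e] K_growth[OF al, of ep "x - y"] e by simp
  also have "\<dots> <= cH al * ((2 + norm x) * (1 + norm y))"
  proof (rule mult_left_mono)
   have "1 * norm y <= (2 + norm x) * norm y" by (intro mult_right_mono) auto
   then show "1 + norm (x - y) <= (2 + norm x) * (1 + norm y)" using norm_triangle_ineq4[of x y] by (simp only: distrib_left mult_1 mult_1_right)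
  qed (use cH_pos[OF al] in simp)
  finally show ?thesis by (simp add: C_def)
 qed
 have kR: "\<bar>k y\<bar> <= 2 * C * R n" if "norm y <= R n" for y n
  using kb[of y] mult_left_mono[of "1 + norm y" "2 * R n" C] that R[of n] c0 by simp
 have dkb: "norm (dk y) <= c" for y using DK_linear_bound[of "x - y" e] e by (simp add: dk_def c_def)
 have dab: "norm (da n y) <= 2 * La" for n y
 proof (cases "norm y <= R n")
  case True
  have "norm (da n y) <= \<bar>k y\<bar> * norm (dbump (R n) y) + bump (R n) y * norm (dk y)"
   unfolding da_def by (rule order_trans[OF norm_triangle_ineq]) (simp add: bump_nonneg)
  also have "\<dots> <= (2 * C * R n) * (4 / R n) + 1 * c"
   by (intro add_mono mult_mono kR True dbump_bound R dkb bump_le_1) (use c0 R[of n] in auto)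
  also have "\<dots> <= 2 * La" using R[of n] c0 by (simp add: La_def)
  finally show ?thesis .
 qed (use c0 R[of n] in \<open>simp add: da_def bump_0 dbump_0\<close>)
 have ab: "\<bar>a n y\<bar> <= 2 * C * R n" for n y
 proof (cases "norm y <= R n")
  case True
  show ?thesis using mult_mono[OF bump_le_1[of "R n" y] kR[OF True]] c0 by (simp add: a_def abs_mult bump_nonneg)
 qed (use c0 R[of n] in \<open>simp add: a_def bump_0\<close>)
 have alip: "\<bar>a n y - a n y'\<bar> <= 2 * La * norm (y - y')" for n y y'
  using differentiable_bound[of UNIV "a n" "%y h. da n y \<bullet> h" "2 * La" y y']
   onorm_le[of "%h. da n _ \<bullet> h" "2 * La"] ad order_trans[OF Cauchy_Schwarz_ineq2 mult_right_mono[OF dab norm_ge_zero]]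
  by (simp add: convex_UNIV)
 have b: "\<bar>(LINT z|g ta. a n (fst z) * bump (R n) (snd z)) - (LINT z|f0. a n (fst z) * bump (R n) (snd z))
   - (LINT t:{0..<ta}|lborel. (LINT z|g t. snd z \<bullet> da n (fst z) * bump (R n) (snd z)))\<bar> <= (cD al * (8 * La + 24 * C) * total) * inverse (R n)" for n
 proof -
  have "cD al * (4 * (2 * La) / R n + 12 * (2 * C * R n) / (R n)^2) * total = (cD al * (8 * La + 24 * C) * total) * inverse (R n)"
   using R[of n] by (simp add: field_simps power2_eq_square)
  moreover have "\<bar>(LINT z|g ta. a n (fst z) * bump (R n) (snd z)) - (LINT z|f0. a n (fst z) * bump (R n) (snd z))
   - (LINT t:{0..<ta}|lborel. (LINT z|g t. snd z \<bullet> da n (fst z) * bump (R n) (snd z)))\<bar> <= cD al * (4 * (2 * La) / R n + 12 * (2 * C * R n) / (R n)^2) * total"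
   by (rule product_balance[OF ta R(1) ad _ ab alip, where r="R n"])
    (auto simp: a_def da_def bump_0 dbump_0 R intro!: continuous_intros kc)
  ultimately show ?thesis by (simp only:)
 qed
 have dalim: "(%n. da n y) ----> dk y" for y
 proof -
  have "(%n. dbump (R n) y) ----> 0"
  proof (rule Lim_null_comparison[OF always_eventually])
   show "(%n. 4 * inverse (R n)) ----> 0" using tendsto_mult[OF tendsto_const iR, of 4] by simp
  qed (simp add: dbump_bound[OF R(1), unfolded divide_inverse])
  then have "(%n. da n y) ----> k y *\<^sub>R 0 + 1 *\<^sub>R dk y" unfolding da_def by (intro tendsto_intros bump_tendsto_1 Rinf)
  then show ?thesis by simp
 qed
 have alim: "(%n. a n y * bump (R n) v) ----> 1 * k y * 1" for y v :: 'a unfolding a_def by (intro tendsto_intros bump_tendsto_1 Rinf)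
 have l1: "(%n. LINT z|N. a n (fst z) * bump (R n) (snd z)) ----> (LINT z|N. 1 * k (fst z) * 1)"
  if N: "integrable N (%z. 1 + norm z)" "sets N = sets borel" for N :: "('a \<times> 'a) measure"
 proof (rule integral_dominated_convergence[where w="%z. C * (1 + norm z)"])
  show "integrable N (%z. C * (1 + norm z))" using N by simp
  have "(%z. 1 * k (fst z) * 1) : borel_measurable borel" "!!n. (%z. a n (fst z) * bump (R n) (snd z)) : borel_measurable borel"
   unfolding a_def by (intro borel_measurable_continuous_onI continuous_intros kc)+
  then show "(%z. 1 * k (fst z) * 1) : borel_measurable N" "!!n. (%z. a n (fst z) * bump (R n) (snd z)) : borel_measurable N"
   by (simp_all add: measurable_cong_sets[OF N(2) refl])
  have "\<bar>a n (fst z) * bump (R n) (snd z)\<bar> <= C * (1 + norm z)" for n and z :: "'a \<times> 'a"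
  proof -
   have "\<bar>a n (fst z) * bump (R n) (snd z)\<bar> <= (1 * (C * (1 + norm (fst z)))) * 1"
    unfolding a_def abs_mult by (intro mult_mono kb) (use c0 in \<open>auto simp: bump_nonneg bump_le_1\<close>)
   then show ?thesis using mult_left_mono[OF add_left_mono[OF norm_fst_le_norm[of z], of 1] c0(2)] by simp
  qed
  then show "AE z in N. norm (a n (fst z) * bump (R n) (snd z)) <= C * (1 + norm z)" for n by simp
 qed (intro AE_I2 alim)
 have l2: "(%n. LINT t:{0..<ta}|lborel. (LINT z|g t. snd z \<bullet> da n (fst z) * bump (R n) (snd z))) ----> (LINT t:{0..<ta}|lborel. (LINT z|g t. snd z \<bullet> dk (fst z) * 1))"
 proof (rule kernel_g_dominated[where C="2 * La"])
  show "continuous_on UNIV (%(t :: real, z). snd z \<bullet> da n (fst z) * bump (R n) (snd z))" "continuous_on UNIV (%(t :: real, z). snd z \<bullet> dk (fst z) * 1)" for n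
   unfolding case_prod_unfold da_def by (intro continuous_intros kc)+
  fix n and t :: real and z :: "'a \<times> 'a"
  have "\<bar>snd z \<bullet> da n (fst z) * bump (R n) (snd z)\<bar> <= ((1 + norm z) * (2 * La)) * 1"
   unfolding abs_mult by (intro mult_mono order_trans[OF Cauchy_Schwarz_ineq2] dab order_trans[OF norm_snd_le_norm]) (use c0 in \<open>auto simp: bump_nonneg bump_le_1\<close>)
  then show "\<bar>snd z \<bullet> da n (fst z) * bump (R n) (snd z)\<bar> <= 2 * La * (1 + norm z)" by (simp add: mult.commute)
  show "(%n. snd z \<bullet> da n (fst z) * bump (R n) (snd z)) ----> snd z \<bullet> dk (fst z) * 1"
   by (intro tendsto_intros dalim bump_tendsto_1 Rinf)
 qed
 have g1: "integrable (g ta) (%z. 1 + norm z)" by (rule g_linear_integrable[of _ 1]) (auto intro!: borel_measurable_continuous_onI continuous_intros)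
 have "\<bar>(LINT z|g ta. 1 * k (fst z) * 1) - (LINT z|f0. 1 * k (fst z) * 1) - (LINT t:{0..<ta}|lborel. (LINT z|g t. snd z \<bullet> dk (fst z) * 1))\<bar> <= (cD al * (8 * La + 24 * C) * total) * 0"
  by (rule LIMSEQ_le[OF tendsto_rabs[OF tendsto_diff[OF tendsto_diff[OF l1[OF g1 g_sets] l1[OF il.f0_wt il.sets_f0]] l2]] tendsto_mult[OF tendsto_const iR]])
   (use b in blast)
 moreover have "(LINT z|g ta. 1 * k (fst z) * 1) = u ep ta x \<bullet> e"
  unfolding k_def u_def convK_def by (simp add: integrable_convK[OF al g_prob g_fst_measurable(1) g_fst_integrable])
 moreover have "(LINT z|f0. 1 * k (fst z) * 1) = convK al ep f0 fst x \<bullet> e"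
  unfolding k_def convK_def by (simp add: integrable_convK[OF al il.f0 il.fst_measurable(1) il.fst_integrable])
 moreover have "(LINT t:{0..<ta}|lborel. (LINT z|g t. snd z \<bullet> dk (fst z) * 1)) = - (integral {0..ta} (%t. w ep t x) \<bullet> e)"
 proof -
  have "(LINT z|g t. snd z \<bullet> dk (fst z) * 1) = - (w ep t x \<bullet> e)" for t
   by (simp add: dk_def w_def DK_sym[of "snd _"] integrable_DK_g inner_commute[of e] flip: integral_inner_left)
  then have "(LINT t:{0..<ta}|lborel. (LINT z|g t. snd z \<bullet> dk (fst z) * 1)) = integral {0..ta} (%t. - (w ep t x \<bullet> e))"
   by (simp only:) (intro LINT_Ico continuous_intros)
  also have "\<dots> = - (integral {0..ta} (%t. w ep t x) \<bullet> e)"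
   using integral_linear[OF integrable_continuous_real bounded_linear_minus[OF bounded_linear_inner_left], of 0 ta "%t. w ep t x" e]
   by (simp add: o_def continuous_intros)
  finally show ?thesis .
 qed
 ultimately show ?thesis by (simp add: inner_diff_left inner_add_left)
qed

lemma u_integral:
 assumes t: "t : {0..T}" shows "u ep t x = convK al ep f0 fst x - integral {0..t} (%s. w ep s x)"
proof -
 let ?D = "%t. u ep t x - convK al ep f0 fst x + integral {0..t} (%s. w ep s x)"
 have "?D ta = 0" if "ta : {0<..<T}" for ta
  by (rule euclidean_eqI) (use u_component[of ta] that norm_Basis in auto)
 moreover have "continuous_on {0..T} ?D"
  by (intro continuous_intros indefinite_integral_continuous_1 integrable_continuous_real)
 ultimately have "?D t = 0"
  using continuous_constant_on_closure[of "{0<..<T}" ?D 0 t] T t by simp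
 then show ?thesis by (simp add: algebra_simps)
qed

lemma u_joint_derivative:
 assumes p: "p : {0..<T} \<times> UNIV"
 shows "((%(t, z :: 'a \<times> 'a). u ep t (fst z)) has_derivative (%(s, z). - s *\<^sub>R w ep (fst p) (fst (snd p)) + ux ep (fst p) (fst (snd p)) (fst z)))
  (at p within {0..<T} \<times> UNIV)"
proof -
 obtain t x v where p_eq: "p = (t, (x, v))" by (metis surj_pair)
 have t: "t : {0..<T}" using p p_eq by auto
 have "((%(x, t). u ep t x) has_derivative (%(tx, ty). ux ep t x tx + blinfun_apply (blinfun_scaleR_left (- w ep t x)) ty)) (at (x, t) within UNIV \<times> {0..<T})"
 proof (rule has_derivative_partialsI[OF u_has_derivative _ _ t])
  fix y s assume s: "s : {0..<T}"
  have "continuous_on {0..T} (%t. w ep t y)" by (intro continuous_intros)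
  from integral_has_vector_derivative[OF this, of s] s
  have "((%t. convK al ep f0 fst y - integral {0..t} (%s. w ep s y)) has_vector_derivative (0 - w ep s y)) (at s within {0..T})"
   by (intro has_vector_derivative_diff has_vector_derivative_const) auto
  then have "((%t. u ep t y) has_vector_derivative (0 - w ep s y)) (at s within {0..T})"
   by (rule has_vector_derivative_transform[rotated 2]) (use s u_integral in auto)
  then have "((%t. u ep t y) has_vector_derivative (0 - w ep s y)) (at s within {0..<T})"
   by (rule has_vector_derivative_within_subset) auto
  then show "((%t. u ep t y) has_derivative blinfun_apply (blinfun_scaleR_left (- w ep s y))) (at s within {0..<T})"
   by (simp add: has_vector_derivative_def)
 next
  have "continuous_on (UNIV \<times> {0..<T}) (%q :: 'a \<times> real. blinfun_scaleR_left (- w ep (snd q) (fst q)))" by (intro continuous_intros)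
  then show "continuous (at (x, t) within UNIV \<times> {0..<T}) (%(x, y). blinfun_scaleR_left (- w ep y x))"
   using t by (simp add: continuous_on_eq_continuous_within case_prod_unfold)
 qed simp
 then have d: "((%(x, t). u ep t x) has_derivative (%(tx, ty). ux ep t x tx - ty *\<^sub>R w ep t x)) (at (x, t) within (%q. (fst (snd q), fst q)) ` ({0..<T} \<times> (UNIV :: ('a \<times> 'a) set)))"
  by (rule has_derivative_subset[OF has_derivative_eq_rhs]) auto
 have c: "((%q :: real \<times> 'a \<times> 'a. (fst (snd q), fst q)) has_derivative (%k. (fst (snd k), fst k))) (at (t, (x, v)) within {0..<T} \<times> UNIV)"
  by (auto intro!: derivative_eq_intros)
 have d': "((%(x, t). u ep t x) has_derivative (%(tx, ty). ux ep t x tx - ty *\<^sub>R w ep t x)) (at ((%q. (fst (snd q), fst q)) (t, (x, v))) within (%q. (fst (snd q), fst q)) ` ({0..<T} \<times> (UNIV :: ('a \<times> 'a) set)))"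
  using d by simp
 from has_derivative_in_compose[OF c d'] show ?thesis unfolding p_eq by (simp add: case_prod_unfold)
qed

end

end

context moving_curve
begin

lemma ig: "initial_law al T (g t)"
 by (intro initial_law.intro al T g_prob g_sets mom(1))

text \<open>At time 0 the free motion \<open>x + s v\<close> with law \<open>g t\<close> has the acceleration \<open>ux\<close> in direction \<open>v\<close> minus \<open>w\<close>, so
this is an instance of \<open>acc_symmetrized\<close>.\<close>

lemma symmetrized:
 assumes ep: "0 < ep" and G: "G : borel_measurable borel" "!!z. norm (G z) <= B"
 shows "(LINT z|g t. snd z \<bullet> ux ep t (fst z) (G z) - G z \<bullet> w ep t (fst z))
   = 1 / 2 * (LINT p|gg t. (G (fst p) - G (snd p)) \<bullet> DK al ep (dx p) (dv p))"
  "integrable (g t) (%z. snd z \<bullet> ux ep t (fst z) (G z) - G z \<bullet> w ep t (fst z))"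
proof -
 interpret i: initial_law al T "g t" by (rule ig)
 define X V where "X s z = fst z + clamp_time 0 T s *\<^sub>R snd z" and "V s z = snd z" for s and z :: "'a \<times> 'a"
 have X: "continuous_on UNIV (%(s, z). X s z)" unfolding X_def case_prod_unfold by (intro continuous_intros)
 have Xb: "norm (X s z) <= (1 + T) * (1 + norm z)" for s z
 proof -
  have "norm (X s z) <= norm (fst z) + T * norm (snd z)"
   unfolding X_def using clamp_time(1)[of 0 T s] T by (intro norm_triangle_le add_mono order_refl) (auto intro!: mult_right_mono)
  also have "\<dots> <= norm z + T * norm z" using T by (intro add_mono norm_fst_le_norm mult_left_mono norm_snd_le_norm) auto
  also have "\<dots> <= (1 + T) * (1 + norm z)" using T by (simp add: algebra_simps)
  finally show ?thesis .
 qed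
 have V: "continuous_on UNIV (%(s, z). V s z)" unfolding V_def case_prod_unfold by (intro continuous_intros)
 have Vb: "norm (V s z) <= 1 * (1 + norm z)" for s z using add_increasing[OF zero_le_one norm_snd_le_norm] by (simp add: V_def)
 have d: "((%s. X s z) has_vector_derivative V s z) (at s within {0..T})" if s: "s : {0..T}" for s z
 proof (rule has_vector_derivative_transform[OF s])
  show "((%s. fst z + s *\<^sub>R snd z) has_vector_derivative V s z) (at s within {0..T})"
   unfolding V_def by (auto intro!: derivative_eq_intros)
 qed (simp add: X_def clamp_time)
 have m: "(%z. (1 :: real)) : borel_measurable (g t)" "G : borel_measurable (g t)" using G by (simp_all add: measurable_g)
 have Gb: "norm (G z) <= B * (1 + norm z)" for z
  using G(2)[of z] mult_left_mono[of 1 "1 + norm z" B] order_trans[OF norm_ge_zero G(2)[of z]] by simp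
 have X0: "X 0 = fst" using T by (simp add: X_def clamp_time fun_eq_iff)
 have a: "i.acc ep X V 0 z = ux ep t (fst z) (snd z) - w ep t (fst z)" for z
  unfolding i.acc_def ux_def w_def X0 V_def by (simp add: linear_diff[OF linear_DK] integrable_DK_g[OF ep])
 have e: "snd z \<bullet> ux ep t (fst z) (G z) - G z \<bullet> w ep t (fst z) = G z \<bullet> i.acc ep X V 0 z" for z
  unfolding a by (simp add: inner_diff_right ux_sym[OF ep, of "snd z"])
 note s = i.acc_symmetrized[where t=0, OF X Xb V Vb d ep m(2) Gb]
 show "(LINT z|g t. snd z \<bullet> ux ep t (fst z) (G z) - G z \<bullet> w ep t (fst z)) = 1 / 2 * (LINT p|gg t. (G (fst p) - G (snd p)) \<bullet> DK al ep (dx p) (dv p))"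
  using s(1) unfolding e X0 by (simp add: V_def[abs_def])
 show "integrable (g t) (%z. snd z \<bullet> ux ep t (fst z) (G z) - G z \<bullet> w ep t (fst z))" unfolding e by (rule s(3))
qed

text \<open>Time, position and label of a phase space point: the coordinates in which the equation becomes linear
transport.\<close>

definition lab :: "real => real => 'a \<times> 'a => real \<times> ('a \<times> 'a)" where
 "lab ep t z = (t, (fst z, snd z + u ep t (fst z)))"

lemma continuous_lab [continuous_intros]:
 "continuous_on S a ==> continuous_on S b ==> continuous_on S (%p. lab ep (a p) (b p))"
 unfolding lab_def by (intro continuous_intros)

context
 fixes Ph :: "real \<times> ('a \<times> 'a) => real" and dPh :: "real \<times> ('a \<times> 'a) => real \<times> ('a \<times> 'a)" and ta L B r :: real
 assumes ta: "0 < ta" "ta < T" and der: "!!p. (Ph has_derivative (%k. dPh p \<bullet> k)) (at p)"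
  and lip: "!!p q. norm (dPh p - dPh q) <= L * norm (p - q)" and B: "!!p. \<bar>Ph p\<bar> <= B" "!!p. norm (dPh p) <= B"
  and supp: "!!t z. r <= norm z ==> Ph (t, z) = 0 \<and> dPh (t, z) = 0"
begin

lemma L_nonneg: "0 <= L" using lip[of "(1, 0)" 0] norm_ge_zero[of "dPh (1, 0) - dPh 0"] by (simp add: norm_Pair del: norm_ge_zero)

lemma continuous_dPh [continuous_intros]: "continuous_on S f ==> continuous_on S (%x. dPh (f x))"
 using lipschitz_on_continuous_on[OF lipschitz_onI, of UNIV dPh L] lip L_nonneg
 by (auto simp: dist_norm intro: continuous_on_compose2)

lemma continuous_Ph [continuous_intros]: "continuous_on S f ==> continuous_on S (%x. Ph (f x))"
 by (rule continuous_on_compose2[OF has_derivative_continuous_on[OF der] _ subset_UNIV])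

text \<open>The derivative of \<open>Ph\<close> in the label.\<close>

definition Gom :: "real => real => 'a \<times> 'a => 'a" where "Gom ep t z = snd (snd (dPh (lab ep t z)))"

lemma Gom_bound: "norm (Gom ep t z) <= B"
 unfolding Gom_def by (rule order_trans[OF norm_snd_le_norm order_trans[OF norm_snd_le_norm B(2)]])

lemma Gom_close: "norm (Gom ep t z - Gom ep t z') <= L * (norm (fst z - fst z') + norm (snd z - snd z') + norm (u ep t (fst z) - u ep t (fst z')))"
proof -
 have "norm (Gom ep t z - Gom ep t z') <= norm (dPh (lab ep t z) - dPh (lab ep t z'))"
  unfolding Gom_def snd_diff[symmetric] by (rule order_trans[OF norm_snd_le_norm norm_snd_le_norm])
 also have "\<dots> <= L * norm (lab ep t z - lab ep t z')" by (rule lip)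
 also have "norm (lab ep t z - lab ep t z') <= norm (fst z - fst z') + norm ((snd z - snd z') + (u ep t (fst z) - u ep t (fst z')))"
  unfolding lab_def using norm_Pair_le[of "fst z - fst z'" "(snd z + u ep t (fst z)) - (snd z' + u ep t (fst z'))"]
  by (simp add: norm_Pair algebra_simps)
 also have "\<dots> <= norm (fst z - fst z') + norm (snd z - snd z') + norm (u ep t (fst z) - u ep t (fst z'))"
  using norm_triangle_ineq by (simp add: add.assoc)
 finally show ?thesis using L_nonneg by (simp add: mult_left_mono)
qed

text \<open>For positive \<open>ep\<close> the composition with \<open>lab\<close> is an admissible test function; the derivatives of the field
\<open>u ep\<close> produce the alignment term with the regularized Hessian, opposite to the true one.\<close>

lemma transport_regularized:
 assumes ep: "0 < ep"
 shows "(LINT z|g ta. Ph (lab ep ta z)) - (LINT z|f0. Ph (lab ep 0 z)) =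
  (LINT t:{0..<ta}|lborel. (LINT z|g t. dPh (lab ep t z) \<bullet> (1, (snd z, 0)))
    + 1 / 2 * (LINT p|gg t. (Gom ep t (fst p) - Gom ep t (snd p)) \<bullet> DK al ep (dx p) (dv p)))
  - 1 / 2 * (LINT t:{0..<ta}|lborel. (LINT p|gg t. (Gom ep t (fst p) - Gom ep t (snd p)) \<bullet> D2W al (dx p) (dv p)))"
proof -
 define c where "c = cD al * ep powr (- al)"
 have c: "0 <= c" using cD_pos[OF al] by (simp add: c_def)
 let ?P = "%p. lab ep (fst p) (snd p)" and ?G = "%p. Gom ep (fst p) (snd p)"
 let ?t = "%p. fst (dPh (?P p)) - ?G p \<bullet> w ep (fst p) (fst (snd p))"
 let ?x = "%p. fst (snd (dPh (?P p))) + ux ep (fst p) (fst (snd p)) (?G p)"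
 have ux0: "ux ep t x 0 = 0" for t x by (simp add: ux_def)
 have "(LINT z|g ta. (%p. Ph (?P p)) (ta, z)) - (LINT z|f0. (%p. Ph (?P p)) (0, z)) =
  (LINT t:{0..<ta}|lborel. (LINT z|g t. ?t (t, z) + snd z \<bullet> ?x (t, z)))
  - 1 / 2 * (LINT t:{0..<ta}|lborel. (LINT p|gg t. (?G (t, fst p) - ?G (t, snd p)) \<bullet> D2W al (dx p) (dv p)))"
 proof (rule balance[where L="L * (2 + c)" and r="r + (r + cH al * (2 + M2 + r))", OF ta])
  fix p :: "real \<times> ('a \<times> 'a)" assume p: "p : {0..<T} \<times> UNIV"
  have "(?P has_derivative (%k. (fst k, (fst (snd k), snd (snd k) + (- fst k *\<^sub>R w ep (fst p) (fst (snd p)) + ux ep (fst p) (fst (snd p)) (fst (snd k))))))) (at p within {0..<T} \<times> UNIV)"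
   unfolding lab_def using u_joint_derivative[OF ep p]
   by (intro has_derivative_Pair has_derivative_add has_derivative_fst has_derivative_snd has_derivative_ident) (simp add: case_prod_unfold)
  from has_derivative_compose[OF this der]
  show "((%p. Ph (?P p)) has_derivative (%(s, (xi, et)). ?t p * s + ?x p \<bullet> xi + ?G p \<bullet> et)) (at p within {0..<T} \<times> UNIV)"
  proof (rule has_derivative_eq_rhs, intro ext)
   fix k :: "real \<times> ('a \<times> 'a)"
   obtain s xi et where k: "k = (s, (xi, et))" by (metis surj_pair)
   have "ux ep (fst p) (fst (snd p)) (?G p) \<bullet> xi = ?G p \<bullet> ux ep (fst p) (fst (snd p)) xi"
    by (subst inner_commute) (rule ux_sym[OF ep])
   then show "dPh (?P p) \<bullet> (fst k, (fst (snd k), snd (snd k) + (- fst k *\<^sub>R w ep (fst p) (fst (snd p)) + ux ep (fst p) (fst (snd p)) (fst (snd k))))) = (%(s, (xi, et)). ?t p * s + ?x p \<bullet> xi + ?G p \<bullet> et) k"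
    by (simp add: k Gom_def inner_prod_def inner_diff_right inner_add_left inner_add_right left_diff_distrib)
  qed
 next
  fix t :: real and z :: "'a \<times> 'a" assume z: "r + (r + cH al * (2 + M2 + r)) <= norm z"
  have "r <= norm (snd (lab ep t z))"
  proof (rule ccontr)
   assume "\<not> r <= norm (snd (lab ep t z))"
   then have a: "norm (fst z) < r" "norm (snd z + u ep t (fst z)) < r"
    using norm_fst_le_norm[of "snd (lab ep t z)"] norm_snd_le_norm[of "snd (lab ep t z)"] by (auto simp: lab_def)
   have "norm (u ep t (fst z)) <= cH al * (2 + M2 + r)"
    using a by (intro order_trans[OF u_growth] mult_left_mono) (use cH_pos[OF al] in auto)
   moreover have "norm (snd z) <= norm (snd z + u ep t (fst z)) + norm (u ep t (fst z))" using norm_triangle_ineq4[of "snd z + u ep t (fst z)" "u ep t (fst z)"] by simp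
   ultimately show False using z a norm_Pair_le[of "fst z" "snd z"] by simp
  qed
  then show "Ph (?P (t, z)) = 0 \<and> ?t (t, z) = 0 \<and> ?x (t, z) = 0"
   using supp[of "snd (lab ep t z)" t] by (simp add: lab_def Gom_def ux0)
 next
  fix t :: real and z z' :: "'a \<times> 'a"
  have "norm (?G (t, z) - ?G (t, z')) <= L * (norm (fst z - fst z') + norm (snd z - snd z') + c * norm (fst z - fst z'))"
   unfolding c_def fst_conv snd_conv by (intro order_trans[OF Gom_close] mult_left_mono add_left_mono u_lipschitz ep L_nonneg)
  also have "\<dots> <= L * (norm (z - z') + norm (z - z') + c * norm (z - z'))"
   using norm_fst_le_norm[of "z - z'"] norm_snd_le_norm[of "z - z'"] c by (intro mult_left_mono add_mono L_nonneg) auto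
  finally show "norm (?G (t, z) - ?G (t, z')) <= L * (2 + c) * norm (z - z')" by (simp add: algebra_simps)
 qed (use L_nonneg c ep in \<open>auto simp: Gom_def intro!: continuous_intros continuous_ux\<close>)
 moreover have "(LINT z|g t. ?t (t, z) + snd z \<bullet> ?x (t, z)) = (LINT z|g t. dPh (lab ep t z) \<bullet> (1, (snd z, 0)))
    + 1 / 2 * (LINT p|gg t. (Gom ep t (fst p) - Gom ep t (snd p)) \<bullet> DK al ep (dx p) (dv p))" for t
 proof -
  have "(LINT z|g t. ?t (t, z) + snd z \<bullet> ?x (t, z)) = (LINT z|g t. dPh (lab ep t z) \<bullet> (1, (snd z, 0)) + (snd z \<bullet> ux ep t (fst z) (Gom ep t z) - Gom ep t z \<bullet> w ep t (fst z)))"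
   by (intro Bochner_Integration.integral_cong refl) (simp add: inner_prod_def inner_add_right inner_commute)
  also have "\<dots> = (LINT z|g t. dPh (lab ep t z) \<bullet> (1, (snd z, 0))) + (LINT z|g t. snd z \<bullet> ux ep t (fst z) (Gom ep t z) - Gom ep t z \<bullet> w ep t (fst z))"
  proof (rule Bochner_Integration.integral_add)
   have "norm (dPh (lab ep t z) \<bullet> (1, (snd z, 0))) <= B * (1 + norm z)" for z
   proof -
    have "norm (1 :: real, (snd z, 0 :: 'a)) <= 1 + norm z" using norm_Pair_le[of "1 :: real" "(snd z, 0 :: 'a)"] norm_snd_le_norm[of z] by (simp add: norm_Pair)
    then show ?thesis unfolding real_norm_def using order_trans[OF norm_ge_zero B(2)] by (intro order_trans[OF Cauchy_Schwarz_ineq2] mult_mono B) auto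
   qed
   then show "integrable (g t) (%z. dPh (lab ep t z) \<bullet> (1, (snd z, 0)))"
    by (rule g_linear_integrable[rotated]) (intro borel_measurable_continuous_onI continuous_intros)
  qed (rule symmetrized(2)[OF ep _ Gom_bound], unfold Gom_def, intro borel_measurable_continuous_onI continuous_intros)
  also have "(LINT z|g t. snd z \<bullet> ux ep t (fst z) (Gom ep t z) - Gom ep t z \<bullet> w ep t (fst z)) = 1 / 2 * (LINT p|gg t. (Gom ep t (fst p) - Gom ep t (snd p)) \<bullet> DK al ep (dx p) (dv p))"
   by (rule symmetrized(1)[OF ep _ Gom_bound], unfold Gom_def, intro borel_measurable_continuous_onI continuous_intros)
  finally show ?thesis .
 qed
 ultimately show ?thesis by simp
qed

text \<open>Both alignment terms converge to the same limit by \<open>alignment_limit\<close> and cancel. This is where the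
integrability of label differences at all times enters for an arbitrary weak solution.\<close>

lemma transport:
 "(LINT z|g ta. Ph (lab 0 ta z)) - (LINT z|f0. Ph (lab 0 0 z)) = (LINT t:{0..<ta}|lborel. (LINT z|g t. dPh (lab 0 t z) \<bullet> (1, (snd z, 0))))"
proof -
 have B0: "0 <= B" by (rule order_trans[OF norm_ge_zero B(2)[of 0]])
 interpret s: phase_curve al ta g Mx M2 E
 proof (intro phase_curve.intro dissipative_curve.intro phase_curve_axioms.intro)
  have "(nn_integral lborel (%t. (nn_integral (gg t) (%p. rate al p)) * indicator {0..ta} t)) <= (nn_integral lborel (%t. (nn_integral (gg t) (%p. rate al p)) * indicator {0..T} t))"
   using ta by (intro nn_integral_mono mult_left_mono) (auto simp: indicator_def)
  then show "(nn_integral lborel (%t. (nn_integral (gg t) (%p. rate al p)) * indicator {0..ta} t)) < \<infinity>" using diss by (rule le_less_trans)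
 qed (assumption | rule al ta(1) g_prob g_sets narrow xmom Mx mom om_energy E)+
 have ulim: "(%n. u (il.eps n) t x) ----> u 0 t x" for t x
 proof (rule LIM_zero_cancel, rule Lim_null_comparison[OF always_eventually il.kap_tendsto], rule allI)
  fix n show "norm (u (il.eps n) t x - u 0 t x) <= il.kap n"
   by (rule order_trans[OF u_eps il.eps_diff_kap(2)[OF order_refl]])
 qed
 have llim: "(%n. lab (il.eps n) t z) ----> lab 0 t z" for t z unfolding lab_def by (intro tendsto_intros ulim)
 have isC: "isCont Ph p" "isCont dPh p" for p
  using has_derivative_continuous[OF der] continuous_on_interior[OF continuous_dPh[OF continuous_on_id, of UNIV], of p] by simp_all
 have clim: "(%n. Ph (lab (il.eps n) t z)) ----> Ph (lab 0 t z)" "(%n. dPh (lab (il.eps n) t z)) ----> dPh (lab 0 t z)" for t z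
  using isCont_tendsto_compose[OF isC(1) llim] isCont_tendsto_compose[OF isC(2) llim] by blast+
 have meas: "(%z. Ph (lab ep t z)) : borel_measurable borel" "(%(t, z). Gom ep t z) : borel_measurable borel" for ep t
  unfolding Gom_def case_prod_unfold by (intro borel_measurable_continuous_onI continuous_intros)+
 have l1: "(%n. LINT z|N. Ph (lab (il.eps n) t z)) ----> (LINT z|N. Ph (lab 0 t z))" if N: "prob_space N" "sets N = sets borel" for N t
  by (rule integral_dominated_convergence[where w="%_. B"])
   (use meas(1) clim(1) B(1) N in \<open>auto simp: measurable_cong_sets[OF N(2) refl] finite_measure.integrable_const[OF prob_space.finite_measure]\<close>)
 have bd: "\<bar>dPh p \<bullet> (1, (snd z, 0))\<bar> <= B * (1 + norm z)" for p and z :: "'a \<times> 'a"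
 proof -
  have "norm (1 :: real, (snd z, 0 :: 'a)) <= 1 + norm z" using norm_Pair_le[of "1 :: real" "(snd z, 0 :: 'a)"] norm_snd_le_norm[of z] by (simp add: norm_Pair)
  then show ?thesis using B0 by (intro order_trans[OF Cauchy_Schwarz_ineq2] mult_mono B) auto
 qed
 have kc: "continuous_on UNIV (%(t, z). dPh (lab ep t z) \<bullet> (1, (snd z, 0)))" for ep
  unfolding case_prod_unfold by (intro continuous_intros)
 note t = kernel_g_dominated[OF kc kc bd tendsto_inner[OF clim(2) tendsto_const], of ta]
 have Gl: "(%n. Gom (il.eps n) t z) ----> Gom 0 t z" for t z unfolding Gom_def by (intro tendsto_intros clim)
 have Gb: "norm (Gom ep t (fst p) - Gom ep t (snd p)) <= L * (1 + cH al) * (norm (dx p) + norm (dv p) + norm (dx p) powr (1 - al))" for ep t p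
 proof -
  have "norm (Gom ep t (fst p) - Gom ep t (snd p)) <= L * (norm (dx p) + norm (dv p) + cH al * norm (dx p) powr (1 - al))"
   by (intro order_trans[OF Gom_close] mult_left_mono add_left_mono u_holder L_nonneg)
  also have "\<dots> <= L * ((1 + cH al) * (norm (dx p) + norm (dv p) + norm (dx p) powr (1 - al)))"
   using cH_pos[OF al] by (intro mult_left_mono L_nonneg) (simp add: algebra_simps)
  finally show ?thesis by (simp add: mult.assoc)
 qed
 have L1: "0 <= L * (1 + cH al)" using L_nonneg cH_pos[OF al] by simp
 note a = s.alignment_limit[where A="%n. Gom (il.eps n)" and ?A0.0="Gom 0", OF meas(2) meas(2) L1 Gb Gl]
 note a1 = a(1)[OF il.eps_tendsto] and a2 = a(1)[of "%_. 0", unfolded DK_0, OF tendsto_const]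
 have "(%n. (LINT z|g ta. Ph (lab (il.eps n) ta z)) - (LINT z|f0. Ph (lab (il.eps n) 0 z))) ----> (LINT z|g ta. Ph (lab 0 ta z)) - (LINT z|f0. Ph (lab 0 0 z))"
  by (intro tendsto_diff l1 g_prob g_sets il.f0 il.sets_f0)
 moreover have "(%n. (LINT z|g ta. Ph (lab (il.eps n) ta z)) - (LINT z|f0. Ph (lab (il.eps n) 0 z))) \<longlonglongrightarrow>
   (LINT t:{0..<ta}|lborel. (LINT z|g t. dPh (lab 0 t z) \<bullet> (1, (snd z, 0)))) + 1 / 2 * (LINT t:{0..<ta}|lborel. (LINT p|gg t. (Gom 0 t (fst p) - Gom 0 t (snd p)) \<bullet> D2W al (dx p) (dv p)))
   - 1 / 2 * (LINT t:{0..<ta}|lborel. (LINT p|gg t. (Gom 0 t (fst p) - Gom 0 t (snd p)) \<bullet> D2W al (dx p) (dv p)))" (is "_ ----> ?R")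
 proof -
  have "(LINT z|g ta. Ph (lab (il.eps n) ta z)) - (LINT z|f0. Ph (lab (il.eps n) 0 z)) = (LINT t:{0..<ta}|lborel. (LINT z|g t. dPh (lab (il.eps n) t z) \<bullet> (1, (snd z, 0))))
    + 1 / 2 * (LINT t:{0..<ta}|lborel. (LINT p|gg t. (Gom (il.eps n) t (fst p) - Gom (il.eps n) t (snd p)) \<bullet> DK al (il.eps n) (dx p) (dv p)))
    - 1 / 2 * (LINT t:{0..<ta}|lborel. (LINT p|gg t. (Gom (il.eps n) t (fst p) - Gom (il.eps n) t (snd p)) \<bullet> D2W al (dx p) (dv p)))" for n
   unfolding transport_regularized[OF il.eps_pos]
   by (subst set_integral_add(2)[OF t(2) set_integrable_mult_right]) (use a(2)[OF il.eps_tendsto] in \<open>auto simp: set_lebesgue_integral_def\<close>)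
  then show ?thesis by (simp only:) (intro tendsto_intros t(1) a1 a2)
 qed
 ultimately show ?thesis using LIMSEQ_unique by fastforce
qed

end

lemma lab_initial: "lab 0 0 z = (0, (fst z, il.label 0 z))"
proof -
 have "(%n. u (il.eps n) 0 x) ----> u 0 0 x" for x
 proof (rule LIM_zero_cancel, rule Lim_null_comparison[OF always_eventually il.kap_tendsto], rule allI)
  fix n show "norm (u (il.eps n) 0 x - u 0 0 x) <= il.kap n" by (rule order_trans[OF u_eps il.eps_diff_kap(2)[OF order_refl]])
 qed
 moreover have "(%n. u (il.eps n) 0 x) ----> convK al 0 f0 fst x" for x
 proof (rule LIM_zero_cancel, rule Lim_null_comparison[OF always_eventually il.kap_tendsto], rule allI)
  fix n
  have "u (il.eps n) 0 x = convK al (il.eps n) f0 fst x" using u_integral[OF il.eps_pos, of 0] T by simp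
  then show "norm (u (il.eps n) 0 x - convK al 0 f0 fst x) <= il.kap n"
   using convK_eps[OF al il.f0 il.fst_measurable(1) il.fst_integrable, of "il.eps n" x 0] il.eps_diff_kap(2)[of n n] by simp
 qed
 ultimately have "u 0 0 x = convK al 0 f0 fst x" for x by (rule LIMSEQ_unique)
 then show ?thesis by (simp add: lab_def il.label_def)
qed

end

section \<open>Uniqueness\<close>

lemma directional_derivative_le:
 fixes F :: "'b::euclidean_space => real"
 assumes der: "(F has_derivative (%k. G \<bullet> k)) (at p)" and h0: "0 < h0" and le: "!!h. 0 < h ==> h < h0 ==> \<bar>F (p + h *\<^sub>R v) - F p\<bar> <= c * h"
 shows "\<bar>G \<bullet> v\<bar> <= c"
proof -
 have "((%h :: real. p + h *\<^sub>R v) has_derivative (%h. h *\<^sub>R v)) (at 0)" by (auto intro!: derivative_eq_intros)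
 from has_derivative_compose[OF this, of F "%k. G \<bullet> k"] der
 have "((%h. F (p + h *\<^sub>R v)) has_real_derivative G \<bullet> v) (at 0)"
  by (simp add: has_field_derivative_def mult_commute_abs)
 then have "((%h. (F (p + h *\<^sub>R v) - F p) / h) \<longlongrightarrow> G \<bullet> v) (at 0)" by (simp add: DERIV_def)
 then have "((%h. \<bar>(F (p + h *\<^sub>R v) - F p) / h\<bar>) \<longlongrightarrow> \<bar>G \<bullet> v\<bar>) (at_right 0)"
  by (intro tendsto_rabs) (rule filterlim_mono[OF _ order_refl], auto simp: at_within_le_nhds intro: at_le)
 moreover have "\<forall>\<^sub>F h in at_right 0. \<bar>(F (p + h *\<^sub>R v) - F p) / h\<bar> <= c"
  using eventually_at_right_less h0
  by (intro eventually_at_rightI[of 0 h0]) (use le in \<open>auto simp: abs_divide pos_divide_le_eq\<close>)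
 ultimately show ?thesis by (intro tendsto_upperbound) auto
qed

context moving_curve
begin

text \<open>The starting time is the first component of the parameter \<open>p\<close>, so that the flow is jointly continuous in
starting time, position and label.\<close>

lemma flow_exists:
 assumes ep: "0 < ep"
 obtains Y :: "real => real \<times> ('a \<times> 'a) => 'a" where "continuous_on UNIV (%(r, p). Y r p)" "Y 0 = (%p. fst (snd p))" "EX C. ALL r p. norm (Y r p) <= C * (1 + norm p)"
  "!!r p. r : {0..T + 1} ==> ((%r. Y r p) has_vector_derivative (snd (snd p) - u ep (fst p + r) (Y r p))) (at r within {0..T + 1})"
proof -
 define c where "c = cD al * ep powr (- al)"
 have c: "0 < c" using cD_pos[OF al] ep by (simp add: c_def)
 obtain Y :: "real => real \<times> ('a \<times> 'a) => 'a" where Y: "continuous_on UNIV (%(t, z). Y t z)" "!!t. Y (clamp_time 0 (T + 1) t) = Y t"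
  "Y 0 = (%p. fst (snd p))" "EX C. ALL t z. norm (Y t z) <= C * (1 + norm z)"
  "!!t z. t : {0..T + 1} ==> ((%t. Y t z) has_vector_derivative (%r X p. snd (snd p) - u ep (fst p + r) (X p)) t (Y t) z) (at t within {0..T + 1})"
 proof (rule picard[of 0 "T + 1" c "%z :: real \<times> ('a \<times> 'a). 1 + norm z" "%p. fst (snd p)" 1 "%r X p. snd (snd p) - u ep (fst p + r) (X p)" "1 + cH al * (2 + M2)"])
  fix t k :: real and X Z :: "real \<times> ('a \<times> 'a) => 'a" and p assume "!!p. norm (X p - Z p) <= k * (1 + norm p)"
  then have "norm (u ep (fst p + t) (Z p) - u ep (fst p + t) (X p)) <= c * (k * (1 + norm p))"
   using c unfolding c_def by (intro order_trans[OF u_lipschitz[OF ep]] mult_left_mono) (simp_all add: norm_minus_commute)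
  then show "norm ((snd (snd p) - u ep (fst p + t) (X p)) - (snd (snd p) - u ep (fst p + t) (Z p))) <= c * k * (1 + norm p)" by (simp add: mult.assoc)
 next
  fix t :: real and p :: "real \<times> ('a \<times> 'a)"
  have "norm (snd (snd p) - u ep (fst p + t) 0) <= norm p + cH al * (2 + M2 + norm (0 :: 'a))"
   by (intro order_trans[OF norm_triangle_ineq4] add_mono u_growth order_trans[OF norm_snd_le_norm norm_snd_le_norm])
  also have "\<dots> <= (1 + cH al * (2 + M2)) * (1 + norm p)"
   using order_trans[OF norm_ge_zero u_growth[of 0 0 0]] mult_nonneg_nonneg[OF order_trans[OF norm_ge_zero u_growth[of 0 0 0]] norm_ge_zero[of p]] by (simp add: algebra_simps)
  finally show "norm (snd (snd p) - u ep (fst p + t) 0) <= (1 + cH al * (2 + M2)) * (1 + norm p)" .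
 next
  fix X :: "real => real \<times> ('a \<times> 'a) => 'a" assume "continuous_on UNIV (%(t, z). X t z)"
  then show "continuous_on UNIV (%(t, p). snd (snd p) - u ep (fst p + clamp_time 0 (T + 1) t) (X t p))"
   unfolding case_prod_unfold by (intro continuous_intros)
 qed (use T c in \<open>auto intro!: continuous_intros order_trans[OF norm_fst_le_norm] order_trans[OF norm_snd_le_norm]\<close>)
 show ?thesis by (rule that[OF Y(1,3,4) Y(5)])
qed

context
 fixes n :: nat and Y :: "real => real \<times> ('a \<times> 'a) => 'a"
 assumes Yc: "continuous_on UNIV (%(r, p). Y r p)" and Y0: "Y 0 = (%p. fst (snd p))"
  and Yd: "!!r p. r : {0..T + 1} ==> ((%r. Y r p) has_vector_derivative (snd (snd p) - u (il.eps n) (fst p + r) (Y r p))) (at r within {0..T + 1})"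
begin

text \<open>Monotonicity of \<open>u\<close> makes the constant independent of the regularization.\<close>

lemma flow_contraction:
 assumes r: "r : {0..T + 1}"
 shows "norm (Y r (s, q) - Y r (s, q')) <= norm (fst q - fst q') + norm (snd q - snd q') * r"
proof -
 have "norm (Y r (s, q) - Y r (s, q')) <= norm (Y 0 (s, q) - Y 0 (s, q')) + norm (snd q - snd q') * (r - 0)"
 proof (rule norm_growth[where y="%r. Y r (s, q) - Y r (s, q')"])
  fix a assume a: "a : {0..r}"
  show "((%r. Y r (s, q) - Y r (s, q')) has_vector_derivative ((snd q - u (il.eps n) (s + a) (Y a (s, q))) - (snd q' - u (il.eps n) (s + a) (Y a (s, q'))))) (at a within {0..r})"
   using has_vector_derivative_within_subset[OF has_vector_derivative_diff[OF Yd[of a "(s, q)"] Yd[of a "(s, q')"]], of "{0..r}"] a r by auto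
  show "(Y a (s, q) - Y a (s, q')) \<bullet> ((snd q - u (il.eps n) (s + a) (Y a (s, q))) - (snd q' - u (il.eps n) (s + a) (Y a (s, q')))) <= norm (snd q - snd q') * norm (Y a (s, q) - Y a (s, q'))"
   using u_mono[of "il.eps n" "s + a" "Y a (s, q)" "Y a (s, q')"] norm_cauchy_schwarz[of "Y a (s, q) - Y a (s, q')" "snd q - snd q'"]
   by (simp add: inner_diff_right inner_diff_left inner_commute mult.commute)
 qed (use r in auto)
 then show ?thesis by (simp add: Y0)
qed

lemma flow_semigroup:
 assumes ar: "0 <= a" "0 <= r" "a + r <= T + 1"
 shows "Y r (s + a, (Y a (s, q), snd q)) = Y (a + r) (s, q)"
proof -
 let ?q = "(s + a, (Y a (s, q), snd q))"
 have "norm (Y (a + r) (s, q) - Y r ?q) <= norm (Y (a + 0) (s, q) - Y 0 ?q) + 0 * (r - 0)"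
 proof (rule norm_growth[where y="%r. Y (a + r) (s, q) - Y r ?q"])
  fix b assume b: "b : {0..r}"
  have "((%r. Y r (s, q)) has_vector_derivative snd q - u (il.eps n) (s + (a + b)) (Y (a + b) (s, q))) (at (a + b) within (%r. a + r) ` {0..r})"
   using has_vector_derivative_within_subset[OF Yd[of "a + b" "(s, q)"], of "(%r. a + r) ` {0..r}"] b ar by auto
  moreover have "((%r. a + r) has_vector_derivative 1) (at b within {0..r})" by (auto intro!: derivative_eq_intros)
  ultimately have "((%r. Y (a + r) (s, q)) has_vector_derivative snd q - u (il.eps n) (s + (a + b)) (Y (a + b) (s, q))) (at b within {0..r})"
   using vector_diff_chain_within[of "%r. a + r" 1 b "{0..r}"] by (fastforce simp: o_def)
  from has_vector_derivative_diff[OF this has_vector_derivative_within_subset[OF Yd[of b ?q]]] b ar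
  show "((%r. Y (a + r) (s, q) - Y r ?q) has_vector_derivative ((snd q - u (il.eps n) (s + (a + b)) (Y (a + b) (s, q))) - (snd q - u (il.eps n) (s + (a + b)) (Y b ?q)))) (at b within {0..r})"
   by (simp add: add.assoc)
  show "(Y (a + b) (s, q) - Y b ?q) \<bullet> ((snd q - u (il.eps n) (s + (a + b)) (Y (a + b) (s, q))) - (snd q - u (il.eps n) (s + (a + b)) (Y b ?q))) <= 0 * norm (Y (a + b) (s, q) - Y b ?q)"
   using u_mono[of "il.eps n" "s + (a + b)" "Y (a + b) (s, q)" "Y b ?q"] by (simp add: inner_diff_right inner_diff_left inner_commute)
 qed (use ar in auto)
 then show ?thesis by (simp add: Y0)
qed

text \<open>Trajectories that end in a bounded set start in a bounded set.\<close>

lemma flow_backward_bound: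
 assumes r: "r : {0..T + 1}" and R: "norm (snd q) <= R"
 shows "(norm (fst q))^2 <= exp (2 * (R + cH al * (3 + M2)) * r) * (1 + (norm (Y r (s, q)))^2)"
proof -
 define l where "l = R + cH al * (3 + M2)"
 let ?y = "%r. Y r (s, q)" and ?b = "%a. snd q - u (il.eps n) (s + a) (Y a (s, q))"
 let ?g' = "%a. exp (2 * l * a) * (2 * (?y a \<bullet> ?b a)) + exp (2 * l * a) * (2 * l) * (1 + (norm (?y a))^2)"
 have "- (exp (2 * l * r) * (1 + (norm (?y r))^2)) <= - (exp (2 * l * 0) * (1 + (norm (?y 0))^2)) + 0 * (r - 0)"
 proof (rule real_deriv_le[where g'="%a. - ?g' a"])
  fix a assume a: "a : {0..r}"
  have d: "(?y has_vector_derivative ?b a) (at a within {0..r})"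
   using has_vector_derivative_within_subset[OF Yd[of a "(s, q)"], of "{0..r}"] a r by auto
  have "((%a. 1 + (norm (?y a))^2) has_vector_derivative 0 + 2 * (?y a \<bullet> ?b a)) (at a within {0..r})"
   by (intro has_vector_derivative_add has_vector_derivative_const has_vector_derivative_norm_square d)
  then have 1: "((%a. 1 + (norm (?y a))^2) has_vector_derivative 2 * (?y a \<bullet> ?b a)) (at a within {0..r})" by simp
  have "((%a. exp (2 * l * a)) has_real_derivative exp (2 * l * a) * (2 * l)) (at a within {0..r})" by (auto intro!: derivative_eq_intros)
  from has_vector_derivative_minus[OF has_vector_derivative_mult[OF this[unfolded has_real_derivative_iff_has_vector_derivative] 1]]
  show "((%a. - (exp (2 * l * a) * (1 + (norm (?y a))^2))) has_vector_derivative - ?g' a) (at a within {0..r})" .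
  have "- (?y a \<bullet> ?b a) <= norm (?y a) * norm (?b a)" using Cauchy_Schwarz_ineq2[of "?y a" "?b a"] by simp
  also have "\<dots> <= norm (?y a) * (R + cH al * (2 + M2 + norm (?y a)))"
   by (intro mult_left_mono order_trans[OF norm_triangle_ineq4] add_mono R u_growth) simp
  also have "\<dots> = (R + cH al * (2 + M2)) * norm (?y a) + cH al * (norm (?y a))^2" by (simp add: algebra_simps power2_eq_square)
  also have "\<dots> <= (R + cH al * (2 + M2)) * (1 + (norm (?y a))^2) + cH al * (1 + (norm (?y a))^2)"
   using order_trans[OF norm_ge_zero R] order_trans[OF norm_ge_zero u_growth[of 0 0 0]] cH_pos[OF al]
   by (intro add_mono mult_left_mono le_one_plus_square) auto
  also have "\<dots> = l * (1 + (norm (?y a))^2)" by (simp add: l_def algebra_simps)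
  finally have "0 <= exp (2 * l * a) * (2 * (?y a \<bullet> ?b a + l * (1 + (norm (?y a))^2)))" by simp
  then show "- ?g' a <= 0" by (simp add: algebra_simps)
 qed (use r in auto)
 then show ?thesis by (simp add: Y0 l_def)
qed

end

end

lemma mean_le:
 fixes f :: "'b::euclidean_space => real"
 assumes N: "prob_space N" "sets N = sets borel" and f: "f : borel_measurable borel" and c: "c : borel_measurable borel"
  and b: "!!z. \<bar>f z\<bar> <= B" "!!z. \<bar>c z\<bar> <= B" and le: "!!z. \<bar>f z - c z\<bar> <= k"
 shows "\<bar>(LINT z|N. f z) - (LINT z|N. c z)\<bar> <= k"
proof -
 interpret prob_space N by (rule N)
 have i: "integrable N f" "integrable N c" using f c b by (auto intro!: integrable_const_bound[where B=B] simp: measurable_cong_sets[OF N(2) refl])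
 have "\<bar>LINT z|N. f z - c z\<bar> <= (LINT z|N. k)"
  by (rule order_trans[OF integral_abs_bound integral_mono]) (use i le in auto)
 then show ?thesis using i prob_space by simp
qed

lemma continuous_on_joint:
 assumes "continuous_on UNIV (%(r, p). Y r p)" "continuous_on A a" "continuous_on A b"
 shows "continuous_on A (%x. Y (a x) (b x))"
 using continuous_on_compose2[OF assms(1) continuous_on_Pair[OF assms(2,3)] subset_UNIV] by simp

lemma compact_support_bounded:
 fixes f :: "'b::euclidean_space => 'c::real_normed_vector"
 assumes f: "continuous_on UNIV f" "!!z. r <= norm z ==> f z = 0"
 obtains B where "!!z. norm (f z) <= B"
proof -
 have "bounded (f ` cball 0 r)" by (intro compact_imp_bounded compact_continuous_image continuous_on_subset[OF f(1)]) auto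
 then obtain B where B: "ALL z:cball 0 r. norm (f z) <= B" unfolding bounded_iff by auto
 have "norm (f z) <= \<bar>B\<bar>" for z using B f(2)[of z] by (cases "norm z <= r") (auto intro!: order_trans[OF bspec[OF B] abs_ge_self])
 then show ?thesis by (rule that)
qed

lemma uniformly_close:
 fixes f :: "'b::heine_borel => 'c::metric_space"
 assumes "continuous_on UNIV f" "compact S" "0 < e"
 obtains d where "0 < d" "!!p q. p : S ==> q : S ==> dist p q < d ==> dist (f p) (f q) <= e"
 using compact_uniformly_continuous[OF continuous_on_subset[OF assms(1) subset_UNIV] assms(2)] assms(3)
 unfolding uniformly_continuous_on_def by (metis less_imp_le dist_commute)

lemma lipschitz_continuous:
 fixes f :: "'b::real_normed_vector => real"
 assumes "!!z z'. \<bar>f z - f z'\<bar> <= L * norm (z - z')" and "continuous_on S h"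
 shows "continuous_on S (%x. f (h x))"
proof (rule continuous_on_compose2[OF _ assms(2) subset_UNIV])
 show "continuous_on UNIV f"
  by (rule lipschitz_on_continuous_on[OF lipschitz_onI[where L="\<bar>L\<bar>"]])
   (use order_trans[OF assms(1) mult_right_mono[OF abs_ge_self norm_ge_zero]] in \<open>auto simp: dist_norm\<close>)
qed

context moving_curve
begin

context
 fixes n :: nat and Y :: "real => real \<times> ('a \<times> 'a) => 'a"
 assumes Yc: "continuous_on UNIV (%(r, p). Y r p)" and Y0: "Y 0 = (%p. fst (snd p))"
  and Yd: "!!r p. r : {0..T + 1} ==> ((%r. Y r p) has_vector_derivative (snd (snd p) - u (il.eps n) (fst p + r) (Y r p))) (at r within {0..T + 1})"
begin

text \<open>Up to regularization, the function \<open>ph (Y (ta - s) (s, y, om), om)\<close> of \<open>(s, y, om)\<close> solves the backward transport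
equation with final value \<open>ph\<close>, so \<open>transport\<close> applied to it would give equality. It is merely Lipschitz
and is therefore mollified. Since \<open>flow_contraction\<close> bounds its Lipschitz constant in \<open>y\<close> independently of
the regularization, replacing the regularized field by the true one costs a multiple of \<open>kap n\<close> only.\<close>

lemma dual_estimate:
 fixes ph :: "'a \<times> 'a => real"
 assumes ta: "0 < ta" "ta < T" and phr: "!!z. r <= norm z ==> ph z = 0" and phL: "!!z z'. \<bar>ph z - ph z'\<bar> <= L * norm (z - z')"
 shows "\<bar>(LINT z|g ta. ph (snd (lab 0 ta z))) - (LINT z|f0. ph (Y ta (lab 0 0 z), snd (snd (lab 0 0 z))))\<bar> <= (4 + 2 * L * T) * il.kap n"
proof -
 define k where "k = il.kap n"
 have k: "0 < k" using il.kap_pos by (simp add: k_def)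
 obtain e1 :: "'a \<times> 'a" where "e1 : Basis" using nonempty_Basis by blast
 then have L: "0 <= L" using phL[of e1 0] norm_Basis[of e1] order_trans[OF abs_ge_zero] by fastforce
 define S where "S = T + 1"
 \<comment> \<open>a cutoff in the starting time, equal to 1 in the relevant range, makes the support bounded\<close>
 define ct where "ct s = max 0 (min 1 (T + 3 - \<bar>s\<bar>))" for s :: real
 have ct: "ct s = 1" if "\<bar>s\<bar> <= T + 2" for s using that by (simp add: ct_def)
 \<comment> \<open>the shift d of the final time leaves room for the mollification: starting times up to ta + dl then give nonnegative durations\<close>
 define F where "F = (%(d :: real, p). ct (fst p) * ph (Y (clamp_time 0 S (ta + d - fst p)) p, snd (snd p)))"
 note [continuous_intros] = continuous_on_joint[OF Yc]
 have Fc: "continuous_on UNIV F"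
  unfolding F_def ct_def case_prod_unfold by (intro continuous_intros lipschitz_continuous[OF phL])
 define r1 where "r1 = T + 3 + (1 + exp (2 * (\<bar>r\<bar> + cH al * (3 + M2)) * S) * (1 + r^2)) + \<bar>r\<bar>"
 have M20: "0 <= cH al * (3 + M2)" using order_trans[OF norm_ge_zero u_growth[of 0 0 0]] cH_pos[OF al] by (simp add: algebra_simps)
 have F0: "F (d, p) = 0" if p: "r1 <= norm p" for d p
 proof (rule ccontr)
  obtain s y om where pe: "p = (s, (y, om))" by (metis surj_pair)
  let ?m = "clamp_time 0 S (ta + d - s)"
  assume "F (d, p) ~= 0"
  then have s: "\<bar>s\<bar> < T + 3" and "\<not> r <= norm (Y ?m p, om)" using phr by (auto simp: F_def pe ct_def)
  then have a: "norm (Y ?m p) < r" "norm om < r" using norm_fst_le_norm[of "(Y ?m p, om)"] norm_snd_le_norm[of "(Y ?m p, om)"] by auto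
  have m: "?m : {0..T + 1}" unfolding S_def using T by (intro clamp_time) auto
  have "(norm y)^2 <= exp (2 * (\<bar>r\<bar> + cH al * (3 + M2)) * ?m) * (1 + (norm (Y ?m p))^2)"
   using flow_backward_bound[OF Yc Y0 Yd m, of "(y, om)" "\<bar>r\<bar>" s] a by (simp add: pe)
  also have "\<dots> <= exp (2 * (\<bar>r\<bar> + cH al * (3 + M2)) * S) * (1 + r^2)"
   using m M20 a by (intro mult_mono add_left_mono power_mono iffD2[OF exp_le_cancel_iff] mult_left_mono) (auto simp: S_def)
  finally have "norm y <= 1 + exp (2 * (\<bar>r\<bar> + cH al * (3 + M2)) * S) * (1 + r^2)" using le_one_plus_square[of "norm y"] by linarith
  moreover have "norm p <= \<bar>s\<bar> + (norm y + norm om)" unfolding pe using norm_Pair_le[of s "(y, om)"] norm_Pair_le[of y om] by simp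
  ultimately show False using p s a unfolding r1_def by linarith
 qed
 have r1: "3 <= r1" using T by (simp add: r1_def)
 define b where "b p = snd (snd p) - u (il.eps n) (fst p) (fst (snd p))" for p
 have bc: "continuous_on UNIV b" unfolding b_def[abs_def] by (intro continuous_intros)
 \<comment> \<open>d1 is the scale of uniform continuity of F, d2 that of the field; dl must resolve both\<close>
 obtain d1 where d1: "0 < d1" "!!p q. p : cball 0 1 \<times> cball 0 (r1 + 2) ==> q : cball 0 1 \<times> cball 0 (r1 + 2) ==> dist p q < d1 ==> dist (F p) (F q) <= k"
  by (rule uniformly_close[OF Fc _ k, of "cball 0 1 \<times> cball 0 (r1 + 2)"]) (auto intro: compact_Times)
 obtain d2' where d2': "0 < d2'" "!!p q. p : cball 0 (r1 + 3) ==> q : cball 0 (r1 + 3) ==> dist p q < d2' ==> dist (b p) (b q) <= k"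
  using uniformly_close[OF bc compact_cball[of 0 "r1 + 3"] k] by blast
 define d2 where "d2 = min d2' 1"
 have d2: "0 < d2" "d2 <= 1" "d2 <= d2'" using d2' by (auto simp: d2_def)
 define dl where "dl = min (min (d1 / 2) (d2 / 4)) (1 / 4)"
 have dl: "0 < dl" "dl < d1" "dl <= d2 / 4" "dl <= 1 / 4" using d1 d2 by (auto simp: dl_def min_less_iff_disj)
 define Fdl where "Fdl p = F (dl, p)" for p
 have Fdl: "continuous_on UNIV Fdl" "!!p. r1 <= norm p ==> Fdl p = 0"
  unfolding Fdl_def using F0 by (auto intro!: continuous_on_compose2[OF Fc] continuous_intros)
 note moll = dl(1) Fdl
 define Ph dPh where "Ph = mollify dl Fdl" and "dPh = dmollify dl Fdl"
 have der: "(Ph has_derivative (%k. dPh p \<bullet> k)) (at p)" for p unfolding Ph_def dPh_def by (rule mollify_deriv[OF moll])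
 have supp: "Ph p = 0" "dPh p = 0" if "r1 + dl <= norm p" for p unfolding Ph_def dPh_def using mollify_support[OF moll that] by auto
 obtain L' where "L'-lipschitz_on UNIV dPh" using dmollify_lipschitz[OF moll] unfolding dPh_def by blast
 then have lip: "norm (dPh p - dPh q) <= L' * norm (p - q)" and dc: "continuous_on UNIV dPh" for p q
  using lipschitz_onD[of L' UNIV dPh p q] lipschitz_on_continuous_on by (auto simp: dist_norm)
 have Phc: "continuous_on UNIV Ph" by (rule has_derivative_continuous_on[OF der])
 obtain B1 B2 B3 where B: "!!p. norm (Ph p) <= B1" "!!p. norm (dPh p) <= B2" "!!z. norm (ph z) <= B3"
  by (metis compact_support_bounded[OF Phc supp(1)] compact_support_bounded[OF dc supp(2)] compact_support_bounded[OF lipschitz_continuous[OF phL continuous_on_id] phr])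
 have close: "\<bar>Ph p - F (0, p)\<bar> <= 2 * k" for p
 proof (cases "norm p <= r1 + 1")
  case True
  have "\<bar>Ph p - Fdl p\<bar> <= k"
   unfolding Ph_def
  proof (rule mollify_close[OF moll])
   fix q assume q: "norm (q - p) <= dl"
   then have "norm q <= r1 + 2" using True dl(4) norm_triangle_sub[of q p] by linarith
   then have "dist (F (dl, q)) (F (dl, p)) <= k"
    using True q dl by (intro d1(2)) (auto simp: dist_Pair_Pair dist_norm)
   then show "\<bar>Fdl q - Fdl p\<bar> <= k" by (simp add: Fdl_def dist_real_def)
  qed
  moreover have "dist (F (dl, p)) (F (0, p)) <= k" using True dl by (intro d1(2)) (auto simp: dist_Pair_Pair)
  ultimately show ?thesis by (simp add: Fdl_def dist_real_def)
 qed (use F0 supp dl k in auto)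
 have slope: "\<bar>dPh (lab 0 t z) \<bullet> (1, (snd z, 0))\<bar> <= L * (2 * k)" if t: "t : {0..<ta}" for t z
 proof (cases "r1 + dl <= norm (lab 0 t z)")
  case False
  define p where "p = lab 0 t z"
  have p: "norm p <= r1 + 1" using False dl by (simp add: p_def)
  have e4: "0 < d2 / 4" using d2 by simp
  obtain d3 where d3: "0 < d3" "!!q q'. q : cball 0 1 \<times> cball 0 (r1 + 2) ==> q' : cball 0 1 \<times> cball 0 (r1 + 2) ==> dist q q' < d3 ==>
    dist ((%(r, p). Y r p) q) ((%(r, p). Y r p) q') <= d2 / 4"
   using uniformly_close[OF Yc compact_Times[OF compact_cball[of 0 1] compact_cball[of 0 "r1 + 2"]] e4] by blast
  define h0 where "h0 = min (min d3 (ta - t)) (d2 / 4)"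
  have "h0 <= d2 / 4" unfolding h0_def by (rule min.cobounded2)
  then have h0: "0 < h0" "h0 <= d3" "h0 <= ta - t" "h0 <= d2 / 4" using d3 d2 t by (auto simp: h0_def)
  show ?thesis
  proof (rule directional_derivative_le[OF der h0(1)])
   fix h assume h: "0 < h" "h < h0"
   have "\<bar>Ph (p + h *\<^sub>R (1, (snd z, 0))) - Ph p\<bar> <= L * (2 * k * h)"
    unfolding Ph_def
   proof (rule mollify_shift_close[OF moll _ Fdl])
    fix q assume q: "norm (q - p) <= dl"
    obtain s y om where qe: "q = (s, (y, om))" by (metis surj_pair)
    have q2: "norm q <= r1 + 2" using q p dl(4) norm_triangle_sub[of q p] by linarith
    have s: "\<bar>s - t\<bar> <= dl" using order_trans[OF norm_fst_le_norm q] by (simp add: qe p_def lab_def)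
    define m where "m = ta + dl - s"
    have m: "h <= m" "m <= T + 1" using s h h0 t ta dl by (auto simp: m_def)
    have cl: "clamp_time 0 S m = m" "clamp_time 0 S (m - h) = m - h" using m h by (auto intro!: clamp_time simp: S_def)
    have ct1: "ct s = 1" "ct (s + h) = 1" using s t ta dl h h0 by (auto intro!: ct)
    \<comment> \<open>the flow started at q agrees after time h with a flow started at the moved point\<close>
    have "Y m q = Y (m - h) (s + h, (Y h q, om))"
    using flow_semigroup[OF Yc Y0 Yd, of h "m - h" s "(y, om)"] m h by (simp add: qe)
    then have 1: "Fdl q = ph (Y (m - h) (s + h, (Y h q, om)), om)" by (simp add: Fdl_def F_def qe ct1 cl flip: m_def)
    have cl2: "clamp_time 0 S (ta + dl - (s + h)) = m - h" using cl(2) by (simp add: m_def algebra_simps)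
    have 2: "Fdl (q + h *\<^sub>R (1, (snd z, 0))) = ph (Y (m - h) (s + h, (y + h *\<^sub>R snd z, om)), om)"
    by (simp add: Fdl_def F_def qe ct1 cl2)
    have "\<bar>Fdl (q + h *\<^sub>R (1, (snd z, 0))) - Fdl q\<bar> <= L * norm (Y (m - h) (s + h, (y + h *\<^sub>R snd z, om)) - Y (m - h) (s + h, (Y h q, om)))"
    unfolding 1 2 using phL[of "(_, om)" "(_, om)"] by (simp add: norm_Pair)
    also have "\<dots> <= L * norm ((y + h *\<^sub>R snd z) - Y h q)"
    using flow_contraction[OF Yc Y0 Yd, of "m - h" "s + h" "(y + h *\<^sub>R snd z, om)" "(Y h q, om)"] m h by (intro mult_left_mono L) auto
    also have "norm ((y + h *\<^sub>R snd z) - Y h q) <= norm ((y + 0 *\<^sub>R snd z) - Y 0 q) + 2 * k * (h - 0)"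
    proof (rule norm_growth[where y="%a. (y + a *\<^sub>R snd z) - Y a q"])
    fix a assume a: "a : {0..h}"
    define pa where "pa = (s + a, (Y a q, om))"
    have aT: "a : {0..T + 1}" "{0..h} \<subseteq> {0..T + 1}" using a m h by auto
    have "((%a. y + a *\<^sub>R snd z) has_vector_derivative snd z) (at a within {0..h})" by (auto intro!: derivative_eq_intros)
    from has_vector_derivative_diff[OF this has_vector_derivative_within_subset[OF Yd[OF aT(1)] aT(2), of q]]
    show "((%a. (y + a *\<^sub>R snd z) - Y a q) has_vector_derivative snd z - b pa) (at a within {0..h})" by (simp add: b_def pa_def qe)
    have "norm (Y a q - y) <= d2 / 4"
    using d3(2)[of "(a, q)" "(0, q)"] a h h0 d2 q2 by (simp add: dist_Pair_Pair Y0 qe dist_norm norm_Pair)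
    moreover have "norm (pa - q) <= \<bar>a\<bar> + norm (Y a q - y)"
    unfolding pa_def qe using norm_Pair_le[of a "(Y a q - y, 0 :: 'a)"] by (simp add: norm_Pair qe)
    ultimately have "norm (pa - q) <= d2 / 2" using a h h0 by auto
    then have pp: "norm (pa - p) <= 3 * d2 / 4" using norm_triangle_ineq[of "pa - q" "q - p"] q dl by simp
    then have "norm pa <= r1 + 3" using p d2 norm_triangle_sub[of pa p] by linarith
    then have "dist (b pa) (b p) <= k" using p pp d2 by (intro d2'(2)) (auto simp: dist_norm)
    moreover have "norm (b p - snd z) <= k"
    using order_trans[OF u_eps[of 0 t "fst z" "il.eps n"]] il.eps_diff_kap(2)[of n n] by (simp add: b_def p_def lab_def k_def abs_minus_commute)
    ultimately have "norm (snd z - b pa) <= 2 * k" using norm_triangle_ineq[of "b pa - b p" "b p - snd z"] by (simp add: dist_norm norm_minus_commute[of "snd z"])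
    then show "((y + a *\<^sub>R snd z) - Y a q) \<bullet> (snd z - b pa) <= 2 * k * norm ((y + a *\<^sub>R snd z) - Y a q)"
    by (intro order_trans[OF norm_cauchy_schwarz]) (simp add: mult.commute mult_right_mono)
    qed (use h k in auto)
    finally show "\<bar>Fdl (q + h *\<^sub>R (1, (snd z, 0))) - Fdl q\<bar> <= L * (2 * k * h)" using L by (simp add: Y0 qe mult_left_mono)
   qed
   then show "\<bar>Ph (lab 0 t z + h *\<^sub>R (1, (snd z, 0))) - Ph (lab 0 t z)\<bar> <= L * (2 * k) * h" by (simp add: p_def mult_ac)
  qed
 qed (use supp L k in simp)
 have tr: "(LINT z|g ta. Ph (lab 0 ta z)) - (LINT z|f0. Ph (lab 0 0 z)) = (LINT t:{0..<ta}|lborel. (LINT z|g t. dPh (lab 0 t z) \<bullet> (1, (snd z, 0))))"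
 proof (rule transport[OF ta der lip, of "max B1 B2" "r1 + dl"])
  show "\<bar>Ph p\<bar> <= max B1 B2" "norm (dPh p) <= max B1 B2" for p using B(1,2)[of p] by auto
  fix t and z :: "'a \<times> 'a" assume "r1 + dl <= norm z"
  then show "Ph (t, z) = 0 \<and> dPh (t, z) = 0" using norm_snd_le_norm[of "(t, z)"] supp[of "(t, z)"] by auto
 qed
 have "\<bar>LINT t:{0..<ta}|lborel. (LINT z|g t. dPh (lab 0 t z) \<bullet> (1, (snd z, 0)))\<bar> <= L * (2 * k) * ta"
 proof -
  have "AE t in lborel. t : {0..<ta} --> (AE z in g t. ennreal \<bar>dPh (lab 0 t z) \<bullet> (1, (snd z, 0))\<bar> <= ennreal (L * (2 * k)))"
   by (intro AE_I2 impI ennreal_leI slope)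
  from kernel_integral_le[OF this]
  have "ennreal \<bar>LINT t:{0..<ta}|lborel. (LINT z|g t. dPh (lab 0 t z) \<bullet> (1, (snd z, 0)))\<bar> <= ennreal (L * (2 * k)) * ennreal ta"
   using prob_space.emeasure_space_1[OF g_prob] ta by (simp add: nn_integral_cmult_indicator)
  then show ?thesis using L k ta by (simp add: ennreal_mult'[symmetric])
 qed
 also have "\<dots> <= L * (2 * k) * T" using L k ta by (intro mult_left_mono) auto
 finally have I: "\<bar>(LINT z|g ta. Ph (lab 0 ta z)) - (LINT z|f0. Ph (lab 0 0 z))\<bar> <= 2 * L * T * k" unfolding tr by (simp add: mult_ac)
 have Om: "(%z. Ph (lab 0 t z)) : borel_measurable borel" "(%z. ph (snd (lab 0 t z))) : borel_measurable borel"
  "(%z. ph (Y t (lab 0 0 z), snd (snd (lab 0 0 z)))) : borel_measurable borel" for t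
  by (intro borel_measurable_continuous_onI lipschitz_continuous[OF phL] continuous_on_compose2[OF Phc] continuous_intros subset_UNIV)+
 have e1: "F (0, lab 0 ta z) = ph (snd (lab 0 ta z))" for z
  using T ta ct[of ta] by (simp add: F_def lab_def clamp_time S_def Y0)
 have e2: "F (0, lab 0 0 z) = ph (Y ta (lab 0 0 z), snd (snd (lab 0 0 z)))" for z
  using T ta ct[of 0] by (simp add: F_def lab_def clamp_time S_def)
 have "\<bar>(LINT z|g ta. Ph (lab 0 ta z)) - (LINT z|g ta. ph (snd (lab 0 ta z)))\<bar> <= 2 * k"
  by (rule mean_le[where B="max B1 B3", OF g_prob g_sets Om(1,2)]) (use B(1,3) close[of "lab 0 ta _", unfolded e1] in \<open>auto simp: le_max_iff_disj\<close>)
 moreover have "\<bar>(LINT z|f0. Ph (lab 0 0 z)) - (LINT z|f0. ph (Y ta (lab 0 0 z), snd (snd (lab 0 0 z))))\<bar> <= 2 * k"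
  by (rule mean_le[where B="max B1 B3", OF il.f0 il.sets_f0 Om(1,3)]) (use B(1,3) close[of "lab 0 0 _", unfolded e2] in \<open>auto simp: le_max_iff_disj\<close>)
 moreover have "(4 + 2 * L * T) * il.kap n = 2 * k + 2 * k + 2 * L * T * k" by (simp add: k_def algebra_simps)
 ultimately show ?thesis using I by linarith
qed

end

text \<open>The flows of the regularized fields of \<open>g\<close> converge to a flow \<open>W\<close>, and by \<open>dual_estimate\<close> the law of
position and label under \<open>g t\<close> is the image of \<open>f0\<close> under \<open>W t\<close> and the initial label. So the field of \<open>g\<close>
is generated by \<open>W\<close> itself, which makes \<open>W\<close> a solution of the first-order system.\<close>

lemma curve_is_push:
 assumes X: "lagrangian al 0 f0 (il.label 0) T X" and t: "t : {0..T}"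
 shows "g t = il.push X t"
proof -
 define P where "P n Y \<longleftrightarrow> continuous_on UNIV (%(r, p). Y r p) \<and> Y 0 = (%p. fst (snd p)) \<and> (EX C. ALL r p. norm (Y r p) <= C * (1 + norm p)) \<and>
   (ALL r p. r : {0..T + 1} --> ((%r. Y r p) has_vector_derivative (snd (snd p) - u (il.eps n) (fst p + r) (Y r p))) (at r within {0..T + 1}))"
  for n and Y :: "real => real \<times> 'a \<times> 'a => 'a"
 have "EX Y. P n Y" for n unfolding P_def by (rule flow_exists[OF il.eps_pos, of n]) blast
 then obtain Y where "!!n. P n (Y n)" using choice[of P] by blast
 then have Yc: "!!n. continuous_on UNIV (%(r, p). Y n r p)" and Y0: "!!n. Y n 0 = (%p. fst (snd p))" and Yb: "!!n. EX C. ALL r p. norm (Y n r p) <= C * (1 + norm p)"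
  and Yd: "!!n r p. r : {0..T + 1} ==> ((%r. Y n r p) has_vector_derivative (snd (snd p) - u (il.eps n) (fst p + r) (Y n r p))) (at r within {0..T + 1})"
  unfolding P_def by blast+
 define c where "c = clamp_time 0 T"
 have c: "c t : {0..T}" "0 <= c t" "c t <= T" for t using clamp_time(1)[of 0 T t] T by (auto simp: c_def)
 have cid: "c t = t" if "t : {0..T}" for t using that by (simp add: c_def clamp_time)
 define Z where "Z n t z = Y n (c t) (lab 0 0 z)" for n t z
 have lb: "fst (lab 0 0 z) = 0" "fst (snd (lab 0 0 z)) = fst z" "snd (snd (lab 0 0 z)) = il.label 0 z" for z by (simp_all add: lab_initial)
 have Zd: "((%t. Z n t z) has_vector_derivative il.label 0 z - u (il.eps n) s (Z n s z)) (at s within {0..T})" if s: "s : {0..T}" for n s z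
 proof (rule has_vector_derivative_transform[OF s])
  show "((%t. Y n t (lab 0 0 z)) has_vector_derivative il.label 0 z - u (il.eps n) s (Z n s z)) (at s within {0..T})"
   using has_vector_derivative_within_subset[OF Yd[of s n "lab 0 0 z"], of "{0..T}"] s by (auto simp: Z_def cid lb)
 qed (simp add: Z_def cid)
 have Zc: "continuous_on UNIV (%(t, z). Z n t z)" for n
  unfolding Z_def c_def case_prod_unfold by (intro continuous_on_joint[OF Yc] continuous_intros)
 have cauchy: "norm (Z n t z - Z m t z) <= T * il.kap N" if nm: "N <= n" "N <= m" for N n m t z
 proof -
  have "norm (Z n (c t) z - Z m (c t) z) <= norm (Z n 0 z - Z m 0 z) + il.kap N * (c t - 0)"
  proof (rule norm_growth[where y="%t. Z n t z - Z m t z", OF c(2)])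
   fix s assume s: "s : {0..c t}"
   then have sT: "s : {0..T}" "{0..c t} \<subseteq> {0..T}" using c[of t] by auto
   let ?D = "Z n s z - Z m s z" and ?e = "u (il.eps n) s (Z m s z) - u (il.eps m) s (Z m s z)"
   show "((%t. Z n t z - Z m t z) has_vector_derivative (il.label 0 z - u (il.eps n) s (Z n s z)) - (il.label 0 z - u (il.eps m) s (Z m s z))) (at s within {0..c t})"
    by (intro has_vector_derivative_diff has_vector_derivative_within_subset[OF Zd[OF sT(1)] sT(2)])
   have "norm ?e <= il.kap N" by (rule order_trans[OF u_eps il.eps_diff_kap(1)[OF nm]])
   then have "- (?D \<bullet> ?e) <= il.kap N * norm ?D"
    using Cauchy_Schwarz_ineq2[of ?D ?e] mult_left_mono[of "norm ?e" "il.kap N" "norm ?D"] by (simp add: mult.commute)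
   then show "?D \<bullet> ((il.label 0 z - u (il.eps n) s (Z n s z)) - (il.label 0 z - u (il.eps m) s (Z m s z))) <= il.kap N * norm ?D"
    using u_mono[of "il.eps n" s "Z n s z" "Z m s z"] by (simp add: inner_diff_right inner_diff_left inner_commute)
  qed (use il.kap_pos[of N] in simp)
  also have "\<dots> <= T * il.kap N" using c[of t] il.kap_pos[of N] T by (simp add: Z_def cid Y0 mult.commute mult_right_mono)
  finally show ?thesis using c[of t] by (simp add: Z_def cid)
 qed
 have gp: "(%n. T * il.kap n) ----> 0" using tendsto_mult[OF tendsto_const[of T] il.kap_tendsto] by simp
 have Zb: "EX C. ALL t z. norm (Z 0 t z) <= C * (1 + norm z)"
 proof -
  obtain C where C: "!!r p. norm (Y 0 r p) <= C * (1 + norm p)" using Yb by blast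
  obtain C' where C': "!!z. norm (il.label 0 z) <= C' * (1 + norm z)" using il.label_bound by blast
  have C0: "0 <= C" using order_trans[OF norm_ge_zero C[of 0 0]] by simp
  have "norm (Z 0 t z) <= (C * (2 + C')) * (1 + norm z)" for t z
  proof -
   have "norm (lab 0 0 z) <= norm z + C' * (1 + norm z)"
    using norm_Pair_le[of "fst z" "il.label 0 z"] C'[of z] norm_fst_le_norm[of z] by (simp add: lab_initial norm_Pair[of 0])
   then have "1 + norm (lab 0 0 z) <= (2 + C') * (1 + norm z)" using norm_ge_zero[of z] by (simp only: algebra_simps mult_1 mult_1_right)
   then show ?thesis using order_trans[OF C mult_left_mono[OF _ C0]] by (simp add: Z_def mult.assoc)
  qed
  then show ?thesis by blast
 qed
 obtain W where W: "!!t z. (%n. Z n t z) ----> W t z" "!!n t z. norm (Z n t z - W t z) <= T * il.kap n"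
  "continuous_on UNIV (%(t, z). W t z)" "EX C. ALL t z. norm (W t z) <= C * (1 + norm z)"
  by (rule uniform_limit_of_curves[where x=Z and p="%z. 1 + norm z", OF Zc gp cauchy Zb]) auto
 have Wd: "((%t. W t z) has_vector_derivative il.label 0 z - u 0 s (W s z)) (at s within {0..T})" if s: "s : {0..T}" for s z
 proof (rule derivative_of_limit[OF Zd W(1) _ _ s])
  fix n s
  have "norm ((il.label 0 z - u (il.eps n) s (Z n s z)) - (il.label 0 z - u 0 s (W s z))) = norm ((u (il.eps n) s (Z n s z) - u 0 s (Z n s z)) + (u 0 s (Z n s z) - u 0 s (W s z)))"
   by (simp add: norm_minus_commute)
  also have "\<dots> <= il.kap n + cH al * (T * il.kap n) powr (1 - al)"
   using al cH_pos[OF al]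
   by (intro norm_triangle_le add_mono order_trans[OF u_eps il.eps_diff_kap(2)[OF order_refl]] order_trans[OF u_holder] mult_left_mono powr_mono2 W(2)) auto
  finally show "norm ((il.label 0 z - u (il.eps n) s (Z n s z)) - (il.label 0 z - u 0 s (W s z))) <= il.kap n + cH al * (T * il.kap n) powr (1 - al)" .
 next
  have "(%n. (T * il.kap n) powr (1 - al)) ----> 0"
   using al T il.kap_pos by (intro tendsto_zero_powrI[OF gp tendsto_const]) (auto intro!: always_eventually less_imp_le)
  then have "(%n. il.kap n + cH al * (T * il.kap n) powr (1 - al)) ----> 0 + cH al * 0" by (intro tendsto_intros il.kap_tendsto)
  then show "(%n. il.kap n + cH al * (T * il.kap n) powr (1 - al)) ----> 0" by simp
 qed
 have Wm: "(%z. (W t z, il.label 0 z)) : f0 \<rightarrow>\<^sub>M borel" for t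
  by (intro borel_measurable_Pair il.flow_measurable[OF W(3,4)]) (simp add: measurable_cong_sets[OF il.sets_f0 refl] borel_measurable_continuous_onI[OF il.continuous_label])
 have labm: "(%z. snd (lab 0 t z)) : g t \<rightarrow>\<^sub>M borel" for t
  unfolding measurable_g by (intro borel_measurable_continuous_onI continuous_intros)
 have law: "distr (g t) borel (%z. snd (lab 0 t z)) = distr f0 borel (%z. (W t z, il.label 0 z))" if t: "t : {0<..<T}" for t
 proof (rule prob_measure_eqI_lipschitz[OF prob_space.prob_space_distr[OF g_prob labm] sets_distr prob_space.prob_space_distr[OF il.f0 Wm] sets_distr])
  fix ph :: "'a \<times> 'a => real" and r L assume ph: "!!z. r <= norm z ==> ph z = 0" "!!z z'. \<bar>ph z - ph z'\<bar> <= L * norm (z - z')"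
  note pc = lipschitz_continuous[OF ph(2)]
  have pm: "ph : borel_measurable borel" by (rule borel_measurable_continuous_onI[OF pc[OF continuous_on_id[of UNIV]]])
  obtain B where B: "!!z. norm (ph z) <= B" using compact_support_bounded[OF pc[OF continuous_on_id[of UNIV]] ph(1)] by blast
  have tT: "c t = t" using t by (simp add: cid)
  have m: "(%z. ph (Z n t z, il.label 0 z)) : borel_measurable f0" for n
   using continuous_on_slice[OF Zc, of n t] unfolding measurable_cong_sets[OF il.sets_f0 refl]
   by (intro borel_measurable_continuous_onI pc continuous_on_Pair il.continuous_label) simp
  have "(%n. LINT z|f0. ph (Z n t z, il.label 0 z)) ----> (LINT z|f0. ph (W t z, il.label 0 z))"
  proof (rule integral_dominated_convergence[where w="%_. B"])
   show "AE z in f0. (%n. ph (Z n t z, il.label 0 z)) ----> ph (W t z, il.label 0 z)"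
    by (rule AE_I2, rule continuous_on_tendsto_compose[OF pc[OF continuous_on_id[of UNIV]] tendsto_Pair[OF W(1) tendsto_const]]) auto
  qed (use m B measurable_compose[OF Wm pm] finite_measure.integrable_const[OF prob_space.finite_measure[OF il.f0]] in auto)
  moreover have "(%n. LINT z|f0. ph (Z n t z, il.label 0 z)) ----> (LINT z|g t. ph (snd (lab 0 t z)))"
  proof (rule LIM_zero_cancel, rule Lim_null_comparison[OF always_eventually], rule allI)
   show "norm ((LINT z|f0. ph (Z n t z, il.label 0 z)) - (LINT z|g t. ph (snd (lab 0 t z)))) <= (4 + 2 * L * T) * il.kap n" for n
    using dual_estimate[OF Yc Y0 Yd, of t r ph L n] t ph by (simp add: Z_def tT lb abs_minus_commute)
   show "(%n. (4 + 2 * L * T) * il.kap n) ----> 0" using tendsto_mult[OF tendsto_const il.kap_tendsto] by simp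
  qed
  ultimately show "(LINT z|distr (g t) borel (%z. snd (lab 0 t z)). ph z) = (LINT z|distr f0 borel (%z. (W t z, il.label 0 z)). ph z)"
   unfolding integral_distr[OF labm pm] integral_distr[OF Wm pm] by (rule LIMSEQ_unique[rotated])
 qed
 have conv: "convK al 0 f0 (W t) x = u 0 t x" if t: "t : {0..T}" for t x
 proof -
  have "convK al 0 f0 (W s) x - u 0 s x = 0" if s: "s : {0<..<T}" for s
  proof -
   have Km: "(%q :: 'a \<times> 'a. K al 0 (x - fst q)) : borel_measurable borel"
    by (intro borel_measurable_continuous_onI continuous_on_K[OF al] continuous_intros)
   have "u 0 s x = (LINT q|distr (g s) borel (%z. snd (lab 0 s z)). K al 0 (x - fst q))"
    unfolding integral_distr[OF labm Km] by (simp add: u_def convK_def lab_def)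
   also have "\<dots> = convK al 0 f0 (W s) x" unfolding law[OF s] integral_distr[OF Wm Km] by (simp add: convK_def)
   finally show ?thesis by simp
  qed
  moreover obtain C where "!!t z. norm (W t z) <= C * (1 + norm z)" using W(4) by blast
  then have "continuous_on UNIV (%s. convK al 0 f0 (W s) x)" by (rule il.continuous_convK[OF W(3)]) (intro continuous_intros)+
  then have "continuous_on {0..T} (%s. convK al 0 f0 (W s) x - u 0 s x)"
   by (intro continuous_intros) (auto intro: continuous_on_subset)
  ultimately show ?thesis
   using continuous_constant_on_closure[of "{0<..<T}" "%s. convK al 0 f0 (W s) x - u 0 s x" 0 t] T t by simp
 qed
 have "lagrangian al 0 f0 (il.label 0) T W"
  unfolding lagrangian_def
 proof (intro conjI allI ballI W(3,4))
  show "W (clamp_time 0 T t) = W t" for t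
   using LIMSEQ_unique[OF W(1)[of "clamp_time 0 T t"]] W(1)[of t] c[of t] by (simp add: fun_eq_iff Z_def c_def[symmetric] cid)
  show "W 0 = fst" using LIMSEQ_unique[OF W(1)[of 0]] T by (auto simp: fun_eq_iff Z_def cid Y0 lb)
  show "((%t. W t z) has_vector_derivative il.label 0 z - convK al 0 f0 (W t) (W t z)) (at t within {0..T})" if "t : {0..T}" for t z
   using Wd[OF that] by (simp add: conv[OF that])
 qed
 from il.lagrangian_unique[OF this X] have WX: "W = X" by (simp add: fun_eq_iff)
 have inner: "g t = il.push X t" if t: "t : {0<..<T}" for t
 proof -
  \<comment> \<open>recovers the velocity from position and label\<close>
  define ps where "ps q = (fst q, snd q - u 0 t (fst q))" for q :: "'a \<times> 'a"
  have ps: "ps : borel \<rightarrow>\<^sub>M borel" unfolding ps_def[abs_def] by (intro borel_measurable_continuous_onI continuous_intros)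
  have "g t = distr (g t) borel (ps \<circ> (%z. snd (lab 0 t z)))"
   by (simp add: ps_def lab_def o_def distr_id2 g_sets)
  also have "\<dots> = distr (distr f0 borel (%z. (W t z, il.label 0 z))) borel ps" unfolding law[OF t, symmetric] by (rule distr_distr[OF ps labm, symmetric])
  also have "\<dots> = distr f0 borel (ps \<circ> (%z. (W t z, il.label 0 z)))" by (rule distr_distr[OF ps Wm])
  also have "\<dots> = il.push X t"
   using t conv[of t, unfolded WX] by (simp add: il.push_def ps_def o_def il.vel_def WX)
  finally show ?thesis .
 qed
 show ?thesis
 proof (rule prob_measure_eqI_lipschitz[OF g_prob g_sets il.prob_push[OF X] il.sets_push[OF X]])
  fix ph :: "'a \<times> 'a => real" and r L assume ph: "!!z. r <= norm z ==> ph z = 0" "!!z z'. \<bar>ph z - ph z'\<bar> <= L * norm (z - z')"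
  note pc = lipschitz_continuous[OF ph(2) continuous_on_id]
  obtain B where B: "!!z. norm (ph z) <= B" using compact_support_bounded[OF pc ph(1)] by blast
  then have b: "bounded (range ph)" by (auto simp: bounded_iff)
  have "continuous_on {0..T} (%t. (LINT z|g t. ph z) - (LINT z|il.push X t. ph z))"
   by (intro continuous_on_diff continuous_on_subset[OF narrow[OF pc b]] continuous_on_subset[OF il.push_narrow[OF X pc b]]) auto
  then show "(LINT z|g t. ph z) = (LINT z|il.push X t. ph z)"
   using continuous_constant_on_closure[of "{0<..<T}" "%t. (LINT z|g t. ph z) - (LINT z|il.push X t. ph z)" 0 t] inner T t by simp
 qed
qed

end

section \<open>Existence and uniqueness\<close>

text \<open>Values outside \<open>{0..T}\<close> are arbitrary, hence the reparametrization by \<open>clamp_time\<close>.\<close>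

lemma weak_solution_unique:
 assumes "initial_law al T f0" and X: "lagrangian al 0 f0 (initial_law.label al f0 0) T X"
  and g: "weak_solution al T f0 g" and E: "(SUP t\<in>{0..T}. omega_energy al (g t)) < \<infinity>" and t: "t : {0..T}"
 shows "g t = initial_law.push al f0 X t"
proof -
 interpret il: initial_law al T f0 by fact
 define c where "c = clamp_time 0 T"
 have c: "c t : {0..T}" for t using clamp_time(1)[of 0 T t] il.T by (simp add: c_def)
 have cid: "c t = t" if "t : {0..T}" for t using that by (simp add: c_def clamp_time)
 have g': "prob_space (g t)" "sets (g t) = sets borel" if "t : {0..T}" for t
  using g that by (auto simp: weak_solution_def prob_measures_def)
 obtain Mx where Mx: "0 <= Mx" "(SUP t\<in>{0..T}. \<integral>\<^sup>+ (x, v). ennreal ((norm x)^2) \<partial>g t) = ennreal Mx"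
  using g unfolding weak_solution_def by (cases "SUP t\<in>{0..T}. \<integral>\<^sup>+ (x, v). ennreal ((norm x)^2) \<partial>g t") auto
 have v0: "(\<integral>\<^sup>+ (x, v). ennreal ((norm v)^2) \<partial>f0) < \<infinity>"
 proof -
  have "(\<integral>\<^sup>+ (x, v). ennreal ((norm v)^2) \<partial>f0) <= (nn_integral f0 (%z. ennreal ((norm z)^2)))"
   by (intro nn_integral_mono) (auto simp: case_prod_unfold intro!: ennreal_leI power_mono norm_snd_le_norm)
  also have "\<dots> < \<infinity>" using il.f0_square by (simp add: nn_integral_eq_integral)
  finally show ?thesis .
 qed
 have dc: "dissipative_curve al T (%t. g (c t)) Mx"
 proof (intro dissipative_curve.intro)
  show "0 < al" "al < 1" "0 < T" "0 <= Mx" by (rule il.al il.T Mx(1))+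
  show "prob_space (g (c t))" "sets (g (c t)) = sets borel" for t by (rule g'[OF c])+
  show "continuous_on UNIV (%t. LINT z|g (c t). h z)" if "continuous_on UNIV h" "bounded (range h)" for h :: "'a \<times> 'a => real"
  proof (rule continuous_on_compose2[of "{0..T}" "%t. LINT z|g t. h z" UNIV c])
   show "continuous_on {0..T} (%t. LINT z|g t. h z)" using g that unfolding weak_solution_def narrowly_continuous_on_def by blast
   show "continuous_on UNIV c" unfolding c_def by (intro continuous_intros)
  qed (use c in auto)
  show "(nn_integral (g (c t)) (%z. ennreal ((norm (fst z))^2))) <= ennreal Mx" for t
   using SUP_upper[OF c, of "%t. \<integral>\<^sup>+ (x, v). ennreal ((norm x)^2) \<partial>g t" t] unfolding Mx(2) by (simp add: case_prod_unfold)
  have "(nn_integral lborel (%t. (nn_integral (g (c t) \<Otimes>\<^sub>M g (c t)) (%p. rate al p)) * indicator {0..T} t)) = (nn_integral lborel (%t. (nn_integral (g t \<Otimes>\<^sub>M g t) (%p. rate al p)) * indicator {0..T} t))"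
   by (intro nn_integral_cong) (auto simp: indicator_def cid)
  also have "\<dots> <= (\<integral>\<^sup>+ (x, v). ennreal ((norm v)^2) \<partial>f0)"
   using g unfolding weak_solution_def energy_inequality_def rate_Diag by (auto intro: order_trans[rotated])
  finally show "(nn_integral lborel (%t. (nn_integral (g (c t) \<Otimes>\<^sub>M g (c t)) (%p. rate al p)) * indicator {0..T} t)) < \<infinity>" using v0 by (rule le_less_trans)
 qed
 have "weak_formulation al T f0 (%t. g (c t)) = weak_formulation al T f0 g"
  unfolding weak_formulation_def
  by (intro all_cong1 arg_cong2[where f="(-->)"] arg_cong2[where f="(=)"] arg_cong2[where f="(+)"] arg_cong2[where f="(*)"] refl set_lebesgue_integral_cong allI impI)
   (auto simp: cid)
 then have wc: "weak_curve al T (%t. g (c t)) Mx f0"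
  using g c cid il.initial_law_axioms unfolding weak_curve_def weak_curve_axioms_def weak_solution_def by (auto simp: dc[unfolded c_def] c_def)
 obtain M2 where M2: "!!t. integrable (g (c t)) (%z. (norm z)^2)" "!!t. (LINT z|g (c t). (norm z)^2) <= M2"
  using weak_curve.second_moments[OF wc] by blast
 have "phase_curve al T (%t. g (c t)) Mx M2 (SUP t\<in>{0..T}. omega_energy al (g t))"
  by (intro phase_curve.intro dc phase_curve_axioms.intro M2 E SUP_upper c)
 with wc interpret m: moving_curve al T Mx M2 "%t. g (c t)" f0 "SUP t\<in>{0..T}. omega_energy al (g t)"
  by (simp add: moving_curve_def)
 show ?thesis using m.curve_is_push[OF X t] t by (simp add: cid)
qed

theorem theorem1p2:
  fixes f0 :: "('a::euclidean_space \<times> 'a) measure" and \<alpha> T :: real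
  assumes "0 < T" and "0 < \<alpha>" and "\<alpha> < 1"
    and "f0 \<in> prob_measures2"
    and "omega_energy \<alpha> f0 < \<infinity>"
  shows "\<exists>f. weak_solution \<alpha> T f0 f \<and>
             (SUP t\<in>{0..T}. omega_energy \<alpha> (f t)) < \<infinity> \<and>
             (\<forall>g. weak_solution \<alpha> T f0 g \<and> (SUP t\<in>{0..T}. omega_energy \<alpha> (g t)) < \<infinity> \<longrightarrow>
                  (\<forall>t\<in>{0..T}. g t = f t))"
proof -
 have p: "prob_space f0" "sets f0 = sets borel" and sq: "(nn_integral f0 (%z. ennreal ((norm z)^2))) < \<infinity>"
  using assms(4) by (auto simp: prob_measures2_def prob_measures_def)
 have "(%z. (norm z)^2) \<in> borel_measurable f0"
  unfolding measurable_cong_sets[OF p(2) refl] by (intro borel_measurable_continuous_onI continuous_intros)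
 then have "integrable f0 (%z. (norm z)^2)" using sq by (intro integrableI_bounded) auto
 then interpret initial_law \<alpha> T f0 by (intro initial_law.intro assms p)
 obtain X where X: "lagrangian \<alpha> 0 f0 (label 0) T X" "weak_solution \<alpha> T f0 (push X)" "!!t. omega_energy \<alpha> (push X t) = omega_energy \<alpha> f0"
  using lagrangian_weak_solution[OF assms(5)] by blast
 have "(SUP t\<in>{0..T}. omega_energy \<alpha> (push X t)) < \<infinity>" using X(3) assms(1,5) by simp
 then show ?thesis using X weak_solution_unique[OF initial_law_axioms X(1)] by blast
qed

end
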